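(* Let $\alpha>0$, let $(\phi,\Omega_\alpha)$ be a subdyadic frame pair, so that $\{\phi_z\}_{z\in\Omega_\alpha}$ is a frame for $L^2(\mathbb R^d)$, and let $\{\widetilde\phi_z\}_{z\in\Omega_\alpha}$ be its canonical dual. Then, for every $N>0$, there is $C_N<\infty$ such that for all $w,z\in\Omega_\alpha$ $$|\langle\widetilde\phi_z,\widetilde\phi_w\rangle|+|\langle\widetilde\phi_z,\phi_w\rangle|\le C_N\bigl(1+\mathbf d_\alpha(w,z)\bigr)^{-N}.$$ Moreover, if $C:L^2(\mathbb R^d)\to\ell^2(\Omega_\alpha)$, $Cf=(\langle f,\phi_w\rangle)_{w\in\Omega_\alpha}$, $S=C^\ast C$ and $G=CC^\ast$, then the Moore–Penrose pseudoinverse $G^\dagger$ of $G$ satisfies $$(G^\dagger)_{w,z}=\langle\widetilde\phi_z,\widetilde\phi_w\rangle,\qquad(GG^\dagger)_{w,z}=\langle\widetilde\phi_z,\phi_w\rangle .$$ In particular, $GG^\dagger=CS^{-1}C^\ast$ is the orthogonal projection of $\ell^2(\Omega_\alpha)$ onto $\operatorname{ran}C$.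
   Context: Conventions: $\widehat f(\eta)=\int_{\mathbb R^d}f(t)e^{-it\cdot\eta}\,dt$; $\langle f,g\rangle=\int f\overline g$; $B(c,r)$ is a Euclidean ball; matrix entries are $T_{w,z}=\langle Te_z,e_w\rangle$ for the standard basis $(e_z)$ of $\ell^2(\Omega_\alpha)$. Subdyadic lattice at scale $\rho\in(0,\rho_0]$. Here $\rho_0,a>0$ are fixed sufficiently small constants and $b>0$ a fixed constant, depending only on $d,\alpha$. For $n\in\mathbb N_0$ let $A_n=\{2^n\le|\xi|<2^{n+1}\}$, $h_n=\rho2^{n(1-\alpha)}$. Partition $\mathbb R^d$ into half-open cubes of side $h_n$ and choose one point of $A_n$ in each cube meeting $A_n$ (candidates). Order all candidates first by $n$ and arbitrarily inside each annulus, and process them in this order, retaining a candidate $\xi$ exactly when the ball $\{|\eta-\xi|<a\rho|\xi|^{1-\alpha}\}$ is disjoint from all such balls of previously retained candidates. Enumerate the retained points as $\{\xi_k\}_{k\in\mathbb N}$ and set $x_j^k=b\rho|\xi_k|^{\alpha-1}j$, $j\in\mathbb Z^d$; $\Omega_\alpha=\{(x_j^k,\xi_k)\}$. There is a constant $A_{\mathrm{cov}}>1$ depending only on $d,\alpha$ such that the balls $\{|\eta-\xi_k|\le A_{\mathrm{cov}}\rho|\xi_k|^{1-\alpha}\}$ cover $\{|\eta|\ge1\}$. Subdyadic frame pair $(\phi,\Omega_\alpha)$: $\phi\in\mathcal S(\mathbb R^d)$ is real-valued, even, $L^2$-normalized, with $\widehat\phi\in C_c^\infty$, $\operatorname{supp}\widehat\phi\subset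 B(0,R_1)$, $|\widehat\phi|\ge m_0>0$ on $\{|\zeta|\le R_0\}$, where $3\cdot2^{\max\{\alpha-1,0\}}<R_0<R_1$; and $\Omega_\alpha$ is a subdyadic lattice at a scale $\rho_\ast\le\rho_0$, i.e. $\Omega_\alpha=\{(x_j^k,\xi_k):k\in\mathbb N,\ j\in\mathbb Z^d\}$ where the $\xi_k$ are the centers retained by the selection procedure run with $\rho=\rho_\ast$ and $x_j^k=b\rho_\ast|\xi_k|^{\alpha-1}j$, with $A_{\mathrm{cov}}\rho_\ast<R_0$ and $b\rho_\ast R_1<\pi$. Packets: for $z=(x,\xi)$, $\phi_z(t)=|\xi|^{\frac d2(1-\alpha)}\phi((t-x)|\xi|^{1-\alpha})e^{it\cdot\xi}$. For a frame pair, $\{\phi_z\}_{z\in\Omega_\alpha}$ is a frame for $L^2(\mathbb R^d)$; its canonical dual is $\widetilde\phi_z=S^{-1}\phi_z$, where $S$ is the frame operator. Adapted separation function: for $w=(x,\xi)$, $z=(y,\eta)$, with $r(w,z)=1+\min\{|\xi|,|\eta|\}$, $\mathbf d_\alpha(w,z)=r(w,z)^{1-\alpha}|x-y|+r(w,z)^{\alpha-1}|\xi-\eta|$. *)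

theory Defs
  imports "HOL-Analysis.Analysis" "HOL-Library.Disjoint_Sets"
begin

section \<open>The Hilbert space \<open>L\<^sup>2(M)\<close> and its operators\<close>

text \<open>
  Elements of \<open>L\<^sup>2(M)\<close> are represented by square-integrable functions, and equality in
  \<open>L\<^sup>2(M)\<close> is \<open>L2_eq\<close>. Thus \<open>L\<^sup>2(\<real>\<^sup>d)\<close> is \<open>L2_space lborel\<close>, and
  \<open>\<ell>\<^sup>2(I)\<close> is \<open>L2_space (count_space I)\<close>, where \<open>L2_eq\<close> is equality on \<open>I\<close>.
  Operators act on representatives; the values of adjoints, inverses and pseudoinverses below
  are representatives chosen by \<open>SOME\<close>, determined up to \<open>L2_eq\<close>.
\<close>

definition L2_space :: "'a measure \<Rightarrow> ('a \<Rightarrow> complex) set" where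
  "L2_space M = {f \<in> borel_measurable M. integrable M (\<lambda>x. (cmod (f x))\<^sup>2)}"

definition L2_inner :: "'a measure \<Rightarrow> ('a \<Rightarrow> complex) \<Rightarrow> ('a \<Rightarrow> complex) \<Rightarrow> complex" where
  "L2_inner M f g = (LINT x|M. f x * cnj (g x))"

definition L2_norm :: "'a measure \<Rightarrow> ('a \<Rightarrow> complex) \<Rightarrow> real" where
  "L2_norm M f = sqrt (LINT x|M. (cmod (f x))\<^sup>2)"

definition L2_eq :: "'a measure \<Rightarrow> ('a \<Rightarrow> complex) \<Rightarrow> ('a \<Rightarrow> complex) \<Rightarrow> bool" where
  "L2_eq M f g \<longleftrightarrow> (AE x in M. f x = g x)"

definition bounded_op ::
  "'a measure \<Rightarrow> 'b measure \<Rightarrow> (('a \<Rightarrow> complex) \<Rightarrow> ('b \<Rightarrow> complex)) \<Rightarrow> bool" where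
  "bounded_op M N T \<longleftrightarrow>
     (\<forall>f \<in> L2_space M. T f \<in> L2_space N) \<and>
     (\<forall>f \<in> L2_space M. \<forall>g \<in> L2_space M.
        L2_eq N (T (\<lambda>x. f x + g x)) (\<lambda>y. T f y + T g y)) \<and>
     (\<forall>f \<in> L2_space M. \<forall>c. L2_eq N (T (\<lambda>x. c * f x)) (\<lambda>y. c * T f y)) \<and>
     (\<exists>K. \<forall>f \<in> L2_space M. L2_norm N (T f) \<le> K * L2_norm M f)"

definition adjoint_op ::
  "'a measure \<Rightarrow> 'b measure \<Rightarrow> (('a \<Rightarrow> complex) \<Rightarrow> ('b \<Rightarrow> complex))
     \<Rightarrow> (('b \<Rightarrow> complex) \<Rightarrow> ('a \<Rightarrow> complex))" where
  "adjoint_op M N T g =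
     (SOME h. h \<in> L2_space M \<and> (\<forall>f \<in> L2_space M. L2_inner N (T f) g = L2_inner M f h))"

definition inverse_op ::
  "'a measure \<Rightarrow> 'b measure \<Rightarrow> (('a \<Rightarrow> complex) \<Rightarrow> ('b \<Rightarrow> complex))
     \<Rightarrow> (('b \<Rightarrow> complex) \<Rightarrow> ('a \<Rightarrow> complex))" where
  "inverse_op M N T g = (SOME f. f \<in> L2_space M \<and> L2_eq N (T f) g)"

definition range_op ::
  "'a measure \<Rightarrow> 'b measure \<Rightarrow> (('a \<Rightarrow> complex) \<Rightarrow> ('b \<Rightarrow> complex)) \<Rightarrow> ('b \<Rightarrow> complex) set" where
  "range_op M N T = {g \<in> L2_space N. \<exists>f \<in> L2_space M. L2_eq N (T f) g}"

definition is_orthogonal_projection ::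
  "'a measure \<Rightarrow> ('a \<Rightarrow> complex) set \<Rightarrow> (('a \<Rightarrow> complex) \<Rightarrow> ('a \<Rightarrow> complex)) \<Rightarrow> bool" where
  "is_orthogonal_projection M V P \<longleftrightarrow>
     (\<forall>c \<in> L2_space M. P c \<in> V \<and> (\<forall>v \<in> V. L2_inner M (\<lambda>x. c x - P c x) v = 0))"

text \<open>The four Penrose equations for a bounded operator \<open>X\<close>.\<close>

definition is_moore_penrose ::
  "'a measure \<Rightarrow> 'b measure \<Rightarrow> (('a \<Rightarrow> complex) \<Rightarrow> ('b \<Rightarrow> complex))
     \<Rightarrow> (('b \<Rightarrow> complex) \<Rightarrow> ('a \<Rightarrow> complex)) \<Rightarrow> bool" where
  "is_moore_penrose M N T X \<longleftrightarrow>
     bounded_op N M X \<and>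
     (\<forall>f \<in> L2_space M. L2_eq N (T (X (T f))) (T f)) \<and>
     (\<forall>g \<in> L2_space N. L2_eq M (X (T (X g))) (X g)) \<and>
     (\<forall>g \<in> L2_space N. \<forall>h \<in> L2_space N. L2_inner N (T (X g)) h = L2_inner N g (T (X h))) \<and>
     (\<forall>f \<in> L2_space M. \<forall>h \<in> L2_space M. L2_inner M (X (T f)) h = L2_inner M f (X (T h)))"

definition moore_penrose ::
  "'a measure \<Rightarrow> 'b measure \<Rightarrow> (('a \<Rightarrow> complex) \<Rightarrow> ('b \<Rightarrow> complex))
     \<Rightarrow> (('b \<Rightarrow> complex) \<Rightarrow> ('a \<Rightarrow> complex))" where
  "moore_penrose M N T = (SOME X. is_moore_penrose M N T X)"

definition matrix_entry ::
  "'i set \<Rightarrow> (('i \<Rightarrow> complex) \<Rightarrow> ('i \<Rightarrow> complex)) \<Rightarrow> 'i \<Rightarrow> 'i \<Rightarrow> complex" where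
  "matrix_entry I T w z = L2_inner (count_space I) (T (indicator {z})) (indicator {w})"


section \<open>Frames\<close>

definition is_frame :: "'a measure \<Rightarrow> 'i set \<Rightarrow> ('i \<Rightarrow> 'a \<Rightarrow> complex) \<Rightarrow> bool" where
  "is_frame M I \<psi> \<longleftrightarrow>
     (\<forall>z \<in> I. \<psi> z \<in> L2_space M) \<and>
     (\<exists>A B. 0 < A \<and> (\<forall>f \<in> L2_space M.
        (\<lambda>z. (cmod (L2_inner M f (\<psi> z)))\<^sup>2) summable_on I \<and>
        A * (L2_norm M f)\<^sup>2 \<le> (\<Sum>\<^sub>\<infinity>z\<in>I. (cmod (L2_inner M f (\<psi> z)))\<^sup>2) \<and>
        (\<Sum>\<^sub>\<infinity>z\<in>I. (cmod (L2_inner M f (\<psi> z)))\<^sup>2) \<le> B * (L2_norm M f)\<^sup>2))"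

definition analysis_op ::
  "'a measure \<Rightarrow> ('i \<Rightarrow> 'a \<Rightarrow> complex) \<Rightarrow> ('a \<Rightarrow> complex) \<Rightarrow> ('i \<Rightarrow> complex)" where
  "analysis_op M \<psi> f = (\<lambda>w. L2_inner M f (\<psi> w))"

definition synthesis_op ::
  "'a measure \<Rightarrow> 'i set \<Rightarrow> ('i \<Rightarrow> 'a \<Rightarrow> complex) \<Rightarrow> ('i \<Rightarrow> complex) \<Rightarrow> ('a \<Rightarrow> complex)" where
  "synthesis_op M I \<psi> = adjoint_op M (count_space I) (analysis_op M \<psi>)"

definition frame_op ::
  "'a measure \<Rightarrow> 'i set \<Rightarrow> ('i \<Rightarrow> 'a \<Rightarrow> complex) \<Rightarrow> ('a \<Rightarrow> complex) \<Rightarrow> ('a \<Rightarrow> complex)" where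
  "frame_op M I \<psi> = synthesis_op M I \<psi> \<circ> analysis_op M \<psi>"

definition canonical_dual ::
  "'a measure \<Rightarrow> 'i set \<Rightarrow> ('i \<Rightarrow> 'a \<Rightarrow> complex) \<Rightarrow> 'i \<Rightarrow> ('a \<Rightarrow> complex)" where
  "canonical_dual M I \<psi> z = inverse_op M M (frame_op M I \<psi>) (\<psi> z)"


section \<open>Smooth functions, Schwartz functions, Fourier transform\<close>

fun iterated_partial ::
  "'n::finite list \<Rightarrow> (real^'n \<Rightarrow> 'b::real_normed_vector) \<Rightarrow> real^'n \<Rightarrow> 'b" where
  "iterated_partial [] f = f"
| "iterated_partial (i # is) f =
     (\<lambda>x. frechet_derivative (iterated_partial is f) (at x) (axis i 1))"

definition smooth :: "(real^'n::finite \<Rightarrow> 'b::real_normed_vector) \<Rightarrow> bool" where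
  "smooth f \<longleftrightarrow> (\<forall>is x. iterated_partial is f differentiable at x)"

definition schwartz :: "(real^'n::finite \<Rightarrow> 'b::real_normed_vector) \<Rightarrow> bool" where
  "schwartz f \<longleftrightarrow> smooth f \<and>
     (\<forall>is (m::nat). \<exists>K. \<forall>x. (1 + norm x) ^ m * norm (iterated_partial is f x) \<le> K)"

definition support :: "('a::topological_space \<Rightarrow> complex) \<Rightarrow> 'a set" where
  "support f = closure {x. f x \<noteq> 0}"

definition fourier :: "(real^'n::finite \<Rightarrow> complex) \<Rightarrow> real^'n \<Rightarrow> complex" where
  "fourier f \<eta> = (LINT t|lborel. f t * exp (- \<i> * complex_of_real (t \<bullet> \<eta>)))"


section \<open>Subdyadic lattices\<close>

definition annulus :: "nat \<Rightarrow> (real^'n::finite) set" where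
  "annulus n = {\<xi>. 2 ^ n \<le> norm \<xi> \<and> norm \<xi> < 2 ^ (n + 1)}"

definition half_open_cube :: "real^'n::finite \<Rightarrow> real \<Rightarrow> (real^'n) set" where
  "half_open_cube c h = {x. \<forall>i. c $ i \<le> x $ i \<and> x $ i < c $ i + h}"

text \<open>\<open>X n\<close> is the set of candidates chosen in the \<open>n\<close>-th annulus.\<close>

definition candidate_family :: "real \<Rightarrow> real \<Rightarrow> (nat \<Rightarrow> (real^'n::finite) set) \<Rightarrow> bool" where
  "candidate_family \<alpha> \<rho> X \<longleftrightarrow>
     (\<forall>n. \<exists>Q p. partition_on UNIV Q \<and>
        (\<forall>q \<in> Q. \<exists>c. q = half_open_cube c (\<rho> * 2 powr (real n * (1 - \<alpha>)))) \<and>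
        (\<forall>q \<in> Q. q \<inter> annulus n \<noteq> {} \<longrightarrow> p q \<in> q \<inter> annulus n) \<and>
        X n = p ` {q \<in> Q. q \<inter> annulus n \<noteq> {}})"

text \<open>
  Each annulus contains only finitely many candidates, so an ordering of the candidates first
  by annulus is an enumeration by the natural numbers.
\<close>

definition candidate_order :: "(nat \<Rightarrow> (real^'n::finite) set) \<Rightarrow> (nat \<Rightarrow> real^'n) \<Rightarrow> bool" where
  "candidate_order X c \<longleftrightarrow>
     bij_betw c UNIV (\<Union>n. X n) \<and>
     (\<forall>i j m n. i < j \<and> c i \<in> X m \<and> c j \<in> X n \<longrightarrow> m \<le> n)"

definition center_ball :: "real \<Rightarrow> real \<Rightarrow> real \<Rightarrow> real^'n::finite \<Rightarrow> (real^'n) set" where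
  "center_ball \<alpha> a \<rho> \<xi> = {\<eta>. norm (\<eta> - \<xi>) < a * \<rho> * norm \<xi> powr (1 - \<alpha>)}"

fun retained :: "real \<Rightarrow> real \<Rightarrow> real \<Rightarrow> (nat \<Rightarrow> real^'n::finite) \<Rightarrow> nat \<Rightarrow> bool" where
  "retained \<alpha> a \<rho> c i \<longleftrightarrow>
     (\<forall>j \<in> {..<i}. retained \<alpha> a \<rho> c j \<longrightarrow>
        center_ball \<alpha> a \<rho> (c i) \<inter> center_ball \<alpha> a \<rho> (c j) = {})"

declare retained.simps [simp del]

definition subdyadic_centers :: "real \<Rightarrow> real \<Rightarrow> real \<Rightarrow> (real^'n::finite) set \<Rightarrow> bool" where
  "subdyadic_centers \<alpha> a \<rho> \<Xi> \<longleftrightarrow>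
     (\<exists>X c. candidate_family \<alpha> \<rho> X \<and> candidate_order X c \<and> \<Xi> = c ` {i. retained \<alpha> a \<rho> c i})"

definition subdyadic_lattice ::
  "real \<Rightarrow> real \<Rightarrow> real \<Rightarrow> real \<Rightarrow> ((real^'n::finite) \<times> (real^'n)) set \<Rightarrow> bool" where
  "subdyadic_lattice \<alpha> a b \<rho> \<Omega> \<longleftrightarrow>
     (\<exists>\<Xi>. subdyadic_centers \<alpha> a \<rho> \<Xi> \<and>
        \<Omega> = {((b * \<rho> * norm \<xi> powr (\<alpha> - 1)) *\<^sub>R (\<chi> i. real_of_int (j $ i)), \<xi>) |
              \<xi> (j :: int^'n). \<xi> \<in> \<Xi>})"

text \<open>
  The defining property of the constant \<open>A\<^sub>c\<^sub>o\<^sub>v\<close>, uniform over all scales up to \<open>\<rho>\<^sub>0\<close> and all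
  choices made in the selection procedure; the \<open>itself\<close> argument carries the dimension.
\<close>

definition covering_constant :: "'n::finite itself \<Rightarrow> real \<Rightarrow> real \<Rightarrow> real \<Rightarrow> real \<Rightarrow> bool" where
  "covering_constant _ \<alpha> a \<rho>\<^sub>0 A \<longleftrightarrow> 1 < A \<and>
     (\<forall>\<rho> (\<Xi> :: (real^'n) set). 0 < \<rho> \<and> \<rho> \<le> \<rho>\<^sub>0 \<and> subdyadic_centers \<alpha> a \<rho> \<Xi> \<longrightarrow>
        {\<eta>. 1 \<le> norm \<eta>} \<subseteq> (\<Union>\<xi>\<in>\<Xi>. {\<eta>. norm (\<eta> - \<xi>) \<le> A * \<rho> * norm \<xi> powr (1 - \<alpha>)}))"

definition subdyadic_frame_pair ::
  "real \<Rightarrow> real \<Rightarrow> real \<Rightarrow> real \<Rightarrow> real \<Rightarrow> (real^'n::finite \<Rightarrow> real)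
     \<Rightarrow> ((real^'n) \<times> (real^'n)) set \<Rightarrow> bool" where
  "subdyadic_frame_pair \<alpha> a b \<rho>\<^sub>0 A \<phi> \<Omega> \<longleftrightarrow>
     (\<exists>R\<^sub>0 R\<^sub>1 m\<^sub>0 \<rho>.
        schwartz \<phi> \<and> (\<forall>t. \<phi> (- t) = \<phi> t) \<and> (LINT t|lborel. (\<phi> t)\<^sup>2) = 1 \<and>
        smooth (fourier (\<lambda>t. complex_of_real (\<phi> t))) \<and>
        compact (support (fourier (\<lambda>t. complex_of_real (\<phi> t)))) \<and>
        support (fourier (\<lambda>t. complex_of_real (\<phi> t))) \<subseteq> ball 0 R\<^sub>1 \<and>
        0 < m\<^sub>0 \<and>
        (\<forall>\<zeta>. norm \<zeta> \<le> R\<^sub>0 \<longrightarrow> m\<^sub>0 \<le> cmod (fourier (\<lambda>t. complex_of_real (\<phi> t)) \<zeta>)) \<and>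
        3 * 2 powr max (\<alpha> - 1) 0 < R\<^sub>0 \<and> R\<^sub>0 < R\<^sub>1 \<and>
        0 < \<rho> \<and> \<rho> \<le> \<rho>\<^sub>0 \<and> subdyadic_lattice \<alpha> a b \<rho> \<Omega> \<and>
        A * \<rho> < R\<^sub>0 \<and> b * \<rho> * R\<^sub>1 < pi)"


section \<open>Packets and the adapted separation function\<close>

definition packet ::
  "real \<Rightarrow> (real^'n::finite \<Rightarrow> real) \<Rightarrow> (real^'n) \<times> (real^'n) \<Rightarrow> real^'n \<Rightarrow> complex" where
  "packet \<alpha> \<phi> = (\<lambda>(x, \<xi>) t.
     complex_of_real (norm \<xi> powr (real CARD('n) / 2 * (1 - \<alpha>)) *
       \<phi> (norm \<xi> powr (1 - \<alpha>) *\<^sub>R (t - x))) *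
     exp (\<i> * complex_of_real (t \<bullet> \<xi>)))"

definition separation ::
  "real \<Rightarrow> (real^'n::finite) \<times> (real^'n) \<Rightarrow> (real^'n) \<times> (real^'n) \<Rightarrow> real" where
  "separation \<alpha> = (\<lambda>(x, \<xi>) (y, \<eta>).
     (1 + min (norm \<xi>) (norm \<eta>)) powr (1 - \<alpha>) * norm (x - y) +
     (1 + min (norm \<xi>) (norm \<eta>)) powr (\<alpha> - 1) * norm (\<xi> - \<eta>))"

end

theory Submission
  imports Defs
begin

text \<open>
  Write \<open>s \<xi> = |\<xi>|\<^sup>1\<^sup>-\<^sup>\<alpha>\<close> and \<open>d\<close> for the dimension. The Fourier transform of a packet at \<open>(x, \<xi>)\<close> is, up to a power of
  \<open>s \<xi>\<close> and a modulation, the bump \<open>hat ((u - \<xi>) / s \<xi>)\<close>, supported in a ball of radius \<open>R\<^sub>1 * s \<xi>\<close>. Because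
  \<open>b * \<rho> * R\<^sub>1 < pi\<close>, this ball fits into a cube on which the exponentials belonging to the positions \<open>x\<close>
  of the lattice form a complete orthogonal system. Parseval's identity on that cube therefore sums the squared
  coefficients over all positions above a fixed center, and summing over the centers shows that on the Fourier
  side the frame operator is multiplication by
  \<open>multiplier u = (b * \<rho>)\<^sup>-\<^sup>d * (\<Sum>\<xi>. |hat ((u - \<xi>) / s \<xi>)|\<^sup>2)\<close> (\<open>frame_identity\<close>).

  The multiplier is bounded below because every frequency lies in some ball on which \<open>hat\<close> is at least \<open>m\<^sub>0\<close>
  (\<open>covering\<close>), and above because the disjointness of the balls around the centers limits the number of bumps that meet a
  point (\<open>neighbours_card\<close>). So the packets form a frame, and dual packets arise by dividing by the multiplier
  (\<open>dual_eq_dual_packet\<close>). The entries in question are thereby explicit Fourier integrals of two bumps against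
  a power of the reciprocal multiplier.

  Such an integral vanishes unless the two bumps overlap. If they do, their scales are comparable, so that after
  rescaling to unit size the integrand has compact support and derivatives bounded uniformly over all pairs of
  overlapping bumps (\<open>symbol_bounded\<close>). Its Fourier integral decays rapidly in \<open>s \<xi> * |x - y|\<close>
  (\<open>Fourier_integral_decay\<close>), and for overlapping bumps this quantity controls the separation of the two
  lattice points (\<open>separation_bound\<close>).

  The statements on the pseudoinverse hold for every frame: \<open>C S\<^sup>-\<^sup>2 C\<^sup>*\<close> satisfies the Penrose equations for
  \<open>C C\<^sup>*\<close>, which determine it (\<open>moore_penrose_unique\<close>), and \<open>C\<^sup>*\<close> maps the unit vector at \<open>z\<close> to the frame
  vector at \<open>z\<close> (\<open>adjoint_indicator\<close>). Adjoints and inverses exist by the Lax--Milgram theorem, which rests on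
  the completeness of \<open>L\<^sup>2\<close>.
\<close>


section \<open>Square-integrable functions form a Hilbert space\<close>

lemma L2_measurable [measurable_dest]: "f \<in> L2_space M \<Longrightarrow> f \<in> borel_measurable M"
  by (simp add: L2_space_def)

lemma L2_integrable_square: "f \<in> L2_space M \<Longrightarrow> integrable M (\<lambda>x. (cmod (f x))\<^sup>2)"
  by (simp add: L2_space_def)

lemma L2_spaceI:
  assumes "f \<in> borel_measurable M" "integrable M (\<lambda>x. (cmod (f x))\<^sup>2)"
  shows "f \<in> L2_space M"
  using assms by (simp add: L2_space_def)

lemma L2_space_nn_integralI:
  assumes [measurable]: "f \<in> borel_measurable M"
    and "(\<integral>\<^sup>+x. ennreal ((cmod (f x))\<^sup>2) \<partial>M) < \<infinity>"
  shows "f \<in> L2_space M"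
  using assms by (intro L2_spaceI integrableI_bounded) auto

lemma L2_space_zero [simp]: "(\<lambda>x. 0) \<in> L2_space M"
  by (simp add: L2_space_def)

lemma L2_space_scale [simp]: "f \<in> L2_space M \<Longrightarrow> (\<lambda>x. c * f x) \<in> L2_space M"
  by (auto simp: L2_space_def norm_mult power_mult_distrib)

lemma L2_space_bound:
  assumes "g \<in> L2_space M" "f \<in> borel_measurable M" "\<And>x. x \<in> space M \<Longrightarrow> cmod (f x) \<le> K * cmod (g x)"
  shows "f \<in> L2_space M"
proof (intro L2_spaceI assms(2))
  have [measurable]: "f \<in> borel_measurable M" by (rule assms(2))
  have le: "(cmod (f x))\<^sup>2 \<le> K\<^sup>2 * (cmod (g x))\<^sup>2" if "x \<in> space M" for x
    using power_mono[OF assms(3)[OF that] norm_ge_zero, of 2] by (simp add: power_mult_distrib)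
  show "integrable M (\<lambda>x. (cmod (f x))\<^sup>2)"
    by (rule Bochner_Integration.integrable_bound[of _ "\<lambda>x. K\<^sup>2 * (cmod (g x))\<^sup>2"])
      (use assms(1) le in \<open>auto simp: L2_integrable_square intro!: AE_I2\<close>)
qed

lemma borel_measurable_cnj [measurable (raw)]:
  fixes f :: "'a \<Rightarrow> complex"
  assumes "f \<in> borel_measurable M" shows "(\<lambda>x. cnj (f x)) \<in> borel_measurable M"
  by (rule borel_measurable_continuous_on[OF _ assms]) (intro continuous_intros)

lemma cmod_add_sq_le: "(cmod (a + b))\<^sup>2 \<le> 2 * (cmod a)\<^sup>2 + 2 * (cmod b)\<^sup>2"
proof -
  have "(cmod (a + b))\<^sup>2 \<le> (cmod a + cmod b)\<^sup>2" by (intro power_mono norm_triangle_ineq) auto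
  also have "\<dots> \<le> 2 * (cmod a)\<^sup>2 + 2 * (cmod b)\<^sup>2"
    using sum_squares_bound[of "cmod a" "cmod b"] by (simp add: power2_sum)
  finally show ?thesis .
qed

lemma L2_space_add [simp]:
  assumes "f \<in> L2_space M" "g \<in> L2_space M" shows "(\<lambda>x. f x + g x) \<in> L2_space M"
proof (rule L2_spaceI)
  have [measurable]: "f \<in> borel_measurable M" "g \<in> borel_measurable M"
    using assms by (auto dest: L2_measurable)
  show "(\<lambda>x. f x + g x) \<in> borel_measurable M" by measurable
  show "integrable M (\<lambda>x. (cmod (f x + g x))\<^sup>2)"
  proof (rule Bochner_Integration.integrable_bound)
    show "integrable M (\<lambda>x. 2 * (cmod (f x))\<^sup>2 + 2 * (cmod (g x))\<^sup>2)"
      by (intro Bochner_Integration.integrable_add integrable_mult_right L2_integrable_square assms)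
    show "AE x in M. norm ((cmod (f x + g x))\<^sup>2) \<le> norm (2 * (cmod (f x))\<^sup>2 + 2 * (cmod (g x))\<^sup>2)"
      using cmod_add_sq_le by auto
  qed simp
qed

lemma L2_space_diff [simp]:
  assumes "f \<in> L2_space M" "g \<in> L2_space M" shows "(\<lambda>x. f x - g x) \<in> L2_space M"
  using L2_space_add[OF assms(1) L2_space_scale[OF assms(2), of "-1"]] by simp

lemma L2_inner_integrable:
  assumes "f \<in> L2_space M" "g \<in> L2_space M" shows "integrable M (\<lambda>x. f x * cnj (g x))"
proof (rule Bochner_Integration.integrable_bound)
  have [measurable]: "f \<in> borel_measurable M" "g \<in> borel_measurable M"
    using assms by (auto dest: L2_measurable)
  show "integrable M (\<lambda>x. (cmod (f x))\<^sup>2 + (cmod (g x))\<^sup>2)"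
    using assms by (auto intro: L2_integrable_square)
  have "cmod (f x) * cmod (g x) \<le> (cmod (f x))\<^sup>2 + (cmod (g x))\<^sup>2" for x
    using sum_squares_bound[of "cmod (f x)" "cmod (g x)"]
      mult_nonneg_nonneg[OF norm_ge_zero[of "f x"] norm_ge_zero[of "g x"]] by linarith
  then show "AE x in M. norm (f x * cnj (g x)) \<le> norm ((cmod (f x))\<^sup>2 + (cmod (g x))\<^sup>2)"
    by (auto simp: norm_mult)
  show "(\<lambda>x. f x * cnj (g x)) \<in> borel_measurable M" by measurable
qed

lemma L2_inner_add_left:
  assumes "f \<in> L2_space M" "g \<in> L2_space M" "h \<in> L2_space M"
  shows "L2_inner M (\<lambda>x. f x + g x) h = L2_inner M f h + L2_inner M g h"
  using assms by (simp add: L2_inner_def L2_inner_integrable distrib_right)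

lemma L2_inner_scale_left: "L2_inner M (\<lambda>x. c * f x) h = c * L2_inner M f h"
  by (simp add: L2_inner_def mult.assoc)

lemma L2_inner_commute: "L2_inner M g f = cnj (L2_inner M f g)"
  unfolding L2_inner_def Bochner_Integration.integral_cnj[symmetric] by (simp add: mult.commute)

lemma L2_inner_diff_left:
  assumes "f \<in> L2_space M" "g \<in> L2_space M" "h \<in> L2_space M"
  shows "L2_inner M (\<lambda>x. f x - g x) h = L2_inner M f h - L2_inner M g h"
  using assms by (simp add: L2_inner_def L2_inner_integrable left_diff_distrib)

lemma L2_inner_add_right:
  assumes "f \<in> L2_space M" "g \<in> L2_space M" "h \<in> L2_space M"
  shows "L2_inner M h (\<lambda>x. f x + g x) = L2_inner M h f + L2_inner M h g"
  by (simp add: L2_inner_commute[of M h] L2_inner_add_left[OF assms])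

lemma L2_inner_diff_right:
  assumes "f \<in> L2_space M" "g \<in> L2_space M" "h \<in> L2_space M"
  shows "L2_inner M h (\<lambda>x. f x - g x) = L2_inner M h f - L2_inner M h g"
  by (simp add: L2_inner_commute[of M h] L2_inner_diff_left[OF assms])

lemma L2_inner_scale_right: "L2_inner M h (\<lambda>x. c * f x) = cnj c * L2_inner M h f"
  by (simp add: L2_inner_commute[of M h] L2_inner_scale_left)

lemma L2_inner_self: "L2_inner M f f = complex_of_real ((L2_norm M f)\<^sup>2)"
proof -
  have "L2_inner M f f = (LINT x|M. complex_of_real ((cmod (f x))\<^sup>2))"
    unfolding L2_inner_def complex_norm_square ..
  then show ?thesis by (simp only: integral_complex_of_real) (simp add: L2_norm_def)
qed

lemma L2_norm_nonneg [simp]: "0 \<le> L2_norm M f"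
  by (simp add: L2_norm_def)

lemma L2_norm_sq: "(L2_norm M f)\<^sup>2 = (LINT x|M. (cmod (f x))\<^sup>2)"
  by (simp add: L2_norm_def)

lemma L2_norm_nn_integral:
  assumes "f \<in> L2_space M"
  shows "(\<integral>\<^sup>+x. ennreal ((cmod (f x))\<^sup>2) \<partial>M) = ennreal ((L2_norm M f)\<^sup>2)"
  unfolding L2_norm_sq using assms by (intro nn_integral_eq_integral L2_integrable_square) auto

lemma L2_norm_scale: "L2_norm M (\<lambda>x. c * f x) = cmod c * L2_norm M f"
  by (simp add: L2_norm_def norm_mult power_mult_distrib real_sqrt_mult)

lemma L2_norm_add_sq:
  assumes "f \<in> L2_space M" "g \<in> L2_space M"
  shows "(L2_norm M (\<lambda>x. f x + g x))\<^sup>2 = (L2_norm M f)\<^sup>2 + 2 * Re (L2_inner M f g) + (L2_norm M g)\<^sup>2"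
proof -
  let ?s = "\<lambda>x. f x + g x"
  have s: "?s \<in> L2_space M" using assms by simp
  have "complex_of_real ((L2_norm M ?s)\<^sup>2) = L2_inner M ?s ?s" by (simp only: L2_inner_self)
  also have "\<dots> = L2_inner M f f + L2_inner M f g + (L2_inner M g f + L2_inner M g g)"
    using assms s by (simp add: L2_inner_add_left L2_inner_add_right)
  also have "Re \<dots> = (L2_norm M f)\<^sup>2 + 2 * Re (L2_inner M f g) + (L2_norm M g)\<^sup>2"
    by (simp add: L2_inner_self L2_inner_commute[of M g f])
  finally show ?thesis by simp
qed

lemma L2_norm_diff_sq:
  assumes "f \<in> L2_space M" "g \<in> L2_space M"
  shows "(L2_norm M (\<lambda>x. f x - g x))\<^sup>2 = (L2_norm M f)\<^sup>2 - 2 * Re (L2_inner M f g) + (L2_norm M g)\<^sup>2"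
  using L2_norm_add_sq[OF assms(1) L2_space_scale[OF assms(2), of "-1"]] L2_norm_scale[of M "-1" g]
    L2_inner_scale_right[of M f "-1" g]
  by simp

lemma L2_Cauchy_Schwarz:
  assumes f: "f \<in> L2_space M" and g: "g \<in> L2_space M"
  shows "cmod (L2_inner M f g) \<le> L2_norm M f * L2_norm M g"
proof -
  define a b where "a = L2_norm M f" and "b = L2_norm M g"
  define u where "u = cnj (sgn (L2_inner M f g))"
  define p where "p = cmod (L2_inner M f g)"
  have u: "u * L2_inner M f g = of_real p" "cmod u \<le> 1"
    by (auto simp: u_def p_def sgn_eq norm_mult norm_divide complex_norm_square[symmetric] power2_eq_square
        mult.commute[of "cnj _"])
  have ab: "a \<ge> 0" "b \<ge> 0" by (auto simp: a_def b_def)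
  \<comment> \<open>The weights \<open>s\<close> and \<open>t\<close> cover the case that one of the norms vanishes; the phase \<open>u\<close> turns the cross term into \<open>p\<close>.\<close>
  have key: "2 * (s * t) * p \<le> s\<^sup>2 * a\<^sup>2 + t\<^sup>2 * b\<^sup>2" for s t :: real
  proof -
    have "0 \<le> (L2_norm M (\<lambda>x. (of_real s * u) * f x - of_real t * g x))\<^sup>2" by simp
    also have "\<dots> = (cmod (of_real s * u) * a)\<^sup>2 - 2 * Re ((of_real s * u) * (of_real t * L2_inner M f g))
        + (cmod (of_real t) * b)\<^sup>2"
      by (subst L2_norm_diff_sq) (use f g in \<open>auto simp: L2_norm_scale L2_inner_scale_left L2_inner_scale_right a_def b_def\<close>)
    also have "(of_real s * u) * (of_real t * L2_inner M f g) = of_real (s * t * p)"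
      using u(1) by (simp add: mult_ac)
    also have "(cmod (of_real s * u) * a)\<^sup>2 \<le> s\<^sup>2 * a\<^sup>2"
      using u(2) ab by (auto simp: norm_mult power_mult_distrib intro!: mult_right_mono mult_left_le power_le_one)
    finally show ?thesis by (simp add: power_mult_distrib)
  qed
  have "p \<le> a * b"
  proof (cases "a = 0 \<or> b = 0")
    case False
    then have "a > 0" "b > 0" using ab by auto
    have "2 * (b * a) * p \<le> 2 * (b * a) * (a * b)"
      using key[of b a] by (simp add: power2_eq_square algebra_simps)
    then show ?thesis using \<open>a > 0\<close> \<open>b > 0\<close> by (simp add: mult.commute)
  next
    case True
    have "p \<le> 0"
    proof (rule ccontr)
      assume "\<not> p \<le> 0" then have p: "p > 0" by simp
      show False
      proof (cases "a = 0")
        case True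
        define v where "v = b\<^sup>2 / p + 1"
        have "2 * (v * p) \<le> b\<^sup>2" using key[of v 1] True by (simp add: mult_ac)
        moreover have "v * p = b\<^sup>2 + p" using p by (simp add: v_def field_simps)
        ultimately have "2 * (b\<^sup>2 + p) \<le> b\<^sup>2" by simp
        then show False using p zero_le_power2[of b] by (smt (verit, best))
      next
        case False
        then have "b = 0" using \<open>a = 0 \<or> b = 0\<close> by auto
        define v where "v = a\<^sup>2 / p + 1"
        have "2 * (v * p) \<le> a\<^sup>2" using key[of 1 v] \<open>b = 0\<close> by (simp add: mult_ac)
        moreover have "v * p = a\<^sup>2 + p" using p by (simp add: v_def field_simps)
        ultimately have "2 * (a\<^sup>2 + p) \<le> a\<^sup>2" by simp
        then show False using p zero_le_power2[of a] by (smt (verit, best))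
      qed
    qed
    then show ?thesis using True ab by auto
  qed
  then show ?thesis by (simp add: p_def a_def b_def)
qed

lemma L2_norm_triangle:
  assumes "f \<in> L2_space M" "g \<in> L2_space M"
  shows "L2_norm M (\<lambda>x. f x + g x) \<le> L2_norm M f + L2_norm M g"
proof (rule power2_le_imp_le)
  have "Re (L2_inner M f g) \<le> L2_norm M f * L2_norm M g"
    using L2_Cauchy_Schwarz[OF assms] complex_Re_le_cmod order_trans by blast
  then show "(L2_norm M (\<lambda>x. f x + g x))\<^sup>2 \<le> (L2_norm M f + L2_norm M g)\<^sup>2"
    unfolding L2_norm_add_sq[OF assms] power2_sum by simp
qed simp

lemma L2_norm_minus_commute: "L2_norm M (\<lambda>x. f x - g x) = L2_norm M (\<lambda>x. g x - f x)"
  by (simp add: L2_norm_def norm_minus_commute)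

lemma L2_norm_triangle_diff:
  assumes "f \<in> L2_space M" "g \<in> L2_space M"
  shows "\<bar>L2_norm M f - L2_norm M g\<bar> \<le> L2_norm M (\<lambda>x. f x - g x)"
proof -
  have "L2_norm M f \<le> L2_norm M (\<lambda>x. f x - g x) + L2_norm M g"
    using L2_norm_triangle[OF L2_space_diff[OF assms] assms(2)] by simp
  moreover have "L2_norm M g \<le> L2_norm M (\<lambda>x. g x - f x) + L2_norm M f"
    using L2_norm_triangle[OF L2_space_diff[OF assms(2,1)] assms(1)] by simp
  ultimately show ?thesis using L2_norm_minus_commute[of M f g] by linarith
qed

lemma L2_norm_diff_triangle:
  assumes "f \<in> L2_space M" "g \<in> L2_space M" "h \<in> L2_space M"
  shows "L2_norm M (\<lambda>x. f x - h x) \<le> L2_norm M (\<lambda>x. f x - g x) + L2_norm M (\<lambda>x. g x - h x)"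
  using L2_norm_triangle[OF L2_space_diff[OF assms(1,2)] L2_space_diff[OF assms(2,3)]] by simp

lemma L2_eq_refl [simp]: "L2_eq M f f"
  by (simp add: L2_eq_def)

lemma L2_eq_sym: "L2_eq M f g \<Longrightarrow> L2_eq M g f"
  by (auto simp: L2_eq_def elim: AE_mp)

lemma L2_eq_trans: "L2_eq M f g \<Longrightarrow> L2_eq M g h \<Longrightarrow> L2_eq M f h"
  unfolding L2_eq_def by (auto elim: AE_mp)

lemma L2_eq_iff_norm:
  assumes "f \<in> L2_space M" "g \<in> L2_space M"
  shows "L2_eq M f g \<longleftrightarrow> L2_norm M (\<lambda>x. f x - g x) = 0"
proof -
  have "L2_norm M (\<lambda>x. f x - g x) = 0 \<longleftrightarrow> (LINT x|M. (cmod (f x - g x))\<^sup>2) = 0"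
    by (simp add: L2_norm_def)
  also have "\<dots> \<longleftrightarrow> (AE x in M. (cmod (f x - g x))\<^sup>2 = 0)"
    using assms by (intro integral_nonneg_eq_0_iff_AE L2_integrable_square L2_space_diff) auto
  finally show ?thesis by (simp add: L2_eq_def)
qed

lemma L2_inner_cong:
  assumes "L2_eq M f f'" "L2_eq M g g'"
    and "f \<in> L2_space M" "f' \<in> L2_space M" "g \<in> L2_space M" "g' \<in> L2_space M"
  shows "L2_inner M f g = L2_inner M f' g'"
proof -
  have [measurable]: "f \<in> borel_measurable M" "g \<in> borel_measurable M"
    "f' \<in> borel_measurable M" "g' \<in> borel_measurable M"
    using assms by (auto dest: L2_measurable)
  show ?thesis unfolding L2_inner_def
    using assms(1,2) by (intro integral_cong_AE) (auto simp: L2_eq_def elim!: AE_mp)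
qed

lemma L2_norm_cong:
  assumes "L2_eq M f g" "f \<in> L2_space M" "g \<in> L2_space M"
  shows "L2_norm M f = L2_norm M g"
  using L2_norm_triangle_diff[OF assms(2,3)] assms by (simp add: L2_eq_iff_norm)

lemma L2_eqI_inner:
  assumes "f \<in> L2_space M" "g \<in> L2_space M"
    and "\<And>h. h \<in> L2_space M \<Longrightarrow> L2_inner M h f = L2_inner M h g"
  shows "L2_eq M f g"
proof -
  have d: "(\<lambda>x. f x - g x) \<in> L2_space M" using assms by simp
  have "L2_inner M (\<lambda>x. f x - g x) (\<lambda>x. f x - g x) = 0"
    using assms(3)[OF d] assms d by (subst L2_inner_diff_right) auto
  then show ?thesis using assms by (simp add: L2_eq_iff_norm L2_inner_self)
qed

lemma L2_inner_tendsto: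
  assumes "\<And>n. F n \<in> L2_space M" "f \<in> L2_space M" "g \<in> L2_space M"
    and "(\<lambda>n. L2_norm M (\<lambda>x. F n x - f x)) \<longlonglongrightarrow> 0"
  shows "(\<lambda>n. L2_inner M (F n) g) \<longlonglongrightarrow> L2_inner M f g"
proof -
  have "(\<lambda>n. L2_inner M (F n) g - L2_inner M f g) \<longlonglongrightarrow> 0"
  proof (rule Lim_null_comparison)
    show "\<forall>\<^sub>F n in sequentially. norm (L2_inner M (F n) g - L2_inner M f g)
       \<le> L2_norm M (\<lambda>x. F n x - f x) * L2_norm M g"
      using L2_Cauchy_Schwarz[OF L2_space_diff[OF assms(1,2)] assms(3)] assms
      by (auto simp: L2_inner_diff_left)
    show "(\<lambda>n. L2_norm M (\<lambda>x. F n x - f x) * L2_norm M g) \<longlonglongrightarrow> 0"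
      using tendsto_mult_right[OF assms(4), of "L2_norm M g"] by simp
  qed
  then show ?thesis by (simp add: LIM_zero_iff)
qed

lemma L2_norm_tendsto:
  assumes "\<And>n. F n \<in> L2_space M" "f \<in> L2_space M"
    and "(\<lambda>n. L2_norm M (\<lambda>x. F n x - f x)) \<longlonglongrightarrow> 0"
  shows "(\<lambda>n. L2_norm M (F n)) \<longlonglongrightarrow> L2_norm M f"
proof -
  have "(\<lambda>n. L2_norm M (F n) - L2_norm M f) \<longlonglongrightarrow> 0"
    by (rule Lim_null_comparison[OF _ assms(3)])
      (use L2_norm_triangle_diff[OF assms(1,2)] in auto)
  then show ?thesis by (simp add: LIM_zero_iff)
qed

text \<open>
  Riesz--Fischer. Along a subsequence with \<open>\<parallel>F\<^bsub>r (k+1)\<^esub> - F\<^bsub>r k\<^esub>\<parallel> \<le> 2\<^sup>-\<^sup>k\<close> the weighted sum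
  of squares \<open>\<Sum>k. 2\<^sup>k |F\<^bsub>r (k+1)\<^esub> x - F\<^bsub>r k\<^esub> x|\<^sup>2\<close> is integrable, hence finite almost everywhere,
  so that the increments decay geometrically there. The pointwise limit is the limit in norm by
  Fatou's lemma.
\<close>

lemma L2_complete:
  assumes F: "\<And>n. F n \<in> L2_space M"
    and Cauchy: "\<And>e. e > 0 \<Longrightarrow> \<exists>N. \<forall>m\<ge>N. \<forall>n\<ge>N. L2_norm M (\<lambda>x. F m x - F n x) < e"
  obtains f where "f \<in> L2_space M" "(\<lambda>n. L2_norm M (\<lambda>x. F n x - f x)) \<longlonglongrightarrow> 0"
proof -
  have Fm [measurable]: "\<And>n. F n \<in> borel_measurable M" using F by (auto dest: L2_measurable)
  have "\<forall>k. \<exists>N. \<forall>m\<ge>N. \<forall>n\<ge>N. L2_norm M (\<lambda>x. F m x - F n x) < (1/2)^k"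
    using Cauchy by simp
  then obtain N where N: "\<And>k m n. m \<ge> N k \<Longrightarrow> n \<ge> N k \<Longrightarrow> L2_norm M (\<lambda>x. F m x - F n x) < (1/2)^k"
    by metis
  \<comment> \<open>The sum makes \<open>r k\<close> exceed \<open>N j\<close> for every \<open>j \<le> k\<close>.\<close>
  define r where "r k = k + (\<Sum>i\<le>k. N i)" for k
  have rN: "r k \<ge> N j" if "j \<le> k" for j k
    using member_le_sum[of j "{..k}" N] that by (auto simp: r_def)
  have rk: "r k \<ge> k" for k by (simp add: r_def)
  define g where "g k x = (cmod (F (r (Suc k)) x - F (r k) x))\<^sup>2" for k x
  have [measurable]: "\<And>k. g k \<in> borel_measurable M" unfolding g_def by measurable
  have diff: "(\<lambda>x. F m x - F n x) \<in> L2_space M" for m n using F by simp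
  have gint: "(\<integral>\<^sup>+x. ennreal (2^k * g k x) \<partial>M) \<le> ennreal ((1/2)^k)" for k
  proof -
    have "(\<integral>\<^sup>+x. ennreal (2^k * g k x) \<partial>M) = ennreal (2^k) * (\<integral>\<^sup>+x. ennreal (g k x) \<partial>M)"
      by (simp add: ennreal_mult g_def nn_integral_cmult)
    also have "\<dots> = ennreal (2^k * (L2_norm M (\<lambda>x. F (r (Suc k)) x - F (r k) x))\<^sup>2)"
      unfolding g_def using L2_norm_nn_integral[OF diff] by (simp add: ennreal_mult)
    also have "\<dots> \<le> ennreal (2^k * ((1/2)^k)\<^sup>2)"
      using N[of k "r (Suc k)" "r k"] rN[of k "Suc k"] rN[of k k]
      by (intro ennreal_leI mult_left_mono power_mono) auto
    also have "2^k * ((1/2::real)^k)\<^sup>2 = (1/2)^k"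
      by (simp add: power2_eq_square power_one_over)
    finally show ?thesis .
  qed
  have "(\<integral>\<^sup>+x. (\<Sum>k. ennreal (2^k * g k x)) \<partial>M) = (\<Sum>k. \<integral>\<^sup>+x. ennreal (2^k * g k x) \<partial>M)"
    by (rule nn_integral_suminf) simp
  also have "\<dots> \<le> (\<Sum>k. ennreal ((1/2)^k))" by (intro suminf_le gint) auto
  also have "\<dots> < \<infinity>" by (subst suminf_ennreal2) (auto intro: summable_geometric)
  finally have "AE x in M. (\<Sum>k. ennreal (2^k * g k x)) \<noteq> \<infinity>"
    by (intro nn_integral_PInf_AE) auto
  then have conv: "AE x in M. convergent (\<lambda>k. F (r k) x)"
  proof (rule AE_mp, intro AE_I2 impI)
    fix x assume fin: "(\<Sum>k. ennreal (2^k * g k x)) \<noteq> \<infinity>"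
    then obtain B where B: "B \<ge> 0" "(\<Sum>k. ennreal (2^k * g k x)) = ennreal B"
      by (cases "(\<Sum>k. ennreal (2^k * g k x))") auto
    have gB: "2^k * g k x \<le> B" for k
    proof -
      have "ennreal (2^k * g k x) \<le> ennreal B"
        unfolding B(2)[symmetric]
        using sum_le_suminf[of "\<lambda>k. ennreal (2^k * g k x)" "{k}"] by simp
      then show ?thesis using B(1) by (simp add: ennreal_le_iff)
    qed
    have dle: "norm (F (r (Suc k)) x - F (r k) x) \<le> sqrt B * (sqrt (1/2))^k" for k
    proof (rule power2_le_imp_le)
      have "(norm (F (r (Suc k)) x - F (r k) x))\<^sup>2 \<le> B * (1/2)^k"
        using gB[of k] by (simp add: g_def power_one_over pos_le_divide_eq mult.commute)
      also have "\<dots> = (sqrt B)\<^sup>2 * ((sqrt (1/2))\<^sup>2)^k" using B(1) by simp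
      also have "\<dots> = (sqrt B * (sqrt (1/2))^k)\<^sup>2"
        by (simp only: power_mult_distrib power_mult[symmetric] mult.commute[of k 2])
      finally show "(norm (F (r (Suc k)) x - F (r k) x))\<^sup>2 \<le> (sqrt B * (sqrt (1/2))^k)\<^sup>2" .
    qed (use B in auto)
    have "summable (\<lambda>k. sqrt B * (sqrt (1/2))^k)"
      by (intro summable_mult summable_geometric) (simp add: real_sqrt_divide)
    then have "summable (\<lambda>k. F (r (Suc k)) x - F (r k) x)"
      by (rule summable_comparison_test'[where N=0]) (rule dle)
    then have "(\<lambda>n. \<Sum>k<n. F (r (Suc k)) x - F (r k) x) \<longlonglongrightarrow> (\<Sum>k. F (r (Suc k)) x - F (r k) x)"
      by (rule summable_LIMSEQ)
    then have "(\<lambda>n. F (r n) x - F (r 0) x) \<longlonglongrightarrow> (\<Sum>k. F (r (Suc k)) x - F (r k) x)"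
      by (simp only: sum_lessThan_telescope[of "\<lambda>k. F (r k) x"])
    from tendsto_add[OF this tendsto_const[of "F (r 0) x"]]
    show "convergent (\<lambda>k. F (r k) x)" by (auto simp: convergent_def)
  qed
  define f where "f x = lim (\<lambda>k. F (r k) x)" for x
  have fm [measurable]: "f \<in> borel_measurable M" unfolding f_def by measurable
  have lim: "AE x in M. (\<lambda>k. F (r k) x) \<longlonglongrightarrow> f x"
    using conv by (rule AE_mp) (auto simp: f_def convergent_LIMSEQ_iff)
  have fatou: "(\<integral>\<^sup>+x. ennreal ((cmod (F n x - f x))\<^sup>2) \<partial>M) \<le> ennreal (((1/2)^j)\<^sup>2)"
    if n: "n \<ge> N j" for n j
  proof -
    have "(\<integral>\<^sup>+x. ennreal ((cmod (F n x - f x))\<^sup>2) \<partial>M)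
        = (\<integral>\<^sup>+x. liminf (\<lambda>k. ennreal ((cmod (F n x - F (r k) x))\<^sup>2)) \<partial>M)"
    proof (rule nn_integral_cong_AE, rule AE_mp[OF lim], intro AE_I2 impI)
      fix x assume "(\<lambda>k. F (r k) x) \<longlonglongrightarrow> f x"
      then have "(\<lambda>k. ennreal ((cmod (F n x - F (r k) x))\<^sup>2)) \<longlonglongrightarrow> ennreal ((cmod (F n x - f x))\<^sup>2)"
        by (intro tendsto_intros)
      then show "ennreal ((cmod (F n x - f x))\<^sup>2) = liminf (\<lambda>k. ennreal ((cmod (F n x - F (r k) x))\<^sup>2))"
        by (intro lim_imp_Liminf[symmetric]) simp_all
    qed
    also have "\<dots> \<le> liminf (\<lambda>k. \<integral>\<^sup>+x. ennreal ((cmod (F n x - F (r k) x))\<^sup>2) \<partial>M)"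
      by (rule nn_integral_liminf) simp
    also have "\<dots> \<le> ennreal (((1/2)^j)\<^sup>2)"
    proof (rule Liminf_le)
      show "\<forall>\<^sub>F k in sequentially. (\<integral>\<^sup>+x. ennreal ((cmod (F n x - F (r k) x))\<^sup>2) \<partial>M) \<le> ennreal (((1/2)^j)\<^sup>2)"
        unfolding L2_norm_nn_integral[OF diff]
        by (rule eventually_sequentiallyI[of j], rule ennreal_leI, rule power_mono,
              rule less_imp_le[OF N[OF n rN]]) auto
    qed simp
    finally show ?thesis .
  qed
  have d: "(\<lambda>x. F n x - f x) \<in> L2_space M" if "n \<ge> N j" for n j
    using le_less_trans[OF fatou[OF that] ennreal_less_top] by (intro L2_space_nn_integralI) auto
  have fL: "f \<in> L2_space M"
    using L2_space_diff[OF F[of "N 0"] d[of 0 "N 0"]] by simp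
  have le: "L2_norm M (\<lambda>x. F n x - f x) \<le> (1/2)^j" if "n \<ge> N j" for n j
  proof (rule power2_le_imp_le)
    show "(L2_norm M (\<lambda>x. F n x - f x))\<^sup>2 \<le> ((1/2)^j)\<^sup>2"
      using fatou[OF that] unfolding L2_norm_nn_integral[OF d[OF that]] by (simp add: ennreal_le_iff)
  qed simp
  have "(\<lambda>n. L2_norm M (\<lambda>x. F n x - f x)) \<longlonglongrightarrow> 0"
  proof (rule LIMSEQ_I)
    fix e :: real assume "e > 0"
    then obtain j where j: "(1/2)^j < e" using real_arch_pow_inv[of e "1/2"] by auto
    show "\<exists>no. \<forall>n\<ge>no. norm (L2_norm M (\<lambda>x. F n x - f x) - 0) < e"
      using le_less_trans[OF le j] by (intro exI[of _ "N j"]) auto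
  qed
  with fL show thesis by (rule that)
qed

text \<open>
  The symmetric Lax--Milgram theorem: the minimizer of \<open>q f f - 2 Re (l f)\<close> represents \<open>l\<close>. A
  minimizing sequence is Cauchy by the parallelogram identity and coercivity.
\<close>

lemma L2_Lax_Milgram:
  fixes q :: "('a \<Rightarrow> complex) \<Rightarrow> ('a \<Rightarrow> complex) \<Rightarrow> complex" and l :: "('a \<Rightarrow> complex) \<Rightarrow> complex"
  assumes q_add: "\<And>f g h. f \<in> L2_space M \<Longrightarrow> g \<in> L2_space M \<Longrightarrow> h \<in> L2_space M \<Longrightarrow>
      q (\<lambda>x. f x + g x) h = q f h + q g h"
    and q_scale: "\<And>f h c. f \<in> L2_space M \<Longrightarrow> h \<in> L2_space M \<Longrightarrow> q (\<lambda>x. c * f x) h = c * q f h"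
    and q_sym: "\<And>f g. f \<in> L2_space M \<Longrightarrow> g \<in> L2_space M \<Longrightarrow> q g f = cnj (q f g)"
    and q_lower: "\<And>f. f \<in> L2_space M \<Longrightarrow> A * (L2_norm M f)\<^sup>2 \<le> Re (q f f)" and "A > 0"
    and q_upper: "\<And>f. f \<in> L2_space M \<Longrightarrow> Re (q f f) \<le> B * (L2_norm M f)\<^sup>2"
    and l_add: "\<And>f g. f \<in> L2_space M \<Longrightarrow> g \<in> L2_space M \<Longrightarrow> l (\<lambda>x. f x + g x) = l f + l g"
    and l_scale: "\<And>f c. f \<in> L2_space M \<Longrightarrow> l (\<lambda>x. c * f x) = c * l f"
    and l_bound: "\<And>f. f \<in> L2_space M \<Longrightarrow> cmod (l f) \<le> K * L2_norm M f"
  obtains h where "h \<in> L2_space M" "\<And>f. f \<in> L2_space M \<Longrightarrow> l f = q f h"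
proof -
  define Q where "Q f = Re (q f f)" for f
  define J where "J f = Q f - 2 * Re (l f)" for f
  have q_add2: "q h (\<lambda>x. f x + g x) = q h f + q h g"
    if "f \<in> L2_space M" "g \<in> L2_space M" "h \<in> L2_space M" for f g h
    using q_sym[OF L2_space_add[OF that(1,2)] that(3)] q_sym[OF that(1,3)] q_sym[OF that(2,3)] q_add[OF that]
    by simp
  have q_scale2: "q h (\<lambda>x. c * f x) = cnj c * q h f"
    if "f \<in> L2_space M" "h \<in> L2_space M" for f h c
    using q_sym[OF L2_space_scale[OF that(1)] that(2)] q_sym[OF that] q_scale[OF that] by simp
  have Q_lin: "Q (\<lambda>x. f x + of_real t * g x) = Q f + 2 * t * Re (q g f) + t\<^sup>2 * Q g"
    if fg: "f \<in> L2_space M" "g \<in> L2_space M" for f g t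
  proof -
    let ?g = "\<lambda>x. of_real t * g x"
    have g: "?g \<in> L2_space M" using fg by simp
    have s: "(\<lambda>x. f x + ?g x) \<in> L2_space M" by (intro L2_space_add fg g)
    have "q (\<lambda>x. f x + ?g x) (\<lambda>x. f x + ?g x)
        = q f f + of_real t * q f g + of_real t * q g f + of_real (t\<^sup>2) * q g g"
      using fg g s by (simp add: q_add q_add2 q_scale q_scale2 power2_eq_square algebra_simps)
    moreover have "Re (q f g) = Re (q g f)" using q_sym[OF fg] by simp
    ultimately show ?thesis by (simp add: Q_def)
  qed
  have l_lin: "l (\<lambda>x. f x + of_real t * g x) = l f + of_real t * l g"
    if "f \<in> L2_space M" "g \<in> L2_space M" for f g t
    using that by (simp add: l_add l_scale L2_space_scale)
  have J_low: "- (K\<^sup>2 / A) \<le> J f" if "f \<in> L2_space M" for f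
  proof -
    have "0 \<le> (A * L2_norm M f - K)\<^sup>2" by simp
    then have "2 * A * K * L2_norm M f \<le> A * (A * (L2_norm M f)\<^sup>2) + K\<^sup>2"
      by (simp add: power2_diff power_mult_distrib) (simp add: power2_eq_square algebra_simps)
    moreover have "Re (l f) \<le> K * L2_norm M f"
      using l_bound[OF that] complex_Re_le_cmod[of "l f"] by linarith
    then have "A * (2 * Re (l f)) \<le> A * (2 * (K * L2_norm M f))" using \<open>A > 0\<close> by simp
    moreover have "A * (A * (L2_norm M f)\<^sup>2) \<le> A * Q f"
      using q_lower[OF that] \<open>A > 0\<close> by (simp add: Q_def)
    ultimately have "- (K\<^sup>2) \<le> A * J f" by (simp add: J_def algebra_simps)
    then show ?thesis using \<open>A > 0\<close> by (simp add: field_simps)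
  qed
  define \<mu> where "\<mu> = Inf (J ` L2_space M)"
  have bdd: "bdd_below (J ` L2_space M)" using J_low by (intro bdd_belowI2)
  have \<mu>_le: "\<mu> \<le> J f" if "f \<in> L2_space M" for f
    unfolding \<mu>_def using that bdd by (intro cInf_lower) auto
  have "\<exists>f\<in>L2_space M. J f < \<mu> + e" if "e > 0" for e
  proof -
    have "(\<lambda>x. 0) \<in> L2_space M" by simp
    then have "J ` L2_space M \<noteq> {}" by blast
    from cInf_lessD[OF this, of "\<mu> + e"] that show ?thesis by (auto simp: \<mu>_def)
  qed
  then have "\<forall>n. \<exists>f\<in>L2_space M. J f < \<mu> + inverse (real (Suc n))" by simp
  then obtain F where F: "\<And>n. F n \<in> L2_space M" "\<And>n. J (F n) < \<mu> + inverse (real (Suc n))"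
    by metis
  \<comment> \<open>The parallelogram identity, obtained by expanding \<open>Q\<close> along the line from \<open>f\<close> to \<open>g\<close> and evaluating \<open>J\<close> at the midpoint.\<close>
  have close: "A * (L2_norm M (\<lambda>x. f x - g x))\<^sup>2 \<le> 2 * (J f - \<mu>) + 2 * (J g - \<mu>)"
    if fg: "f \<in> L2_space M" "g \<in> L2_space M" for f g
  proof -
    let ?m = "\<lambda>x. f x + of_real (-1/2) * (f x - g x)"
    let ?d = "\<lambda>x. f x - g x"
    have d: "?d \<in> L2_space M" using fg by simp
    have m: "?m \<in> L2_space M" by (intro L2_space_add L2_space_scale fg d)
    have g: "g = (\<lambda>x. f x + of_real (-1) * (f x - g x))" by auto
    have Qg: "Q g = Q f + 2 * (-1) * Re (q ?d f) + (-1)\<^sup>2 * Q ?d"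
      by (subst g) (rule Q_lin[OF fg(1) d])
    have lg: "l g = l f + of_real (-1) * l ?d"
      by (subst g) (rule l_lin[OF fg(1) d])
    have "J ?m = Q f + 2 * (-1/2) * Re (q ?d f) + (-1/2)\<^sup>2 * Q ?d - 2 * Re (l f + of_real (-1/2) * l ?d)"
      unfolding J_def Q_lin[OF fg(1) d] l_lin[OF fg(1) d] ..
    also have "\<dots> = (J f + J g) / 2 - Q ?d / 4"
    proof -
      have "Re (l g) = Re (l f) - Re (l ?d)" unfolding lg by simp
      moreover have "Re (l f + of_real (-1/2) * l ?d) = Re (l f) - Re (l ?d) / 2" by simp
      moreover have "Q g = Q f - 2 * Re (q ?d f) + Q ?d" unfolding Qg by simp
      ultimately show ?thesis unfolding J_def by (simp add: power2_eq_square field_simps)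
    qed
    finally have "\<mu> \<le> (J f + J g) / 2 - Q ?d / 4" using \<mu>_le[OF m] by simp
    moreover have "A * (L2_norm M ?d)\<^sup>2 \<le> Q ?d" using q_lower[OF d] by (simp add: Q_def)
    ultimately show ?thesis by (simp add: field_simps)
  qed
  have "\<exists>N. \<forall>m\<ge>N. \<forall>n\<ge>N. L2_norm M (\<lambda>x. F m x - F n x) < e" if "e > 0" for e
  proof -
    obtain N where N: "inverse (real (Suc N)) < A * e\<^sup>2 / 4"
      using reals_Archimedean[of "A * e\<^sup>2 / 4"] \<open>A > 0\<close> \<open>e > 0\<close> by auto
    have Nn: "J (F n) - \<mu> < A * e\<^sup>2 / 4" if "n \<ge> N" for n
    proof -
      have "inverse (real (Suc n)) \<le> inverse (real (Suc N))" using that by (simp add: field_simps)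
      then show ?thesis using F(2)[of n] N by linarith
    qed
    have "L2_norm M (\<lambda>x. F m x - F n x) < e" if "m \<ge> N" "n \<ge> N" for m n
    proof (rule power2_less_imp_less)
      have "A * (L2_norm M (\<lambda>x. F m x - F n x))\<^sup>2 < A * e\<^sup>2"
        using close[OF F(1)[of m] F(1)[of n]] Nn[OF that(1)] Nn[OF that(2)] by simp
      then show "(L2_norm M (\<lambda>x. F m x - F n x))\<^sup>2 < e\<^sup>2" using \<open>A > 0\<close> by simp
    qed (use \<open>e > 0\<close> in auto)
    then show ?thesis by blast
  qed
  then obtain h where h: "h \<in> L2_space M" "(\<lambda>n. L2_norm M (\<lambda>x. F n x - h x)) \<longlonglongrightarrow> 0"
    using L2_complete[of F M] F(1) by blast
  \<comment> \<open>\<open>J\<close> is continuous along the minimizing sequence; it suffices to control \<open>J h - J (F n)\<close>.\<close>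
  have Jh: "J h \<le> \<mu>"
  proof -
    have est: "J h \<le> J (F n) + ((2 * K) * L2_norm M (\<lambda>x. F n x - h x)
        + 2 * sqrt (B * B) * L2_norm M h * L2_norm M (\<lambda>x. F n x - h x))" for n
    proof -
      let ?d = "\<lambda>x. F n x - h x"
      have d: "?d \<in> L2_space M" using F h by simp
      have Fn: "F n = (\<lambda>x. h x + of_real 1 * (F n x - h x))" by auto
      have QF: "Q (F n) = Q h + 2 * 1 * Re (q ?d h) + 1\<^sup>2 * Q ?d"
        by (subst Fn) (rule Q_lin[OF h(1) d])
      have lF: "l (F n) = l h + of_real 1 * l ?d"
        by (subst Fn) (rule l_lin[OF h(1) d])
      have Qpos: "0 \<le> Q f" if "f \<in> L2_space M" for f
        using q_lower[OF that] \<open>A > 0\<close> by (smt (verit) Q_def mult_nonneg_nonneg zero_le_power2)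
      \<comment> \<open>Cauchy--Schwarz for \<open>q\<close>; the root is \<open>|B|\<close>, as \<open>B\<close> may be negative if all norms vanish.\<close>
      have cs: "\<bar>Re (q ?d h)\<bar> \<le> sqrt (B * B) * L2_norm M h * L2_norm M ?d"
      proof -
        have pos: "0 \<le> Q h + 2 * t * Re (q ?d h) + t\<^sup>2 * Q ?d" for t
          using Qpos[of "\<lambda>x. h x + of_real t * ?d x"] Q_lin[OF h(1) d, of t]
            L2_space_add[OF h(1) L2_space_scale[OF d]] by metis
        have "(Re (q ?d h))\<^sup>2 \<le> Q h * Q ?d"
        proof (cases "Q ?d = 0")
          case True
          have "Re (q ?d h) = 0"
          proof (rule ccontr)
            assume c: "Re (q ?d h) \<noteq> 0"
            show False using pos[of "- (Q h + 1) / (2 * Re (q ?d h))"] c True by (simp add: field_simps)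
          qed
          then show ?thesis using True by simp
        next
          case False
          then have "Q ?d > 0" using Qpos[OF d] by simp
          then show ?thesis using pos[of "- Re (q ?d h) / Q ?d"]
            by (simp add: field_simps power2_eq_square)
        qed
        also have "\<dots> \<le> (B * (L2_norm M h)\<^sup>2) * (B * (L2_norm M ?d)\<^sup>2)"
          using q_upper[OF h(1)] q_upper[OF d] Qpos[OF h(1)] Qpos[OF d]
          unfolding Q_def by (intro mult_mono) auto
        also have "\<dots> = (sqrt (B * B) * L2_norm M h * L2_norm M ?d)\<^sup>2"
          by (simp add: power_mult_distrib) (simp add: power2_eq_square)
        finally show ?thesis
          by (metis abs_le_square_iff abs_of_nonneg mult_nonneg_nonneg L2_norm_nonneg real_sqrt_ge_zero zero_le_square)
      qed
      have "Re (l ?d) \<le> K * L2_norm M ?d"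
        using l_bound[OF d] complex_Re_le_cmod[of "l ?d"] by linarith
      then show ?thesis unfolding J_def QF lF using cs Qpos[OF d] by simp
    qed
    have "(\<lambda>n. (\<mu> + inverse (real (Suc n))) + ((2 * K) * L2_norm M (\<lambda>x. F n x - h x)
        + 2 * sqrt (B * B) * L2_norm M h * L2_norm M (\<lambda>x. F n x - h x)))
        \<longlonglongrightarrow> (\<mu> + 0) + ((2 * K) * 0 + 2 * sqrt (B * B) * L2_norm M h * 0)"
      by (intro tendsto_intros h LIMSEQ_inverse_real_of_nat)
    from LIMSEQ_le_const[OF this, of "J h"] show ?thesis
      using order_trans[OF est add_right_mono[OF less_imp_le[OF F(2)]]] by simp
  qed
  \<comment> \<open>The first variation of \<open>J\<close> at its minimizer vanishes.\<close>
  have real_part: "Re (l f) = Re (q f h)" if f: "f \<in> L2_space M" for f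
  proof -
    define c where "c = Re (q f h) - Re (l f)"
    have pos: "0 \<le> 2 * t * c + t\<^sup>2 * Q f" for t
    proof -
      have "J h \<le> J (\<lambda>x. h x + of_real t * f x)"
        using Jh \<mu>_le[OF L2_space_add[OF h(1) L2_space_scale[OF f, of "of_real t"]]] by simp
      also have "\<dots> = J h + 2 * t * c + t\<^sup>2 * Q f"
        unfolding J_def Q_lin[OF h(1) f] l_lin[OF h(1) f] by (simp add: c_def algebra_simps)
      finally show ?thesis by simp
    qed
    have "c = 0"
    proof (rule ccontr)
      assume c: "c \<noteq> 0"
      have Qf: "0 \<le> Q f"
        using order_trans[OF _ q_lower[OF f], of 0] \<open>A > 0\<close> by (simp add: Q_def)
      define t where "t = c / (Q f + 1)"
      have c': "c = t * (Q f + 1)" using Qf by (simp add: t_def)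
      have "t \<noteq> 0" using c Qf by (simp add: t_def)
      have "0 \<le> 2 * (- t) * c + (- t)\<^sup>2 * Q f" by (rule pos)
      also have "\<dots> = - (t\<^sup>2 * (Q f + 2))"
        unfolding c' by (simp add: power2_eq_square algebra_simps)
      also have "\<dots> < 0" using \<open>t \<noteq> 0\<close> Qf by simp
      finally show False by simp
    qed
    then show ?thesis by (simp add: c_def)
  qed
  have "l f = q f h" if f: "f \<in> L2_space M" for f
  proof (rule complex_eqI)
    show "Re (l f) = Re (q f h)" by (rule real_part[OF f])
    have "Re (l (\<lambda>x. \<i> * f x)) = Re (q (\<lambda>x. \<i> * f x) h)" using f by (intro real_part) simp
    then show "Im (l f) = Im (q f h)" using f h by (simp add: l_scale q_scale)
  qed
  with h(1) show thesis by (rule that)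
qed


section \<open>Moore--Penrose inverses\<close>

lemma bounded_op_L2: "bounded_op M N T \<Longrightarrow> f \<in> L2_space M \<Longrightarrow> T f \<in> L2_space N"
  by (simp add: bounded_op_def)

lemma bounded_op_add: "bounded_op M N T \<Longrightarrow> f \<in> L2_space M \<Longrightarrow> g \<in> L2_space M \<Longrightarrow>
    L2_eq N (T (\<lambda>x. f x + g x)) (\<lambda>y. T f y + T g y)"
  and bounded_op_scale: "bounded_op M N T \<Longrightarrow> f \<in> L2_space M \<Longrightarrow>
    L2_eq N (T (\<lambda>x. c * f x)) (\<lambda>y. c * T f y)"
  by (simp_all add: bounded_op_def)

lemma bounded_op_norm: "bounded_op M N T \<Longrightarrow> \<exists>K. \<forall>f\<in>L2_space M. L2_norm N (T f) \<le> K * L2_norm M f"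
  by (simp add: bounded_op_def)

text \<open>Operators act on representatives; boundedness makes them respect equality almost everywhere.\<close>

lemma bounded_op_cong:
  assumes T: "bounded_op M N T" and fg: "f \<in> L2_space M" "g \<in> L2_space M" "L2_eq M f g"
  shows "L2_eq N (T f) (T g)"
proof -
  have d: "(\<lambda>x. f x - g x) \<in> L2_space M" using fg by simp
  obtain K where "L2_norm N (T (\<lambda>x. f x - g x)) \<le> K * L2_norm M (\<lambda>x. f x - g x)"
    using T d unfolding bounded_op_def by blast
  then have "L2_norm N (T (\<lambda>x. f x - g x)) = 0"
    using fg by (simp add: L2_eq_iff_norm order_antisym)
  then have "L2_eq N (T (\<lambda>x. f x - g x)) (\<lambda>x. 0)"
    using bounded_op_L2[OF T d] by (simp add: L2_eq_iff_norm)
  moreover have "L2_eq N (T (\<lambda>x. g x + (f x - g x))) (\<lambda>x. T g x + T (\<lambda>x. f x - g x) x)"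
    by (rule bounded_op_add[OF T fg(2) d])
  ultimately show ?thesis by (auto simp: L2_eq_def elim: AE_mp)
qed

declare L2_eq_trans [trans]

lemma bounded_op_comp:
  assumes T: "bounded_op M N T" and U: "bounded_op N P U"
  shows "bounded_op M P (\<lambda>f. U (T f))"
  unfolding bounded_op_def
proof (intro conjI ballI allI)
  fix f g :: "'a \<Rightarrow> complex" and c assume f: "f \<in> L2_space M"
  show "U (T f) \<in> L2_space P" by (rule bounded_op_L2[OF U bounded_op_L2[OF T f]])
  have "L2_eq P (U (T (\<lambda>x. c * f x))) (U (\<lambda>x. c * T f x))"
    using f by (intro bounded_op_cong[OF U] bounded_op_L2[OF T] bounded_op_scale[OF T] L2_space_scale)
  moreover have "L2_eq P (U (\<lambda>x. c * T f x)) (\<lambda>x. c * U (T f) x)"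
    by (rule bounded_op_scale[OF U bounded_op_L2[OF T f]])
  ultimately show "L2_eq P (U (T (\<lambda>x. c * f x))) (\<lambda>x. c * U (T f) x)" by (rule L2_eq_trans)
  assume g: "g \<in> L2_space M"
  have "L2_eq P (U (T (\<lambda>x. f x + g x))) (U (\<lambda>x. T f x + T g x))"
    using f g by (intro bounded_op_cong[OF U] bounded_op_L2[OF T] bounded_op_add[OF T] L2_space_add)
  moreover have "L2_eq P (U (\<lambda>x. T f x + T g x)) (\<lambda>x. U (T f) x + U (T g) x)"
    by (rule bounded_op_add[OF U bounded_op_L2[OF T f] bounded_op_L2[OF T g]])
  ultimately show "L2_eq P (U (T (\<lambda>x. f x + g x))) (\<lambda>x. U (T f) x + U (T g) x)" by (rule L2_eq_trans)
next
  obtain K where "\<forall>f\<in>L2_space M. L2_norm N (T f) \<le> K * L2_norm M f"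
    using bounded_op_norm[OF T] by auto
  note K = this[rule_format]
  obtain L where "\<forall>f\<in>L2_space N. L2_norm P (U f) \<le> L * L2_norm N f"
    using bounded_op_norm[OF U] by auto
  note L = this[rule_format]
  show "\<exists>K. \<forall>f\<in>L2_space M. L2_norm P (U (T f)) \<le> K * L2_norm M f"
  proof (intro exI ballI)
    fix f assume f: "f \<in> L2_space M"
    have "L2_norm P (U (T f)) \<le> \<bar>L\<bar> * L2_norm N (T f)"
      using L[OF bounded_op_L2[OF T f]] mult_right_mono[OF abs_ge_self[of L] L2_norm_nonneg[of N "T f"]] by linarith
    also have "\<dots> \<le> \<bar>L\<bar> * (K * L2_norm M f)" by (intro mult_left_mono K f) simp
    finally show "L2_norm P (U (T f)) \<le> (\<bar>L\<bar> * K) * L2_norm M f" by (simp add: mult_ac)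
  qed
qed

text \<open>
  Penrose's uniqueness argument: \<open>T X\<close> and \<open>T Y\<close> are self-adjoint and absorb each other, hence
  agree; likewise \<open>X T\<close> and \<open>Y T\<close>; and then \<open>X = X T X = X T Y = Y T Y = Y\<close>.
\<close>

lemma moore_penrose_unique:
  assumes T: "bounded_op M N T"
    and X: "is_moore_penrose M N T X" and Y: "is_moore_penrose M N T Y"
    and g: "g \<in> L2_space N"
  shows "L2_eq M (X g) (Y g)"
proof -
  have bX: "bounded_op N M X" and bY: "bounded_op N M Y"
    using X Y by (auto simp: is_moore_penrose_def)
  note L2 = bounded_op_L2[OF T] bounded_op_L2[OF bX] bounded_op_L2[OF bY]
  note cong = bounded_op_cong[OF T] bounded_op_cong[OF bX] bounded_op_cong[OF bY]
  have PT: "L2_eq N (T (Z (T f))) (T f)" if "is_moore_penrose M N T Z" "f \<in> L2_space M" for Z f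
    using that by (auto simp: is_moore_penrose_def)
  have PX: "L2_eq M (Z (T (Z f))) (Z f)" if "is_moore_penrose M N T Z" "f \<in> L2_space N" for Z f
    using that by (auto simp: is_moore_penrose_def)
  have TZ: "L2_inner N (T (Z f)) h = L2_inner N f (T (Z h))"
    if "is_moore_penrose M N T Z" "f \<in> L2_space N" "h \<in> L2_space N" for Z f h
    using that by (auto simp: is_moore_penrose_def)
  have ZT: "L2_inner M (Z (T f)) h = L2_inner M f (Z (T h))"
    if "is_moore_penrose M N T Z" "f \<in> L2_space M" "h \<in> L2_space M" for Z f h
    using that by (auto simp: is_moore_penrose_def)
  have TXTY: "L2_eq N (T (X f)) (T (Y f))" if f: "f \<in> L2_space N" for f
  proof (rule L2_eqI_inner)
    fix h assume h: "h \<in> L2_space N"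
    have "L2_inner N h (T (X f)) = L2_inner N h (T (Y (T (X f))))"
      using f h L2 by (intro L2_inner_cong L2_eq_refl L2_eq_sym[OF PT[OF Y]]) auto
    also have "\<dots> = L2_inner N (T (Y h)) (T (X f))" using TZ[OF Y, of h "T (X f)"] f h L2 by simp
    also have "\<dots> = L2_inner N (T (X (T (Y h)))) f" using TZ[OF X, of "T (Y h)" f] f h L2 by simp
    also have "\<dots> = L2_inner N (T (Y h)) f"
      using f h L2 by (intro L2_inner_cong L2_eq_refl PT[OF X]) auto
    also have "\<dots> = L2_inner N h (T (Y f))" using TZ[OF Y, of h f] f h by simp
    finally show "L2_inner N h (T (X f)) = L2_inner N h (T (Y f))" .
  qed (use f L2 in auto)
  have XTYT: "L2_eq M (X (T f)) (Y (T f))" if f: "f \<in> L2_space M" for f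
  proof (rule L2_eqI_inner)
    fix h assume h: "h \<in> L2_space M"
    have "L2_inner M h (X (T f)) = L2_inner M h (X (T (Y (T f))))"
      using f h L2 by (intro L2_inner_cong L2_eq_refl L2_eq_sym[OF cong(2)[OF _ _ PT[OF Y]]]) auto
    also have "\<dots> = L2_inner M (X (T h)) (Y (T f))" using ZT[OF X, of h "Y (T f)"] f h L2 by simp
    also have "\<dots> = L2_inner M (Y (T (X (T h)))) f" using ZT[OF Y, of "X (T h)" f] f h L2 by simp
    also have "\<dots> = L2_inner M (Y (T h)) f"
      using f h L2 by (intro L2_inner_cong L2_eq_refl cong(3)[OF _ _ PT[OF X]]) auto
    also have "\<dots> = L2_inner M h (Y (T f))" using ZT[OF Y, of h f] f h by simp
    finally show "L2_inner M h (X (T f)) = L2_inner M h (Y (T f))" .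
  qed (use f L2 in auto)
  have "L2_eq M (X g) (X (T (X g)))" using PX[OF X g] by (rule L2_eq_sym)
  also have "L2_eq M (X (T (X g))) (X (T (Y g)))"
    using g L2 by (intro cong(2) TXTY) auto
  also have "L2_eq M (X (T (Y g))) (Y (T (Y g)))"
    using g L2 by (intro XTYT) auto
  also have "L2_eq M (Y (T (Y g))) (Y g)" by (rule PX[OF Y g])
  finally show ?thesis .
qed


section \<open>The Gram operator of a frame\<close>

lemma L2_eq_count_space: "L2_eq (count_space I) u v \<longleftrightarrow> (\<forall>w\<in>I. u w = v w)"
  by (simp add: L2_eq_def AE_count_space)

lemma L2_space_indicator_singleton:
  assumes "z \<in> I" shows "(indicator {z} :: 'i \<Rightarrow> complex) \<in> L2_space (count_space I)"
proof (rule L2_space_nn_integralI)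
  have "(\<integral>\<^sup>+x. ennreal ((cmod (indicator {z} x))\<^sup>2) \<partial>count_space I)
      = (\<Sum>x\<in>{z}. ennreal ((cmod (indicator {z} x))\<^sup>2))"
    by (rule nn_integral_count_space') (use assms in auto)
  then show "(\<integral>\<^sup>+x. ennreal ((cmod (indicator {z} x))\<^sup>2) \<partial>count_space I) < \<infinity>"
    by simp
qed simp

lemma L2_inner_count_space_indicator:
  assumes "w \<in> I"
  shows "L2_inner (count_space I) u (indicator {w}) = u w"
proof -
  have "L2_inner (count_space I) u (indicator {w}) = (LINT x|count_space I. u w * indicator {w} x)"
    unfolding L2_inner_def by (intro Bochner_Integration.integral_cong) (auto simp: indicator_def)
  also have "\<dots> = (\<Sum>x | x \<in> I \<and> u w * indicator {w} x \<noteq> 0. u w * indicator {w} x)"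
    by (rule lebesgue_integral_count_space_finite_support)
      (rule finite_subset[of _ "{w}"], auto simp: indicator_def)
  also have "\<dots> = (\<Sum>x\<in>{w}. u w * indicator {w} x)"
    using assms by (intro sum.mono_neutral_left) (auto simp: indicator_def)
  finally show ?thesis by simp
qed

locale L2_frame =
  fixes M :: "'a measure" and I :: "'i set" and \<psi> :: "'i \<Rightarrow> 'a \<Rightarrow> complex"
  assumes frame: "is_frame M I \<psi>"
begin

abbreviation "C \<equiv> analysis_op M \<psi>"
abbreviation "Cadj \<equiv> adjoint_op M (count_space I) C"
abbreviation "S \<equiv> Cadj \<circ> C"
abbreviation "Sinv \<equiv> inverse_op M M S"
abbreviation "G \<equiv> C \<circ> Cadj"
abbreviation "l2 \<equiv> L2_space (count_space I)"

lemma frame_L2: "z \<in> I \<Longrightarrow> \<psi> z \<in> L2_space M"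
  using frame by (auto simp: is_frame_def)

lemma analysis_cong:
  assumes "f \<in> L2_space M" "g \<in> L2_space M" "L2_eq M f g" "w \<in> I"
  shows "C f w = C g w"
  unfolding analysis_op_def using assms frame_L2 by (intro L2_inner_cong) auto

lemma analysis_L2: "f \<in> L2_space M \<Longrightarrow> C f \<in> l2"
  and analysis_norm_sq: "f \<in> L2_space M \<Longrightarrow>
    (L2_norm (count_space I) (C f))\<^sup>2 = (\<Sum>\<^sub>\<infinity>z\<in>I. (cmod (L2_inner M f (\<psi> z)))\<^sup>2)"
proof -
  assume f: "f \<in> L2_space M"
  let ?F = "\<lambda>z. (cmod (L2_inner M f (\<psi> z)))\<^sup>2"
  have "(\<lambda>z. norm (?F z)) summable_on I" using frame f unfolding is_frame_def by simp blast
  then have s: "integrable (count_space I) ?F"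
    by (simp only: abs_summable_equivalent flip: abs_summable_on_def)
  then show "C f \<in> l2"
    by (intro L2_spaceI) (auto simp: analysis_op_def)
  show "(L2_norm (count_space I) (C f))\<^sup>2 = infsum ?F I"
    using infsetsum_infsum[of ?F I] s by (simp add: abs_summable_on_def L2_norm_sq infsetsum_def analysis_op_def)
qed

lemma analysis_lower: "\<exists>A>0. \<forall>f\<in>L2_space M. A * (L2_norm M f)\<^sup>2 \<le> (L2_norm (count_space I) (C f))\<^sup>2"
  and analysis_upper: "\<exists>B. \<forall>f\<in>L2_space M. (L2_norm (count_space I) (C f))\<^sup>2 \<le> B * (L2_norm M f)\<^sup>2"
proof -
  obtain A B where A: "0 < A" and AB: "\<And>f. f \<in> L2_space M \<Longrightarrow>
        A * (L2_norm M f)\<^sup>2 \<le> (\<Sum>\<^sub>\<infinity>z\<in>I. (cmod (L2_inner M f (\<psi> z)))\<^sup>2) \<and>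
        (\<Sum>\<^sub>\<infinity>z\<in>I. (cmod (L2_inner M f (\<psi> z)))\<^sup>2) \<le> B * (L2_norm M f)\<^sup>2"
    using frame unfolding is_frame_def by blast
  show "\<exists>A>0. \<forall>f\<in>L2_space M. A * (L2_norm M f)\<^sup>2 \<le> (L2_norm (count_space I) (C f))\<^sup>2"
    by (rule exI[of _ A]) (simp add: A AB analysis_norm_sq)
  show "\<exists>B. \<forall>f\<in>L2_space M. (L2_norm (count_space I) (C f))\<^sup>2 \<le> B * (L2_norm M f)\<^sup>2"
    by (rule exI[of _ B]) (simp add: AB analysis_norm_sq)
qed

lemma analysis_add:
  assumes "f \<in> L2_space M" "g \<in> L2_space M"
  shows "L2_eq (count_space I) (C (\<lambda>x. f x + g x)) (\<lambda>w. C f w + C g w)"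
  using assms frame_L2 by (simp add: L2_eq_count_space analysis_op_def L2_inner_add_left)

lemma analysis_scale: "C (\<lambda>x. c * f x) = (\<lambda>w. c * C f w)"
  by (simp add: analysis_op_def L2_inner_scale_left)

lemma analysis_inner_add:
  assumes "f \<in> L2_space M" "g \<in> L2_space M" "u \<in> l2"
  shows "L2_inner (count_space I) (C (\<lambda>x. f x + g x)) u
    = L2_inner (count_space I) (C f) u + L2_inner (count_space I) (C g) u"
proof -
  have "L2_inner (count_space I) (C (\<lambda>x. f x + g x)) u = L2_inner (count_space I) (\<lambda>w. C f w + C g w) u"
    using assms analysis_L2 by (intro L2_inner_cong analysis_add) auto
  also have "\<dots> = L2_inner (count_space I) (C f) u + L2_inner (count_space I) (C g) u"
    using assms analysis_L2 by (intro L2_inner_add_left) auto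
  finally show ?thesis .
qed

lemma analysis_norm_bound:
  "\<exists>K\<ge>0. \<forall>f\<in>L2_space M. L2_norm (count_space I) (C f) \<le> K * L2_norm M f"
proof -
  obtain B where B: "\<forall>f\<in>L2_space M. (L2_norm (count_space I) (C f))\<^sup>2 \<le> B * (L2_norm M f)\<^sup>2"
    using analysis_upper by auto
  show ?thesis
  proof (intro exI[of _ "sqrt \<bar>B\<bar>"] conjI ballI)
    fix f assume f: "f \<in> L2_space M"
    have "(L2_norm (count_space I) (C f))\<^sup>2 \<le> B * (L2_norm M f)\<^sup>2" using B f by simp
    also have "\<dots> \<le> \<bar>B\<bar> * (L2_norm M f)\<^sup>2" by (intro mult_right_mono) auto
    finally have le: "(L2_norm (count_space I) (C f))\<^sup>2 \<le> \<bar>B\<bar> * (L2_norm M f)\<^sup>2" .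
    show "L2_norm (count_space I) (C f) \<le> sqrt \<bar>B\<bar> * L2_norm M f"
      by (rule power2_le_imp_le) (use le in \<open>auto simp: power_mult_distrib\<close>)
  qed simp
qed

text \<open>
  The Riesz representation theorem, as the case of Lax--Milgram in which the form is the inner product.
\<close>

lemma adjoint_ex:
  assumes u: "u \<in> l2"
  shows "\<exists>h. h \<in> L2_space M \<and> (\<forall>f \<in> L2_space M. L2_inner (count_space I) (C f) u = L2_inner M f h)"
proof -
  obtain K where K: "0 \<le> K" "\<And>f. f \<in> L2_space M \<Longrightarrow> L2_norm (count_space I) (C f) \<le> K * L2_norm M f"
    using analysis_norm_bound by auto
  obtain h where "h \<in> L2_space M" "\<And>f. f \<in> L2_space M \<Longrightarrow> L2_inner (count_space I) (C f) u = L2_inner M f h"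
  proof (rule L2_Lax_Milgram[where q="L2_inner M" and A=1 and B=1
        and l="\<lambda>f. L2_inner (count_space I) (C f) u" and M=M and K="K * L2_norm (count_space I) u"])
    fix f assume f: "f \<in> L2_space M"
    have "cmod (L2_inner (count_space I) (C f) u) \<le> L2_norm (count_space I) (C f) * L2_norm (count_space I) u"
      by (rule L2_Cauchy_Schwarz[OF analysis_L2[OF f] u])
    also have "\<dots> \<le> (K * L2_norm M f) * L2_norm (count_space I) u"
      by (intro mult_right_mono K f) simp
    finally show "cmod (L2_inner (count_space I) (C f) u) \<le> K * L2_norm (count_space I) u * L2_norm M f"
      by (simp add: mult_ac)
  qed (auto simp: L2_inner_add_left L2_inner_scale_left L2_inner_self analysis_inner_add u analysis_scale
      intro: L2_inner_commute)
  then show ?thesis by blast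
qed

lemma adjoint_L2: "u \<in> l2 \<Longrightarrow> Cadj u \<in> L2_space M"
  and adjoint_inner: "u \<in> l2 \<Longrightarrow> f \<in> L2_space M \<Longrightarrow>
    L2_inner (count_space I) (C f) u = L2_inner M f (Cadj u)"
  using someI_ex[OF adjoint_ex[of u]] unfolding adjoint_op_def by blast+

lemma frame_op_L2: "f \<in> L2_space M \<Longrightarrow> S f \<in> L2_space M"
  by (simp add: adjoint_L2 analysis_L2)

lemma frame_op_inner:
  "f \<in> L2_space M \<Longrightarrow> g \<in> L2_space M \<Longrightarrow> L2_inner M f (S g) = L2_inner (count_space I) (C f) (C g)"
  by (simp add: adjoint_inner analysis_L2)

lemma frame_op_eq_iff:
  assumes "f \<in> L2_space M" "g \<in> L2_space M"
  shows "L2_eq M (S f) g \<longleftrightarrow> (\<forall>h\<in>L2_space M. L2_inner (count_space I) (C h) (C f) = L2_inner M h g)"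
proof
  assume e: "L2_eq M (S f) g"
  show "\<forall>h\<in>L2_space M. L2_inner (count_space I) (C h) (C f) = L2_inner M h g"
  proof
    fix h assume h: "h \<in> L2_space M"
    have "L2_inner M h (S f) = L2_inner M h g"
      using assms h frame_op_L2 e by (intro L2_inner_cong) auto
    then show "L2_inner (count_space I) (C h) (C f) = L2_inner M h g"
      using frame_op_inner[OF h assms(1)] by simp
  qed
next
  assume "\<forall>h\<in>L2_space M. L2_inner (count_space I) (C h) (C f) = L2_inner M h g"
  then show "L2_eq M (S f) g"
    using assms frame_op_L2 frame_op_inner by (intro L2_eqI_inner) auto
qed

lemma frame_op_inj:
  assumes f: "f \<in> L2_space M" and g: "g \<in> L2_space M" and e: "L2_eq M (S f) (S g)"
  shows "L2_eq M f g"
proof -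
  let ?d = "\<lambda>x. f x - g x"
  have d: "?d \<in> L2_space M" using f g by simp
  obtain A where A: "0 < A" "A * (L2_norm M ?d)\<^sup>2 \<le> (L2_norm (count_space I) (C ?d))\<^sup>2"
    using analysis_lower d by auto
  have Cd: "L2_eq (count_space I) (C ?d) (\<lambda>w. C f w - C g w)"
    using f g frame_L2 by (simp add: L2_eq_count_space analysis_op_def L2_inner_diff_left)
  have "complex_of_real ((L2_norm (count_space I) (C ?d))\<^sup>2) = L2_inner (count_space I) (C ?d) (C ?d)"
    by (simp only: L2_inner_self)
  also have "\<dots> = L2_inner (count_space I) (C ?d) (\<lambda>w. C f w - C g w)"
    using f g d analysis_L2 by (intro L2_inner_cong Cd) auto
  also have "\<dots> = L2_inner M ?d (S f) - L2_inner M ?d (S g)"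
    using f g d by (simp add: L2_inner_diff_right analysis_L2 adjoint_inner)
  also have "\<dots> = 0"
    using f g d frame_op_L2 L2_inner_cong[OF L2_eq_refl e d d] by simp
  finally have "(L2_norm M ?d)\<^sup>2 \<le> 0" using A by (simp add: mult_le_0_iff)
  then show ?thesis using f g by (simp add: L2_eq_iff_norm)
qed

text \<open>The frame operator is coercive, so solving \<open>S h = g\<close> is an instance of Lax--Milgram.\<close>

lemma frame_op_surj:
  assumes g: "g \<in> L2_space M"
  shows "\<exists>h. h \<in> L2_space M \<and> L2_eq M (S h) g"
proof -
  obtain A B where AB: "0 < A"
    "\<And>f. f \<in> L2_space M \<Longrightarrow> A * (L2_norm M f)\<^sup>2 \<le> (L2_norm (count_space I) (C f))\<^sup>2"
    "\<And>f. f \<in> L2_space M \<Longrightarrow> (L2_norm (count_space I) (C f))\<^sup>2 \<le> B * (L2_norm M f)\<^sup>2"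
    using analysis_lower analysis_upper by auto
  let ?q = "\<lambda>f g. L2_inner (count_space I) (C f) (C g)"
  obtain h where "h \<in> L2_space M" "\<And>f. f \<in> L2_space M \<Longrightarrow> L2_inner M f g = ?q f h"
  proof (rule L2_Lax_Milgram[where q="?q" and l="\<lambda>f. L2_inner M f g" and M=M and A=A and B=B
        and K="L2_norm M g"])
    fix f assume f: "f \<in> L2_space M"
    show "cmod (L2_inner M f g) \<le> L2_norm M g * L2_norm M f"
      using L2_Cauchy_Schwarz[OF f g] by (simp add: mult.commute)
  qed (auto simp: analysis_inner_add analysis_L2 analysis_scale L2_inner_scale_left L2_inner_self AB
      L2_inner_add_left g intro: L2_inner_commute)
  then show ?thesis using frame_op_eq_iff[OF _ g] by (intro exI[of _ h]) simp
qed

lemma inverse_L2: "g \<in> L2_space M \<Longrightarrow> Sinv g \<in> L2_space M"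
  and frame_op_inverse: "g \<in> L2_space M \<Longrightarrow> L2_eq M (S (Sinv g)) g"
  using someI_ex[OF frame_op_surj[of g]] unfolding inverse_op_def by blast+

lemma inverse_unique:
  assumes "f \<in> L2_space M" "g \<in> L2_space M" "L2_eq M (S f) g"
  shows "L2_eq M (Sinv g) f"
  by (rule frame_op_inj[OF inverse_L2 _ L2_eq_trans[OF frame_op_inverse L2_eq_sym]]) (use assms in auto)

lemma inverse_frame_op:
  "f \<in> L2_space M \<Longrightarrow> L2_eq M (Sinv (S f)) f"
  by (rule inverse_unique) (use frame_op_L2 in auto)

lemma inverse_symmetric:
  assumes "f \<in> L2_space M" "g \<in> L2_space M"
  shows "L2_inner M (Sinv f) g = L2_inner M f (Sinv g)"
proof -
  have "L2_inner M (Sinv f) g = L2_inner M (Sinv f) (S (Sinv g))"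
    using assms inverse_L2 frame_op_L2 by (intro L2_inner_cong L2_eq_refl L2_eq_sym[OF frame_op_inverse]) auto
  also have "\<dots> = cnj (L2_inner M (Sinv g) (S (Sinv f)))"
    using assms inverse_L2 by (simp add: frame_op_inner del: o_apply) (metis L2_inner_commute)
  also have "\<dots> = cnj (L2_inner M (Sinv g) f)"
    using assms inverse_L2 frame_op_L2
    by (intro arg_cong[of _ _ cnj] L2_inner_cong L2_eq_refl frame_op_inverse) auto
  finally show ?thesis by (simp add: L2_inner_commute[of M f])
qed

lemma inverse_cong:
  assumes "f \<in> L2_space M" "g \<in> L2_space M" "L2_eq M f g"
  shows "L2_eq M (Sinv f) (Sinv g)"
  using assms
  by (intro inverse_unique inverse_L2 L2_eq_trans[OF frame_op_inverse L2_eq_sym]) auto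

lemma adjoint_bounded: "bounded_op (count_space I) M Cadj"
  unfolding bounded_op_def
proof (intro conjI ballI allI)
  fix u v :: "'i \<Rightarrow> complex" and c assume u: "u \<in> l2"
  show "Cadj u \<in> L2_space M" by (rule adjoint_L2[OF u])
  show "L2_eq M (Cadj (\<lambda>x. c * u x)) (\<lambda>y. c * Cadj u y)"
    using u adjoint_L2 analysis_L2
    by (intro L2_eqI_inner) (auto simp: adjoint_inner[symmetric] L2_inner_scale_right L2_space_scale)
  assume v: "v \<in> l2"
  show "L2_eq M (Cadj (\<lambda>x. u x + v x)) (\<lambda>y. Cadj u y + Cadj v y)"
    using u v adjoint_L2 analysis_L2
    by (intro L2_eqI_inner) (auto simp: adjoint_inner[symmetric] L2_inner_add_right L2_space_add)
next
  obtain K where K: "0 \<le> K" "\<And>f. f \<in> L2_space M \<Longrightarrow> L2_norm (count_space I) (C f) \<le> K * L2_norm M f"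
    using analysis_norm_bound by auto
  show "\<exists>K. \<forall>u\<in>l2. L2_norm M (Cadj u) \<le> K * L2_norm (count_space I) u"
  proof (intro exI ballI)
    fix u :: "'i \<Rightarrow> complex" assume u: "u \<in> l2"
    let ?f = "Cadj u"
    have "(L2_norm M ?f)\<^sup>2 = cmod (L2_inner M ?f ?f)" by (simp only: L2_inner_self norm_of_real) simp
    also have "\<dots> = cmod (L2_inner (count_space I) (C ?f) u)"
      using adjoint_inner[OF u adjoint_L2[OF u]] by simp
    also have "\<dots> \<le> L2_norm (count_space I) (C ?f) * L2_norm (count_space I) u"
      by (intro L2_Cauchy_Schwarz analysis_L2 adjoint_L2 u)
    also have "\<dots> \<le> (K * L2_norm M ?f) * L2_norm (count_space I) u"
      by (intro mult_right_mono K adjoint_L2 u) simp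
    finally have "L2_norm M ?f * L2_norm M ?f \<le> L2_norm M ?f * (K * L2_norm (count_space I) u)"
      by (simp add: power2_eq_square mult_ac)
    then show "L2_norm M ?f \<le> K * L2_norm (count_space I) u"
      using K(1) by (cases "L2_norm M ?f = 0") (auto simp: less_le)
  qed
qed

lemma analysis_bounded: "bounded_op M (count_space I) C"
  unfolding bounded_op_def
  using analysis_L2 analysis_add analysis_norm_bound by (auto simp: analysis_scale)

lemma inverse_bounded: "bounded_op M M Sinv"
  unfolding bounded_op_def
proof (intro conjI ballI allI)
  fix f g :: "'a \<Rightarrow> complex" and c assume f: "f \<in> L2_space M"
  show "Sinv f \<in> L2_space M" by (rule inverse_L2[OF f])
  show "L2_eq M (Sinv (\<lambda>x. c * f x)) (\<lambda>y. c * Sinv f y)"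
    using f inverse_L2
    by (intro L2_eqI_inner) (auto simp: inverse_symmetric[symmetric] L2_inner_scale_right L2_space_scale)
  assume g: "g \<in> L2_space M"
  show "L2_eq M (Sinv (\<lambda>x. f x + g x)) (\<lambda>y. Sinv f y + Sinv g y)"
    using f g inverse_L2
    by (intro L2_eqI_inner) (auto simp: inverse_symmetric[symmetric] L2_inner_add_right L2_space_add)
next
  obtain A where A: "0 < A"
    "\<And>f. f \<in> L2_space M \<Longrightarrow> A * (L2_norm M f)\<^sup>2 \<le> (L2_norm (count_space I) (C f))\<^sup>2"
    using analysis_lower by auto
  show "\<exists>K. \<forall>f\<in>L2_space M. L2_norm M (Sinv f) \<le> K * L2_norm M f"
  proof (intro exI[of _ "1 / A"] ballI)
    fix f assume f: "f \<in> L2_space M"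
    let ?h = "Sinv f"
    have h: "?h \<in> L2_space M" by (rule inverse_L2[OF f])
    have "L2_inner (count_space I) (C ?h) (C ?h) = L2_inner M ?h f"
      using frame_op_eq_iff[OF h f] frame_op_inverse[OF f] h by blast
    then have "(L2_norm (count_space I) (C ?h))\<^sup>2 = cmod (L2_inner M ?h f)"
      by (metis L2_inner_self norm_of_real abs_of_nonneg zero_le_power2)
    also have "\<dots> \<le> L2_norm M ?h * L2_norm M f" by (rule L2_Cauchy_Schwarz[OF h f])
    finally have "L2_norm M ?h * (A * L2_norm M ?h) \<le> L2_norm M ?h * L2_norm M f"
      using A(2)[OF h] by (simp add: power2_eq_square mult_ac)
    then have "A * L2_norm M ?h \<le> L2_norm M f"
      by (cases "L2_norm M ?h = 0") (auto simp: less_le)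
    then show "L2_norm M ?h \<le> 1 / A * L2_norm M f" using A(1) by (simp add: field_simps)
  qed
qed

lemma Gram_bounded: "bounded_op (count_space I) (count_space I) G"
  using bounded_op_comp[OF adjoint_bounded analysis_bounded] by (simp add: comp_def)

text \<open>
  With this candidate both products with the Gram operator \<open>C C\<^sup>*\<close> collapse to \<open>C S\<^sup>-\<^sup>1 C\<^sup>*\<close>, which is self-adjoint.
\<close>

definition "Gram_pinv u = C (Sinv (Sinv (Cadj u)))"

lemma Gram_Gram_pinv:
  assumes "u \<in> l2"
  shows "L2_eq (count_space I) (G (Gram_pinv u)) (C (Sinv (Cadj u)))"
proof -
  have "L2_eq M (S (Sinv (Sinv (Cadj u)))) (Sinv (Cadj u))"
    by (intro frame_op_inverse inverse_L2 adjoint_L2 assms)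
  then show ?thesis
    using assms by (auto simp: L2_eq_count_space Gram_pinv_def
        intro!: analysis_cong adjoint_L2 analysis_L2 inverse_L2)
qed

lemma Gram_pinv_Gram:
  assumes "u \<in> l2"
  shows "L2_eq (count_space I) (Gram_pinv (G u)) (C (Sinv (Cadj u)))"
proof -
  have "L2_eq M (Sinv (Sinv (S (Cadj u)))) (Sinv (Cadj u))"
    by (intro inverse_cong inverse_frame_op inverse_L2 frame_op_L2 adjoint_L2 assms)
  then show ?thesis
    using assms by (auto simp: L2_eq_count_space Gram_pinv_def
        intro!: analysis_cong adjoint_L2 analysis_L2 inverse_L2)
qed

lemma projection_symmetric:
  assumes "u \<in> l2" "v \<in> l2"
  shows "L2_inner (count_space I) (C (Sinv (Cadj u))) v = L2_inner (count_space I) u (C (Sinv (Cadj v)))"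
proof -
  have "L2_inner (count_space I) (C (Sinv (Cadj u))) v = L2_inner M (Cadj u) (Sinv (Cadj v))"
    using assms by (simp add: adjoint_inner inverse_symmetric inverse_L2 adjoint_L2)
  also have "\<dots> = cnj (L2_inner (count_space I) (C (Sinv (Cadj v))) u)"
    using assms by (simp add: adjoint_inner inverse_L2 adjoint_L2 L2_inner_commute[of M "Cadj u"])
  finally show ?thesis by (simp add: L2_inner_commute[of "count_space I" u])
qed

lemma moore_penrose_Gram_pinv: "is_moore_penrose (count_space I) (count_space I) G Gram_pinv"
  unfolding is_moore_penrose_def
proof (intro conjI ballI)
  show bX: "bounded_op (count_space I) (count_space I) Gram_pinv"
    unfolding Gram_pinv_def
    by (rule bounded_op_comp[OF bounded_op_comp[OF bounded_op_comp[OF adjoint_bounded inverse_bounded]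
            inverse_bounded] analysis_bounded])
  fix u :: "'i \<Rightarrow> complex" assume u: "u \<in> l2"
  note mem = adjoint_L2 analysis_L2 inverse_L2
  have Gu: "G u \<in> l2" and Pu: "Gram_pinv u \<in> l2"
    using u mem by (auto simp: Gram_pinv_def)
  have "L2_eq (count_space I) (G (Gram_pinv (G u))) (C (Sinv (S (Cadj u))))"
    using Gram_Gram_pinv[OF Gu] by simp
  moreover have "L2_eq (count_space I) (C (Sinv (S (Cadj u)))) (C (Cadj u))"
    using u by (intro bounded_op_cong[OF analysis_bounded] inverse_frame_op inverse_L2 frame_op_L2 adjoint_L2)
  ultimately show "L2_eq (count_space I) (G (Gram_pinv (G u))) (G u)"
    using L2_eq_trans by (auto simp del: L2_eq_def)
  have "L2_eq (count_space I) (Gram_pinv (G (Gram_pinv u))) (C (Sinv (Cadj (Gram_pinv u))))"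
    by (rule Gram_pinv_Gram[OF Pu])
  moreover have "C (Sinv (Cadj (Gram_pinv u))) = C (Sinv (S (Sinv (Sinv (Cadj u)))))"
    by (simp add: Gram_pinv_def)
  moreover have "L2_eq (count_space I) (C (Sinv (S (Sinv (Sinv (Cadj u)))))) (C (Sinv (Sinv (Cadj u))))"
    using u by (intro bounded_op_cong[OF analysis_bounded] inverse_frame_op inverse_L2 frame_op_L2 adjoint_L2)
  ultimately show "L2_eq (count_space I) (Gram_pinv (G (Gram_pinv u))) (Gram_pinv u)"
    using L2_eq_trans[of "count_space I"] by (metis Gram_pinv_def)
  fix v :: "'i \<Rightarrow> complex" assume v: "v \<in> l2"
  have Gv: "G v \<in> l2" and Pv: "Gram_pinv v \<in> l2"
    using v mem by (auto simp: Gram_pinv_def)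
  have GP: "G (Gram_pinv w) \<in> l2" "Gram_pinv (G w) \<in> l2" "C (Sinv (Cadj w)) \<in> l2" if "w \<in> l2" for w
    using that mem by (auto simp: Gram_pinv_def)
  show "L2_inner (count_space I) (G (Gram_pinv u)) v = L2_inner (count_space I) u (G (Gram_pinv v))"
    using L2_inner_cong[OF Gram_Gram_pinv[OF u] L2_eq_refl, of v]
      L2_inner_cong[OF L2_eq_refl Gram_Gram_pinv[OF v], of u] projection_symmetric[OF u v] u v GP by simp
  show "L2_inner (count_space I) (Gram_pinv (G u)) v = L2_inner (count_space I) u (Gram_pinv (G v))"
    using L2_inner_cong[OF Gram_pinv_Gram[OF u] L2_eq_refl, of v]
      L2_inner_cong[OF L2_eq_refl Gram_pinv_Gram[OF v], of u] projection_symmetric[OF u v] u v GP by simp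
qed

abbreviation "Gpinv \<equiv> moore_penrose (count_space I) (count_space I) G"

lemma moore_penrose_Gram: "is_moore_penrose (count_space I) (count_space I) G Gpinv"
  unfolding moore_penrose_def by (rule someI[of _ Gram_pinv]) (rule moore_penrose_Gram_pinv)

text \<open>
  The pseudoinverse is chosen among all operators that satisfy the Penrose equations; by uniqueness the choice does not matter.
\<close>

lemma Gpinv_eq:
  assumes "u \<in> l2" shows "L2_eq (count_space I) (Gpinv u) (C (Sinv (Sinv (Cadj u))))"
  using moore_penrose_unique[OF Gram_bounded moore_penrose_Gram moore_penrose_Gram_pinv assms]
  by (simp add: Gram_pinv_def)

lemma Gpinv_L2: "u \<in> l2 \<Longrightarrow> Gpinv u \<in> l2"
  using moore_penrose_Gram by (auto simp: is_moore_penrose_def bounded_op_def)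

lemma Gram_Gpinv_eq:
  assumes u: "u \<in> l2" shows "L2_eq (count_space I) (G (Gpinv u)) (C (Sinv (Cadj u)))"
proof (rule L2_eq_trans)
  show "L2_eq (count_space I) (G (Gpinv u)) (G (Gram_pinv u))"
    using u by (intro bounded_op_cong[OF Gram_bounded] Gpinv_L2)
      (auto simp: Gram_pinv_def intro!: Gpinv_eq analysis_L2 inverse_L2 adjoint_L2)
qed (rule Gram_Gram_pinv[OF u])

text \<open>
  This turns the operator identities into formulas for matrix entries.
\<close>

lemma adjoint_indicator:
  assumes "z \<in> I" shows "L2_eq M (Cadj (indicator {z})) (\<psi> z)"
  using assms frame_L2
  by (intro L2_eqI_inner adjoint_L2)
    (auto simp: adjoint_inner[symmetric] L2_space_indicator_singleton L2_inner_count_space_indicator analysis_op_def)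

abbreviation "dual \<equiv> canonical_dual M I \<psi>"

lemma dual_eq: "dual z = Sinv (\<psi> z)"
  by (simp add: canonical_dual_def frame_op_def synthesis_op_def)

lemma matrix_entry_eq: "w \<in> I \<Longrightarrow> matrix_entry I T w z = T (indicator {z}) w"
  by (simp add: matrix_entry_def L2_inner_count_space_indicator)

lemma matrix_entry_Gpinv:
  assumes w: "w \<in> I" and z: "z \<in> I"
  shows "matrix_entry I Gpinv w z = L2_inner M (dual z) (dual w)"
proof -
  have i: "indicator {z} \<in> l2" by (rule L2_space_indicator_singleton[OF z])
  have "L2_eq M (Sinv (Sinv (Cadj (indicator {z})))) (Sinv (Sinv (\<psi> z)))"
    using z i by (intro inverse_cong inverse_L2 adjoint_L2 adjoint_indicator frame_L2)
  then have "C (Sinv (Sinv (Cadj (indicator {z})))) w = C (Sinv (Sinv (\<psi> z))) w"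
    using z w i by (intro analysis_cong inverse_L2 adjoint_L2 frame_L2)
  also have "\<dots> = L2_inner M (dual z) (dual w)"
    using z w by (simp add: analysis_op_def dual_eq inverse_symmetric inverse_L2 frame_L2)
  finally show ?thesis
    using Gpinv_eq[OF i] w by (simp add: matrix_entry_eq L2_eq_count_space)
qed

lemma matrix_entry_Gram_Gpinv:
  assumes w: "w \<in> I" and z: "z \<in> I"
  shows "matrix_entry I (G \<circ> Gpinv) w z = L2_inner M (dual z) (\<psi> w)"
proof -
  have i: "indicator {z} \<in> l2" by (rule L2_space_indicator_singleton[OF z])
  have "L2_eq M (Sinv (Cadj (indicator {z}))) (Sinv (\<psi> z))"
    using z i by (intro inverse_cong inverse_L2 adjoint_L2 adjoint_indicator frame_L2)
  then have "C (Sinv (Cadj (indicator {z}))) w = C (Sinv (\<psi> z)) w"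
    using z w i by (intro analysis_cong inverse_L2 adjoint_L2 frame_L2)
  also have "\<dots> = L2_inner M (dual z) (\<psi> w)"
    by (simp add: analysis_op_def dual_eq)
  finally show ?thesis
    using Gram_Gpinv_eq[OF i] w by (simp add: matrix_entry_eq L2_eq_count_space)
qed

text \<open>
  \<open>C\<^sup>*\<close> annihilates \<open>u - C S\<^sup>-\<^sup>1 C\<^sup>* u\<close>, which is therefore orthogonal to the range of \<open>C\<close>.
\<close>

lemma orthogonal_projection_Gram_Gpinv:
  "is_orthogonal_projection (count_space I) (range_op M (count_space I) C) (G \<circ> Gpinv)"
  unfolding is_orthogonal_projection_def
proof (intro ballI conjI)
  fix u :: "'i \<Rightarrow> complex" assume u: "u \<in> l2"
  have P: "C (Sinv (Cadj u)) \<in> l2" "Sinv (Cadj u) \<in> L2_space M"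
    using u by (auto intro: adjoint_L2 analysis_L2 inverse_L2)
  have GP: "G (Gpinv u) \<in> l2" using u by (auto intro: adjoint_L2 analysis_L2 Gpinv_L2)
  show "(G \<circ> Gpinv) u \<in> range_op M (count_space I) C"
    unfolding range_op_def using GP P L2_eq_sym[OF Gram_Gpinv_eq[OF u]] by auto
  fix v assume "v \<in> range_op M (count_space I) C"
  then obtain f where v: "v \<in> l2" and f: "f \<in> L2_space M" "L2_eq (count_space I) (C f) v"
    by (auto simp: range_op_def)
  have "L2_inner (count_space I) (\<lambda>x. u x - (G \<circ> Gpinv) u x) v
      = L2_inner (count_space I) (\<lambda>x. u x - C (Sinv (Cadj u)) x) (C f)"
    using u v GP P f Gram_Gpinv_eq[OF u] analysis_L2
    by (intro L2_inner_cong) (auto simp: L2_eq_count_space)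
  also have "\<dots> = cnj (L2_inner M f (Cadj u) - L2_inner M f (S (Sinv (Cadj u))))"
    using u f P analysis_L2
    by (simp add: L2_inner_diff_left L2_inner_commute[of "count_space I" "C f"] adjoint_inner[symmetric])
  also have "L2_inner M f (S (Sinv (Cadj u))) = L2_inner M f (Cadj u)"
    using u f by (intro L2_inner_cong L2_eq_refl frame_op_inverse) (auto intro: adjoint_L2 analysis_L2 inverse_L2)
  finally show "L2_inner (count_space I) (\<lambda>x. u x - (G \<circ> Gpinv) u x) v = 0" by (simp add: comp_def)
qed

end


section \<open>Lebesgue measure on Euclidean space: products and affine maps\<close>

lemma Basis_cart: "(Basis :: (real^'n) set) = range (\<lambda>i. axis i 1)"
  by (auto simp: Basis_vec_def)

lemma prod_Basis_cart: "prod F (Basis :: (real^'n) set) = (\<Prod>i\<in>UNIV. F (axis i 1))"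
  unfolding Basis_cart by (subst prod.reindex) (auto simp: inj_on_def axis_eq_axis)

lemma integral_prod_cart:
  fixes g :: "'n::finite \<Rightarrow> real \<Rightarrow> complex"
  assumes g: "\<And>i. integrable lborel (g i)"
  shows "integrable lborel (\<lambda>t::real^'n. \<Prod>i\<in>UNIV. g i (t $ i))" (is ?int)
    and "(LINT t|lborel. (\<Prod>i\<in>UNIV. g i ((t::real^'n) $ i))) = (\<Prod>i\<in>UNIV. (LINT x|lborel. g i x))" (is ?eq)
proof -
  interpret product_sigma_finite "\<lambda>_::real^'n. lborel :: real measure" ..
  define ix :: "real^'n \<Rightarrow> 'n" where "ix b = (THE i. b = axis i 1)" for b
  have ix [simp]: "ix (axis i 1) = i" for i
    unfolding ix_def by (rule the_equality) (auto simp: axis_eq_axis)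
  let ?T = "\<lambda>f. \<Sum>b\<in>Basis. f b *\<^sub>R b :: real^'n"
  have T: "?T f $ i = f (axis i 1)" for f i
  proof -
    have "?T f $ i = ?T f \<bullet> axis i 1" by (simp only: cart_eq_inner_axis)
    also have "\<dots> = f (axis i 1)" by (rule inner_sum_left_Basis) (auto simp: Basis_cart)
    finally show ?thesis .
  qed
  have m [measurable]: "g i \<in> borel_measurable borel" for i
    using g[of i] by (auto dest: borel_measurable_integrable)
  have mT: "?T \<in> (\<Pi>\<^sub>M b\<in>Basis. lborel) \<rightarrow>\<^sub>M borel" by measurable
  have pm: "(\<lambda>t::real^'n. \<Prod>i\<in>UNIV. g i (t $ i)) \<in> borel_measurable borel" by measurable
  have eqT: "(\<Prod>i\<in>UNIV. g i (?T f $ i)) = (\<Prod>b\<in>Basis. g (ix b) (f b))" for f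
    by (simp only: T prod_Basis_cart ix)
  have "integrable (\<Pi>\<^sub>M b\<in>Basis. lborel) (\<lambda>f. \<Prod>b\<in>(Basis::(real^'n) set). g (ix b) (f b))"
    by (rule product_integrable_prod) (use g in auto)
  then show ?int
    by (subst lborel_eq, subst integrable_distr_eq[OF mT pm]) (simp only: eqT)
  have "(LINT t|lborel. (\<Prod>i\<in>UNIV. g i ((t::real^'n) $ i)))
      = (LINT f|(\<Pi>\<^sub>M b\<in>Basis. lborel). (\<Prod>b\<in>(Basis::(real^'n) set). g (ix b) (f b)))"
    by (subst lborel_eq, subst integral_distr[OF mT pm]) (simp only: eqT)
  also have "\<dots> = (\<Prod>b\<in>(Basis::(real^'n) set). (LINT x|lborel. g (ix b) x))"
    by (rule product_integral_prod) (use g in auto)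
  finally show ?eq by (simp add: prod_Basis_cart)
qed

lemma nn_integral_lborel_affine:
  fixes f :: "'a::euclidean_space \<Rightarrow> ennreal"
  assumes [measurable]: "f \<in> borel_measurable borel" and s: "s \<noteq> 0"
  shows "(\<integral>\<^sup>+x. f x \<partial>lborel) = ennreal (\<bar>s\<bar>^DIM('a)) * (\<integral>\<^sup>+x. f (c + s *\<^sub>R x) \<partial>lborel)"
  by (subst lborel_affine[OF s, of c], subst nn_integral_density)
    (auto simp: nn_integral_distr nn_integral_cmult)

lemma lborel_integrable_affine:
  fixes f :: "'a::euclidean_space \<Rightarrow> 'b::{banach,second_countable_topology}"
  assumes f: "integrable lborel f" and s: "s \<noteq> 0"
  shows "integrable lborel (\<lambda>x. f (c + s *\<^sub>R x))"
proof (rule integrableI_bounded)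
  have [measurable]: "f \<in> borel_measurable borel" using f by auto
  show "(\<lambda>x. f (c + s *\<^sub>R x)) \<in> borel_measurable lborel" by measurable
  have "ennreal (\<bar>s\<bar>^DIM('a)) * (\<integral>\<^sup>+x. ennreal (norm (f (c + s *\<^sub>R x))) \<partial>lborel)
      = (\<integral>\<^sup>+x. ennreal (norm (f x)) \<partial>lborel)"
    by (rule nn_integral_lborel_affine[symmetric]) (use s in auto)
  also have "\<dots> < \<infinity>" using f by (simp add: integrable_iff_bounded)
  finally have "ennreal (\<bar>s\<bar>^DIM('a)) * (\<integral>\<^sup>+x. ennreal (norm (f (c + s *\<^sub>R x))) \<partial>lborel) < \<infinity>" .
  moreover have "ennreal (\<bar>s\<bar>^DIM('a)) \<noteq> 0" using s by (simp add: ennreal_eq_0_iff not_le)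
  ultimately show "(\<integral>\<^sup>+x. ennreal (norm (f (c + s *\<^sub>R x))) \<partial>lborel) < \<infinity>"
    by (auto simp: ennreal_mult_less_top)
qed

lemma lborel_integral_affine:
  fixes f :: "'a::euclidean_space \<Rightarrow> 'b::{banach,second_countable_topology}"
  assumes [measurable]: "f \<in> borel_measurable borel" and s: "s \<noteq> 0"
  shows "(LINT x|lborel. f x) = \<bar>s\<bar>^DIM('a) *\<^sub>R (LINT x|lborel. f (c + s *\<^sub>R x))"
  by (subst lborel_affine[OF s, of c], subst integral_density)
    (auto simp: integral_distr)

lemma L2_space_affine:
  fixes f :: "'a::euclidean_space \<Rightarrow> complex"
  assumes "f \<in> L2_space lborel" and s: "s \<noteq> 0"
  shows "(\<lambda>x. f (c + s *\<^sub>R x)) \<in> L2_space lborel"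
proof (rule L2_spaceI)
  have [measurable]: "f \<in> borel_measurable borel" using L2_measurable[OF assms(1)] by simp
  show "(\<lambda>x. f (c + s *\<^sub>R x)) \<in> borel_measurable lborel" by measurable
  show "integrable lborel (\<lambda>x. (cmod (f (c + s *\<^sub>R x)))\<^sup>2)"
    by (rule lborel_integrable_affine[OF L2_integrable_square[OF assms(1)] s])
qed


section \<open>Fourier series on the cube\<close>

definition int_vec :: "int^'n \<Rightarrow> real^'n" where
  "int_vec j = (\<chi> i. real_of_int (j $ i))"

definition open_cube :: "(real^'n) set" where
  "open_cube = {t. \<forall>i. - pi < t $ i \<and> t $ i < pi}"

text \<open>
  The cutoff makes the exponential square-integrable on the whole space, and inner products with it
  are the Fourier coefficients on the cube.
\<close>

definition cube_exp :: "int^'n \<Rightarrow> real^'n \<Rightarrow> complex" where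
  "cube_exp j t = indicator open_cube t * exp (\<i> * complex_of_real (int_vec j \<bullet> t))"

lemma int_vec_add: "int_vec (j + k) = int_vec j + int_vec k"
  and int_vec_diff: "int_vec (j - k) = int_vec j - int_vec k"
  and int_vec_zero [simp]: "int_vec 0 = 0"
  by (simp_all add: int_vec_def vec_eq_iff)

lemma open_cube_eq_box: "open_cube = box (\<chi> i. - pi) (\<chi> i. pi)"
  by (auto simp: open_cube_def mem_box_cart)

lemma open_open_cube [simp]: "open open_cube"
  unfolding open_cube_eq_box by (rule open_box)

lemma borel_open_cube [measurable]: "open_cube \<in> sets borel"
  by simp

lemma borel_measurable_cube_exp [measurable]: "cube_exp j \<in> borel_measurable borel"
  unfolding cube_exp_def[abs_def] by measurable

lemma cmod_cube_exp_le: "cmod (cube_exp j t) \<le> 1"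
  by (simp add: cube_exp_def norm_mult indicator_def)

lemma cube_exp_cnj: "cube_exp j t * cnj (cube_exp k t) = cube_exp (j - k) t"
  by (simp add: cube_exp_def int_vec_diff inner_diff_left exp_cnj indicator_def mult_exp_exp
      right_diff_distrib)

lemma integral_exp_circle:
  fixes n :: int
  defines "f \<equiv> \<lambda>x. indicator {- pi<..<pi} x * exp (\<i> * complex_of_real (real_of_int n * x))"
  shows "integrable lborel f" and "(LINT x|lborel. f x) = (if n = 0 then 2 * pi else 0)"
proof -
  define e where "e x = exp (\<i> * complex_of_real (real_of_int n * x))" for x
  have cont: "continuous_on S e" for S unfolding e_def by (intro continuous_intros)
  have [measurable]: "e \<in> borel_measurable borel" using cont by (intro borel_measurable_continuous_onI)
  have int: "integrable lborel (\<lambda>x. indicator {-pi..pi} x *\<^sub>R e x)"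
    using borel_integrable_compact[OF _ cont, of "{-pi..pi}"] by simp
  have ae: "AE x in lborel. f x = indicator {-pi..pi} x *\<^sub>R e x"
  proof -
    have "AE x in lborel. x \<noteq> - pi" "AE x in lborel. x \<noteq> pi" by (auto intro: AE_lborel_singleton)
    then show ?thesis by eventually_elim (auto simp: f_def e_def indicator_def)
  qed
  have fm: "f \<in> borel_measurable lborel" unfolding f_def by measurable
  show "integrable lborel f"
    using int fm ae by (subst integrable_cong_AE) auto
  have "(LINT x|lborel. f x) = (LINT x|lborel. indicator {-pi..pi} x *\<^sub>R e x)"
    using fm ae by (intro integral_cong_AE) auto
  also have "\<dots> = (if n = 0 then 2 * pi else 0)"
  proof (cases "n = 0")
    case True
    have "(LINT x|lborel. indicator {-pi..pi} x *\<^sub>R e x) = complex_of_real pi - complex_of_real (- pi)"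
      by (rule integral_FTC_Icc) (auto simp: cont e_def True intro!: derivative_eq_intros)
    then show ?thesis using True by simp
  next
    case False
    let ?F = "\<lambda>x. e x / (\<i> * of_int n)"
    have "(LINT x|lborel. indicator {-pi..pi} x *\<^sub>R e x) = ?F pi - ?F (- pi)"
    proof (rule integral_FTC_Icc)
      fix x
      have "((\<lambda>z. exp (\<i> * of_int n * z) / (\<i> * of_int n)) has_field_derivative exp (\<i> * of_int n * of_real x))
          (at (of_real x))"
        using False by (auto intro!: derivative_eq_intros)
      from has_vector_derivative_real_field[OF this]
      show "(?F has_vector_derivative e x) (at x within {-pi..pi})"
        by (simp add: e_def mult.assoc has_vector_derivative_at_within)
    qed (auto simp: cont)
    also have "e pi = e (- pi)"
    proof -
      have "e pi = e (- pi) * exp (2 * of_int n * of_real pi * \<i>)"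
        unfolding e_def mult_exp_exp by (rule arg_cong[of _ _ exp]) (simp add: algebra_simps)
      also have "exp (2 * of_int n * of_real pi * \<i>) = 1" using exp_integer_2pi[of "of_int n"] by simp
      finally show ?thesis by simp
    qed
    finally show ?thesis using False by simp
  qed
  finally show "(LINT x|lborel. f x) = (if n = 0 then 2 * pi else 0)" .
qed

lemma integral_cube_exp:
  "integrable lborel (cube_exp j)"
  "(LINT t|lborel. cube_exp (j :: int^'n::finite) t) = (if j = 0 then (2 * pi) ^ CARD('n) else 0)"
proof -
  define f where "f i x = indicator {- pi<..<pi} x * exp (\<i> * complex_of_real (real_of_int (j $ i) * x))"
    for i x
  have "indicator open_cube t = (\<Prod>i\<in>UNIV. indicator {- pi<..<pi} (t $ i) :: complex)" for t :: "real^'n"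
    by (auto simp: open_cube_def indicator_def)
  moreover have "exp (\<i> * complex_of_real (int_vec j \<bullet> t))
      = (\<Prod>i\<in>UNIV. exp (\<i> * complex_of_real (real_of_int (j $ i) * t $ i)))" for t
    by (simp add: int_vec_def inner_vec_def sum_distrib_left exp_sum)
  ultimately have eq: "cube_exp j t = (\<Prod>i\<in>UNIV. f i (t $ i))" for t
    unfolding cube_exp_def f_def by (simp only: prod.distrib)
  have f: "integrable lborel (f i)" "(LINT x|lborel. f i x) = (if j $ i = 0 then 2 * pi else 0)" for i
    unfolding f_def using integral_exp_circle[of "j $ i"] by auto
  show "integrable lborel (cube_exp j)"
    using integral_prod_cart(1)[of f, OF f(1)] by (simp add: eq[abs_def])
  have "(LINT t|lborel. cube_exp j t) = (\<Prod>i\<in>UNIV. complex_of_real (if j $ i = 0 then 2 * pi else 0))"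
    using integral_prod_cart(2)[of f, OF f(1)] by (simp add: eq f(2) if_distrib)
  also have "\<dots> = (if j = 0 then (2 * pi) ^ CARD('n) else 0)"
    by (auto simp: vec_eq_iff)
  finally show "(LINT t|lborel. cube_exp j t) = (if j = 0 then (2 * pi) ^ CARD('n) else 0)" .
qed

lemma cube_exp_L2: "cube_exp j \<in> L2_space lborel"
proof (rule L2_spaceI)
  show "integrable lborel (\<lambda>t. (cmod (cube_exp j t))\<^sup>2)"
  proof (rule Bochner_Integration.integrable_bound)
    show "integrable lborel (cube_exp j)" by (rule integral_cube_exp)
    have "(cmod (cube_exp j t))\<^sup>2 \<le> cmod (cube_exp j t)" for t
      using mult_right_mono[OF cmod_cube_exp_le[of j t], of "cmod (cube_exp j t)"] by (simp add: power2_eq_square)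
    then show "AE t in lborel. norm ((cmod (cube_exp j t))\<^sup>2) \<le> norm (cube_exp j t)" by simp
  qed simp
qed simp

lemma cube_exp_orthogonal:
  "L2_inner lborel (cube_exp j) (cube_exp (k :: int^'n::finite)) = (if j = k then (2 * pi) ^ CARD('n) else 0)"
  by (simp add: L2_inner_def cube_exp_cnj integral_cube_exp)

lemma mult_cnj_cmod: "z * cnj z = (complex_of_real (cmod z))\<^sup>2"
  by (simp only: complex_norm_square[symmetric] of_real_power)

lemma L2_space_sum:
  "finite D \<Longrightarrow> (\<And>j. j \<in> D \<Longrightarrow> e j \<in> L2_space M) \<Longrightarrow> (\<lambda>x. \<Sum>j\<in>D. a j * e j x) \<in> L2_space M"
  by (induction D rule: finite_induct) auto

lemma L2_inner_sum_left:
  assumes "finite D" "\<And>j. j \<in> D \<Longrightarrow> e j \<in> L2_space M" "h \<in> L2_space M"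
  shows "L2_inner M (\<lambda>x. \<Sum>j\<in>D. a j * e j x) h = (\<Sum>j\<in>D. a j * L2_inner M (e j) h)"
  using assms
proof (induction D rule: finite_induct)
  case empty
  then show ?case by (simp add: L2_inner_def)
next
  case (insert j D)
  then show ?case
    by (simp add: L2_inner_add_left L2_space_sum L2_inner_scale_left)
qed

lemma L2_norm_mono:
  assumes "u \<in> L2_space M" "v \<in> L2_space M" "\<And>x. cmod (u x) \<le> cmod (v x)"
  shows "L2_norm M u \<le> L2_norm M v"
  unfolding L2_norm_def using assms
  by (intro real_sqrt_le_mono integral_mono L2_integrable_square power_mono) auto

text \<open>
  Parseval for an orthogonal family that is total among the functions supported in \<open>Q\<close>: by
  Bessel the partial sums are Cauchy, and totality identifies their limit.
\<close>

lemma orthogonal_total_Parseval: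
  fixes e :: "'i::countable \<Rightarrow> 'a \<Rightarrow> complex" and c :: real
  assumes e: "\<And>j. e j \<in> L2_space M" and c: "c > 0"
    and orth: "\<And>j k. L2_inner M (e j) (e k) = (if j = k then of_real c else 0)"
    and Q: "Q \<in> sets M" "\<And>j x. x \<notin> Q \<Longrightarrow> e j x = 0"
    and total: "\<And>h. h \<in> L2_space M \<Longrightarrow> (\<And>x. x \<notin> Q \<Longrightarrow> h x = 0) \<Longrightarrow>
      (\<And>j. L2_inner M h (e j) = 0) \<Longrightarrow> L2_norm M h = 0"
    and g: "g \<in> L2_space M" "\<And>x. x \<notin> Q \<Longrightarrow> g x = 0"
  shows "(\<integral>\<^sup>+j. ennreal ((cmod (L2_inner M g (e j)))\<^sup>2) \<partial>count_space UNIV) = ennreal (c * (L2_norm M g)\<^sup>2)"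
proof -
  define D :: "nat \<Rightarrow> 'i set" where "D n = {j. to_nat j < n}" for n
  have D_fin [simp]: "finite (D n)" for n
  proof -
    have "D n = to_nat -` {..<n}" by (auto simp: D_def)
    then show ?thesis by (simp add: finite_vimageI)
  qed
  have D_mono: "m \<le> n \<Longrightarrow> D m \<subseteq> D n" for m n by (auto simp: D_def)
  define a where "a j = L2_inner M g (e j)" for j
  define F where "F n x = (\<Sum>j\<in>D n. (a j / of_real c) * e j x)" for n x
  define s where "s n = (\<Sum>j\<in>D n. (cmod (a j))\<^sup>2)" for n
  have F [simp]: "F n \<in> L2_space M" for n
    unfolding F_def[abs_def] by (rule L2_space_sum) (use e in auto)
  have Fh: "L2_inner M (F n) h = (\<Sum>j\<in>D n. (a j / of_real c) * L2_inner M (e j) h)"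
    if "h \<in> L2_space M" for n h
    unfolding F_def[abs_def] by (rule L2_inner_sum_left) (use e that in auto)
  have Fe: "L2_inner M (F n) (e k) = (if k \<in> D n then a k else 0)" for n k
    using c by (simp add: Fh e orth if_distrib sum.delta cong: if_cong)
  have FF: "L2_inner M (F m) (F n) = of_real (s m / c)" if "m \<le> n" for m n
  proof -
    have "L2_inner M (e j) (F n) = cnj (a j)" if "j \<in> D m" for j
      using that D_mono[OF \<open>m \<le> n\<close>] by (subst L2_inner_commute) (auto simp: Fe)
    then show ?thesis
      by (simp add: Fh s_def sum_divide_distrib mult_cnj_cmod)
  qed
  have Fg: "L2_inner M (F n) g = of_real (s n / c)" for n
  proof -
    have "L2_inner M (e j) g = cnj (a j)" for j unfolding a_def by (rule L2_inner_commute)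
    then show ?thesis
      using g by (simp add: Fh s_def sum_divide_distrib mult_cnj_cmod)
  qed
  have nF: "(L2_norm M (F n))\<^sup>2 = s n / c" for n
    using FF[of n n] by (simp only: L2_inner_self of_real_eq_iff)
  have diff: "(L2_norm M (\<lambda>x. F m x - F n x))\<^sup>2 = (s n - s m) / c" if "m \<le> n" for m n
    by (simp add: L2_norm_diff_sq nF FF[OF that] diff_divide_distrib)
  have gF: "(L2_norm M (\<lambda>x. F n x - g x))\<^sup>2 = (L2_norm M g)\<^sup>2 - s n / c" for n
    using g by (simp add: L2_norm_diff_sq nF Fg)
  have s_mono: "incseq s"
    by (auto simp: incseq_def s_def intro!: sum_mono2 D_mono)
  have s_le: "s n \<le> c * (L2_norm M g)\<^sup>2" for n
  proof -
    have "0 \<le> (L2_norm M g)\<^sup>2 - s n / c" unfolding gF[symmetric] by simp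
    then show ?thesis using c by (simp add: field_simps)
  qed
  obtain l where "s \<longlonglongrightarrow> l"
    by (rule incseq_convergent[OF s_mono, of "c * (L2_norm M g)\<^sup>2"]) (use s_le in auto)
  then have sC: "Cauchy s" by (rule LIMSEQ_imp_Cauchy)
  have cau: "\<exists>N. \<forall>m\<ge>N. \<forall>n\<ge>N. L2_norm M (\<lambda>x. F m x - F n x) < r" if "r > 0" for r
  proof -
    have "r\<^sup>2 * c > 0" using that c by simp
    then obtain N where N: "\<And>m n. m \<ge> N \<Longrightarrow> n \<ge> N \<Longrightarrow> norm (s m - s n) < r\<^sup>2 * c"
      using CauchyD[OF sC] by meson
    have lt: "L2_norm M (\<lambda>x. F m x - F n x) < r" if "m \<ge> N" "n \<ge> N" "m \<le> n" for m n
    proof (rule power2_less_imp_less)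
      have "s n - s m < r\<^sup>2 * c" using N[OF that(2,1)] by simp
      then show "(L2_norm M (\<lambda>x. F m x - F n x))\<^sup>2 < r\<^sup>2"
        using c by (simp add: diff[OF that(3)] divide_less_eq)
    qed (use \<open>r > 0\<close> in simp)
    have "L2_norm M (\<lambda>x. F m x - F n x) < r" if "m \<ge> N" "n \<ge> N" for m n
    proof (cases "m \<le> n")
      case False
      then show ?thesis using lt[OF that(2,1)] L2_norm_minus_commute[of M "F m" "F n"] by simp
    qed (use lt that in auto)
    then show ?thesis by (intro exI[of _ N]) simp
  qed
  obtain p where p: "p \<in> L2_space M" "(\<lambda>n. L2_norm M (\<lambda>x. F n x - p x)) \<longlonglongrightarrow> 0"
    by (rule L2_complete[of F M, OF F cau])
  \<comment> \<open>The limit matters only up to null sets; cutting it off makes it vanish outside \<open>Q\<close> everywhere.\<close>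
  define p' where "p' x = indicator Q x * p x" for x
  have p'L: "p' \<in> L2_space M"
  proof (rule L2_space_bound[OF p(1), of _ 1])
    show "p' \<in> borel_measurable M" unfolding p'_def[abs_def] using L2_measurable[OF p(1)] Q(1) by measurable
  qed (simp add: p'_def norm_mult indicator_def)
  have F0: "F n x = 0" if "x \<notin> Q" for n x by (simp add: F_def Q(2)[OF that])
  have p': "(\<lambda>n. L2_norm M (\<lambda>x. F n x - p' x)) \<longlonglongrightarrow> 0"
  proof (rule tendsto_sandwich[OF _ _ tendsto_const p(2)])
    have "L2_norm M (\<lambda>x. F n x - p' x) \<le> L2_norm M (\<lambda>x. F n x - p x)" for n
    proof (rule L2_norm_mono)
      show "cmod (F n x - p' x) \<le> cmod (F n x - p x)" for x
        using F0[of x n] by (cases "x \<in> Q") (auto simp: p'_def)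
    qed (use p p'L in auto)
    then show "\<forall>\<^sub>F n in sequentially. L2_norm M (\<lambda>x. F n x - p' x) \<le> L2_norm M (\<lambda>x. F n x - p x)" by simp
  qed simp
  have "L2_norm M (\<lambda>x. g x - p' x) = 0"
  proof (rule total)
    show "L2_inner M (\<lambda>x. g x - p' x) (e k) = 0" for k
    proof -
      have "\<forall>\<^sub>F n in sequentially. L2_inner M (F n) (e k) = a k"
        using eventually_gt_at_top[of "to_nat k"] by eventually_elim (simp add: Fe D_def)
      then have "(\<lambda>n. L2_inner M (F n) (e k)) \<longlonglongrightarrow> a k" by (rule tendsto_eventually)
      moreover have "(\<lambda>n. L2_inner M (F n) (e k)) \<longlonglongrightarrow> L2_inner M p' (e k)"
        by (rule L2_inner_tendsto[OF F p'L e p'])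
      ultimately have "L2_inner M p' (e k) = a k" by (rule LIMSEQ_unique[rotated])
      then show ?thesis using g p'L e by (simp add: L2_inner_diff_left a_def)
    qed
    show "(\<lambda>x. g x - p' x) \<in> L2_space M" by (rule L2_space_diff[OF g(1) p'L])
    show "g x - p' x = 0" if "x \<notin> Q" for x using that g(2) by (simp add: p'_def)
  qed
  then have gp: "L2_norm M (\<lambda>x. p' x - g x) = 0" using L2_norm_minus_commute[of M p' g] by simp
  have "(\<lambda>n. L2_norm M (\<lambda>x. F n x - g x)) \<longlonglongrightarrow> 0"
  proof (rule tendsto_sandwich[OF _ _ tendsto_const p'])
    have "L2_norm M (\<lambda>x. F n x - g x) \<le> L2_norm M (\<lambda>x. F n x - p' x)" for n
      using L2_norm_diff_triangle[OF F p'L g(1)] gp by simp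
    then show "\<forall>\<^sub>F n in sequentially. L2_norm M (\<lambda>x. F n x - g x) \<le> L2_norm M (\<lambda>x. F n x - p' x)" by simp
  qed simp
  from tendsto_power[OF this, of 2] have "(\<lambda>n. (L2_norm M g)\<^sup>2 - s n / c) \<longlonglongrightarrow> 0"
    by (simp add: gF)
  then have "(\<lambda>n. c * (L2_norm M g)\<^sup>2 - c * ((L2_norm M g)\<^sup>2 - s n / c)) \<longlonglongrightarrow> c * (L2_norm M g)\<^sup>2 - c * 0"
    by (intro tendsto_intros)
  then have "s \<longlonglongrightarrow> c * (L2_norm M g)\<^sup>2" using c by (simp add: right_diff_distrib)
  then have "(\<lambda>n. ennreal (s n)) \<longlonglongrightarrow> ennreal (c * (L2_norm M g)\<^sup>2)" by (rule tendsto_ennrealI)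
  moreover have "(\<lambda>n. ennreal (s n)) \<longlonglongrightarrow> (SUP n. ennreal (s n))"
    using s_mono by (intro LIMSEQ_SUP) (auto simp: incseq_def intro: ennreal_leI)
  ultimately have lim: "(SUP n. ennreal (s n)) = ennreal (c * (L2_norm M g)\<^sup>2)" by (rule LIMSEQ_unique[rotated])
  have "(\<integral>\<^sup>+j. ennreal ((cmod (a j))\<^sup>2) \<partial>count_space UNIV)
      = (\<integral>\<^sup>+j. (SUP n. ennreal ((cmod (a j))\<^sup>2) * indicator (D n) j) \<partial>count_space UNIV)"
  proof (intro nn_integral_cong antisym)
    fix j :: 'i
    show "ennreal ((cmod (a j))\<^sup>2) \<le> (SUP n. ennreal ((cmod (a j))\<^sup>2) * indicator (D n) j)"
      by (rule SUP_upper2[of "Suc (to_nat j)"]) (auto simp: D_def)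
    show "(SUP n. ennreal ((cmod (a j))\<^sup>2) * indicator (D n) j) \<le> ennreal ((cmod (a j))\<^sup>2)"
      by (rule SUP_least) (simp add: indicator_def)
  qed
  also have "\<dots> = (SUP n. \<integral>\<^sup>+j. ennreal ((cmod (a j))\<^sup>2) * indicator (D n) j \<partial>count_space UNIV)"
    using D_mono by (intro nn_integral_monotone_convergence_SUP)
      (auto simp: incseq_def le_fun_def indicator_def)
  also have "\<dots> = (SUP n. ennreal (s n))"
  proof (rule SUP_cong[OF refl])
    fix n
    have "(\<integral>\<^sup>+j. ennreal ((cmod (a j))\<^sup>2) * indicator (D n) j \<partial>count_space UNIV)
        = (\<Sum>j\<in>D n. ennreal ((cmod (a j))\<^sup>2) * indicator (D n) j)"
      by (rule nn_integral_count_space') auto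
    also have "\<dots> = ennreal (s n)" by (simp add: s_def sum_ennreal)
    finally show "(\<integral>\<^sup>+j. ennreal ((cmod (a j))\<^sup>2) * indicator (D n) j \<partial>count_space UNIV) = ennreal (s n)" .
  qed
  finally show ?thesis using lim by (simp add: a_def)
qed

text \<open>
  Polynomials in the real and imaginary parts of the coordinates pull back to trigonometric polynomials.
\<close>

definition torus_map :: "real^'n \<Rightarrow> complex^'n" where
  "torus_map t = (\<chi> i. cis (t $ i))"

definition closed_cube :: "(real^'n) set" where
  "closed_cube = cbox (\<chi> i. - pi) (\<chi> i. pi)"

lemma open_cube_subset_closed: "open_cube \<subseteq> closed_cube"
  by (auto simp: open_cube_def closed_cube_def mem_box_cart less_imp_le)

lemma continuous_torus_map: "continuous_on S torus_map"
  unfolding torus_map_def cis_conv_exp by (intro continuous_on_vec_lambda continuous_intros)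

text \<open>
  Only boundary points of the cube are identified with other points.
\<close>

lemma torus_map_inj:
  assumes t: "t \<in> open_cube" and s: "s \<in> closed_cube" and e: "torus_map t = torus_map s"
  shows "t = s"
proof -
  have "t $ i = s $ i" for i
  proof -
    have ti: "- pi < t $ i" "t $ i < pi" using t by (auto simp: open_cube_def)
    have si: "- pi \<le> s $ i" "s $ i \<le> pi" using s by (auto simp: closed_cube_def mem_box_cart)
    have c: "cis (t $ i) = cis (s $ i)" using e by (simp add: torus_map_def vec_eq_iff)
    have at: "Arg (cis (t $ i)) = t $ i" using ti by (intro Arg_cis) auto
    show ?thesis
    proof (cases "s $ i = - pi")
      case True
      have "cis (s $ i) = cis pi" by (simp add: True cis.ctr complex_eq_iff)
      then have "Arg (cis (s $ i)) = pi" using Arg_cis[of pi] by simp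
      then show ?thesis using at c ti by simp
    next
      case False
      then have "Arg (cis (s $ i)) = s $ i" using si by (intro Arg_cis) auto
      then show ?thesis using at c by simp
    qed
  qed
  then show ?thesis by (simp add: vec_eq_iff)
qed

text \<open>
  Functions annihilated by all exponentials. By Stone--Weierstrass on the torus, whose polynomial
  functions pull back to trigonometric polynomials, such an \<open>h\<close> integrates to zero against every
  continuous function on the torus, and hence over every open subset of the cube.
\<close>

locale cube_annihilator =
  fixes h :: "real^'n::finite \<Rightarrow> complex"
  assumes h: "integrable lborel h" and h0: "\<And>t. t \<notin> open_cube \<Longrightarrow> h t = 0"
    and ann: "\<And>j. (LINT t|lborel. h t * exp (\<i> * complex_of_real (int_vec j \<bullet> t))) = 0"
begin

abbreviation "E j t \<equiv> exp (\<i> * complex_of_real (int_vec j \<bullet> t))"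

lemma h_meas [measurable]: "h \<in> borel_measurable borel"
  using h by auto

text \<open>
  Quantifying over all frequencies makes the class stable under multiplication by exponentials, and
  hence by sines and cosines.
\<close>

definition annihilated :: "(real^'n \<Rightarrow> complex) \<Rightarrow> bool" where
  "annihilated u \<longleftrightarrow> u \<in> borel_measurable borel \<and> (\<exists>B. \<forall>t. cmod (u t) \<le> B) \<and>
     (\<forall>j. (LINT t|lborel. h t * (E j t * u t)) = 0)"

lemma integrable_h_mult:
  assumes "u \<in> borel_measurable borel" "\<And>t. cmod (u t) \<le> B"
  shows "integrable lborel (\<lambda>t. h t * u t)"
proof (rule Bochner_Integration.integrable_bound)
  show "integrable lborel (\<lambda>t. of_real B * h t)" using h by simp
  have [measurable]: "u \<in> borel_measurable borel" by fact
  show "(\<lambda>t. h t * u t) \<in> borel_measurable lborel" by measurable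
  have "norm (h t * u t) \<le> norm (of_real B * h t)" for t
  proof -
    have "norm (u t) \<le> \<bar>B\<bar>" using assms(2)[of t] by linarith
    from mult_left_mono[OF this norm_ge_zero[of "h t"]] show ?thesis by (simp add: norm_mult mult.commute)
  qed
  then show "AE t in lborel. norm (h t * u t) \<le> norm (of_real B * h t)" by simp
qed

lemma E_add: "E j t * E k t = E (j + k) t"
  by (simp add: mult_exp_exp int_vec_add inner_add_left distrib_left)

lemma annihilated_integrable:
  assumes "annihilated u" shows "integrable lborel (\<lambda>t. h t * (E j t * u t))"
proof -
  obtain B where u: "u \<in> borel_measurable borel" "\<forall>t. cmod (u t) \<le> B"
    using assms by (auto simp: annihilated_def)
  have [measurable]: "u \<in> borel_measurable borel" by fact
  show ?thesis
    by (rule integrable_h_mult[of _ B]) (use u in \<open>auto simp: norm_mult\<close>)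
qed

lemma annihilated_one: "annihilated (\<lambda>t. 1)"
  using ann by (auto simp: annihilated_def)

lemma annihilated_add:
  assumes u: "annihilated u" and v: "annihilated v" shows "annihilated (\<lambda>t. u t + v t)"
proof -
  obtain A B where "\<forall>t. cmod (u t) \<le> A" "\<forall>t. cmod (v t) \<le> B"
    using u v by (auto simp: annihilated_def)
  then have "cmod (u t + v t) \<le> A + B" for t
    using norm_triangle_ineq[of "u t" "v t"] by (smt (verit))
  moreover have "(LINT t|lborel. h t * (E j t * (u t + v t))) = 0" for j
    using u v annihilated_integrable[OF u, of j] annihilated_integrable[OF v, of j]
    by (simp add: distrib_left annihilated_def)
  moreover have "(\<lambda>t. u t + v t) \<in> borel_measurable borel" using u v by (auto simp: annihilated_def)
  ultimately show ?thesis unfolding annihilated_def by blast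
qed

lemma annihilated_scale:
  assumes u: "annihilated u" shows "annihilated (\<lambda>t. c * u t)"
proof -
  obtain A where A: "\<forall>t. cmod (u t) \<le> A"
    using u by (auto simp: annihilated_def)
  have "cmod (c * u t) \<le> cmod c * A" for t
    using A by (simp add: norm_mult mult_left_mono)
  moreover have "(LINT t|lborel. h t * (E j t * (c * u t))) = 0" for j
  proof -
    have "(LINT t|lborel. h t * (E j t * (c * u t))) = (LINT t|lborel. c * (h t * (E j t * u t)))"
      by (simp add: mult_ac)
    then show ?thesis using u by (simp add: annihilated_def)
  qed
  moreover have "(\<lambda>t. c * u t) \<in> borel_measurable borel" using u by (auto simp: annihilated_def)
  ultimately show ?thesis unfolding annihilated_def by blast
qed

lemma annihilated_E:
  assumes u: "annihilated u" shows "annihilated (\<lambda>t. u t * E k t)"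
proof -
  have "(LINT t|lborel. h t * (E j t * (u t * E k t))) = 0" for j
  proof -
    have "(LINT t|lborel. h t * (E j t * (u t * E k t))) = (LINT t|lborel. h t * (E (j + k) t * u t))"
      by (simp only: E_add[symmetric] mult_ac)
    then show ?thesis using u by (simp add: annihilated_def)
  qed
  moreover have [measurable]: "u \<in> borel_measurable borel" using u by (auto simp: annihilated_def)
  have "(\<lambda>t. u t * E k t) \<in> borel_measurable borel" by measurable
  moreover have "\<exists>B. \<forall>t. cmod (u t * E k t) \<le> B" using u by (simp add: annihilated_def norm_mult)
  ultimately show ?thesis unfolding annihilated_def by blast
qed

lemma annihilated_sum:
  "finite D \<Longrightarrow> (\<And>i. i \<in> D \<Longrightarrow> annihilated (u i)) \<Longrightarrow> annihilated (\<lambda>t. \<Sum>i\<in>D. u i t)"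
proof (induction D rule: finite_induct)
  case empty
  then show ?case using annihilated_scale[OF annihilated_one, of 0] by simp
qed (simp add: annihilated_add)

lemma annihilated_cos_sin:
  assumes u: "annihilated u"
  shows "annihilated (\<lambda>t. u t * of_real (cos (t $ i)))" "annihilated (\<lambda>t. u t * of_real (sin (t $ i)))"
proof -
  have ax: "int_vec (axis i 1) \<bullet> t = t $ i" "int_vec (- axis i 1) \<bullet> t = - t $ i" for t :: "real^'n"
  proof -
    have "int_vec (axis i 1) = axis i (1::real)" "int_vec (- axis i 1) = - axis i (1::real)"
      by (auto simp: int_vec_def axis_def vec_eq_iff)
    then show "int_vec (axis i 1) \<bullet> t = t $ i" "int_vec (- axis i 1) \<bullet> t = - t $ i"
      by (simp_all add: inner_axis' )
  qed
  note E = annihilated_E[OF u, of "axis i 1"] annihilated_E[OF u, of "- axis i 1"]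
  have "u t * of_real (cos (t $ i)) = (1/2) * (u t * E (axis i 1) t) + (1/2) * (u t * E (- axis i 1) t)" for t
    by (simp add: ax cos_exp_eq cos_of_real[symmetric] algebra_simps add_divide_distrib)
  then show "annihilated (\<lambda>t. u t * of_real (cos (t $ i)))"
    using annihilated_add[OF annihilated_scale[OF E(1), of "1/2"] annihilated_scale[OF E(2), of "1/2"]] by simp
  have "u t * of_real (sin (t $ i)) = (1/(2*\<i>)) * (u t * E (axis i 1) t) + (-1/(2*\<i>)) * (u t * E (- axis i 1) t)" for t
    by (simp add: ax sin_exp_eq sin_of_real[symmetric] field_simps)
  then show "annihilated (\<lambda>t. u t * of_real (sin (t $ i)))"
    using annihilated_add[OF annihilated_scale[OF E(1), of "1/(2*\<i>)"] annihilated_scale[OF E(2), of "-1/(2*\<i>)"]] by simp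
qed

text \<open>
  A real-linear functional of the torus coordinates is a combination of sines and cosines. The factor \<open>u\<close> is
  carried along so that products can be treated one factor at a time.
\<close>

lemma annihilated_polynomial:
  fixes p :: "complex^'n \<Rightarrow> real"
  assumes "real_polynomial_function p"
  shows "annihilated u \<Longrightarrow> annihilated (\<lambda>t. u t * of_real (p (torus_map t)))"
  using assms
proof (induction arbitrary: u rule: real_polynomial_function.induct)
  case (linear p)
  interpret bounded_linear p by fact
  have ax: "axis i z = Re z *\<^sub>R axis i (1::complex) + Im z *\<^sub>R axis i \<i>" for i :: 'n and z
    by (simp add: vec_eq_iff axis_def complex_eq_iff)
  have "p (torus_map t) = (\<Sum>i\<in>UNIV. cos (t $ i) * p (axis i 1) + sin (t $ i) * p (axis i \<i>))" for t
  proof -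
    have "torus_map t = (\<Sum>i\<in>UNIV. axis i (cis (t $ i)))"
      by (simp add: vec_eq_iff torus_map_def axis_def sum.delta if_distrib cong: if_cong)
    also have "p \<dots> = (\<Sum>i\<in>UNIV. p (axis i (cis (t $ i))))" by (rule sum)
    also have "\<dots> = (\<Sum>i\<in>UNIV. cos (t $ i) * p (axis i 1) + sin (t $ i) * p (axis i \<i>))"
      by (rule sum.cong[OF refl], subst ax) (simp add: add scaleR)
    finally show ?thesis .
  qed
  then have eq: "u t * of_real (p (torus_map t)) = (\<Sum>i\<in>UNIV. of_real (p (axis i 1)) * (u t * of_real (cos (t $ i)))
      + of_real (p (axis i \<i>)) * (u t * of_real (sin (t $ i))))" for t
    by (simp add: sum_distrib_left algebra_simps)
  show ?case unfolding eq
    by (intro annihilated_sum annihilated_add annihilated_scale annihilated_cos_sin linear.prems) simp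
next
  case (const c)
  then show ?case using annihilated_scale[of u "of_real c"] by (simp add: mult.commute)
next
  case (add f g)
  then show ?case using annihilated_add[OF add.IH(1)[OF add.prems] add.IH(2)[OF add.prems]]
    by (simp add: distrib_left)
next
  case (mult f g)
  then show ?case using mult.IH(2)[OF mult.IH(1)[OF mult.prems]] by (simp add: mult.assoc)
qed

lemma integral_continuous_torus:
  fixes H :: "complex^'n \<Rightarrow> real"
  assumes H: "continuous_on UNIV H"
  shows "(LINT t|lborel. h t * of_real (H (torus_map t))) = 0"
proof -
  let ?T = "torus_map ` (closed_cube :: (real^'n) set)"
  have T: "compact ?T"
    by (intro compact_continuous_image continuous_torus_map) (simp add: closed_cube_def compact_cbox)
  have HT: "continuous_on UNIV (\<lambda>t. H (torus_map t))"
    by (rule continuous_on_compose2[OF H continuous_torus_map]) auto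
  then have [measurable]: "(\<lambda>t. H (torus_map t)) \<in> borel_measurable borel"
    by (rule borel_measurable_continuous_onI)
  have "bounded (H ` ?T)"
    by (intro compact_imp_bounded compact_continuous_image[OF _ T] continuous_on_subset[OF H]) simp
  then obtain B where B: "\<And>t. t \<in> closed_cube \<Longrightarrow> \<bar>H (torus_map t)\<bar> \<le> B"
    by (auto simp: bounded_iff)
  define I where "I = (LINT t|lborel. h t * of_real (H (torus_map t)))"
  have bound: "cmod I \<le> e * (LINT t|lborel. cmod (h t))" if e: "e > 0" for e
  proof -
    obtain p where p: "real_polynomial_function p" "\<And>w. w \<in> ?T \<Longrightarrow> \<bar>H w - p w\<bar> < e"
      using Stone_Weierstrass_real_polynomial_function[OF T continuous_on_subset[OF H] e] by blast
    have ap: "annihilated (\<lambda>t. 1 * of_real (p (torus_map t)))"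
      by (rule annihilated_polynomial[OF p(1) annihilated_one])
    then have p0: "(LINT t|lborel. h t * of_real (p (torus_map t))) = 0"
      and ip: "integrable lborel (\<lambda>t. h t * of_real (p (torus_map t)))"
      using annihilated_integrable[OF ap, of 0] by (auto simp: annihilated_def dest: spec[of _ 0])
    have pm [measurable]: "(\<lambda>t. complex_of_real (p (torus_map t))) \<in> borel_measurable borel"
      using ap by (simp add: annihilated_def)
    have le: "cmod (h t * of_real (H (torus_map t)) - h t * of_real (p (torus_map t))) \<le> e * cmod (h t)" for t
    proof (cases "t \<in> open_cube")
      case True
      then have "torus_map t \<in> ?T" using open_cube_subset_closed by auto
      from p(2)[OF this] have "\<bar>H (torus_map t) - p (torus_map t)\<bar> \<le> e" by simp
      then have "cmod (h t) * \<bar>H (torus_map t) - p (torus_map t)\<bar> \<le> cmod (h t) * e"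
        by (rule mult_left_mono) simp
      moreover have "cmod (h t * of_real (H (torus_map t)) - h t * of_real (p (torus_map t)))
          = cmod (h t) * \<bar>H (torus_map t) - p (torus_map t)\<bar>"
        by (simp add: norm_mult flip: right_diff_distrib of_real_diff)
      ultimately show ?thesis by (simp add: mult.commute)
    qed (simp add: h0)
    have int: "integrable lborel (\<lambda>t. h t * of_real (H (torus_map t)) - h t * of_real (p (torus_map t)))"
      by (rule Bochner_Integration.integrable_bound[of _ "\<lambda>t. e * cmod (h t)"])
        (use h le e in \<open>auto simp: abs_mult\<close>)
    have iH: "integrable lborel (\<lambda>t. h t * of_real (H (torus_map t)))"
      using Bochner_Integration.integrable_add[OF int ip] by simp
    have "I = (LINT t|lborel. h t * of_real (H (torus_map t)) - h t * of_real (p (torus_map t)))"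
      using iH ip p0 by (simp add: I_def)
    also have "cmod \<dots> \<le> (LINT t|lborel. e * cmod (h t))"
      by (rule Bochner_Integration.integral_norm_bound_integral[OF int]) (use h le in auto)
    finally show ?thesis by simp
  qed
  have "cmod I \<le> 0"
  proof (rule field_le_epsilon)
    fix d :: real assume d: "d > 0"
    define L where "L = (LINT t|lborel. cmod (h t))"
    have L: "L \<ge> 0" by (simp add: L_def)
    have "0 < d / (L + 1)" using d L by simp
    from bound[OF this, folded L_def] have "cmod I \<le> d / (L + 1) * L" .
    also have "\<dots> \<le> d" using d L by (simp add: field_simps)
    finally show "cmod I \<le> 0 + d" by simp
  qed
  then show ?thesis by (simp add: I_def)
qed

text \<open>
  The indicator of \<open>U\<close> is the limit of \<open>min 1 (m * dist)\<close>, where \<open>dist\<close> is the distance on the torus to the image of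
  the complement of \<open>U\<close>.
\<close>

lemma integral_open_subset_cube:
  assumes U: "open U" "U \<subseteq> open_cube"
  shows "(LINT t|lborel. indicator U t *\<^sub>R h t) = 0"
proof -
  let ?K = "torus_map ` (closed_cube - U)"
  have K: "compact ?K"
    by (intro compact_continuous_image continuous_torus_map compact_diff U)
      (simp add: closed_cube_def compact_cbox)
  have "(\<chi> i. pi) \<in> closed_cube - U"
    using U(2) by (auto simp: closed_cube_def open_cube_def mem_box_cart)
  then have Kne: "?K \<noteq> {}" by blast
  define H where "H m w = min 1 (real m * infdist w ?K)" for m w
  have Hc: "continuous_on UNIV (H m)" for m
    unfolding H_def[abs_def] by (intro continuous_intros)
  have Hm [measurable]: "(\<lambda>t. H m (torus_map t)) \<in> borel_measurable borel" for m
    by (intro borel_measurable_continuous_onI continuous_on_compose2[OF Hc continuous_torus_map]) auto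
  have Um [measurable]: "U \<in> sets borel" using U by simp
  have "(\<lambda>m. LINT t|lborel. h t * of_real (H m (torus_map t))) \<longlonglongrightarrow> (LINT t|lborel. indicator U t *\<^sub>R h t)"
  proof (rule integral_dominated_convergence)
    show "integrable lborel (\<lambda>t. cmod (h t))" using h by simp
    show "AE t in lborel. (\<lambda>m. h t * of_real (H m (torus_map t))) \<longlonglongrightarrow> indicator U t *\<^sub>R h t"
    proof (rule AE_I2)
      fix t :: "real^'n"
      consider "t \<notin> open_cube" | "t \<in> open_cube" "t \<in> U" | "t \<in> open_cube" "t \<notin> U" by blast
      then show "(\<lambda>m. h t * of_real (H m (torus_map t))) \<longlonglongrightarrow> indicator U t *\<^sub>R h t"
      proof cases
        case 2
        have "torus_map t \<notin> ?K" using torus_map_inj[OF 2(1)] 2(2) by auto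
        then have d: "infdist (torus_map t) ?K > 0"
          using Kne compact_imp_closed[OF K] infdist_pos_not_in_closed by blast
        obtain N where N: "1 \<le> real N * infdist (torus_map t) ?K"
          using reals_Archimedean3[OF d] less_imp_le by blast
        have "\<forall>\<^sub>F m in sequentially. h t * of_real (H m (torus_map t)) = indicator U t *\<^sub>R h t"
          using eventually_ge_at_top[of N]
        proof eventually_elim
          case (elim m)
          have "real N * infdist (torus_map t) ?K \<le> real m * infdist (torus_map t) ?K"
            using elim d by (intro mult_right_mono) auto
          then show ?case using N 2 by (simp add: H_def)
        qed
        then show ?thesis by (rule tendsto_eventually)
      next
        case 3
        then have "torus_map t \<in> ?K" using open_cube_subset_closed by blast
        then show ?thesis using 3 by (simp add: H_def)
      qed (simp add: h0)
    qed
    show "AE t in lborel. norm (h t * of_real (H m (torus_map t))) \<le> cmod (h t)" for m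
    proof (rule AE_I2)
      fix t :: "real^'n"
      have "0 \<le> H m (torus_map t)" "H m (torus_map t) \<le> 1" by (auto simp: H_def infdist_nonneg)
      then show "norm (h t * of_real (H m (torus_map t))) \<le> cmod (h t)"
        by (simp add: norm_mult mult_left_le)
    qed
  qed measurable
  then show ?thesis using integral_continuous_torus[OF Hc] LIMSEQ_unique[OF _ tendsto_const] by simp
qed

lemma AE_zero: "AE t in lborel. h t = 0"
proof (rule sigma_finite_measure.density_zero[OF lborel.sigma_finite_measure_axioms h])
  fix A :: "(real^'n) set" assume "A \<in> sets lborel"
  then have A: "A \<in> sigma_sets UNIV {S. open S}" by (simp add: sets_borel)
  have "Int_stable {S :: (real^'n) set. open S}" by (auto simp: Int_stable_def)
  moreover have "{S :: (real^'n) set. open S} \<subseteq> Pow UNIV" by simp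
  moreover note A
  ultimately show "set_lebesgue_integral lborel A h = 0"
  proof (induction A rule: sigma_sets_induct_disjoint)
    case (basic A)
    then have "open (A \<inter> open_cube)" by auto
    then have "(LINT t|lborel. indicator (A \<inter> open_cube) t *\<^sub>R h t) = 0"
      by (rule integral_open_subset_cube) simp
    moreover have "indicator (A \<inter> open_cube) t *\<^sub>R h t = indicator A t *\<^sub>R h t" for t
      using h0[of t] by (auto simp: indicator_def)
    ultimately show ?case by (simp add: set_lebesgue_integral_def)
  next
    case empty
    then show ?case by (simp add: set_lebesgue_integral_def)
  next
    case (compl A)
    then have A: "A \<in> sets lborel" by (simp add: sets_borel)
    have iA: "integrable lborel (\<lambda>t. indicator A t *\<^sub>R h t)"
      by (rule integrable_mult_indicator[OF A h])
    have "set_lebesgue_integral lborel (UNIV - A) h = (LINT t|lborel. h t - indicator A t *\<^sub>R h t)"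
      unfolding set_lebesgue_integral_def by (intro Bochner_Integration.integral_cong) (auto simp: indicator_def)
    also have "\<dots> = (LINT t|lborel. h t) - set_lebesgue_integral lborel A h"
      using h iA by (simp add: set_lebesgue_integral_def)
    also have "(LINT t|lborel. h t) = 0"
      using ann[of 0] by simp
    finally show ?case using compl by simp
  next
    case (union A)
    then have A: "A i \<in> sets lborel" for i using subsetD[OF union(2), of "A i"] by (simp add: sets_borel)
    have "set_lebesgue_integral lborel (\<Union>i. A i) h = (\<Sum>i. set_lebesgue_integral lborel (A i) h)"
    proof (rule lebesgue_integral_countable_add)
      show "set_integrable lborel (\<Union>i. A i) h"
        unfolding set_integrable_def using A by (intro integrable_mult_indicator h sets.countable_UN) auto
    qed (use A union(1) in \<open>auto simp: disjoint_family_on_def\<close>)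
    then show ?case using union by simp
  qed
qed

end

lemma cube_exp_total:
  fixes h :: "real^'n::finite \<Rightarrow> complex"
  assumes hL: "h \<in> L2_space lborel" and h0: "\<And>t. t \<notin> open_cube \<Longrightarrow> h t = 0"
    and ann: "\<And>j. L2_inner lborel h (cube_exp j) = 0"
  shows "L2_norm lborel h = 0"
proof -
  have eq: "h t * cnj (cube_exp (- j) t) = h t * exp (\<i> * complex_of_real (int_vec j \<bullet> t))" for j t
  proof (cases "t \<in> open_cube")
    case True
    have "int_vec (- j) = - int_vec j" by (simp add: int_vec_def vec_eq_iff)
    then show ?thesis using True by (simp add: cube_exp_def exp_cnj)
  qed (simp add: h0)
  interpret cube_annihilator h
  proof
    show "integrable lborel h"
      using L2_inner_integrable[OF hL cube_exp_L2, of "- 0"] by (simp only: eq) simp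
    show "(LINT t|lborel. h t * exp (\<i> * complex_of_real (int_vec j \<bullet> t))) = 0" for j
      using ann[of "- j"] by (simp only: L2_inner_def eq)
  qed (rule h0)
  have "L2_eq lborel h (\<lambda>t. 0)" using AE_zero by (simp add: L2_eq_def)
  then show ?thesis using L2_eq_iff_norm[OF hL L2_space_zero] by simp
qed

lemma cube_Parseval:
  fixes g :: "real^'n::finite \<Rightarrow> complex"
  assumes "g \<in> L2_space lborel" "\<And>t. t \<notin> open_cube \<Longrightarrow> g t = 0"
  shows "(\<integral>\<^sup>+j. ennreal ((cmod (L2_inner lborel g (cube_exp j)))\<^sup>2) \<partial>count_space UNIV)
    = ennreal ((2 * pi) ^ CARD('n) * (L2_norm lborel g)\<^sup>2)"
  by (rule orthogonal_total_Parseval[where Q=open_cube])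
    (use assms cube_exp_total in \<open>auto simp: cube_exp_L2 cube_exp_orthogonal cube_exp_def\<close>)

text \<open>
  Frequencies with spacing \<open>\<beta>\<close> suffice because the support of \<open>g\<close> lies in a cube of side \<open>2 * pi / \<beta>\<close>.
\<close>

lemma cube_Parseval_scaled:
  fixes g :: "real^'n::finite \<Rightarrow> complex"
  assumes g: "g \<in> L2_space lborel" and \<beta>: "\<beta> > 0"
    and g0: "\<And>t i. g t \<noteq> 0 \<Longrightarrow> \<bar>t $ i\<bar> < pi / \<beta>"
  shows "(\<integral>\<^sup>+j. ennreal ((cmod (LINT t|lborel. g t * exp (- \<i> * complex_of_real (\<beta> * (int_vec j \<bullet> t)))))\<^sup>2)
      \<partial>count_space UNIV) = ennreal ((2 * pi / \<beta>) ^ CARD('n) * (L2_norm lborel g)\<^sup>2)"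
proof -
  define d where "d = CARD('n)"
  define g' where "g' t = g (0 + (1 / \<beta>) *\<^sub>R t)" for t
  have gm [measurable]: "g \<in> borel_measurable borel" using L2_measurable[OF g] by simp
  have g': "g' \<in> L2_space lborel"
    unfolding g'_def[abs_def] using g \<beta> by (intro L2_space_affine) auto
  have g'0: "g' t = 0" if "t \<notin> open_cube" for t
  proof (rule ccontr)
    assume "g' t \<noteq> 0"
    then have "\<bar>((1 / \<beta>) *\<^sub>R t) $ i\<bar> < pi / \<beta>" for i using g0[of "(1 / \<beta>) *\<^sub>R t" i] by (simp add: g'_def)
    then have "\<bar>t $ i\<bar> < pi" for i using \<beta> by (simp add: abs_mult field_simps)
    then have "- pi < t $ i \<and> t $ i < pi" for i by (simp add: abs_less_iff minus_less_iff)
    then show False using that by (simp add: open_cube_def)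
  qed
  define J where "J j = (LINT t|lborel. g t * exp (- \<i> * complex_of_real (\<beta> * (int_vec j \<bullet> t))))" for j
  have in_eq: "J j = of_real ((1/\<beta>)^d) * L2_inner lborel g' (cube_exp j)" for j
  proof -
    have "J j = \<bar>1/\<beta>\<bar>^DIM(real^'n) *\<^sub>R (LINT t|lborel. g (0 + (1/\<beta>) *\<^sub>R t)
        * exp (- \<i> * complex_of_real (\<beta> * (int_vec j \<bullet> (0 + (1/\<beta>) *\<^sub>R t)))))"
      unfolding J_def by (rule lborel_integral_affine) (use \<beta> in auto)
    also have "(LINT t|lborel. g (0 + (1/\<beta>) *\<^sub>R t)
        * exp (- \<i> * complex_of_real (\<beta> * (int_vec j \<bullet> (0 + (1/\<beta>) *\<^sub>R t))))) = L2_inner lborel g' (cube_exp j)"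
      unfolding L2_inner_def
    proof (rule Bochner_Integration.integral_cong[OF refl])
      fix t :: "real^'n"
      show "g (0 + (1/\<beta>) *\<^sub>R t) * exp (- \<i> * complex_of_real (\<beta> * (int_vec j \<bullet> (0 + (1/\<beta>) *\<^sub>R t))))
          = g' t * cnj (cube_exp j t)"
      proof (cases "t \<in> open_cube")
        case True
        then show ?thesis using \<beta> by (simp add: g'_def cube_exp_def exp_cnj)
      next
        case False
        then show ?thesis using g'0[OF False] by (simp add: g'_def)
      qed
    qed
    finally show ?thesis using \<beta> by (simp add: d_def scaleR_conv_of_real)
  qed
  have norm_g': "(L2_norm lborel g)\<^sup>2 = (1/\<beta>)^d * (L2_norm lborel g')\<^sup>2"
  proof -
    have "(L2_norm lborel g)\<^sup>2 = \<bar>1/\<beta>\<bar>^DIM(real^'n) *\<^sub>R (LINT t|lborel. (cmod (g (0 + (1/\<beta>) *\<^sub>R t)))\<^sup>2)"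
      unfolding L2_norm_sq by (rule lborel_integral_affine) (use \<beta> in auto)
    then show ?thesis using \<beta> by (simp add: g'_def L2_norm_sq d_def)
  qed
  have "(\<integral>\<^sup>+j. ennreal ((cmod (J j))\<^sup>2) \<partial>count_space UNIV)
      = (\<integral>\<^sup>+j. ennreal (((1/\<beta>)^d)\<^sup>2) * ennreal ((cmod (L2_inner lborel g' (cube_exp j)))\<^sup>2) \<partial>count_space UNIV)"
    using \<beta> by (intro nn_integral_cong)
      (simp add: in_eq norm_mult power_mult_distrib ennreal_mult[symmetric] norm_power norm_divide)
  also have "\<dots> = ennreal (((1/\<beta>)^d)\<^sup>2) * ennreal ((2 * pi) ^ d * (L2_norm lborel g')\<^sup>2)"
    by (simp add: nn_integral_cmult cube_Parseval[OF g' g'0] d_def)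
  also have "\<dots> = ennreal (((1/\<beta>)^d)\<^sup>2 * ((2 * pi) ^ d * (L2_norm lborel g')\<^sup>2))"
    by (simp add: ennreal_mult)
  also have "((1/\<beta>)^d)\<^sup>2 * ((2 * pi) ^ d * (L2_norm lborel g')\<^sup>2) = (2 * pi / \<beta>) ^ d * (L2_norm lborel g)\<^sup>2"
    unfolding norm_g' by (simp add: power_divide power2_eq_square)
  finally show ?thesis by (simp only: J_def d_def)
qed

lemma emeasure_half_open_cube:
  assumes \<beta>: "\<beta> > 0"
  shows "half_open_cube (0::real^'n::finite) \<beta> \<in> sets borel"
    and "emeasure lborel (half_open_cube (0::real^'n) \<beta>) = ennreal (\<beta> ^ CARD('n))"
proof -
  let ?T = "half_open_cube (0::real^'n) \<beta>" and ?u = "(\<chi> i. \<beta>) :: real^'n"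
  have "?T = (\<Inter>i. {x. 0 \<le> x $ i} \<inter> {x. x $ i < \<beta>})" by (auto simp: half_open_cube_def)
  also have "\<dots> \<in> sets borel"
    by (intro sets.countable_INT' sets.Int borel_closed borel_open closed_halfspace_component_ge_cart
        open_halfspace_component_lt_cart) (auto simp: countable_finite)
  finally show T: "?T \<in> sets borel" .
  have vol: "(\<Prod>b\<in>Basis. (?u - 0) \<bullet> b) = \<beta> ^ CARD('n)" by (simp add: prod_Basis_cart inner_axis)
  have nn: "\<And>b. b \<in> Basis \<Longrightarrow> (0::real^'n) \<bullet> b \<le> ?u \<bullet> b" using \<beta> by (auto simp: Basis_cart inner_axis)
  have "emeasure lborel (box 0 ?u) \<le> emeasure lborel ?T"
    using T by (intro emeasure_mono) (auto simp: half_open_cube_def mem_box_cart less_imp_le)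
  moreover have "emeasure lborel ?T \<le> emeasure lborel (cbox 0 ?u)"
    by (intro emeasure_mono) (auto simp: half_open_cube_def mem_box_cart less_imp_le)
  moreover have "emeasure lborel (box 0 ?u) = ennreal (\<beta> ^ CARD('n))"
    using nn by (subst emeasure_lborel_box) (auto simp: vol[simplified])
  moreover have "emeasure lborel (cbox 0 ?u) = ennreal (\<beta> ^ CARD('n))"
    using nn by (subst emeasure_lborel_cbox) (auto simp: vol[simplified])
  ultimately show "emeasure lborel ?T = ennreal (\<beta> ^ CARD('n))" by simp
qed

text \<open>
  Each point lies in exactly one translate of the half-open cube.
\<close>

lemma nn_integral_tiling:
  fixes f :: "real^'n::finite \<Rightarrow> ennreal"
  assumes f [measurable]: "f \<in> borel_measurable borel" and \<beta>: "\<beta> > 0"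
  shows "(\<integral>\<^sup>+x. f x \<partial>lborel)
    = (\<integral>\<^sup>+j. \<integral>\<^sup>+\<theta>. f (\<theta> + \<beta> *\<^sub>R int_vec j) * indicator (half_open_cube 0 \<beta>) \<theta> \<partial>lborel \<partial>count_space UNIV)"
proof -
  let ?T = "half_open_cube (0::real^'n) \<beta>"
  have T [measurable]: "?T \<in> sets borel" by (rule emeasure_half_open_cube(1)[OF \<beta>])
  have one: "(\<integral>\<^sup>+j. indicator ?T (x - \<beta> *\<^sub>R int_vec j) \<partial>count_space UNIV) = 1" for x :: "real^'n"
  proof -
    define j0 :: "int^'n" where "j0 = (\<chi> i. \<lfloor>x $ i / \<beta>\<rfloor>)"
    have mem: "x - \<beta> *\<^sub>R int_vec j \<in> ?T \<longleftrightarrow> j = j0" for j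
    proof -
      have "x - \<beta> *\<^sub>R int_vec j \<in> ?T \<longleftrightarrow> (\<forall>i. \<lfloor>x $ i / \<beta>\<rfloor> = j $ i)"
        using \<beta> by (simp add: half_open_cube_def int_vec_def floor_eq_iff field_simps)
      then show ?thesis by (auto simp: j0_def vec_eq_iff)
    qed
    have "(\<integral>\<^sup>+j. indicator ?T (x - \<beta> *\<^sub>R int_vec j) \<partial>count_space UNIV)
        = (\<Sum>j\<in>{j0}. indicator ?T (x - \<beta> *\<^sub>R int_vec j) :: ennreal)"
      by (rule nn_integral_count_space') (auto simp: indicator_def mem)
    then show ?thesis by (simp add: mem)
  qed
  have "(\<integral>\<^sup>+x. f x \<partial>lborel) = (\<integral>\<^sup>+x. (\<integral>\<^sup>+j. f x * indicator ?T (x - \<beta> *\<^sub>R int_vec j) \<partial>count_space UNIV) \<partial>lborel)"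
    by (simp add: nn_integral_cmult one)
  also have "\<dots> = (\<integral>\<^sup>+j. (\<integral>\<^sup>+x. f x * indicator ?T (x - \<beta> *\<^sub>R int_vec j) \<partial>lborel) \<partial>count_space UNIV)"
    by (rule nn_integral_count_space_nn_integral) auto
  also have "\<dots> = (\<integral>\<^sup>+j. \<integral>\<^sup>+\<theta>. f (\<theta> + \<beta> *\<^sub>R int_vec j) * indicator ?T \<theta> \<partial>lborel \<partial>count_space UNIV)"
  proof (rule nn_integral_cong)
    fix j :: "int^'n"
    show "(\<integral>\<^sup>+x. f x * indicator ?T (x - \<beta> *\<^sub>R int_vec j) \<partial>lborel)
        = (\<integral>\<^sup>+\<theta>. f (\<theta> + \<beta> *\<^sub>R int_vec j) * indicator ?T \<theta> \<partial>lborel)"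
      by (subst nn_integral_lborel_affine[where s=1 and c="\<beta> *\<^sub>R int_vec j"]) (auto simp: add.commute)
  qed
  finally show ?thesis .
qed


section \<open>The Plancherel theorem\<close>

text \<open>
  Norms of \<open>u + v\<close> and \<open>u + \<i> v\<close> determine the real and the imaginary part of the inner product.
\<close>

lemma L2_polarize:
  assumes u: "u \<in> L2_space M" and v: "v \<in> L2_space M" and U: "U \<in> L2_space N" and V: "V \<in> L2_space N"
    and "(L2_norm N U)\<^sup>2 = c * (L2_norm M u)\<^sup>2" "(L2_norm N V)\<^sup>2 = c * (L2_norm M v)\<^sup>2"
    and "(L2_norm N (\<lambda>x. U x + V x))\<^sup>2 = c * (L2_norm M (\<lambda>x. u x + v x))\<^sup>2"
    and "(L2_norm N (\<lambda>x. U x + \<i> * V x))\<^sup>2 = c * (L2_norm M (\<lambda>x. u x + \<i> * v x))\<^sup>2"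
  shows "L2_inner N U V = of_real c * L2_inner M u v"
proof (rule complex_eqI)
  have "2 * Re (L2_inner N U V) = 2 * (c * Re (L2_inner M u v))"
    using assms(5-7) unfolding L2_norm_add_sq[OF u v] L2_norm_add_sq[OF U V]
    by (simp add: algebra_simps)
  then show "Re (L2_inner N U V) = Re (of_real c * L2_inner M u v)" by simp
  have "2 * Im (L2_inner N U V) = 2 * (c * Im (L2_inner M u v))"
    using assms(5,6,8) unfolding L2_norm_add_sq[OF u L2_space_scale[OF v]] L2_norm_add_sq[OF U L2_space_scale[OF V]]
    by (simp add: algebra_simps L2_inner_scale_right L2_norm_scale)
  then show "Im (L2_inner N U V) = Im (of_real c * L2_inner M u v)" by simp
qed

definition L2_compact :: "(real^'n::finite \<Rightarrow> complex) \<Rightarrow> bool" where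
  "L2_compact f \<longleftrightarrow> f \<in> L2_space lborel \<and> (\<exists>R. \<forall>t. R < norm t \<longrightarrow> f t = 0)"

lemma L2_compact_L2: "L2_compact f \<Longrightarrow> f \<in> L2_space lborel"
  by (simp add: L2_compact_def)

lemma L2_compact_add: "L2_compact f \<Longrightarrow> L2_compact g \<Longrightarrow> L2_compact (\<lambda>t. f t + g t)"
proof -
  assume f: "L2_compact f" and g: "L2_compact g"
  then obtain R R' where "\<And>t. R < norm t \<Longrightarrow> f t = 0" "\<And>t. R' < norm t \<Longrightarrow> g t = 0"
    by (auto simp: L2_compact_def)
  then have "\<forall>t. max R R' < norm t \<longrightarrow> f t + g t = 0" by simp
  then show ?thesis using f g unfolding L2_compact_def by (intro conjI exI[of _ "max R R'"]) auto
qed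

lemma L2_compact_scale: "L2_compact f \<Longrightarrow> L2_compact (\<lambda>t. c * f t)"
  by (auto simp: L2_compact_def)

lemma L2_compact_truncate:
  fixes f :: "real^'n::finite \<Rightarrow> complex"
  assumes f: "f \<in> L2_space lborel"
  shows "L2_compact (\<lambda>t. indicator (cball 0 R) t * f t)"
  unfolding L2_compact_def
proof (intro conjI exI[of _ R])
  show "(\<lambda>t. indicator (cball 0 R) t * f t) \<in> L2_space lborel"
  proof (rule L2_space_bound[OF f, of _ 1])
    have [measurable]: "f \<in> borel_measurable borel" "cball (0::real^'n) R \<in> sets borel"
      using L2_measurable[OF f] by auto
    show "(\<lambda>t. indicator (cball 0 R) t * f t) \<in> borel_measurable lborel" by measurable
  qed (simp add: indicator_def norm_mult)
qed (simp add: indicator_def)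

lemma L2_compact_integrable:
  fixes f :: "real^'n::finite \<Rightarrow> complex"
  assumes f: "L2_compact f" shows "integrable lborel f"
proof -
  obtain R where R: "\<And>t. R < norm t \<Longrightarrow> f t = 0" using f by (auto simp: L2_compact_def)
  have "(\<lambda>t::real^'n. indicator (cball 0 R) t :: complex) \<in> L2_space lborel"
  proof (rule L2_space_nn_integralI)
    have "(\<integral>\<^sup>+t. ennreal ((cmod (indicator (cball 0 R :: (real^'n) set) t))\<^sup>2) \<partial>lborel) = (\<integral>\<^sup>+t. indicator (cball 0 R :: (real^'n) set) t \<partial>lborel)"
      by (intro nn_integral_cong) (simp add: indicator_def)
    also have "\<dots> < \<infinity>" using emeasure_bounded_finite[OF bounded_cball[of "0::real^'n" R]] by simp
    finally show "(\<integral>\<^sup>+t. ennreal ((cmod (indicator (cball 0 R :: (real^'n) set) t))\<^sup>2) \<partial>lborel) < \<infinity>" .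
  qed (simp add: borel_measurable_indicator)
  from L2_inner_integrable[OF L2_compact_L2[OF f] this]
  have "integrable lborel (\<lambda>t. f t * cnj (indicator (cball 0 R) t))" .
  moreover have "f t * cnj (indicator (cball 0 R) t) = f t" for t
    using R[of t] by (auto simp: indicator_def)
  ultimately show ?thesis by simp
qed

lemma integrable_mult_exp:
  fixes f :: "real^'n::finite \<Rightarrow> complex"
  assumes f: "integrable lborel f"
  shows "integrable lborel (\<lambda>t. f t * exp (- \<i> * complex_of_real (t \<bullet> \<eta>)))"
proof (rule Bochner_Integration.integrable_bound[OF f])
  have [measurable]: "f \<in> borel_measurable borel" using f by auto
  show "(\<lambda>t. f t * exp (- \<i> * complex_of_real (t \<bullet> \<eta>))) \<in> borel_measurable lborel" by measurable
qed (simp add: norm_mult)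

lemma borel_measurable_fourier [measurable]:
  fixes f :: "real^'n::finite \<Rightarrow> complex"
  assumes [measurable]: "f \<in> borel_measurable borel"
  shows "fourier f \<in> borel_measurable borel"
  unfolding fourier_def[abs_def] by measurable

lemma fourier_add:
  assumes "integrable lborel f" "integrable lborel g"
  shows "fourier (\<lambda>t. f t + g t) = (\<lambda>\<eta>. fourier f \<eta> + fourier g \<eta>)"
proof
  fix \<eta>
  show "fourier (\<lambda>t. f t + g t) \<eta> = fourier f \<eta> + fourier g \<eta>"
    unfolding fourier_def distrib_right
    by (rule Bochner_Integration.integral_add) (intro integrable_mult_exp assms)+
qed

lemma fourier_scale: "fourier (\<lambda>t. c * f t) = (\<lambda>\<eta>. c * fourier f \<eta>)"
  by (rule ext) (simp add: fourier_def mult.assoc)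

text \<open>
  Parseval on a large cube, applied to \<open>f (t) e\<^sup>-\<^sup>i\<^sup>\<theta>\<^sup>t\<close>, evaluates the sum of \<open>|fourier f|\<^sup>2\<close> over
  each translate of the dual lattice; averaging over \<open>\<theta>\<close> in a period yields the integral.
\<close>

lemma Plancherel_nn_integral:
  fixes f :: "real^'n::finite \<Rightarrow> complex"
  assumes f: "L2_compact f"
  shows "(\<integral>\<^sup>+\<eta>. ennreal ((cmod (fourier f \<eta>))\<^sup>2) \<partial>lborel) = ennreal ((2 * pi) ^ CARD('n) * (L2_norm lborel f)\<^sup>2)"
proof -
  have fL: "f \<in> L2_space lborel" by (rule L2_compact_L2[OF f])
  have fm [measurable]: "f \<in> borel_measurable borel" using L2_measurable[OF fL] by simp
  obtain R0 where R0: "\<And>t. R0 < norm t \<Longrightarrow> f t = 0" using f by (auto simp: L2_compact_def)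
  define R where "R = \<bar>R0\<bar> + 1"
  have R: "R > 0" by (simp add: R_def)
  define \<beta> where "\<beta> = pi / R"
  have \<beta>: "\<beta> > 0" "pi / \<beta> = R" using R by (auto simp: \<beta>_def)
  let ?T = "half_open_cube (0::real^'n) \<beta>"
  have T [measurable]: "?T \<in> sets borel" by (rule emeasure_half_open_cube[OF \<beta>(1)])
  have inner_sum: "(\<integral>\<^sup>+j. ennreal ((cmod (fourier f (\<theta> + \<beta> *\<^sub>R int_vec j)))\<^sup>2) \<partial>count_space UNIV)
      = ennreal ((2 * pi / \<beta>) ^ CARD('n) * (L2_norm lborel f)\<^sup>2)" for \<theta>
  proof -
    define g where "g t = f t * exp (- \<i> * complex_of_real (t \<bullet> \<theta>))" for t
    have g: "g \<in> L2_space lborel"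
    proof (rule L2_space_bound[OF fL, of _ 1])
      show "g \<in> borel_measurable lborel" unfolding g_def[abs_def] by measurable
    qed (simp add: g_def norm_mult)
    have ng: "L2_norm lborel g = L2_norm lborel f" by (simp add: L2_norm_def g_def norm_mult)
    have eq: "fourier f (\<theta> + \<beta> *\<^sub>R int_vec j)
        = (LINT t|lborel. g t * exp (- \<i> * complex_of_real (\<beta> * (int_vec j \<bullet> t))))" for j
      unfolding fourier_def g_def mult.assoc mult_exp_exp
      by (simp add: inner_add_right inner_commute distrib_left)
    have bd: "\<bar>t $ i\<bar> < pi / \<beta>" if "g t \<noteq> 0" for t i
    proof -
      have "norm t \<le> R0" using that R0[of t] by (force simp: g_def)
      then show ?thesis using component_le_norm_cart[of t i] by (simp add: \<beta>(2) R_def)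
    qed
    show ?thesis unfolding eq ng[symmetric] by (rule cube_Parseval_scaled[OF g \<beta>(1)]) (rule bd)
  qed
  have "(\<integral>\<^sup>+\<eta>. ennreal ((cmod (fourier f \<eta>))\<^sup>2) \<partial>lborel)
      = (\<integral>\<^sup>+j. \<integral>\<^sup>+\<theta>. ennreal ((cmod (fourier f (\<theta> + \<beta> *\<^sub>R int_vec j)))\<^sup>2) * indicator ?T \<theta> \<partial>lborel \<partial>count_space UNIV)"
    by (rule nn_integral_tiling[OF _ \<beta>(1)]) measurable
  also have "\<dots> = (\<integral>\<^sup>+\<theta>. \<integral>\<^sup>+j. ennreal ((cmod (fourier f (\<theta> + \<beta> *\<^sub>R int_vec j)))\<^sup>2) * indicator ?T \<theta> \<partial>count_space UNIV \<partial>lborel)"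
    by (rule nn_integral_count_space_nn_integral[symmetric]) auto
  also have "\<dots> = (\<integral>\<^sup>+\<theta>. ennreal ((2 * pi / \<beta>) ^ CARD('n) * (L2_norm lborel f)\<^sup>2) * indicator ?T \<theta> \<partial>lborel)"
    by (simp add: nn_integral_multc inner_sum)
  also have "\<dots> = ennreal ((2 * pi / \<beta>) ^ CARD('n) * (L2_norm lborel f)\<^sup>2) * ennreal (\<beta> ^ CARD('n))"
    by (simp add: nn_integral_cmult_indicator emeasure_half_open_cube(2)[OF \<beta>(1)])
  also have "\<dots> = ennreal ((2 * pi) ^ CARD('n) * (L2_norm lborel f)\<^sup>2)"
    using \<beta>(1) by (simp add: ennreal_mult[symmetric] power_divide)
  finally show ?thesis .
qed

lemma fourier_L2:
  fixes f :: "real^'n::finite \<Rightarrow> complex"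
  assumes f: "L2_compact f" shows "fourier f \<in> L2_space lborel"
proof (rule L2_space_nn_integralI)
  have "f \<in> borel_measurable borel" using L2_measurable[OF L2_compact_L2[OF f]] by simp
  then show "fourier f \<in> borel_measurable lborel" by simp
qed (simp add: Plancherel_nn_integral[OF f])

lemma Plancherel:
  fixes f :: "real^'n::finite \<Rightarrow> complex"
  assumes f: "L2_compact f"
  shows "(L2_norm lborel (fourier f))\<^sup>2 = (2 * pi) ^ CARD('n) * (L2_norm lborel f)\<^sup>2"
  using Plancherel_nn_integral[OF f] unfolding L2_norm_nn_integral[OF fourier_L2[OF f]] by simp

lemma Plancherel_inner:
  fixes f g :: "real^'n::finite \<Rightarrow> complex"
  assumes f: "L2_compact f" and g: "L2_compact g"
  shows "L2_inner lborel (fourier f) (fourier g) = of_real ((2 * pi) ^ CARD('n)) * L2_inner lborel f g"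
proof (rule L2_polarize)
  note i = L2_compact_integrable[OF f] L2_compact_integrable[OF g] L2_compact_integrable[OF L2_compact_scale[OF g, of \<i>]]
  show "(L2_norm lborel (\<lambda>x. fourier f x + fourier g x))\<^sup>2 = (2 * pi) ^ CARD('n) * (L2_norm lborel (\<lambda>x. f x + g x))\<^sup>2"
    using Plancherel[OF L2_compact_add[OF f g]] by (simp add: fourier_add[OF i(1,2)])
  show "(L2_norm lborel (\<lambda>x. fourier f x + \<i> * fourier g x))\<^sup>2 = (2 * pi) ^ CARD('n) * (L2_norm lborel (\<lambda>x. f x + \<i> * g x))\<^sup>2"
    using Plancherel[OF L2_compact_add[OF f L2_compact_scale[OF g, of \<i>]]] by (simp add: fourier_add[OF i(1,3)] fourier_scale)
qed (use f g in \<open>auto intro: L2_compact_L2 fourier_L2 simp: Plancherel\<close>)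

text \<open>
  Fubini's theorem; the reflection comes from the complex conjugate in the inner product.
\<close>

lemma fourier_multiplication:
  fixes f \<Theta> :: "real^'n::finite \<Rightarrow> complex"
  assumes f: "integrable lborel f" and \<Theta>: "integrable lborel \<Theta>"
  shows "L2_inner lborel (fourier f) \<Theta> = L2_inner lborel f (\<lambda>t. fourier \<Theta> (- t))"
proof -
  have [measurable]: "f \<in> borel_measurable borel" "\<Theta> \<in> borel_measurable borel" using f \<Theta> by auto
  let ?k = "\<lambda>t \<eta>. f t * exp (- \<i> * complex_of_real (t \<bullet> \<eta>)) * cnj (\<Theta> \<eta>)"
  have nk: "cmod (?k t \<eta>) = cmod (f t) * cmod (\<Theta> \<eta>)" for t \<eta> by (simp add: norm_mult)
  have m: "(\<lambda>(t, \<eta>). ?k t \<eta>) \<in> borel_measurable (lborel \<Otimes>\<^sub>M lborel)" by measurable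
  have int: "integrable (lborel \<Otimes>\<^sub>M lborel) (\<lambda>(t, \<eta>). ?k t \<eta>)"
  proof (rule lborel_pair.Fubini_integrable[OF m])
    show "integrable lborel (\<lambda>t. LINT \<eta>|lborel. norm (case (t, \<eta>) of (t, \<eta>) \<Rightarrow> ?k t \<eta>))"
      unfolding case_prod_conv nk using f \<Theta> by simp
    show "AE t in lborel. integrable lborel (\<lambda>\<eta>. case (t, \<eta>) of (t, \<eta>) \<Rightarrow> ?k t \<eta>)"
    proof (rule AE_I2)
      fix t
      have "integrable lborel (\<lambda>\<eta>. norm (?k t \<eta>))" using \<Theta> by (simp only: nk) simp
      then show "integrable lborel (\<lambda>\<eta>. case (t, \<eta>) of (t, \<eta>) \<Rightarrow> ?k t \<eta>)"
        by (subst (asm) integrable_norm_iff) auto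
    qed
  qed
  have "L2_inner lborel (fourier f) \<Theta> = (LINT \<eta>|lborel. LINT t|lborel. ?k t \<eta>)"
    by (simp add: L2_inner_def fourier_def)
  also have "\<dots> = (LINT t|lborel. LINT \<eta>|lborel. ?k t \<eta>)"
    by (rule lborel_pair.Fubini_integral[OF int])
  also have "\<dots> = L2_inner lborel f (\<lambda>t. fourier \<Theta> (- t))"
    unfolding L2_inner_def
  proof (rule Bochner_Integration.integral_cong[OF refl])
    fix t
    have "cnj (fourier \<Theta> (- t)) = (LINT \<eta>|lborel. exp (- \<i> * complex_of_real (t \<bullet> \<eta>)) * cnj (\<Theta> \<eta>))"
      unfolding fourier_def Bochner_Integration.integral_cnj[symmetric]
      by (simp add: exp_cnj inner_commute mult.commute)
    then show "(LINT \<eta>|lborel. ?k t \<eta>) = f t * cnj (fourier \<Theta> (- t))"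
      by (simp add: mult.assoc)
  qed
  finally show ?thesis .
qed

text \<open>
  \<open>fourier_pair f F\<close> says that \<open>F\<close> represents the \<open>L\<^sup>2\<close> Fourier transform of \<open>f\<close>, for which the integral
  need not converge; it is characterised by duality with compactly supported functions.
\<close>

definition fourier_pair :: "(real^'n::finite \<Rightarrow> complex) \<Rightarrow> (real^'n \<Rightarrow> complex) \<Rightarrow> bool" where
  "fourier_pair f F \<longleftrightarrow> f \<in> L2_space lborel \<and> F \<in> L2_space lborel \<and>
     (\<forall>\<Theta>. L2_compact \<Theta> \<longrightarrow> L2_inner lborel F \<Theta> = L2_inner lborel f (\<lambda>t. fourier \<Theta> (- t)))"

lemma L2_space_reflect: "f \<in> L2_space lborel \<Longrightarrow> (\<lambda>t::real^'n::finite. f (- t)) \<in> L2_space lborel"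
  using L2_space_affine[of f "-1" 0] by simp

lemma fourier_pair_L2: "fourier_pair f F \<Longrightarrow> f \<in> L2_space lborel" "fourier_pair f F \<Longrightarrow> F \<in> L2_space lborel"
  by (auto simp: fourier_pair_def)

lemma fourier_pair_add:
  assumes "fourier_pair f F" "fourier_pair g G"
  shows "fourier_pair (\<lambda>t. f t + g t) (\<lambda>\<eta>. F \<eta> + G \<eta>)"
  using assms by (simp add: fourier_pair_def L2_inner_add_left L2_compact_L2 L2_space_reflect fourier_L2)

lemma fourier_pair_scale:
  assumes "fourier_pair f F" shows "fourier_pair (\<lambda>t. c * f t) (\<lambda>\<eta>. c * F \<eta>)"
  using assms by (simp add: fourier_pair_def L2_inner_scale_left)

lemma fourier_pair_integrable:
  assumes "f \<in> L2_space lborel" "integrable lborel f" "fourier f \<in> L2_space lborel"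
  shows "fourier_pair f (fourier f)"
  using assms by (simp add: fourier_pair_def fourier_multiplication L2_compact_integrable)

text \<open>
  Truncations of the difference \<open>F - G\<close> are admissible test functions.
\<close>

lemma fourier_pair_unique:
  fixes f :: "real^'n::finite \<Rightarrow> complex"
  assumes F: "fourier_pair f F" and G: "fourier_pair f G"
  shows "L2_eq lborel F G"
proof -
  let ?D = "\<lambda>t. F t - G t"
  have D: "?D \<in> L2_space lborel" using fourier_pair_L2[OF F] fourier_pair_L2[OF G] by simp
  have [measurable]: "F \<in> borel_measurable borel" "G \<in> borel_measurable borel"
    using L2_measurable[OF fourier_pair_L2(2)[OF F]] L2_measurable[OF fourier_pair_L2(2)[OF G]] by auto
  have "AE t in lborel. norm t \<le> real n \<longrightarrow> F t = G t" for n
  proof -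
    let ?\<Theta> = "\<lambda>t. indicator (cball 0 (real n)) t * ?D t"
    have \<Theta>: "L2_compact ?\<Theta>" by (rule L2_compact_truncate[OF D])
    have "L2_inner lborel ?D ?\<Theta> = 0"
      using F G \<Theta> by (simp add: fourier_pair_def L2_inner_diff_left L2_compact_L2)
    moreover have "L2_inner lborel ?D ?\<Theta> = L2_inner lborel ?\<Theta> ?\<Theta>"
      unfolding L2_inner_def by (intro Bochner_Integration.integral_cong) (auto simp: indicator_def)
    ultimately have "L2_norm lborel ?\<Theta> = 0" by (simp add: L2_inner_self)
    then have "L2_eq lborel ?\<Theta> (\<lambda>t. 0)"
      using L2_eq_iff_norm[OF L2_compact_L2[OF \<Theta>] L2_space_zero] by simp
    then show ?thesis
      unfolding L2_eq_def by (rule AE_mp) (auto simp: indicator_def)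
  qed
  then have "AE t in lborel. \<forall>n. norm t \<le> real n \<longrightarrow> F t = G t" by (subst AE_all_countable) auto
  then show ?thesis
    unfolding L2_eq_def
  proof (rule AE_mp, intro AE_I2 impI)
    fix t assume a: "\<forall>n. norm t \<le> real n \<longrightarrow> F t = G t"
    obtain n where "norm t \<le> real n" using real_arch_simple by blast
    then show "F t = G t" using a by blast
  qed
qed

lemma L2_truncate_tendsto:
  fixes f :: "real^'n::finite \<Rightarrow> complex"
  assumes f: "f \<in> L2_space lborel"
  shows "(\<lambda>n. L2_norm lborel (\<lambda>t. indicator (cball 0 (real n)) t * f t - f t)) \<longlonglongrightarrow> 0"
proof -
  have [measurable]: "f \<in> borel_measurable borel" using L2_measurable[OF f] by simp
  have "(\<lambda>n. LINT t|lborel. (cmod (indicator (cball 0 (real n)) t * f t - f t))\<^sup>2) \<longlonglongrightarrow> (LINT t|(lborel::(real^'n) measure). 0)"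
  proof (rule integral_dominated_convergence)
    show "integrable lborel (\<lambda>t. (cmod (f t))\<^sup>2)" by (rule L2_integrable_square[OF f])
    show "AE t in lborel. (\<lambda>n. (cmod (indicator (cball 0 (real n)) t * f t - f t))\<^sup>2) \<longlonglongrightarrow> 0"
    proof (rule AE_I2)
      fix t :: "real^'n"
      obtain N where N: "norm t \<le> real N" using real_arch_simple by blast
      have "\<forall>\<^sub>F n in sequentially. (cmod (indicator (cball 0 (real n)) t * f t - f t))\<^sup>2 = 0"
        using eventually_ge_at_top[of N]
      proof eventually_elim
        case (elim n)
        then have "norm t \<le> real n" using N by linarith
        then show ?case by simp
      qed
      then show "(\<lambda>n. (cmod (indicator (cball 0 (real n)) t * f t - f t))\<^sup>2) \<longlonglongrightarrow> 0" by (rule tendsto_eventually)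
    qed
  qed (auto simp: indicator_def)
  then have "(\<lambda>n. sqrt (LINT t|lborel. (cmod (indicator (cball 0 (real n)) t * f t - f t))\<^sup>2)) \<longlonglongrightarrow> sqrt 0"
    by (intro tendsto_real_sqrt) simp
  then show ?thesis by (simp add: L2_norm_def)
qed

text \<open>
  The transforms of the truncations of \<open>f\<close> form a Cauchy sequence by Plancherel.
\<close>

lemma fourier_pair_ex:
  fixes f :: "real^'n::finite \<Rightarrow> complex"
  assumes f: "f \<in> L2_space lborel"
  shows "\<exists>F. fourier_pair f F \<and> (L2_norm lborel F)\<^sup>2 = (2 * pi) ^ CARD('n) * (L2_norm lborel f)\<^sup>2"
proof -
  define f' where "f' n t = indicator (cball 0 (real n)) t * f t" for n t
  have f': "L2_compact (f' n)" for n unfolding f'_def[abs_def] by (rule L2_compact_truncate[OF f])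
  note f'L = L2_compact_L2[OF f'] and f'i = L2_compact_integrable[OF f']
  have lim: "(\<lambda>n. L2_norm lborel (\<lambda>t. f' n t - f t)) \<longlonglongrightarrow> 0"
    unfolding f'_def by (rule L2_truncate_tendsto[OF f])
  define c where "c = sqrt ((2 * pi) ^ CARD('n))"
  have c: "c > 0" "c\<^sup>2 = (2 * pi) ^ CARD('n)" by (auto simp: c_def)
  have dn: "L2_norm lborel (\<lambda>\<eta>. fourier (f' m) \<eta> - fourier (f' n) \<eta>) = c * L2_norm lborel (\<lambda>t. f' m t - f' n t)" for m n
  proof -
    have e: "(\<lambda>\<eta>. fourier (f' m) \<eta> - fourier (f' n) \<eta>) = fourier (\<lambda>t. f' m t + (-1) * f' n t)"
      using fourier_add[OF f'i[of m] integrable_mult_right[OF f'i[of n], of "-1"]] fourier_scale[of "-1" "f' n"]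
      by simp
    have "(L2_norm lborel (\<lambda>\<eta>. fourier (f' m) \<eta> - fourier (f' n) \<eta>))\<^sup>2
        = c\<^sup>2 * (L2_norm lborel (\<lambda>t. f' m t + (-1) * f' n t))\<^sup>2"
      unfolding e c(2) by (rule Plancherel[OF L2_compact_add[OF f' L2_compact_scale[OF f']]])
    then have "(L2_norm lborel (\<lambda>\<eta>. fourier (f' m) \<eta> - fourier (f' n) \<eta>))\<^sup>2
        = (c * L2_norm lborel (\<lambda>t. f' m t - f' n t))\<^sup>2" by (simp add: power_mult_distrib)
    then show ?thesis using c(1) by (intro power2_eq_imp_eq[of _ "c * _"]) auto
  qed
  have cau: "\<exists>N. \<forall>m\<ge>N. \<forall>n\<ge>N. L2_norm lborel (\<lambda>\<eta>. fourier (f' m) \<eta> - fourier (f' n) \<eta>) < e" if "e > 0" for e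
  proof -
    have "e / (2 * c) > 0" using that c by simp
    then obtain N where N: "\<And>n. n \<ge> N \<Longrightarrow> L2_norm lborel (\<lambda>t. f' n t - f t) < e / (2 * c)"
      using LIMSEQ_D[OF lim, of "e / (2 * c)"] by auto
    have "L2_norm lborel (\<lambda>\<eta>. fourier (f' m) \<eta> - fourier (f' n) \<eta>) < e" if "m \<ge> N" "n \<ge> N" for m n
    proof -
      have "L2_norm lborel (\<lambda>t. f' m t - f' n t) \<le> L2_norm lborel (\<lambda>t. f' m t - f t) + L2_norm lborel (\<lambda>t. f t - f' n t)"
        by (rule L2_norm_diff_triangle[OF f'L f f'L])
      also have "L2_norm lborel (\<lambda>t. f t - f' n t) = L2_norm lborel (\<lambda>t. f' n t - f t)"
        by (rule L2_norm_minus_commute)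
      finally have "L2_norm lborel (\<lambda>t. f' m t - f' n t) < e / (2 * c) + e / (2 * c)"
        using N[OF that(1)] N[OF that(2)] by linarith
      also have "\<dots> = e / c" using c(1) by (simp add: field_simps)
      finally have "L2_norm lborel (\<lambda>t. f' m t - f' n t) < e / c" .
      then show ?thesis unfolding dn using c(1) by (simp add: field_simps)
    qed
    then show ?thesis by (intro exI[of _ N]) simp
  qed
  obtain F where F: "F \<in> L2_space lborel" "(\<lambda>n. L2_norm lborel (\<lambda>\<eta>. fourier (f' n) \<eta> - F \<eta>)) \<longlonglongrightarrow> 0"
    by (rule L2_complete[of "\<lambda>n. fourier (f' n)" lborel, OF fourier_L2[OF f'] cau])
  have "L2_inner lborel F \<Theta> = L2_inner lborel f (\<lambda>t. fourier \<Theta> (- t))" if \<Theta>: "L2_compact \<Theta>" for \<Theta>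
  proof -
    have "(\<lambda>n. L2_inner lborel (fourier (f' n)) \<Theta>) \<longlonglongrightarrow> L2_inner lborel F \<Theta>"
      by (rule L2_inner_tendsto[OF fourier_L2[OF f'] F(1) L2_compact_L2[OF \<Theta>] F(2)])
    moreover have "(\<lambda>n. L2_inner lborel (f' n) (\<lambda>t. fourier \<Theta> (- t))) \<longlonglongrightarrow> L2_inner lborel f (\<lambda>t. fourier \<Theta> (- t))"
      by (rule L2_inner_tendsto[OF f'L f L2_space_reflect[OF fourier_L2[OF \<Theta>]] lim])
    moreover have "L2_inner lborel (fourier (f' n)) \<Theta> = L2_inner lborel (f' n) (\<lambda>t. fourier \<Theta> (- t))" for n
      by (rule fourier_multiplication[OF f'i L2_compact_integrable[OF \<Theta>]])
    ultimately show ?thesis using LIMSEQ_unique by simp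
  qed
  then have "fourier_pair f F" using f F by (simp add: fourier_pair_def)
  moreover have "(L2_norm lborel F)\<^sup>2 = (2 * pi) ^ CARD('n) * (L2_norm lborel f)\<^sup>2"
  proof -
    have A: "(\<lambda>n. (L2_norm lborel (fourier (f' n)))\<^sup>2) \<longlonglongrightarrow> (L2_norm lborel F)\<^sup>2"
      by (intro tendsto_power L2_norm_tendsto fourier_L2 f' F)
    have B: "(\<lambda>n. (2 * pi) ^ CARD('n) * (L2_norm lborel (f' n))\<^sup>2) \<longlonglongrightarrow> (2 * pi) ^ CARD('n) * (L2_norm lborel f)\<^sup>2"
      by (intro tendsto_mult tendsto_const tendsto_power L2_norm_tendsto f'L f lim)
    show ?thesis by (rule LIMSEQ_unique[OF A[unfolded Plancherel[OF f']] B])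
  qed
  ultimately show ?thesis by blast
qed

lemma fourier_pair_norm:
  fixes f :: "real^'n::finite \<Rightarrow> complex"
  assumes fF: "fourier_pair f F"
  shows "(L2_norm lborel F)\<^sup>2 = (2 * pi) ^ CARD('n) * (L2_norm lborel f)\<^sup>2"
proof -
  obtain G where G: "fourier_pair f G" "(L2_norm lborel G)\<^sup>2 = (2 * pi) ^ CARD('n) * (L2_norm lborel f)\<^sup>2"
    using fourier_pair_ex[OF fourier_pair_L2(1)[OF fF]] by blast
  have "L2_norm lborel F = L2_norm lborel G"
    by (intro L2_norm_cong fourier_pair_unique[OF fF G(1)] fourier_pair_L2(2)[OF fF] fourier_pair_L2(2)[OF G(1)])
  then show ?thesis using G(2) by simp
qed

lemma fourier_pair_inner:
  fixes f g :: "real^'n::finite \<Rightarrow> complex"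
  assumes f: "fourier_pair f F" and g: "fourier_pair g G"
  shows "L2_inner lborel F G = of_real ((2 * pi) ^ CARD('n)) * L2_inner lborel f g"
  by (intro L2_polarize fourier_pair_norm fourier_pair_add fourier_pair_scale fourier_pair_L2(1)[OF f]
      fourier_pair_L2(2)[OF f] fourier_pair_L2(1)[OF g] fourier_pair_L2(2)[OF g] f g)

text \<open>
  The duality that defines a pair becomes Plancherel's identity after a reflection.
\<close>

lemma fourier_pair_inverse:
  fixes \<Theta> :: "real^'n::finite \<Rightarrow> complex"
  assumes \<Theta>: "L2_compact \<Theta>"
  shows "fourier_pair (\<lambda>t. of_real (1 / (2 * pi) ^ CARD('n)) * fourier \<Theta> (- t)) \<Theta>"
  unfolding fourier_pair_def
proof (intro conjI allI impI)
  show "(\<lambda>t. of_real (1 / (2 * pi) ^ CARD('n)) * fourier \<Theta> (- t)) \<in> L2_space lborel"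
    by (intro L2_space_scale L2_space_reflect fourier_L2 \<Theta>)
  show "\<Theta> \<in> L2_space lborel" by (rule L2_compact_L2[OF \<Theta>])
  fix \<Psi> :: "real^'n \<Rightarrow> complex" assume \<Psi>: "L2_compact \<Psi>"
  have [measurable]: "\<Theta> \<in> borel_measurable borel" "\<Psi> \<in> borel_measurable borel"
    using L2_measurable[OF L2_compact_L2[OF \<Theta>]] L2_measurable[OF L2_compact_L2[OF \<Psi>]] by auto
  have "L2_inner lborel (\<lambda>t. fourier \<Theta> (- t)) (\<lambda>t. fourier \<Psi> (- t)) = L2_inner lborel (fourier \<Theta>) (fourier \<Psi>)"
    unfolding L2_inner_def
    by (subst (2) lborel_integral_affine[where s="-1" and c=0]) auto
  then show "L2_inner lborel \<Theta> \<Psi>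
      = L2_inner lborel (\<lambda>t. of_real (1 / (2 * pi) ^ CARD('n)) * fourier \<Theta> (- t)) (\<lambda>t. fourier \<Psi> (- t))"
    unfolding L2_inner_scale_left Plancherel_inner[OF \<Theta> \<Psi>] by simp
qed


section \<open>Families of functions with uniformly bounded derivatives\<close>

text \<open>
  The bounds are uniform over the index set, so that one constant serves all pairs of lattice points. The derivative
  is existentially quantified, so that closure under algebraic operations is proved by exhibiting the derivative from
  the usual rules; the sets \<open>U i\<close> are meant to be open.
\<close>

fun deriv_bounded :: "nat \<Rightarrow> 'i set \<Rightarrow> ('i \<Rightarrow> real set) \<Rightarrow> ('i \<Rightarrow> real \<Rightarrow> complex) \<Rightarrow> bool" where
  "deriv_bounded 0 I U f \<longleftrightarrow> (\<exists>K. \<forall>i\<in>I. \<forall>t\<in>U i. cmod (f i t) \<le> K)"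
| "deriv_bounded (Suc n) I U f \<longleftrightarrow> (\<exists>K. \<forall>i\<in>I. \<forall>t\<in>U i. cmod (f i t) \<le> K) \<and>
     (\<exists>f'. (\<forall>i\<in>I. \<forall>t\<in>U i. (f i has_vector_derivative f' i t) (at t)) \<and> deriv_bounded n I U f')"

lemma deriv_bounded_bound:
  assumes "deriv_bounded n I U f"
  shows "\<exists>K\<ge>0. \<forall>i\<in>I. \<forall>t\<in>U i. cmod (f i t) \<le> K"
proof -
  obtain K where K: "\<forall>i\<in>I. \<forall>t\<in>U i. cmod (f i t) \<le> K"
    using assms by (cases n) auto
  show ?thesis
  proof (intro exI[of _ "\<bar>K\<bar>"] conjI ballI)
    fix i t assume "i \<in> I" "t \<in> U i"
    then have "cmod (f i t) \<le> K" using K by blast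
    then show "cmod (f i t) \<le> \<bar>K\<bar>" by simp
  qed simp
qed

lemma deriv_bounded_deriv:
  assumes "deriv_bounded (Suc n) I U f"
  shows "\<exists>f'. (\<forall>i\<in>I. \<forall>t\<in>U i. (f i has_vector_derivative f' i t) (at t)) \<and> deriv_bounded n I U f'"
  using assms by simp

lemma deriv_bounded_SucI:
  assumes "\<And>i t. i \<in> I \<Longrightarrow> t \<in> U i \<Longrightarrow> cmod (f i t) \<le> K"
    "\<And>i t. i \<in> I \<Longrightarrow> t \<in> U i \<Longrightarrow> (f i has_vector_derivative f' i t) (at t)"
    "deriv_bounded n I U f'"
  shows "deriv_bounded (Suc n) I U f"
  unfolding deriv_bounded.simps
  by (intro conjI exI[of _ K] exI[of _ f'] ballI assms)

lemma deriv_bounded_Suc_imp: "deriv_bounded (Suc n) I U f \<Longrightarrow> deriv_bounded n I U f"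
proof (induction n arbitrary: f)
  case (Suc n)
  obtain f' where "\<forall>i\<in>I. \<forall>t\<in>U i. (f i has_vector_derivative f' i t) (at t)"
    "deriv_bounded (Suc n) I U f'"
    using deriv_bounded_deriv[OF Suc.prems] by blast
  note f' = this(1)[rule_format] this(2)
  obtain K where "\<forall>i\<in>I. \<forall>t\<in>U i. cmod (f i t) \<le> K"
    using deriv_bounded_bound[OF Suc.prems] by blast
  note K = this[rule_format]
  then show ?case using f'(1) Suc.IH[OF f'(2)] by (rule deriv_bounded_SucI)
qed auto

lemma deriv_bounded_cong:
  assumes U: "\<And>i. i \<in> I \<Longrightarrow> open (U i)" and eq: "\<And>i t. i \<in> I \<Longrightarrow> t \<in> U i \<Longrightarrow> f i t = g i t"
    and f: "deriv_bounded n I U f"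
  shows "deriv_bounded n I U g"
proof (cases n)
  case 0
  then show ?thesis using f eq by auto
next
  case (Suc m)
  obtain f' where "\<forall>i\<in>I. \<forall>t\<in>U i. (f i has_vector_derivative f' i t) (at t)"
    "deriv_bounded m I U f'"
    using deriv_bounded_deriv[OF f[unfolded Suc]] by blast
  note f' = this(1)[rule_format] this(2)
  obtain K where "\<forall>i\<in>I. \<forall>t\<in>U i. cmod (f i t) \<le> K"
    using deriv_bounded_bound[OF f] by blast
  note K = this[rule_format]
  have "deriv_bounded (Suc m) I U g"
  proof (rule deriv_bounded_SucI[OF _ _ f'(2)])
    fix i t assume it: "i \<in> I" "t \<in> U i"
    show "cmod (g i t) \<le> K" using K[OF it] eq[OF it] by simp
    show "(g i has_vector_derivative f' i t) (at t)"
      using has_vector_derivative_transform_within_open[OF f'(1)[OF it] U[OF it(1)] it(2)] eq[OF it(1)] by simp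
  qed
  then show ?thesis by (simp only: Suc)
qed

lemma deriv_bounded_reindex:
  "deriv_bounded n I U f \<Longrightarrow> (\<And>j. j \<in> J \<Longrightarrow> h j \<in> I \<and> V j \<subseteq> U (h j)) \<Longrightarrow>
    deriv_bounded n J V (\<lambda>j. f (h j))"
proof (induction n arbitrary: f)
  case 0
  obtain K where K: "\<forall>i\<in>I. \<forall>t\<in>U i. cmod (f i t) \<le> K"
    using deriv_bounded_bound[OF 0(1)] by blast
  show ?case unfolding deriv_bounded.simps by (intro exI[of _ K] ballI) (use K 0(2) in blast)
next
  case (Suc n)
  obtain f' where "\<forall>i\<in>I. \<forall>t\<in>U i. (f i has_vector_derivative f' i t) (at t)"
    "deriv_bounded n I U f'"
    using deriv_bounded_deriv[OF Suc.prems(1)] by blast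
  note f' = this(1)[rule_format] this(2)
  obtain K where "\<forall>i\<in>I. \<forall>t\<in>U i. cmod (f i t) \<le> K"
    using deriv_bounded_bound[OF Suc.prems(1)] by blast
  note K = this[rule_format]
  show ?case
    by (rule deriv_bounded_SucI[OF _ _ Suc.IH[OF f'(2) Suc.prems(2)], where K=K])
      (use K f'(1) Suc.prems(2) in blast)+
qed

lemma deriv_bounded_const:
  "(\<And>i. i \<in> I \<Longrightarrow> cmod (c i) \<le> K) \<Longrightarrow> deriv_bounded n I U (\<lambda>i t. c i)"
proof (induction n arbitrary: c K)
  case (Suc n)
  have "deriv_bounded n I U (\<lambda>i t. 0)" by (rule Suc.IH[of "\<lambda>_. 0" 0]) simp
  then show ?case
    by (intro deriv_bounded_SucI[where f'="\<lambda>_ _. 0" and K=K]) (auto intro: Suc.prems)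
qed auto

lemma deriv_bounded_add:
  "deriv_bounded n I U f \<Longrightarrow> deriv_bounded n I U g \<Longrightarrow> deriv_bounded n I U (\<lambda>i t. f i t + g i t)"
proof (induction n arbitrary: f g)
  case 0
  obtain K L where "\<forall>i\<in>I. \<forall>t\<in>U i. cmod (f i t) \<le> K" "\<forall>i\<in>I. \<forall>t\<in>U i. cmod (g i t) \<le> L"
    using deriv_bounded_bound[OF 0(1)] deriv_bounded_bound[OF 0(2)] by blast
  then show ?case by (auto intro!: exI[of _ "K + L"] order_trans[OF norm_triangle_ineq] add_mono)
next
  case (Suc n)
  obtain f' where "\<forall>i\<in>I. \<forall>t\<in>U i. (f i has_vector_derivative f' i t) (at t)"
    "deriv_bounded n I U f'"
    using deriv_bounded_deriv[OF Suc.prems(1)] by blast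
  note f' = this(1)[rule_format] this(2)
  obtain g' where "\<forall>i\<in>I. \<forall>t\<in>U i. (g i has_vector_derivative g' i t) (at t)"
    "deriv_bounded n I U g'"
    using deriv_bounded_deriv[OF Suc.prems(2)] by blast
  note g' = this(1)[rule_format] this(2)
  obtain K where "\<forall>i\<in>I. \<forall>t\<in>U i. cmod (f i t) \<le> K"
    using deriv_bounded_bound[OF Suc.prems(1)] by blast
  note K = this[rule_format]
  obtain L where "\<forall>i\<in>I. \<forall>t\<in>U i. cmod (g i t) \<le> L"
    using deriv_bounded_bound[OF Suc.prems(2)] by blast
  note L = this[rule_format]
  show ?case
  proof (rule deriv_bounded_SucI[OF _ _ Suc.IH[OF f'(2) g'(2)], where K="K + L"])
    fix i t assume it: "i \<in> I" "t \<in> U i"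
    show "cmod (f i t + g i t) \<le> K + L" by (rule norm_triangle_le) (intro add_mono K L it)
    show "((\<lambda>t. f i t + g i t) has_vector_derivative f' i t + g' i t) (at t)"
      by (intro has_vector_derivative_add f' g' it)
  qed
qed

lemma deriv_bounded_mult:
  "deriv_bounded n I U f \<Longrightarrow> deriv_bounded n I U g \<Longrightarrow> deriv_bounded n I U (\<lambda>i t. f i t * g i t)"
proof (induction n arbitrary: f g)
  case 0
  obtain K where "0 \<le> K" "\<forall>i\<in>I. \<forall>t\<in>U i. cmod (f i t) \<le> K"
    using deriv_bounded_bound[OF 0(1)] by blast
  note K = this(1) this(2)[rule_format]
  obtain L where "0 \<le> L" "\<forall>i\<in>I. \<forall>t\<in>U i. cmod (g i t) \<le> L"
    using deriv_bounded_bound[OF 0(2)] by blast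
  note L = this(1) this(2)[rule_format]
  show ?case using K L by (auto simp: norm_mult intro!: exI[of _ "K * L"] mult_mono)
next
  case (Suc n)
  obtain f' where "\<forall>i\<in>I. \<forall>t\<in>U i. (f i has_vector_derivative f' i t) (at t)"
    "deriv_bounded n I U f'"
    using deriv_bounded_deriv[OF Suc.prems(1)] by blast
  note f' = this(1)[rule_format] this(2)
  obtain g' where "\<forall>i\<in>I. \<forall>t\<in>U i. (g i has_vector_derivative g' i t) (at t)"
    "deriv_bounded n I U g'"
    using deriv_bounded_deriv[OF Suc.prems(2)] by blast
  note g' = this(1)[rule_format] this(2)
  obtain K where "0 \<le> K" "\<forall>i\<in>I. \<forall>t\<in>U i. cmod (f i t) \<le> K"
    using deriv_bounded_bound[OF Suc.prems(1)] by blast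
  note K = this(1) this(2)[rule_format]
  obtain L where "0 \<le> L" "\<forall>i\<in>I. \<forall>t\<in>U i. cmod (g i t) \<le> L"
    using deriv_bounded_bound[OF Suc.prems(2)] by blast
  note L = this(1) this(2)[rule_format]
  have "deriv_bounded n I U (\<lambda>i t. f i t * g' i t + f' i t * g i t)"
    by (rule deriv_bounded_add[OF Suc.IH[OF deriv_bounded_Suc_imp[OF Suc.prems(1)] g'(2)]
          Suc.IH[OF f'(2) deriv_bounded_Suc_imp[OF Suc.prems(2)]]])
  then show ?case
  proof (rule deriv_bounded_SucI[rotated 2, where K="K * L"])
    fix i t assume it: "i \<in> I" "t \<in> U i"
    show "cmod (f i t * g i t) \<le> K * L"
      unfolding norm_mult by (intro mult_mono K L it norm_ge_zero)
    show "((\<lambda>t. f i t * g i t) has_vector_derivative f i t * g' i t + f' i t * g i t) (at t)"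
      by (intro has_vector_derivative_mult f' g' it)
  qed
qed

lemma deriv_bounded_power: "deriv_bounded n I U f \<Longrightarrow> deriv_bounded n I U (\<lambda>i t. f i t ^ p)"
  by (induction p) (auto intro!: deriv_bounded_const[where K=1] deriv_bounded_mult)

lemma deriv_bounded_cnj:
  "deriv_bounded n I U f \<Longrightarrow> deriv_bounded n I U (\<lambda>i t. cnj (f i t))"
proof (induction n arbitrary: f)
  case (Suc n)
  obtain f' where "\<forall>i\<in>I. \<forall>t\<in>U i. (f i has_vector_derivative f' i t) (at t)"
    "deriv_bounded n I U f'"
    using deriv_bounded_deriv[OF Suc.prems(1)] by blast
  note f' = this(1)[rule_format] this(2)
  obtain K where "\<forall>i\<in>I. \<forall>t\<in>U i. cmod (f i t) \<le> K"
    using deriv_bounded_bound[OF Suc.prems(1)] by blast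
  note K = this[rule_format]
  show ?case
    by (rule deriv_bounded_SucI[OF _ _ Suc.IH[OF f'(2)], where K=K])
      (simp_all add: K f'(1) has_vector_derivative_cnj)
qed auto

lemma deriv_bounded_inverse:
  assumes c: "c > 0" "\<And>i t. i \<in> I \<Longrightarrow> t \<in> U i \<Longrightarrow> c \<le> cmod (f i t)"
  shows "deriv_bounded n I U f \<Longrightarrow> deriv_bounded n I U (\<lambda>i t. inverse (f i t))"
proof (induction n)
  case 0
  show ?case using c(1) by (auto simp: norm_inverse intro!: exI[of _ "inverse c"] le_imp_inverse_le c(2))
next
  case (Suc n)
  obtain f' where "\<forall>i\<in>I. \<forall>t\<in>U i. (f i has_vector_derivative f' i t) (at t)"
    "deriv_bounded n I U f'"
    using deriv_bounded_deriv[OF Suc.prems(1)] by blast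
  note f' = this(1)[rule_format] this(2)
  note IH = Suc.IH[OF deriv_bounded_Suc_imp[OF Suc.prems]]
  have "deriv_bounded n I U (\<lambda>i t. (- 1) * (inverse (f i t) * f' i t * inverse (f i t)))"
    by (intro deriv_bounded_mult IH f' deriv_bounded_const[where K=1]) simp
  then show ?case
  proof (rule deriv_bounded_SucI[rotated 2, where K="inverse c"])
    fix i t assume it: "i \<in> I" "t \<in> U i"
    have ne: "f i t \<noteq> 0" using c(1) c(2)[OF it] by auto
    show "cmod (inverse (f i t)) \<le> inverse c"
      unfolding norm_inverse by (rule le_imp_inverse_le[OF c(2)[OF it] c(1)])
    show "((\<lambda>t. inverse (f i t)) has_vector_derivative (- 1) * (inverse (f i t) * f' i t * inverse (f i t))) (at t)"
      using Deriv.has_derivative_inverse[OF ne f'(1)[OF it, unfolded has_vector_derivative_def]]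
      by (simp add: has_vector_derivative_def mult_ac)
  qed
qed

lemma deriv_bounded_affine:
  assumes \<sigma>: "\<And>i. i \<in> I \<Longrightarrow> \<bar>\<sigma> i\<bar> \<le> S"
    and V: "\<And>i t. i \<in> I \<Longrightarrow> t \<in> V i \<Longrightarrow> c i + \<sigma> i * t \<in> U i"
  shows "deriv_bounded n I U f \<Longrightarrow> deriv_bounded n I V (\<lambda>i t. f i (c i + \<sigma> i * t))"
proof (induction n arbitrary: f)
  case 0
  obtain K where K: "\<forall>i\<in>I. \<forall>t\<in>U i. cmod (f i t) \<le> K"
    using deriv_bounded_bound[OF 0(1)] by blast
  show ?case unfolding deriv_bounded.simps by (intro exI[of _ K] ballI) (use K V in blast)
next
  case (Suc n)
  obtain f' where "\<forall>i\<in>I. \<forall>t\<in>U i. (f i has_vector_derivative f' i t) (at t)"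
    "deriv_bounded n I U f'"
    using deriv_bounded_deriv[OF Suc.prems(1)] by blast
  note f' = this(1)[rule_format] this(2)
  obtain K where "\<forall>i\<in>I. \<forall>t\<in>U i. cmod (f i t) \<le> K"
    using deriv_bounded_bound[OF Suc.prems(1)] by blast
  note K = this[rule_format]
  have "deriv_bounded n I V (\<lambda>i t. of_real (\<sigma> i) * f' i (c i + \<sigma> i * t))"
    by (intro deriv_bounded_mult Suc.IH f' deriv_bounded_const[where K=S]) (simp add: \<sigma>)
  then show ?case
  proof (rule deriv_bounded_SucI[rotated 2, where K=K])
    fix i t assume it: "i \<in> I" "t \<in> V i"
    show "cmod (f i (c i + \<sigma> i * t)) \<le> K" by (rule K[OF it(1) V[OF it]])
    have "((\<lambda>t. c i + \<sigma> i * t) has_vector_derivative \<sigma> i) (at t)"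
      by (auto intro!: derivative_eq_intros)
    from vector_diff_chain_at[OF this f'(1)[OF it(1) V[OF it]]]
    show "((\<lambda>t. f i (c i + \<sigma> i * t)) has_vector_derivative of_real (\<sigma> i) * f' i (c i + \<sigma> i * t)) (at t)"
      by (simp add: o_def scaleR_conv_of_real)
  qed
qed

lemma deriv_bounded_sum:
  assumes fin: "\<And>i. i \<in> I \<Longrightarrow> finite (D i)" and card: "\<And>i. i \<in> I \<Longrightarrow> card (D i) \<le> m"
  shows "deriv_bounded n (Sigma I D) (\<lambda>(i, k). U i) f \<Longrightarrow> deriv_bounded n I U (\<lambda>i t. \<Sum>k\<in>D i. f (i, k) t)"
proof (induction n arbitrary: f)
  have bound: "\<exists>L. \<forall>i\<in>I. \<forall>t\<in>U i. cmod (\<Sum>k\<in>D i. f (i, k) t) \<le> L"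
    if hyp: "deriv_bounded n (Sigma I D) (\<lambda>(i, k). U i) f" for n f
  proof -
    obtain K where "0 \<le> K" "\<forall>p\<in>Sigma I D. \<forall>t\<in>(case p of (i, k) \<Rightarrow> U i). cmod (f p t) \<le> K"
      using deriv_bounded_bound[OF hyp] by blast
    note K = this(1) this(2)[rule_format]
    have "cmod (\<Sum>k\<in>D i. f (i, k) t) \<le> real m * K" if "i \<in> I" "t \<in> U i" for i t
    proof -
      have "cmod (\<Sum>k\<in>D i. f (i, k) t) \<le> of_nat (card (D i)) * K"
        by (rule order_trans[OF norm_sum sum_bounded_above]) (use K that in auto)
      also have "\<dots> \<le> real m * K" using card[OF that(1)] K(1) by (intro mult_right_mono) auto
      finally show ?thesis .
    qed
    then show ?thesis by blast
  qed
  {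
    case 0
    then show ?case using bound[OF 0] by simp
  next
    case (Suc n)
    obtain f' where "\<forall>p\<in>Sigma I D. \<forall>t\<in>(case p of (i, k) \<Rightarrow> U i). (f p has_vector_derivative f' p t) (at t)"
      "deriv_bounded n (Sigma I D) (\<lambda>(i, k). U i) f'"
      using deriv_bounded_deriv[OF Suc.prems(1)] by blast
    note f' = this(1)[rule_format] this(2)
    obtain L where L: "\<forall>i\<in>I. \<forall>t\<in>U i. cmod (\<Sum>k\<in>D i. f (i, k) t) \<le> L"
      using bound[OF Suc.prems] by blast
    show ?case
    proof (rule deriv_bounded_SucI[OF _ _ Suc.IH[OF f'(2)], where K=L])
      fix i t assume it: "i \<in> I" "t \<in> U i"
      show "cmod (\<Sum>k\<in>D i. f (i, k) t) \<le> L" using L it by blast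
      show "((\<lambda>t. \<Sum>k\<in>D i. f (i, k) t) has_vector_derivative (\<Sum>k\<in>D i. f' (i, k) t)) (at t)"
        by (intro has_vector_derivative_sum f'(1)) (use it in auto)
    qed
  }
qed

text \<open>
  A factor supported in a closed subset of \<open>U i\<close> allows extending by zero a product that is
  controlled on \<open>U i\<close> only.
\<close>

lemma deriv_bounded_extend:
  assumes U: "\<And>i. i \<in> I \<Longrightarrow> open (U i)" and K: "\<And>i. i \<in> I \<Longrightarrow> closed (K i)" "\<And>i. i \<in> I \<Longrightarrow> K i \<subseteq> U i"
  shows "deriv_bounded n I (\<lambda>_. UNIV) f \<Longrightarrow> (\<And>i t. i \<in> I \<Longrightarrow> t \<notin> K i \<Longrightarrow> f i t = 0) \<Longrightarrow>
    deriv_bounded n I U g \<Longrightarrow> deriv_bounded n I (\<lambda>_. UNIV) (\<lambda>i t. if t \<in> U i then f i t * g i t else 0)"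
proof (induction n arbitrary: f g)
  case 0
  obtain A where "0 \<le> A" "\<forall>i\<in>I. \<forall>t\<in>UNIV. cmod (f i t) \<le> A"
    using deriv_bounded_bound[OF 0(1)] by blast
  note A = this(1) this(2)[rule_format]
  obtain B where "0 \<le> B" "\<forall>i\<in>I. \<forall>t\<in>U i. cmod (g i t) \<le> B"
    using deriv_bounded_bound[OF 0(3)] by blast
  note B = this(1) this(2)[rule_format]
  show ?case using A B by (auto simp: norm_mult intro!: exI[of _ "A * B"] mult_mono)
next
  case (Suc n)
  obtain f' where "\<forall>i\<in>I. \<forall>t\<in>UNIV. (f i has_vector_derivative f' i t) (at t)"
    "deriv_bounded n I (\<lambda>_. UNIV) f'"
    using deriv_bounded_deriv[OF Suc.prems(1)] by blast
  note f' = this(1)[rule_format] this(2)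
  obtain g' where "\<forall>i\<in>I. \<forall>t\<in>U i. (g i has_vector_derivative g' i t) (at t)"
    "deriv_bounded n I U g'"
    using deriv_bounded_deriv[OF Suc.prems(3)] by blast
  note g' = this(1)[rule_format] this(2)
  obtain A where "0 \<le> A" "\<forall>i\<in>I. \<forall>t\<in>UNIV. cmod (f i t) \<le> A"
    using deriv_bounded_bound[OF Suc.prems(1)] by blast
  note A = this(1) this(2)[rule_format]
  obtain B where "0 \<le> B" "\<forall>i\<in>I. \<forall>t\<in>U i. cmod (g i t) \<le> B"
    using deriv_bounded_bound[OF Suc.prems(3)] by blast
  note B = this(1) this(2)[rule_format]
  have f'0: "f' i t = 0" if it: "i \<in> I" "t \<notin> K i" for i t
  proof -
    have "((\<lambda>_. 0) has_vector_derivative f' i t) (at t)"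
      by (rule has_vector_derivative_transform_within_open[OF f'(1)[OF it(1)], of _ "- K i"])
        (use it K(1)[OF it(1)] Suc.prems(2) in auto)
    then show ?thesis using vector_derivative_unique_at has_vector_derivative_const by blast
  qed
  have "deriv_bounded n I (\<lambda>_. UNIV) (\<lambda>i t. (if t \<in> U i then f i t * g' i t else 0) + (if t \<in> U i then f' i t * g i t else 0))"
    by (intro deriv_bounded_add Suc.IH deriv_bounded_Suc_imp[OF Suc.prems(1)] Suc.prems(2) g' f'
        deriv_bounded_Suc_imp[OF Suc.prems(3)] f'0)
  then show ?case
  proof (rule deriv_bounded_SucI[rotated 2, where K="A * B"])
    fix i t assume it: "i \<in> I" "t \<in> (UNIV :: real set)"
    show "cmod (if t \<in> U i then f i t * g i t else 0) \<le> A * B"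
      using A B it by (auto simp: norm_mult intro!: mult_mono)
    show "((\<lambda>t. if t \<in> U i then f i t * g i t else 0) has_vector_derivative
      (if t \<in> U i then f i t * g' i t else 0) + (if t \<in> U i then f' i t * g i t else 0)) (at t)"
    proof (cases "t \<in> U i")
      case True
      have "((\<lambda>t. f i t * g i t) has_vector_derivative f i t * g' i t + f' i t * g i t) (at t)"
        by (intro has_vector_derivative_mult f' g' it True)
      then have "((\<lambda>t. if t \<in> U i then f i t * g i t else 0) has_vector_derivative f i t * g' i t + f' i t * g i t) (at t)"
        by (rule has_vector_derivative_transform_within_open[OF _ U[OF it(1)] True]) simp
      then show ?thesis using True by simp
    next
      case False
      then have tK: "t \<in> - K i" using K(2)[OF it(1)] by auto
      have "((\<lambda>t. if t \<in> U i then f i t * g i t else 0) has_vector_derivative 0) (at t)"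
        by (rule has_vector_derivative_transform_within_open[OF has_vector_derivative_const[of 0] _ tK])
          (use K(1)[OF it(1)] Suc.prems(2)[OF it(1)] in auto)
      then show ?thesis using False by simp
    qed
  qed
qed


section \<open>Decay of Fourier integrals\<close>

definition shift_diff :: "'a::ab_group_add \<Rightarrow> ('a \<Rightarrow> complex) \<Rightarrow> ('a \<Rightarrow> complex)" where
  "shift_diff e h = (\<lambda>t. h (t + e) - h t)"

lemma shift_diff_apply: "shift_diff e h t = h (t + e) - h t"
  by (simp add: shift_diff_def)

text \<open>
  By the mean value theorem each difference costs a factor \<open>|\<tau>|\<close> and one derivative.
\<close>

lemma shift_diff_bound:
  "deriv_bounded n I (\<lambda>_. UNIV) f \<Longrightarrow>
    \<exists>K\<ge>0. \<forall>i\<in>I. \<forall>\<tau> t. cmod ((shift_diff \<tau> ^^ n) (f i) t) \<le> K * \<bar>\<tau>\<bar> ^ n"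
proof (induction n arbitrary: f)
  case 0
  obtain K where "0 \<le> K" "\<forall>i\<in>I. \<forall>t\<in>UNIV. cmod (f i t) \<le> K"
    using deriv_bounded_bound[OF 0(1)] by blast
  note K = this(1) this(2)[rule_format]
  then show ?case by auto
next
  case (Suc n)
  obtain f' where "\<forall>i\<in>I. \<forall>t\<in>UNIV. (f i has_vector_derivative f' i t) (at t)"
    "deriv_bounded n I (\<lambda>_. UNIV) f'"
    using deriv_bounded_deriv[OF Suc.prems(1)] by blast
  note f' = this(1)[rule_format] this(2)
  obtain K where K: "K \<ge> 0" "\<And>i \<tau> t. i \<in> I \<Longrightarrow> cmod ((shift_diff \<tau> ^^ n) (f' i) t) \<le> K * \<bar>\<tau>\<bar> ^ n"
    using Suc.IH[OF f'(2)] by blast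
  have der: "((shift_diff \<tau> ^^ m) (f i) has_vector_derivative (shift_diff \<tau> ^^ m) (f' i) t) (at t)"
    if i: "i \<in> I" for i \<tau> m t
  proof (induction m arbitrary: t)
    case 0
    then show ?case using f'(1)[OF i] by simp
  next
    case (Suc m)
    have "((\<lambda>t. t + \<tau>) has_vector_derivative 1) (at t)" by (auto intro!: derivative_eq_intros)
    from vector_diff_chain_at[OF this Suc[of "t + \<tau>"]]
    have "((\<lambda>t. (shift_diff \<tau> ^^ m) (f i) (t + \<tau>)) has_vector_derivative (shift_diff \<tau> ^^ m) (f' i) (t + \<tau>)) (at t)"
      by (simp add: o_def)
    from has_vector_derivative_diff[OF this Suc[of t]]
    show ?case by (simp add: shift_diff_def[of \<tau> "(shift_diff \<tau> ^^ m) _"])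
  qed
  have "cmod ((shift_diff \<tau> ^^ Suc n) (f i) t) \<le> K * \<bar>\<tau>\<bar> ^ Suc n" if i: "i \<in> I" for i \<tau> t
  proof -
    let ?g = "(shift_diff \<tau> ^^ n) (f i)"
    have "norm (?g (t + \<tau>) - ?g t) \<le> (K * \<bar>\<tau>\<bar> ^ n) * norm ((t + \<tau>) - t)"
    proof (rule differentiable_bound[where S=UNIV and f'="\<lambda>x h. h *\<^sub>R (shift_diff \<tau> ^^ n) (f' i) x"])
      show "(?g has_derivative (\<lambda>h. h *\<^sub>R (shift_diff \<tau> ^^ n) (f' i) x)) (at x within UNIV)" for x
        using der[OF i, where t=x] by (simp add: has_vector_derivative_def)
      show "onorm (\<lambda>h. h *\<^sub>R (shift_diff \<tau> ^^ n) (f' i) x) \<le> K * \<bar>\<tau>\<bar> ^ n" for x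
        by (rule onorm_bound) (use K i in \<open>auto simp: mult.commute[of "\<bar>_\<bar>"] intro!: mult_right_mono\<close>)
    qed auto
    then show ?thesis by (simp add: shift_diff_apply mult_ac)
  qed
  then show ?case using K(1) by blast
qed

lemma integrable_bounded_support:
  fixes g :: "real^'n::finite \<Rightarrow> complex"
  assumes [measurable]: "g \<in> borel_measurable borel" and B: "\<And>x. cmod (g x) \<le> B" and 0: "\<And>x. \<rho> < norm x \<Longrightarrow> g x = 0"
  shows "integrable lborel g" and "cmod (LINT x|lborel. g x) \<le> B * measure lborel (cball (0::real^'n) \<rho>)"
proof -
  let ?c = "\<lambda>x::real^'n. indicat_real (cball 0 \<rho>) x *\<^sub>R B"
  have c: "integrable lborel ?c"
    using emeasure_bounded_finite[OF bounded_cball[of "0::real^'n" \<rho>]]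
    by (intro integrable_scaleR_left integrable_real_indicator) auto
  have le: "cmod (g x) \<le> ?c x" for x
    using B[of x] 0[of x] by (auto simp: indicator_def)
  show int: "integrable lborel g"
    by (rule Bochner_Integration.integrable_bound[OF c])
      (use le in \<open>auto intro!: AE_I2 order_trans[OF _ abs_ge_self]\<close>)
  have "cmod (LINT x|lborel. g x) \<le> (LINT x|lborel. ?c x)"
    by (rule Bochner_Integration.integral_norm_bound_integral[OF int c le])
  also have "\<dots> = B * measure lborel (cball (0::real^'n) \<rho>)" by simp
  finally show "cmod (LINT x|lborel. g x) \<le> B * measure lborel (cball (0::real^'n) \<rho>)" .
qed

lemma borel_measurable_shift_diff_power [measurable]:
  fixes h :: "real^'n::finite \<Rightarrow> complex"
  assumes "h \<in> borel_measurable borel" shows "(shift_diff e ^^ m) h \<in> borel_measurable borel"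
proof (induction m)
  case (Suc m)
  note [measurable] = Suc
  have "(\<lambda>x. (shift_diff e ^^ m) h (x + e) - (shift_diff e ^^ m) h x) \<in> borel_measurable borel" by measurable
  then show ?case by (simp add: shift_diff_def[of e "(shift_diff e ^^ m) h", symmetric])
qed (use assms in simp)

lemma shift_diff_power_support:
  fixes h :: "real^'n::finite \<Rightarrow> complex"
  assumes "\<And>x. R < norm x \<Longrightarrow> h x = 0"
  shows "R + real m * norm e < norm x \<Longrightarrow> (shift_diff e ^^ m) h x = 0"
proof (induction m arbitrary: x)
  case (Suc m)
  have "norm x \<le> norm (x + e) + norm e" using norm_triangle_ineq4[of "x + e" e] by simp
  moreover have "R + (real m * norm e + norm e) < norm x" using Suc.prems by (simp add: distrib_right)
  ultimately have "R + real m * norm e < norm (x + e)" "R + real m * norm e < norm x"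
    using norm_ge_zero[of e] by linarith+
  then show ?case using Suc.IH by (simp add: shift_diff_apply)
qed (use assms in simp)

lemma shift_diff_power_bounded:
  assumes "\<And>x. cmod (h x) \<le> B"
  shows "cmod ((shift_diff e ^^ m) h x) \<le> 2 ^ m * B"
proof (induction m arbitrary: x)
  case (Suc m)
  have "cmod ((shift_diff e ^^ Suc m) h x) \<le> cmod ((shift_diff e ^^ m) h (x + e)) + cmod ((shift_diff e ^^ m) h x)"
    by (simp add: shift_diff_apply norm_triangle_ineq4)
  also have "\<dots> \<le> 2 ^ m * B + 2 ^ m * B" by (intro add_mono Suc)
  finally show ?case by (simp add: mult_ac)
qed (use assms in simp)

text \<open>
  With \<open>v \<bullet> e = \<pi>\<close>, the shift by \<open>e\<close> changes the sign of the exponential, so one difference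
  multiplies the Fourier integral by \<open>-2\<close>.
\<close>

lemma Fourier_integral_shift_diff:
  fixes h :: "real^'n::finite \<Rightarrow> complex"
  assumes h [measurable]: "h \<in> borel_measurable borel" and B: "\<And>x. cmod (h x) \<le> B"
    and R: "\<And>x. R < norm x \<Longrightarrow> h x = 0" and e: "v \<bullet> e = pi"
  shows "(LINT x|lborel. (shift_diff e ^^ m) h x * exp (- \<i> * complex_of_real (v \<bullet> x)))
    = (- 2) ^ m * (LINT x|lborel. h x * exp (- \<i> * complex_of_real (v \<bullet> x)))"
proof (induction m)
  case (Suc m)
  let ?h = "(shift_diff e ^^ m) h" and ?E = "\<lambda>x. exp (- \<i> * complex_of_real (v \<bullet> x))"
  let ?k = "\<lambda>x. ?h x * ?E x"
  have k: "integrable lborel ?k"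
  proof (rule integrable_bounded_support(1))
    show "?k \<in> borel_measurable borel" by measurable
    show "cmod (?k x) \<le> 2 ^ m * B" for x using shift_diff_power_bounded[where h=h and B=B and e=e and m=m and x=x] B by (simp add: norm_mult)
    show "?k x = 0" if "R + real m * norm e < norm x" for x using shift_diff_power_support[OF R, where e=e and m=m and x=x] that by simp
  qed
  have km: "?k \<in> borel_measurable borel" by measurable
  have ks: "integrable lborel (\<lambda>x. ?k (x + e))"
    using lborel_integrable_affine[OF k, of 1 e] by (simp only: scaleR_one add.commute[of e])
  have shift: "(LINT x|lborel. ?k (x + e)) = (LINT x|lborel. ?k x)"
    using lborel_integral_affine[OF km, of 1 e] by (simp only: scaleR_one add.commute[of e]) simp
  have E: "?E (x + e) = - ?E x" for x
  proof -
    have "?E (x + e) = ?E x * exp (- (\<i> * complex_of_real pi))"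
      by (simp add: inner_add_right e distrib_left mult_exp_exp)
    also have "exp (- (\<i> * complex_of_real pi)) = - 1"
      by (simp add: exp_minus exp_pi_i')
    finally show ?thesis by simp
  qed
  have "(LINT x|lborel. (shift_diff e ^^ Suc m) h x * ?E x) = (LINT x|lborel. - ?k (x + e) - ?k x)"
  proof (rule Bochner_Integration.integral_cong[OF refl])
    fix x
    have "- ?k (x + e) = ?h (x + e) * ?E x" by (simp only: E) simp
    then show "(shift_diff e ^^ Suc m) h x * ?E x = - ?k (x + e) - ?k x"
      by (simp only: funpow.simps o_apply shift_diff_apply left_diff_distrib)
  qed
  also have "\<dots> = - (LINT x|lborel. ?k x) - (LINT x|lborel. ?k x)"
    using k ks by (simp only: Bochner_Integration.integral_diff Bochner_Integration.integrable_minus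
        Bochner_Integration.integral_minus shift)
  also have "\<dots> = (- 2) * (LINT x|lborel. ?k x)" by simp
  finally show ?case unfolding Suc by simp
qed simp

text \<open>
  Differences replace integration by parts: taken \<open>N\<close> times along a coordinate \<open>i\<close> that carries a fixed share of the norm of \<open>v\<close>, with step
  \<open>\<tau> = pi / v $ i\<close>, they multiply the integral by \<open>(-2)\<^sup>N\<close> and bound the integrand by a multiple of \<open>|\<tau>|\<^sup>N\<close>.
\<close>

lemma Fourier_integral_decay:
  fixes H :: "'p \<Rightarrow> real^'n::finite \<Rightarrow> complex"
  assumes Hm: "\<And>p. p \<in> P \<Longrightarrow> H p \<in> borel_measurable borel"
    and HR: "\<And>p x. p \<in> P \<Longrightarrow> R < norm x \<Longrightarrow> H p x = 0"
    and HD: "deriv_bounded N (P \<times> UNIV) (\<lambda>_. UNIV) (\<lambda>(p, x, i) \<tau>. H p (x + \<tau> *\<^sub>R axis i 1))"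
  shows "\<exists>K\<ge>0. \<forall>p\<in>P. \<forall>v. cmod (LINT x|lborel. H p x * exp (- \<i> * complex_of_real (v \<bullet> x)))
    * (1 + norm v) ^ N \<le> K"
proof -
  define d where "d = real CARD('n)"
  have d: "d \<ge> 1" by (simp add: d_def Suc_leI)
  obtain B where "0 \<le> B" "\<forall>i\<in>P \<times> UNIV. \<forall>t\<in>UNIV. cmod ((\<lambda>(p, x, i) \<tau>. H p (x + \<tau> *\<^sub>R axis i 1)) i t) \<le> B"
    using deriv_bounded_bound[OF HD] by blast
  note B = this(1) this(2)[rule_format]
  have HB: "cmod (H p x) \<le> B" if "p \<in> P" for p x
    using B(2)[of "(p, x, undefined)" 0] that by simp
  obtain K where K: "K \<ge> 0" "\<And>i \<tau> t. i \<in> P \<times> UNIV \<Longrightarrow>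
      cmod ((shift_diff \<tau> ^^ N) ((\<lambda>(p, x, i) \<tau>. H p (x + \<tau> *\<^sub>R axis i 1)) i) t) \<le> K * \<bar>\<tau>\<bar> ^ N"
    using shift_diff_bound[OF HD] by blast
  have sd: "(shift_diff (\<tau> *\<^sub>R axis i 1) ^^ m) (H p) (x + t *\<^sub>R axis i 1)
      = (shift_diff \<tau> ^^ m) (\<lambda>t. H p (x + t *\<^sub>R axis i 1)) t" for \<tau> i m p x t
  proof (induction m arbitrary: t)
    case (Suc m)
    show ?case
      using Suc[of t] Suc[of "t + \<tau>"] by (simp add: shift_diff_apply scaleR_add_left add.assoc)
  qed simp
  have KH: "cmod ((shift_diff (\<tau> *\<^sub>R axis i 1) ^^ N) (H p) x) \<le> K * \<bar>\<tau>\<bar> ^ N" if "p \<in> P" for p \<tau> i x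
    using K(2)[of "(p, x, i)" \<tau> 0] that sd[of N \<tau> i p x 0] by simp
  let ?V = "\<lambda>r. measure lborel (cball (0::real^'n) r)"
  define K' where "K' = B * ?V R * (1 + pi * d) ^ N + K * ?V (R + real N) * (2 * pi * d) ^ N"
  have nonneg: "0 \<le> B * ?V R * (1 + pi * d) ^ N" "0 \<le> K * ?V (R + real N) * (2 * pi * d) ^ N"
    using B(1) K(1) d by auto
  have "cmod (LINT x|lborel. H p x * exp (- \<i> * complex_of_real (v \<bullet> x))) * (1 + norm v) ^ N \<le> K'"
    if p: "p \<in> P" for p v
  \<comment> \<open>Beyond this threshold the step has length at most 1, so the differences vanish outside a fixed ball.\<close>
  proof (cases "norm v \<le> pi * d")
    case True
    have [measurable]: "H p \<in> borel_measurable borel" by (rule Hm[OF p])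
    have "cmod (LINT x|lborel. H p x * exp (- \<i> * complex_of_real (v \<bullet> x))) \<le> B * ?V R"
      by (rule integrable_bounded_support(2)) (use HB[OF p] HR[OF p] in \<open>auto simp: norm_mult\<close>)
    then have "cmod (LINT x|lborel. H p x * exp (- \<i> * complex_of_real (v \<bullet> x))) * (1 + norm v) ^ N
        \<le> B * ?V R * (1 + pi * d) ^ N"
      using True B(1) by (intro mult_mono power_mono) auto
    then show ?thesis using nonneg by (simp add: K'_def)
  next
    case False
    then have v: "norm v > pi * d" by simp
    have v1: "norm v \<ge> 1"
    proof -
      have "1 * 1 \<le> pi * d" using d pi_ge_two by (intro mult_mono) auto
      then show ?thesis using v by simp
    qed
    have [measurable]: "H p \<in> borel_measurable borel" by (rule Hm[OF p])
    have "\<exists>i. norm v \<le> d * \<bar>v $ i\<bar>"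
    proof (rule ccontr)
      assume "\<nexists>i. norm v \<le> d * \<bar>v $ i\<bar>"
      then have lt: "\<bar>v $ i\<bar> < norm v / d" for i using d by (simp add: not_le field_simps)
      have "norm v \<le> (\<Sum>i\<in>UNIV. \<bar>v $ i\<bar>)" by (rule norm_le_l1_cart)
      also have "\<dots> < (\<Sum>i\<in>(UNIV::'n set). norm v / d)" by (intro sum_strict_mono lt) auto
      also have "\<dots> = norm v" by (simp add: d_def)
      finally show False by simp
    qed
    then obtain i where i: "norm v \<le> d * \<bar>v $ i\<bar>" by blast
    define \<tau> where "\<tau> = pi / v $ i"
    have vi: "\<bar>v $ i\<bar> > pi"
    proof -
      have "d * pi < d * \<bar>v $ i\<bar>" using i v by (simp add: mult.commute)
      then show ?thesis using d by simp
    qed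
    then have vi0: "v $ i \<noteq> 0" by auto
    have \<tau>1: "\<bar>\<tau>\<bar> \<le> 1" using vi pi_gt_zero by (simp add: \<tau>_def abs_divide divide_le_eq)
    have \<tau>v: "\<bar>\<tau>\<bar> * (1 + norm v) \<le> 2 * pi * d"
    proof -
      have "\<bar>\<tau>\<bar> * (1 + norm v) \<le> \<bar>\<tau>\<bar> * (2 * (d * \<bar>v $ i\<bar>))"
        using v1 i by (intro mult_left_mono) auto
      also have "\<dots> = 2 * pi * d" using vi0 by (simp add: \<tau>_def)
      finally show ?thesis .
    qed
    let ?e = "\<tau> *\<^sub>R axis i 1 :: real^'n" and ?E = "\<lambda>x. exp (- \<i> * complex_of_real (v \<bullet> x))"
    have ve: "v \<bullet> ?e = pi" using vi0 by (simp add: inner_axis \<tau>_def)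
    have ne: "norm ?e \<le> 1" using \<tau>1 by simp
    have "cmod (LINT x|lborel. (shift_diff ?e ^^ N) (H p) x * ?E x) \<le> (K * \<bar>\<tau>\<bar> ^ N) * ?V (R + real N)"
    proof (rule integrable_bounded_support(2))
      show "(\<lambda>x. (shift_diff ?e ^^ N) (H p) x * ?E x) \<in> borel_measurable borel" by measurable
      show "cmod ((shift_diff ?e ^^ N) (H p) x * ?E x) \<le> K * \<bar>\<tau>\<bar> ^ N" for x
        using KH[OF p] by (simp add: norm_mult)
      show "(shift_diff ?e ^^ N) (H p) x * ?E x = 0" if "R + real N < norm x" for x
      proof -
        have "real N * norm ?e \<le> real N" using ne by (simp add: mult_left_le)
        then show ?thesis using shift_diff_power_support[OF HR[OF p], where m=N and e="?e" and x=x] that by simp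
      qed
    qed
    moreover have "(LINT x|lborel. (shift_diff ?e ^^ N) (H p) x * ?E x) = (- 2) ^ N * (LINT x|lborel. H p x * ?E x)"
      by (rule Fourier_integral_shift_diff[OF Hm[OF p] HB[OF p] HR[OF p] ve])
    ultimately have "2 ^ N * cmod (LINT x|lborel. H p x * ?E x) \<le> (K * \<bar>\<tau>\<bar> ^ N) * ?V (R + real N)"
      by (simp only: norm_mult norm_power norm_minus_cancel norm_numeral)
    moreover have "cmod (LINT x|lborel. H p x * ?E x) \<le> 2 ^ N * cmod (LINT x|lborel. H p x * ?E x)"
      using mult_right_mono[of 1 "2 ^ N" "cmod (LINT x|lborel. H p x * ?E x)"] by simp
    ultimately have "cmod (LINT x|lborel. H p x * ?E x) \<le> (K * \<bar>\<tau>\<bar> ^ N) * ?V (R + real N)" by linarith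
    then have "cmod (LINT x|lborel. H p x * ?E x) * (1 + norm v) ^ N
        \<le> (K * \<bar>\<tau>\<bar> ^ N) * ?V (R + real N) * (1 + norm v) ^ N"
      by (rule mult_right_mono) simp
    also have "\<dots> = K * ?V (R + real N) * (\<bar>\<tau>\<bar> * (1 + norm v)) ^ N" by (simp add: power_mult_distrib)
    also have "\<dots> \<le> K * ?V (R + real N) * (2 * pi * d) ^ N"
      using K(1) \<tau>v by (intro mult_left_mono power_mono) auto
    finally show ?thesis using nonneg by (simp add: K'_def)
  qed
  moreover have "K' \<ge> 0" using nonneg by (simp add: K'_def)
  ultimately show ?thesis by blast
qed


section \<open>Geometry of subdyadic centers\<close>

lemma powr_comparable:
  fixes x y k e :: real
  assumes "0 < x" "0 < y" "1 \<le> k" "x \<le> k * y" "y \<le> k * x"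
  shows "x powr e \<le> k powr \<bar>e\<bar> * y powr e"
proof (cases "e \<ge> 0")
  case True
  have "x powr e \<le> (k * y) powr e" using assms True by (intro powr_mono2) auto
  then show ?thesis using True assms by (simp add: powr_mult)
next
  case False
  have "(k * x) powr e \<le> y powr e" using assms False by (intro powr_mono2') auto
  then have "k powr e * x powr e \<le> y powr e" using assms by (simp add: powr_mult)
  then have "k powr (- e) * (k powr e * x powr e) \<le> k powr (- e) * y powr e"
    by (intro mult_left_mono) auto
  moreover have "k powr (- e) * (k powr e * x powr e) = x powr e"
    using assms by (simp add: powr_minus field_simps)
  ultimately show ?thesis using False by simp
qed

definition local_scale :: "real \<Rightarrow> real^'n::finite \<Rightarrow> real" where
  "local_scale \<alpha> \<xi> = norm \<xi> powr (1 - \<alpha>)"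

text \<open>
  A center is within a bounded ratio of the modulus of any point of its ball; the sublinear size
  \<open>|\<xi>|\<^sup>1\<^sup>-\<^sup>\<alpha>\<close> of the ball enters through \<open>\<alpha> > 0\<close>.
\<close>

lemma center_comparable:
  fixes \<alpha> R :: real
  assumes \<alpha>: "0 < \<alpha>" and R: "0 < R"
  shows "\<exists>\<kappa>\<ge>1. \<forall>(\<xi>::real^'n::finite) u. 1 \<le> norm \<xi> \<longrightarrow> norm (u - \<xi>) \<le> R * local_scale \<alpha> \<xi> \<longrightarrow>
    1 + norm u \<le> \<kappa> * norm \<xi> \<and> norm \<xi> \<le> \<kappa> * (1 + norm u)"
proof -
  define \<kappa> where "\<kappa> = 2 + R + (2 * R) powr (1 / \<alpha>)"
  have \<kappa>: "\<kappa> \<ge> 2 + R" by (simp add: \<kappa>_def)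
  show ?thesis
  proof (intro exI[of _ \<kappa>] conjI allI impI)
    show "1 \<le> \<kappa>" using \<kappa> R by simp
    fix \<xi> u :: "real^'n" assume \<xi>: "1 \<le> norm \<xi>" and u: "norm (u - \<xi>) \<le> R * local_scale \<alpha> \<xi>"
    define x where "x = norm \<xi>"
    have x: "x \<ge> 1" using \<xi> by (simp add: x_def)
    have "x powr (1 - \<alpha>) \<le> x powr 1" using x \<alpha> by (intro powr_mono) auto
    then have s: "local_scale \<alpha> \<xi> \<le> x" using x by (simp add: local_scale_def x_def)
    have "norm u \<le> norm \<xi> + norm (u - \<xi>)" using norm_triangle_ineq[of \<xi> "u - \<xi>"] by simp
    also have "\<dots> \<le> x + R * x" using order_trans[OF u mult_left_mono[OF s less_imp_le[OF R]]] by (simp add: x_def)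
    finally have "1 + norm u \<le> (2 + R) * x" using x by (simp add: algebra_simps)
    also have "\<dots> \<le> \<kappa> * x" using \<kappa> x by (intro mult_right_mono) auto
    finally show "1 + norm u \<le> \<kappa> * norm \<xi>" by (simp add: x_def)
    have low: "x \<le> norm u + R * local_scale \<alpha> \<xi>"
      using norm_triangle_ineq[of u "\<xi> - u"] u by (simp add: x_def norm_minus_commute)
    show "norm \<xi> \<le> \<kappa> * (1 + norm u)"
    proof (cases "R * local_scale \<alpha> \<xi> \<le> x / 2")
      case True
      then have "x \<le> 2 * norm u" using low by simp
      also have "\<dots> \<le> \<kappa> * (1 + norm u)" using \<kappa> R by (intro mult_mono) auto
      finally show ?thesis by (simp add: x_def)
    next
      case False
      have "x powr \<alpha> * x powr (1 - \<alpha>) = x" using x by (simp add: powr_add[symmetric])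
      then have "x powr \<alpha> * x powr (1 - \<alpha>) < 2 * R * x powr (1 - \<alpha>)"
        using False by (simp add: local_scale_def x_def)
      then have "x powr \<alpha> < 2 * R" using x by simp
      then have "(x powr \<alpha>) powr (1 / \<alpha>) \<le> (2 * R) powr (1 / \<alpha>)"
        using \<alpha> by (intro powr_mono2) auto
      then have "x \<le> (2 * R) powr (1 / \<alpha>)" using x \<alpha> by (simp add: powr_powr)
      also have "\<dots> \<le> \<kappa>" using R by (simp add: \<kappa>_def)
      also have "\<dots> \<le> \<kappa> * (1 + norm u)" using \<kappa> R by (simp add: mult_le_cancel_left1)
      finally show ?thesis by (simp add: x_def)
    qed
  qed
qed

text \<open>
  For \<open>R = R\<^sub>1\<close> this is the condition under which the Fourier transforms of packets centered at \<open>\<xi>\<close> and \<open>\<eta>\<close>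
  can overlap.
\<close>

definition neighbours :: "real \<Rightarrow> real \<Rightarrow> real^'n::finite \<Rightarrow> real^'n \<Rightarrow> bool" where
  "neighbours \<alpha> R \<xi> \<eta> \<longleftrightarrow>
    (\<exists>u. norm (u - \<xi>) < R * local_scale \<alpha> \<xi> \<and> norm (u - \<eta>) < R * local_scale \<alpha> \<eta>)"

lemma neighbours_comparable:
  fixes \<alpha> R :: real
  assumes \<alpha>: "0 < \<alpha>" and R: "0 < R"
  shows "\<exists>\<Lambda>\<ge>1. \<forall>\<xi> \<eta> :: real^'n::finite. 1 \<le> norm \<xi> \<longrightarrow> 1 \<le> norm \<eta> \<longrightarrow> neighbours \<alpha> R \<xi> \<eta> \<longrightarrow>
    norm \<xi> \<le> \<Lambda> * norm \<eta> \<and> norm \<eta> \<le> \<Lambda> * norm \<xi> \<and>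
    local_scale \<alpha> \<xi> \<le> \<Lambda> * local_scale \<alpha> \<eta> \<and> local_scale \<alpha> \<eta> \<le> \<Lambda> * local_scale \<alpha> \<xi>"
proof -
  obtain \<kappa> where \<kappa>: "\<kappa> \<ge> 1" and cmp: "\<forall>(\<xi>::real^'n) u. 1 \<le> norm \<xi> \<longrightarrow> norm (u - \<xi>) \<le> R * local_scale \<alpha> \<xi> \<longrightarrow>
    1 + norm u \<le> \<kappa> * norm \<xi> \<and> norm \<xi> \<le> \<kappa> * (1 + norm u)"
    using center_comparable[OF \<alpha> R] by blast
  define k where "k = \<kappa> * \<kappa>"
  have k: "k \<ge> 1" using mult_mono[OF \<kappa> \<kappa>] \<kappa> by (simp add: k_def)
  define \<Lambda> where "\<Lambda> = max k (k powr \<bar>1 - \<alpha>\<bar>)"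
  have half: "norm \<xi> \<le> k * norm \<eta>"
    if h: "1 \<le> norm \<xi>" "1 \<le> norm \<eta>" "neighbours \<alpha> R \<xi> \<eta>" for \<xi> \<eta> :: "real^'n"
  proof -
    obtain u where u: "norm (u - \<xi>) < R * local_scale \<alpha> \<xi>" "norm (u - \<eta>) < R * local_scale \<alpha> \<eta>"
      using h(3) by (auto simp: neighbours_def)
    have "norm \<xi> \<le> \<kappa> * (1 + norm u)" using cmp h(1) less_imp_le[OF u(1)] by simp
    also have "\<dots> \<le> \<kappa> * (\<kappa> * norm \<eta>)" using cmp h(2) less_imp_le[OF u(2)] \<kappa> by (intro mult_left_mono) auto
    finally show ?thesis by (simp add: k_def mult.assoc)
  qed
  have sym: "neighbours \<alpha> R \<eta> \<xi>" if "neighbours \<alpha> R \<xi> \<eta>" for \<xi> \<eta> :: "real^'n"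
    using that by (auto simp: neighbours_def)
  have main: "norm \<xi> \<le> \<Lambda> * norm \<eta> \<and> local_scale \<alpha> \<xi> \<le> \<Lambda> * local_scale \<alpha> \<eta>"
    if h: "1 \<le> norm \<xi>" "1 \<le> norm \<eta>" "neighbours \<alpha> R \<xi> \<eta>" for \<xi> \<eta> :: "real^'n"
  proof
    have "k * norm \<eta> \<le> \<Lambda> * norm \<eta>" by (intro mult_right_mono) (auto simp: \<Lambda>_def)
    then show "norm \<xi> \<le> \<Lambda> * norm \<eta>" using half[OF h] by linarith
    have "local_scale \<alpha> \<xi> \<le> k powr \<bar>1 - \<alpha>\<bar> * local_scale \<alpha> \<eta>"
      unfolding local_scale_def using half[OF h] half[OF h(2,1) sym[OF h(3)]] h k
      by (intro powr_comparable) auto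
    also have "\<dots> \<le> \<Lambda> * local_scale \<alpha> \<eta>"
      by (intro mult_right_mono) (auto simp: \<Lambda>_def local_scale_def)
    finally show "local_scale \<alpha> \<xi> \<le> \<Lambda> * local_scale \<alpha> \<eta>" .
  qed
  have "\<Lambda> \<ge> 1" using k by (simp add: \<Lambda>_def)
  then show ?thesis using main sym by blast
qed

locale subdyadic_center_set =
  fixes \<alpha> a \<rho> :: real and \<Xi> :: "(real^'n::finite) set"
  assumes \<alpha>: "0 < \<alpha>" and a: "0 < a" and \<rho>: "0 < \<rho>" and centers: "subdyadic_centers \<alpha> a \<rho> \<Xi>"
begin

abbreviation "s \<equiv> local_scale \<alpha> :: real^'n \<Rightarrow> real"

lemma centers_countable: "countable \<Xi>"
  using centers by (auto simp: subdyadic_centers_def)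

lemma candidate_annulus:
  assumes X: "candidate_family \<alpha> \<rho> X" and \<xi>: "\<xi> \<in> X n"
  shows "\<xi> \<in> annulus n"
proof -
  from X[unfolded candidate_family_def, rule_format, of n]
  obtain Q p where "\<forall>q \<in> Q. q \<inter> annulus n \<noteq> {} \<longrightarrow> p q \<in> q \<inter> annulus n"
    "X n = p ` {q \<in> Q. q \<inter> annulus n \<noteq> {}}"
    by (elim exE conjE)
  then show ?thesis using \<xi> by auto
qed

lemma norm_center: assumes "\<xi> \<in> \<Xi>" shows "1 \<le> norm \<xi>"
proof -
  obtain X c where X: "candidate_family \<alpha> \<rho> X" "candidate_order X c" "\<Xi> = c ` {i. retained \<alpha> a \<rho> c i}"
    using centers by (auto simp: subdyadic_centers_def)
  have "\<xi> \<in> (\<Union>n. X n)" using X assms by (auto simp: candidate_order_def bij_betw_def)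
  then obtain n where "\<xi> \<in> X n" by blast
  then have "\<xi> \<in> annulus n" by (rule candidate_annulus[OF X(1)])
  then have "2 ^ n \<le> norm \<xi>" by (simp add: annulus_def)
  moreover have "(1::real) \<le> 2 ^ n" by simp
  ultimately show ?thesis by linarith
qed

lemma scale_pos: "\<xi> \<in> \<Xi> \<Longrightarrow> 0 < s \<xi>"
  using norm_center[of \<xi>] by (auto simp: local_scale_def)

lemma center_balls_disjoint:
  assumes "\<xi> \<in> \<Xi>" "\<eta> \<in> \<Xi>" "\<xi> \<noteq> \<eta>"
  shows "center_ball \<alpha> a \<rho> \<xi> \<inter> center_ball \<alpha> a \<rho> \<eta> = {}"
proof -
  obtain X c where X: "\<Xi> = c ` {i. retained \<alpha> a \<rho> c i}"
    using centers by (auto simp: subdyadic_centers_def)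
  obtain i j where ij: "\<xi> = c i" "retained \<alpha> a \<rho> c i" "\<eta> = c j" "retained \<alpha> a \<rho> c j"
    using assms X by auto
  have "i \<noteq> j" using ij assms(3) by auto
  then consider "i < j" | "j < i" by linarith
  then show ?thesis
  proof cases
    case 1
    then show ?thesis using ij(4) ij by (subst (asm) retained.simps) auto
  next
    case 2
    then show ?thesis using ij(2) ij by (subst (asm) retained.simps) auto
  qed
qed

text \<open>The first candidate is retained, and it lies in the innermost annulus.\<close>

lemma small_center: "\<exists>\<xi>\<in>\<Xi>. norm \<xi> < 2"
proof -
  obtain X c where X: "candidate_family \<alpha> \<rho> X" "candidate_order X c" "\<Xi> = c ` {i. retained \<alpha> a \<rho> c i}"
    using centers by (auto simp: subdyadic_centers_def)
  from X(1)[unfolded candidate_family_def, rule_format, of 0]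
  obtain Q where "\<exists>p. partition_on UNIV Q \<and>
        (\<forall>q \<in> Q. \<exists>c. q = half_open_cube c (\<rho> * 2 powr (real 0 * (1 - \<alpha>)))) \<and>
        (\<forall>q \<in> Q. q \<inter> annulus 0 \<noteq> {} \<longrightarrow> p q \<in> q \<inter> annulus 0) \<and>
        X 0 = p ` {q \<in> Q. q \<inter> annulus 0 \<noteq> {}}" ..
  then obtain p where Qp: "partition_on UNIV Q \<and>
        (\<forall>q \<in> Q. \<exists>c. q = half_open_cube c (\<rho> * 2 powr (real 0 * (1 - \<alpha>)))) \<and>
        (\<forall>q \<in> Q. q \<inter> annulus 0 \<noteq> {} \<longrightarrow> p q \<in> q \<inter> annulus 0) \<and>
        X 0 = p ` {q \<in> Q. q \<inter> annulus 0 \<noteq> {}}" ..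
  note Q = conjunct1[OF Qp] conjunct2[OF conjunct2[OF conjunct2[OF Qp]]]
  define e :: "real^'n" where "e = axis undefined 1"
  have e: "e \<in> annulus 0" by (simp add: annulus_def e_def)
  have "e \<in> \<Union>Q" using Q(1) by (simp add: partition_on_def)
  then obtain q where "q \<in> Q" "e \<in> q" by (rule UnionE)
  then have "q \<in> {q \<in> Q. q \<inter> annulus 0 \<noteq> {}}" using e by auto
  then have "X 0 \<noteq> {}" unfolding Q(2) by (simp only: image_is_empty) auto
  then obtain \<xi> where \<xi>: "\<xi> \<in> X 0" by blast
  note bij = conjunct1[OF X(2)[unfolded candidate_order_def]]
    and ord = conjunct2[OF X(2)[unfolded candidate_order_def]]
  have "\<xi> \<in> range c" using bij \<xi> by (auto simp: bij_betw_def)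
  then obtain j where j: "\<xi> = c j" by blast
  obtain m where m: "c 0 \<in> X m" using bij by (auto simp: bij_betw_def)
  have "c 0 \<in> X 0"
  proof (cases "j = 0")
    case False
    then have "m \<le> 0" using ord[rule_format, of 0 j m 0] m \<xi> j by simp
    then show ?thesis using m by simp
  qed (use \<xi> j in simp)
  then have "c 0 \<in> annulus 0" by (rule candidate_annulus[OF X(1)])
  then have "norm (c 0) < 2" by (simp add: annulus_def)
  moreover have "retained \<alpha> a \<rho> c 0" by (subst retained.simps) simp
  ultimately show ?thesis using X(3) by blast
qed

text \<open>
  The covering constant takes care of the points outside the unit ball. All others have distance at most 3 from
  a center of modulus less than 2, whose scale is at least \<open>1\<close> or \<open>2\<^sup>1\<^sup>-\<^sup>\<alpha>\<close>; this is what the lower bound on \<open>R\<^sub>0\<close> is for.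
\<close>

lemma covering:
  assumes A: "covering_constant TYPE('n) \<alpha> a \<rho>\<^sub>0 A" and \<rho>0: "\<rho> \<le> \<rho>\<^sub>0" and AR: "A * \<rho> < R\<^sub>0"
    and R0: "3 * 2 powr max (\<alpha> - 1) 0 < R\<^sub>0"
  shows "\<exists>\<xi>\<in>\<Xi>. norm (u - \<xi>) \<le> R\<^sub>0 * s \<xi>"
proof (cases "1 \<le> norm u")
  case True
  have "{\<eta>. 1 \<le> norm \<eta>} \<subseteq> (\<Union>\<xi>\<in>\<Xi>. {\<eta>. norm (\<eta> - \<xi>) \<le> A * \<rho> * norm \<xi> powr (1 - \<alpha>)})"
    using A \<rho> \<rho>0 centers unfolding covering_constant_def by blast
  then obtain \<xi> where \<xi>: "\<xi> \<in> \<Xi>" "norm (u - \<xi>) \<le> A * \<rho> * s \<xi>"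
    using True by (auto simp: local_scale_def)
  have "A * \<rho> * s \<xi> \<le> R\<^sub>0 * s \<xi>" using AR by (intro mult_right_mono) (auto simp: local_scale_def)
  then show ?thesis using \<xi> by (meson order_trans)
next
  case False
  obtain \<xi> where \<xi>: "\<xi> \<in> \<Xi>" "norm \<xi> < 2" using small_center by blast
  have n1: "1 \<le> norm \<xi>" by (rule norm_center[OF \<xi>(1)])
  have "norm (u - \<xi>) \<le> norm u + norm \<xi>" by (rule norm_triangle_ineq4)
  also have "\<dots> \<le> 3" using False \<xi>(2) by simp
  also have "3 \<le> R\<^sub>0 * s \<xi>"
  proof (cases "\<alpha> \<le> 1")
    case True
    have "1 \<le> s \<xi>" using n1 True by (simp add: local_scale_def ge_one_powr_ge_zero)
    then have "3 * 1 \<le> R\<^sub>0 * s \<xi>" using R0 True by (intro mult_mono) auto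
    then show ?thesis by simp
  next
    case False
    have "2 powr (1 - \<alpha>) \<le> s \<xi>" unfolding local_scale_def
      using n1 \<xi>(2) False by (intro powr_mono2') auto
    then have "(3 * 2 powr (\<alpha> - 1)) * 2 powr (1 - \<alpha>) \<le> R\<^sub>0 * s \<xi>"
      using R0 False order_trans[OF _ less_imp_le[OF R0], of 0] by (intro mult_mono) auto
    moreover have "(3 * 2 powr (\<alpha> - 1)) * 2 powr (1 - \<alpha>) = (3::real)"
      by (simp add: mult.assoc powr_add[symmetric])
    ultimately show ?thesis by simp
  qed
  finally show ?thesis using \<xi>(1) by blast
qed

text \<open>
  Bounded overlap, by comparing volumes: the disjoint balls around the neighbours of \<open>\<xi>\<close> have
  radius comparable to \<open>s \<xi>\<close> and lie in a ball around \<open>\<xi>\<close> of comparable radius.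
\<close>

lemma neighbours_card:
  assumes R: "0 < R"
  shows "\<exists>m::nat. \<forall>\<xi>\<in>\<Xi>. finite {\<eta>\<in>\<Xi>. neighbours \<alpha> R \<xi> \<eta>} \<and> card {\<eta>\<in>\<Xi>. neighbours \<alpha> R \<xi> \<eta>} \<le> m"
proof -
  obtain \<Lambda> where \<Lambda>: "\<Lambda> \<ge> 1" and cmp: "\<forall>\<xi> \<eta> :: real^'n. 1 \<le> norm \<xi> \<longrightarrow> 1 \<le> norm \<eta> \<longrightarrow> neighbours \<alpha> R \<xi> \<eta> \<longrightarrow>
    norm \<xi> \<le> \<Lambda> * norm \<eta> \<and> norm \<eta> \<le> \<Lambda> * norm \<xi> \<and> s \<xi> \<le> \<Lambda> * s \<eta> \<and> s \<eta> \<le> \<Lambda> * s \<xi>"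
    using neighbours_comparable[OF \<alpha> R] by blast
  define D where "D = R * \<Lambda> + R + a * \<rho>"
  have D: "D > 0" using R \<Lambda> a \<rho> by (simp add: D_def add_pos_pos)
  define m where "m = nat \<lceil>(D * \<Lambda> / (a * \<rho>)) ^ CARD('n)\<rceil>"
  have "finite {\<eta>\<in>\<Xi>. neighbours \<alpha> R \<xi> \<eta>} \<and> card {\<eta>\<in>\<Xi>. neighbours \<alpha> R \<xi> \<eta>} \<le> m" if \<xi>: "\<xi> \<in> \<Xi>" for \<xi>
  proof (rule finite_if_finite_subsets_card_bdd)
    fix F assume F: "F \<subseteq> {\<eta>\<in>\<Xi>. neighbours \<alpha> R \<xi> \<eta>}" "finite F"
    define r where "r = a * \<rho> * s \<xi> / \<Lambda>"
    have s\<xi>: "s \<xi> > 0" by (rule scale_pos[OF \<xi>])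
    have r: "r > 0" using a \<rho> s\<xi> \<Lambda> by (simp add: r_def)
    have scmp: "s \<xi> \<le> \<Lambda> * s \<eta>" "s \<eta> \<le> \<Lambda> * s \<xi>" if "\<eta> \<in> F" for \<eta>
      using cmp norm_center[OF \<xi>] norm_center[of \<eta>] that F(1) by blast+
    have sub: "ball \<eta> r \<subseteq> center_ball \<alpha> a \<rho> \<eta>" if "\<eta> \<in> F" for \<eta>
    proof
      fix v assume "v \<in> ball \<eta> r"
      then have "norm (v - \<eta>) < r" by (simp add: dist_norm norm_minus_commute)
      also have "r \<le> a * \<rho> * s \<eta>"
      proof -
        have "a * \<rho> * s \<xi> \<le> a * \<rho> * (\<Lambda> * s \<eta>)" using a \<rho> scmp[OF that] by (intro mult_left_mono) auto
        then show ?thesis using \<Lambda> by (simp add: r_def pos_divide_le_eq mult_ac)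
      qed
      finally show "v \<in> center_ball \<alpha> a \<rho> \<eta>" by (simp add: center_ball_def local_scale_def)
    qed
    have disj: "disjoint_family_on (\<lambda>\<eta>. ball \<eta> r) F"
      unfolding disjoint_family_on_def
    proof (intro ballI impI)
      fix \<eta> \<eta>' assume "\<eta> \<in> F" "\<eta>' \<in> F" "\<eta> \<noteq> \<eta>'"
      then show "ball \<eta> r \<inter> ball \<eta>' r = {}"
        using sub center_balls_disjoint[of \<eta> \<eta>'] F(1) by blast
    qed
    have big: "(\<Union>\<eta>\<in>F. ball \<eta> r) \<subseteq> ball \<xi> (D * s \<xi>)"
    proof
      fix v assume "v \<in> (\<Union>\<eta>\<in>F. ball \<eta> r)"
      then obtain \<eta> where \<eta>: "\<eta> \<in> F" "norm (v - \<eta>) < r" by (auto simp: dist_norm norm_minus_commute)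
      obtain u where u: "norm (u - \<xi>) < R * s \<xi>" "norm (u - \<eta>) < R * s \<eta>"
        using \<eta>(1) F(1) by (auto simp: neighbours_def)
      have "norm (v - \<xi>) \<le> norm (v - \<eta>) + norm (u - \<eta>) + norm (u - \<xi>)"
        using norm_triangle_ineq[of "v - \<eta>" "\<eta> - \<xi>"] norm_triangle_ineq[of "\<eta> - u" "u - \<xi>"]
        by (simp add: norm_minus_commute)
      also have "\<dots> < r + R * s \<eta> + R * s \<xi>" using u \<eta> by simp
      also have "\<dots> \<le> a * \<rho> * s \<xi> + R * (\<Lambda> * s \<xi>) + R * s \<xi>"
      proof (intro add_mono mult_left_mono order_refl scmp \<eta>)
        have "a * \<rho> * s \<xi> * 1 \<le> a * \<rho> * s \<xi> * \<Lambda>" using a \<rho> s\<xi> \<Lambda> by (intro mult_left_mono) auto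
        then show "r \<le> a * \<rho> * s \<xi>" using \<Lambda> by (simp add: r_def pos_divide_le_eq)
      qed (use R in auto)
      also have "\<dots> = D * s \<xi>" by (simp add: D_def algebra_simps)
      finally show "v \<in> ball \<xi> (D * s \<xi>)" by (simp add: dist_norm norm_minus_commute)
    qed
    let ?\<nu> = "unit_ball_vol (real CARD('n))"
    have "real (card F) * (?\<nu> * r ^ CARD('n)) = (\<Sum>\<eta>\<in>F. measure lborel (ball \<eta> r))"
      using r by (simp add: content_ball)
    also have "\<dots> = measure lborel (\<Union>\<eta>\<in>F. ball \<eta> r)"
    proof (rule measure_finite_Union[symmetric, OF F(2) _ disj])
      show "emeasure lborel (ball \<eta> r) \<noteq> \<infinity>" for \<eta> :: "real^'n"
        using emeasure_bounded_finite[OF bounded_ball[of \<eta> r]] by simp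
    qed auto
    also have "\<dots> \<le> measure lborel (ball \<xi> (D * s \<xi>))"
    proof (rule measure_mono_fmeasurable[OF big])
      show "(\<Union>\<eta>\<in>F. ball \<eta> r) \<in> sets lborel" by (simp, intro borel_open open_UN ballI open_ball)
      show "ball \<xi> (D * s \<xi>) \<in> fmeasurable lborel"
        using emeasure_bounded_finite[OF bounded_ball[of \<xi> "D * s \<xi>"]] by (simp add: fmeasurable_def)
    qed
    also have "\<dots> = ?\<nu> * (D * s \<xi>) ^ CARD('n)"
      using D s\<xi> by (simp add: content_ball)
    finally have "?\<nu> * (real (card F) * r ^ CARD('n)) \<le> ?\<nu> * (D * s \<xi>) ^ CARD('n)" by (simp add: mult_ac)
    then have "real (card F) * r ^ CARD('n) \<le> (D * s \<xi>) ^ CARD('n)"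
      using unit_ball_vol_pos[of "real CARD('n)"] by simp
    then have "real (card F) \<le> (D * s \<xi> / r) ^ CARD('n)" using r by (simp add: power_divide pos_le_divide_eq)
    also have "D * s \<xi> / r = D * \<Lambda> / (a * \<rho>)" using s\<xi> a \<rho> \<Lambda> by (simp add: r_def)
    finally have "real (card F) \<le> (D * \<Lambda> / (a * \<rho>)) ^ CARD('n)" .
    then have "\<lceil>real (card F)\<rceil> \<le> \<lceil>(D * \<Lambda> / (a * \<rho>)) ^ CARD('n)\<rceil>" by (rule ceiling_mono)
    then show "card F \<le> m" by (simp add: m_def)
  qed
  then show ?thesis by blast
qed

end


section \<open>Packets and the Fourier multiplier of their frame operator\<close>

lemma integrable_inverse_one_plus_square: "integrable lborel (\<lambda>x::real. 1 / (1 + x\<^sup>2))"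
proof -
  let ?f = "\<lambda>x::real. 1 / (1 + x\<^sup>2)"
  have pos: "0 < 1 + x\<^sup>2" for x :: real by (simp add: add_pos_nonneg)
  have half: "(\<integral>\<^sup>+x. ennreal (?f x) * indicator {0..} x \<partial>lborel) = ennreal (pi / 2 - arctan 0)"
  proof (rule nn_integral_FTC_atLeast)
    show "DERIV arctan x :> ?f x" for x using DERIV_arctan[of x] by (simp add: inverse_eq_divide)
    show "(arctan \<longlongrightarrow> pi / 2) at_top" by (rule tendsto_arctan_at_top)
  qed auto
  have refl: "(\<integral>\<^sup>+x. ennreal (?f x) * indicator {0..} (- x) \<partial>lborel)
      = (\<integral>\<^sup>+x. ennreal (?f x) * indicator {0..} x \<partial>lborel)"
    by (subst (2) nn_integral_lborel_affine[where s="-1" and c=0]) auto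
  have "(\<integral>\<^sup>+x. ennreal (norm (?f x)) \<partial>lborel)
      \<le> (\<integral>\<^sup>+x. (ennreal (?f x) * indicator {0..} x + ennreal (?f x) * indicator {0..} (- x)) \<partial>lborel)"
  proof (rule nn_integral_mono)
    fix x :: real
    show "ennreal (norm (?f x)) \<le> ennreal (?f x) * indicator {0..} x + ennreal (?f x) * indicator {0..} (- x)"
      using pos[of x] by (cases "0 \<le> x") (auto simp: indicator_def)
  qed
  also have "\<dots> = (\<integral>\<^sup>+x. ennreal (?f x) * indicator {0..} x \<partial>lborel) + (\<integral>\<^sup>+x. ennreal (?f x) * indicator {0..} (- x) \<partial>lborel)"
    by (rule nn_integral_add) auto
  also have "\<dots> < \<infinity>" unfolding refl half by simp
  finally show ?thesis by (intro integrableI_bounded) auto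
qed

lemma smooth_continuous: "smooth f \<Longrightarrow> continuous_on S (iterated_partial is f)"
  by (intro continuous_at_imp_continuous_on ballI differentiable_imp_continuous_within)
    (simp add: smooth_def)

text \<open>
  Comparison with the integrable product of the functions \<open>1 / (1 + t\<^sub>i\<^sup>2)\<close>.
\<close>

lemma schwartz_integrable:
  fixes \<phi> :: "real^'n::finite \<Rightarrow> real"
  assumes \<phi>: "schwartz \<phi>"
  shows "integrable lborel (\<lambda>t. complex_of_real (\<phi> t))"
proof -
  have cont: "continuous_on UNIV \<phi>"
    using smooth_continuous[of \<phi> UNIV "[]"] \<phi> by (simp add: schwartz_def)
  have m [measurable]: "\<phi> \<in> borel_measurable borel" by (rule borel_measurable_continuous_onI[OF cont])
  obtain K where K: "\<And>x. (1 + norm x) ^ (2 * CARD('n)) * norm (iterated_partial [] \<phi> x) \<le> K"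
    using \<phi> unfolding schwartz_def by blast
  let ?g = "\<lambda>t::real^'n. \<Prod>i\<in>UNIV. complex_of_real (1 / (1 + (t $ i)\<^sup>2))"
  have g: "integrable lborel ?g"
    by (rule integral_prod_cart(1)) (simp add: integrable_inverse_one_plus_square del: of_real_divide)
  have pos: "0 < 1 + x\<^sup>2" for x :: real by (simp add: add_pos_nonneg)
  have bound: "\<bar>\<phi> t\<bar> \<le> \<bar>K\<bar> * (\<Prod>i\<in>UNIV. 1 / (1 + (t $ i)\<^sup>2))" for t
  proof -
    have "(\<Prod>i\<in>UNIV. 1 + (t $ i)\<^sup>2) \<le> (\<Prod>i\<in>(UNIV::'n set). (1 + norm t)\<^sup>2)"
    proof (rule prod_mono)
      fix i
      have "(t $ i)\<^sup>2 \<le> (norm t)\<^sup>2" using component_le_norm_cart[of t i] by (simp add: abs_le_square_iff[symmetric])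
      then show "0 \<le> 1 + (t $ i)\<^sup>2 \<and> 1 + (t $ i)\<^sup>2 \<le> (1 + norm t)\<^sup>2"
        by (simp add: power2_sum add_increasing2)
    qed
    also have "\<dots> = (1 + norm t) ^ (2 * CARD('n))" by (simp add: power_mult[symmetric])
    finally have "(\<Prod>i\<in>UNIV. 1 + (t $ i)\<^sup>2) * \<bar>\<phi> t\<bar> \<le> (1 + norm t) ^ (2 * CARD('n)) * \<bar>\<phi> t\<bar>"
      by (rule mult_right_mono) simp
    also have "\<dots> \<le> K" using K[of t] by simp
    finally have "(\<Prod>i\<in>UNIV. 1 + (t $ i)\<^sup>2) * \<bar>\<phi> t\<bar> \<le> \<bar>K\<bar>" by simp
    moreover have "0 < (\<Prod>i\<in>UNIV. 1 + (t $ i)\<^sup>2)" by (intro prod_pos) (simp add: pos)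
    ultimately show ?thesis by (simp add: prod_dividef pos_le_divide_eq mult.commute)
  qed
  show ?thesis
  proof (rule Bochner_Integration.integrable_bound)
    show "integrable lborel (\<lambda>t. of_real \<bar>K\<bar> * ?g t)" using g by (rule integrable_mult_right)
    show "AE t in lborel. norm (complex_of_real (\<phi> t)) \<le> norm (of_real \<bar>K\<bar> * ?g t)"
    proof (rule AE_I2)
      fix t :: "real^'n"
      let ?p = "\<Prod>i\<in>UNIV. 1 / (1 + (t $ i)\<^sup>2)"
      have "?g t = complex_of_real ?p" by (simp only: of_real_prod)
      moreover have "0 \<le> ?p" by (intro prod_nonneg divide_nonneg_pos ballI) (simp_all only: pos zero_le_one)
      ultimately have "norm (of_real \<bar>K\<bar> * ?g t) = \<bar>K\<bar> * ?p"
        by (simp only: norm_mult norm_of_real abs_abs abs_of_nonneg)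
      then show "norm (complex_of_real (\<phi> t)) \<le> norm (of_real \<bar>K\<bar> * ?g t)" using bound[of t] by (simp only: norm_of_real)
    qed
  qed measurable
qed

lemma borel_measurable_nn_integral_count_space:
  fixes f :: "'i \<Rightarrow> 'a \<Rightarrow> ennreal"
  assumes "countable I" and f: "\<And>i. i \<in> I \<Longrightarrow> f i \<in> borel_measurable N"
  shows "(\<lambda>x. \<integral>\<^sup>+i. f i x \<partial>count_space I) \<in> borel_measurable N"
proof -
  interpret sigma_finite_measure "count_space I" by (rule sigma_finite_measure_count_space_countable) fact
  have "(\<lambda>p. f (fst p) (snd p)) \<in> borel_measurable (count_space I \<Otimes>\<^sub>M N)"
    by (rule measurable_pair_measure_countable1[OF assms(1)]) (simp add: f)
  from measurable_pair_swap[OF this]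
  have "(\<lambda>(x, i). f i x) \<in> borel_measurable (N \<Otimes>\<^sub>M count_space I)" by (simp add: case_prod_unfold)
  then show ?thesis by (rule borel_measurable_nn_integral)
qed

locale subdyadic_packets = subdyadic_center_set \<alpha> a \<rho> \<Xi>
  for \<alpha> a \<rho> :: real and \<Xi> :: "(real^'n::finite) set" +
  fixes b R\<^sub>0 R\<^sub>1 m\<^sub>0 :: real and \<phi> :: "real^'n \<Rightarrow> real"
  assumes b: "0 < b" and schwartz: "schwartz \<phi>" and normalized: "(LINT t|lborel. (\<phi> t)\<^sup>2) = 1"
    and smooth_hat: "smooth (fourier (\<lambda>t. complex_of_real (\<phi> t)))"
    and compact_hat: "compact (support (fourier (\<lambda>t. complex_of_real (\<phi> t))))"
    and support_hat: "support (fourier (\<lambda>t. complex_of_real (\<phi> t))) \<subseteq> ball 0 R\<^sub>1"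
    and m0: "0 < m\<^sub>0"
    and hat_lower: "\<And>\<zeta>. norm \<zeta> \<le> R\<^sub>0 \<Longrightarrow> m\<^sub>0 \<le> cmod (fourier (\<lambda>t. complex_of_real (\<phi> t)) \<zeta>)"
    and R: "0 < R\<^sub>0" "R\<^sub>0 < R\<^sub>1"
    and cover: "\<And>u. \<exists>\<xi>\<in>\<Xi>. norm (u - \<xi>) \<le> R\<^sub>0 * local_scale \<alpha> \<xi>"
    and band: "b * \<rho> * R\<^sub>1 < pi"
begin

definition hat :: "real^'n \<Rightarrow> complex" where "hat = fourier (\<lambda>t. complex_of_real (\<phi> t))"

abbreviation "\<beta> \<equiv> b * \<rho>"

definition lattice :: "((real^'n) \<times> (real^'n)) set" where
  "lattice = {((b * \<rho> * norm \<xi> powr (\<alpha> - 1)) *\<^sub>R (\<chi> i. real_of_int (j $ i)), \<xi>) | \<xi> (j :: int^'n). \<xi> \<in> \<Xi>}"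

lemma beta_pos: "0 < \<beta>" using b \<rho> by simp

lemma hat_zero: "R\<^sub>1 \<le> norm \<zeta> \<Longrightarrow> hat \<zeta> = 0"
proof (rule ccontr)
  assume "R\<^sub>1 \<le> norm \<zeta>" "hat \<zeta> \<noteq> 0"
  moreover have "\<zeta> \<in> support hat" if "hat \<zeta> \<noteq> 0"
    using closure_subset[of "{x. hat x \<noteq> 0}"] that by (auto simp: support_def)
  ultimately show False using support_hat unfolding hat_def[symmetric] by auto
qed

lemma hat_partial_zero: "x \<notin> support hat \<Longrightarrow> iterated_partial is hat x = 0"
proof (induction "is" arbitrary: x)
  case Nil
  then show ?case using closure_subset[of "{x. hat x \<noteq> 0}"] by (auto simp: support_def)
next
  case (Cons i "is")
  have op: "open (- support hat)" by (simp add: support_def open_Compl)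
  have "((\<lambda>_. 0 :: complex) has_derivative (\<lambda>_. 0)) (at x)" by simp
  then have "(iterated_partial is hat has_derivative (\<lambda>_. 0)) (at x)"
    by (rule has_derivative_transform_within_open[OF _ op]) (use Cons in auto)
  from frechet_derivative_at[OF this] show ?case by (metis iterated_partial.simps(2))
qed

lemma hat_partial_bounded: "\<exists>K. \<forall>x. cmod (iterated_partial is hat x) \<le> K"
proof -
  have "bounded (iterated_partial is hat ` support hat)"
    using compact_hat smooth_hat unfolding hat_def[symmetric]
    by (intro compact_imp_bounded compact_continuous_image smooth_continuous)
  then obtain K where K: "\<And>x. x \<in> support hat \<Longrightarrow> cmod (iterated_partial is hat x) \<le> K"
    by (auto simp: bounded_iff)
  have "cmod (iterated_partial is hat x) \<le> max K 0" for x
    using K[of x] hat_partial_zero[of x "is"] by (cases "x \<in> support hat") auto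
  then show ?thesis by blast
qed

lemma hat_continuous: "continuous_on S hat"
  using smooth_continuous[OF smooth_hat, of S "[]"] by (simp add: hat_def)

lemma hat_measurable [measurable]: "hat \<in> borel_measurable borel"
  by (rule borel_measurable_continuous_onI[OF hat_continuous])

lemma hat_bounded: obtains B where "0 \<le> B" "\<And>\<zeta>. cmod (hat \<zeta>) \<le> B"
proof -
  obtain K where K: "\<forall>x. cmod (iterated_partial [] hat x) \<le> K" using hat_partial_bounded[of "[]"] by blast
  then have "0 \<le> K" using norm_ge_zero order_trans by blast
  then show thesis using K by (intro that[of K]) auto
qed

lemma hat_partial_line:
  "((\<lambda>\<tau>. iterated_partial is hat (\<zeta> + \<tau> *\<^sub>R axis i 1)) has_vector_derivative
    iterated_partial (i # is) hat (\<zeta> + \<tau> *\<^sub>R axis i 1)) (at \<tau>)"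
proof -
  let ?f = "iterated_partial is hat" and ?x = "\<zeta> + \<tau> *\<^sub>R axis i 1"
  have "?f differentiable at ?x" using smooth_hat by (simp add: smooth_def hat_def)
  then have D: "(?f has_derivative frechet_derivative ?f (at ?x)) (at ?x)"
    by (simp add: frechet_derivative_works)
  have "((\<lambda>\<tau>. \<zeta> + \<tau> *\<^sub>R axis i 1) has_derivative (\<lambda>h. h *\<^sub>R axis i 1)) (at \<tau>)"
    by (auto intro!: derivative_eq_intros)
  from diff_chain_at[OF this D]
  have "((\<lambda>\<tau>. ?f (\<zeta> + \<tau> *\<^sub>R axis i 1)) has_derivative (\<lambda>h. frechet_derivative ?f (at ?x) (h *\<^sub>R axis i 1))) (at \<tau>)"
    by (simp add: o_def)
  moreover have "frechet_derivative ?f (at ?x) (h *\<^sub>R axis i 1) = h *\<^sub>R frechet_derivative ?f (at ?x) (axis i 1)" for h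
    using linear_frechet_derivative[of ?f "at ?x"] \<open>?f differentiable at ?x\<close> by (simp add: linear_scale)
  ultimately show ?thesis by (simp add: has_vector_derivative_def)
qed

text \<open>
  Only derivatives along coordinate lines enter, and these are iterated partial derivatives in one direction;
  \<open>k\<close> of them have been taken already.
\<close>

lemma hat_line_bounded:
  "deriv_bounded n UNIV (\<lambda>_. UNIV) (\<lambda>(\<zeta>, i) \<tau>. iterated_partial (replicate k i) hat (\<zeta> + \<tau> *\<^sub>R axis i 1))"
proof (induction n arbitrary: k)
  have bound: "\<exists>K. \<forall>i x. cmod (iterated_partial (replicate k i) hat x) \<le> K" for k
  proof -
    have "\<forall>i. \<exists>K. \<forall>x. cmod (iterated_partial (replicate k i) hat x) \<le> K" using hat_partial_bounded by blast
    then obtain K where K: "\<forall>i x. cmod (iterated_partial (replicate k i) hat x) \<le> K i" by metis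
    have "cmod (iterated_partial (replicate k i) hat x) \<le> Max (range K)" for i x
      using K Max_ge[of "range K" "K i"] by (meson finite_class.finite_UNIV finite_imageI order_trans rangeI)
    then show ?thesis by blast
  qed
  {
    case 0
    then show ?case using bound[of k] by auto
  next
    case (Suc n)
    obtain K where K: "\<forall>i x. cmod (iterated_partial (replicate k i) hat x) \<le> K" using bound by blast
    show ?case
    proof (rule deriv_bounded_SucI[OF _ _ Suc.IH[of "Suc k"], where K=K])
      fix p :: "(real^'n) \<times> 'n" and \<tau> :: real
      show "cmod ((case p of (\<zeta>, i) \<Rightarrow> \<lambda>\<tau>. iterated_partial (replicate k i) hat (\<zeta> + \<tau> *\<^sub>R axis i 1)) \<tau>) \<le> K"
        using K by (cases p) simp
      show "((case p of (\<zeta>, i) \<Rightarrow> \<lambda>\<tau>. iterated_partial (replicate k i) hat (\<zeta> + \<tau> *\<^sub>R axis i 1))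
          has_vector_derivative (case p of (\<zeta>, i) \<Rightarrow> \<lambda>\<tau>. iterated_partial (replicate (Suc k) i) hat (\<zeta> + \<tau> *\<^sub>R axis i 1)) \<tau>) (at \<tau>)"
      proof (cases p)
        case (Pair \<zeta> i)
        show ?thesis unfolding Pair case_prod_conv replicate_Suc by (rule hat_partial_line)
      qed
    qed
  }
qed

lemma profile_L2: "(\<lambda>t. complex_of_real (\<phi> t)) \<in> L2_space lborel"
proof (rule L2_spaceI)
  \<comment> \<open>A function that is not integrable has integral 0, not 1.\<close>
  have "integrable lborel (\<lambda>t. (\<phi> t)\<^sup>2)" using normalized not_integrable_integral_eq by fastforce
  then show "integrable lborel (\<lambda>t. (cmod (complex_of_real (\<phi> t)))\<^sup>2)" by simp
  show "(\<lambda>t. complex_of_real (\<phi> t)) \<in> borel_measurable lborel"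
    using schwartz_integrable[OF schwartz] by auto
qed

definition packet_hat :: "(real^'n) \<times> (real^'n) \<Rightarrow> real^'n \<Rightarrow> complex" where
  "packet_hat = (\<lambda>(x, \<xi>) \<eta>. of_real (s \<xi> powr (- (real CARD('n) / 2))) * hat ((1 / s \<xi>) *\<^sub>R (\<eta> - \<xi>)) *
     exp (- \<i> * complex_of_real (x \<bullet> (\<eta> - \<xi>))))"

lemma packet_hat_measurable [measurable]: "packet_hat z \<in> borel_measurable borel"
  unfolding packet_hat_def case_prod_unfold by measurable

lemma packet_hat_compact:
  assumes "\<xi> \<in> \<Xi>" shows "L2_compact (packet_hat (x, \<xi>))"
proof -
  obtain B where B: "0 \<le> B" "\<And>\<zeta>. cmod (hat \<zeta>) \<le> B" by (rule hat_bounded) blast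
  have s: "0 < s \<xi>" by (rule scale_pos[OF assms])
  let ?c = "s \<xi> powr (- (real CARD('n) / 2))"
  have bd: "cmod (packet_hat (x, \<xi>) \<eta>) \<le> ?c * B" for \<eta>
    using B(2) by (simp add: packet_hat_def norm_mult mult_left_mono)
  have zero: "packet_hat (x, \<xi>) \<eta> = 0" if "norm \<xi> + R\<^sub>1 * s \<xi> < norm \<eta>" for \<eta>
  proof -
    have "norm \<eta> \<le> norm \<xi> + norm (\<eta> - \<xi>)" using norm_triangle_ineq[of \<xi> "\<eta> - \<xi>"] by simp
    then have "R\<^sub>1 * s \<xi> \<le> norm (\<eta> - \<xi>)" using that by simp
    then have "R\<^sub>1 \<le> norm ((1 / s \<xi>) *\<^sub>R (\<eta> - \<xi>))" using s by (simp add: pos_le_divide_eq)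
    then show ?thesis by (simp add: packet_hat_def hat_zero)
  qed
  have "packet_hat (x, \<xi>) \<in> L2_space lborel"
  proof (rule L2_spaceI)
    let ?g = "\<lambda>\<eta>. complex_of_real ((cmod (packet_hat (x, \<xi>) \<eta>))\<^sup>2)"
    have "integrable lborel ?g"
    proof (rule integrable_bounded_support(1)[where B="(?c * B)\<^sup>2" and \<rho>="norm \<xi> + R\<^sub>1 * s \<xi>"])
      show "cmod (?g \<eta>) \<le> (?c * B)\<^sup>2" for \<eta>
        using power_mono[OF bd[of \<eta>] norm_ge_zero, of 2] by (simp add: norm_power)
    qed (use zero in auto)
    then show "integrable lborel (\<lambda>\<eta>. (cmod (packet_hat (x, \<xi>) \<eta>))\<^sup>2)" by (simp only: complex_of_real_integrable_eq)
  qed measurable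
  then show ?thesis using zero unfolding L2_compact_def by blast
qed

lemma packet_coeff: "norm \<xi> powr (real CARD('n) / 2 * (1 - \<alpha>)) = s \<xi> powr (real CARD('n) / 2)"
  by (simp add: local_scale_def powr_powr mult.commute)

lemma packet_pair:
  assumes \<xi>: "\<xi> \<in> \<Xi>" shows "fourier_pair (packet \<alpha> \<phi> (x, \<xi>)) (packet_hat (x, \<xi>))"
proof -
  have s: "0 < s \<xi>" by (rule scale_pos[OF \<xi>])
  let ?c = "s \<xi> powr (real CARD('n) / 2)" and ?P = "packet \<alpha> \<phi> (x, \<xi>)"
  have P: "?P t = of_real ?c * of_real (\<phi> (s \<xi> *\<^sub>R (t - x))) * exp (\<i> * complex_of_real (t \<bullet> \<xi>))" for t
    by (simp only: packet_def case_prod_conv packet_coeff local_scale_def[symmetric] of_real_mult)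
  have dil: "(\<lambda>t. complex_of_real (\<phi> (s \<xi> *\<^sub>R (t - x)))) = (\<lambda>t. complex_of_real (\<phi> (- (s \<xi> *\<^sub>R x) + s \<xi> *\<^sub>R t)))"
    by (simp add: scaleR_diff_right)
  have L2: "(\<lambda>t. complex_of_real (\<phi> (s \<xi> *\<^sub>R (t - x)))) \<in> L2_space lborel"
    unfolding dil by (rule L2_space_affine[OF profile_L2]) (use s in simp)
  have int: "integrable lborel (\<lambda>t. complex_of_real (\<phi> (s \<xi> *\<^sub>R (t - x))))"
    unfolding dil by (rule lborel_integrable_affine[OF schwartz_integrable[OF schwartz]]) (use s in simp)
  have [measurable]: "(\<lambda>t. complex_of_real (\<phi> (s \<xi> *\<^sub>R (t - x)))) \<in> borel_measurable borel" using int by auto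
  have Pm [measurable]: "?P \<in> borel_measurable borel" unfolding P[abs_def] by measurable
  have PL2: "?P \<in> L2_space lborel"
    by (rule L2_space_bound[OF L2, of _ ?c]) (auto simp: P norm_mult)
  have Pint: "integrable lborel ?P"
    by (rule Bochner_Integration.integrable_bound[OF integrable_mult_right[OF int, of "of_real ?c"]])
      (auto simp: P norm_mult)
  have "fourier ?P \<eta> = packet_hat (x, \<xi>) \<eta>" for \<eta>
  proof -
    have "fourier ?P \<eta> = \<bar>1 / s \<xi>\<bar> ^ DIM(real^'n) *\<^sub>R
        (LINT u|lborel. ?P (x + (1 / s \<xi>) *\<^sub>R u) * exp (- \<i> * complex_of_real ((x + (1 / s \<xi>) *\<^sub>R u) \<bullet> \<eta>)))"
      unfolding fourier_def by (rule lborel_integral_affine) (use s in auto)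
    also have "(LINT u|lborel. ?P (x + (1 / s \<xi>) *\<^sub>R u) * exp (- \<i> * complex_of_real ((x + (1 / s \<xi>) *\<^sub>R u) \<bullet> \<eta>)))
        = (LINT u|lborel. (of_real ?c * exp (- \<i> * complex_of_real (x \<bullet> (\<eta> - \<xi>)))) *
          (complex_of_real (\<phi> u) * exp (- \<i> * complex_of_real (u \<bullet> ((1 / s \<xi>) *\<^sub>R (\<eta> - \<xi>))))))"
    proof (rule Bochner_Integration.integral_cong[OF refl])
      fix u
      have "exp (\<i> * complex_of_real ((x + (1 / s \<xi>) *\<^sub>R u) \<bullet> \<xi>)) * exp (- \<i> * complex_of_real ((x + (1 / s \<xi>) *\<^sub>R u) \<bullet> \<eta>))
          = exp (- \<i> * complex_of_real (x \<bullet> (\<eta> - \<xi>))) * exp (- \<i> * complex_of_real (u \<bullet> ((1 / s \<xi>) *\<^sub>R (\<eta> - \<xi>))))"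
        unfolding mult_exp_exp
        by (rule arg_cong[of _ _ exp]) (simp add: inner_add_left inner_diff_right algebra_simps diff_divide_distrib)
      then show "?P (x + (1 / s \<xi>) *\<^sub>R u) * exp (- \<i> * complex_of_real ((x + (1 / s \<xi>) *\<^sub>R u) \<bullet> \<eta>))
          = (of_real ?c * exp (- \<i> * complex_of_real (x \<bullet> (\<eta> - \<xi>)))) *
          (complex_of_real (\<phi> u) * exp (- \<i> * complex_of_real (u \<bullet> ((1 / s \<xi>) *\<^sub>R (\<eta> - \<xi>)))))"
        using s by (simp only: P mult.assoc) (simp add: mult_ac)
    qed
    also have "\<dots> = (of_real ?c * exp (- \<i> * complex_of_real (x \<bullet> (\<eta> - \<xi>)))) * hat ((1 / s \<xi>) *\<^sub>R (\<eta> - \<xi>))"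
      unfolding hat_def fourier_def by (rule integral_mult_right_zero)
    finally have "fourier ?P \<eta> = of_real ((1 / s \<xi>) ^ CARD('n) * ?c) *
        (exp (- \<i> * complex_of_real (x \<bullet> (\<eta> - \<xi>))) * hat ((1 / s \<xi>) *\<^sub>R (\<eta> - \<xi>)))"
      using s by (simp add: scaleR_conv_of_real)
    also have "(1 / s \<xi>) ^ CARD('n) * ?c = s \<xi> powr (- (real CARD('n) / 2))"
    proof -
      have "(1 / s \<xi>) ^ CARD('n) = s \<xi> powr (- real CARD('n))"
        using s by (simp add: powr_minus powr_realpow power_one_over inverse_eq_divide)
      then show ?thesis using s by (simp add: powr_add[symmetric])
    qed
    finally show ?thesis by (simp add: packet_hat_def)
  qed
  then have eq: "fourier ?P = packet_hat (x, \<xi>)" by (rule ext)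
  show ?thesis
    using fourier_pair_integrable[OF PL2 Pint] L2_compact_L2[OF packet_hat_compact[OF \<xi>, of x]] by (simp only: eq)
qed

text \<open>
  In the coordinate \<open>\<zeta> = (u - \<xi>) / s \<xi>\<close> the coefficients are samples with spacing \<open>\<beta>\<close> of a Fourier transform, and the
  band condition places the support of \<open>hat\<close> in a cube of side \<open>2 * pi / \<beta>\<close>.
\<close>

lemma center_coefficients:
  assumes \<xi>: "\<xi> \<in> \<Xi>" and F: "F \<in> L2_space lborel"
  shows "(\<integral>\<^sup>+j. ennreal ((cmod (L2_inner lborel F (packet_hat ((\<beta> / s \<xi>) *\<^sub>R int_vec j, \<xi>))))\<^sup>2) \<partial>count_space UNIV)
    = ennreal ((2 * pi / \<beta>) ^ CARD('n)) * (\<integral>\<^sup>+\<eta>. ennreal ((cmod (F \<eta>))\<^sup>2 * (cmod (hat ((1 / s \<xi>) *\<^sub>R (\<eta> - \<xi>))))\<^sup>2) \<partial>lborel)"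
proof -
  have s: "0 < s \<xi>" by (rule scale_pos[OF \<xi>])
  have Fm [measurable]: "F \<in> borel_measurable borel" using L2_measurable[OF F] by simp
  obtain B where B: "0 \<le> B" "\<And>\<zeta>. cmod (hat \<zeta>) \<le> B" by (rule hat_bounded) blast
  define g where "g \<zeta> = cnj (F (\<xi> + s \<xi> *\<^sub>R \<zeta>)) * hat \<zeta>" for \<zeta>
  have gm [measurable]: "g \<in> borel_measurable borel" unfolding g_def[abs_def] by measurable
  have g: "g \<in> L2_space lborel"
  proof (rule L2_space_bound[OF L2_space_affine[OF F], of "s \<xi>" g B \<xi>])
    show "cmod (g \<zeta>) \<le> B * cmod (F (\<xi> + s \<xi> *\<^sub>R \<zeta>))" for \<zeta>
      using mult_left_mono[OF B(2)[of \<zeta>] norm_ge_zero[of "F (\<xi> + s \<xi> *\<^sub>R \<zeta>)"]]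
      by (simp add: g_def norm_mult mult.commute)
  qed (use s in auto)
  have g0: "\<bar>\<zeta> $ i\<bar> < pi / \<beta>" if "g \<zeta> \<noteq> 0" for \<zeta> i
  proof -
    have "norm \<zeta> < R\<^sub>1" using that hat_zero[of \<zeta>] by (force simp: g_def not_le[symmetric])
    moreover have "R\<^sub>1 < pi / \<beta>" using band beta_pos by (simp add: pos_less_divide_eq mult.commute)
    ultimately show ?thesis using component_le_norm_cart[of \<zeta> i] by linarith
  qed
  let ?J = "\<lambda>j. LINT t|lborel. g t * exp (- \<i> * complex_of_real (\<beta> * (int_vec j \<bullet> t)))"
  have inner: "(cmod (L2_inner lborel F (packet_hat ((\<beta> / s \<xi>) *\<^sub>R int_vec j, \<xi>))))\<^sup>2 = s \<xi> ^ CARD('n) * (cmod (?J j))\<^sup>2" for j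
  proof -
    let ?z = "((\<beta> / s \<xi>) *\<^sub>R int_vec j, \<xi>)" and ?c = "s \<xi> powr (- (real CARD('n) / 2))"
    have ph: "packet_hat ?z (\<xi> + s \<xi> *\<^sub>R \<zeta>) = of_real ?c * (hat \<zeta> * exp (- \<i> * complex_of_real (\<beta> * (int_vec j \<bullet> \<zeta>))))" for \<zeta>
      using s by (simp add: packet_hat_def mult.assoc)
    have "L2_inner lborel F (packet_hat ?z)
        = \<bar>s \<xi>\<bar> ^ DIM(real^'n) *\<^sub>R (LINT \<zeta>|lborel. F (\<xi> + s \<xi> *\<^sub>R \<zeta>) * cnj (packet_hat ?z (\<xi> + s \<xi> *\<^sub>R \<zeta>)))"
      unfolding L2_inner_def by (rule lborel_integral_affine) (use s in auto)
    also have "(LINT \<zeta>|lborel. F (\<xi> + s \<xi> *\<^sub>R \<zeta>) * cnj (packet_hat ?z (\<xi> + s \<xi> *\<^sub>R \<zeta>)))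
        = (LINT \<zeta>|lborel. of_real ?c * cnj (g \<zeta> * exp (- \<i> * complex_of_real (\<beta> * (int_vec j \<bullet> \<zeta>)))))"
      unfolding ph by (intro Bochner_Integration.integral_cong refl) (simp add: g_def mult_ac)
    also have "\<dots> = of_real ?c * cnj (?J j)"
      by (simp only: integral_mult_right_zero Bochner_Integration.integral_cnj)
    finally have "cmod (L2_inner lborel F (packet_hat ?z)) = (s \<xi> ^ CARD('n) * ?c) * cmod (?J j)"
      using s by (simp add: norm_mult)
    also have "s \<xi> ^ CARD('n) * ?c = s \<xi> powr (real CARD('n) / 2)"
      using s by (simp add: powr_realpow[symmetric] powr_add[symmetric])
    finally show ?thesis using s
      by (simp add: power_mult_distrib power2_eq_square[of "s \<xi> powr _"] powr_add[symmetric] powr_realpow)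
  qed
  have norm_g: "(\<integral>\<^sup>+\<eta>. ennreal ((cmod (F \<eta>))\<^sup>2 * (cmod (hat ((1 / s \<xi>) *\<^sub>R (\<eta> - \<xi>))))\<^sup>2) \<partial>lborel)
      = ennreal (s \<xi> ^ CARD('n)) * ennreal ((L2_norm lborel g)\<^sup>2)"
  proof -
    have "(\<integral>\<^sup>+\<eta>. ennreal ((cmod (F \<eta>))\<^sup>2 * (cmod (hat ((1 / s \<xi>) *\<^sub>R (\<eta> - \<xi>))))\<^sup>2) \<partial>lborel)
      = ennreal (\<bar>s \<xi>\<bar> ^ DIM(real^'n)) * (\<integral>\<^sup>+\<zeta>. ennreal ((cmod (F (\<xi> + s \<xi> *\<^sub>R \<zeta>)))\<^sup>2 *
          (cmod (hat ((1 / s \<xi>) *\<^sub>R (\<xi> + s \<xi> *\<^sub>R \<zeta> - \<xi>))))\<^sup>2) \<partial>lborel)"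
      by (rule nn_integral_lborel_affine) (use s in auto)
    also have "(\<integral>\<^sup>+\<zeta>. ennreal ((cmod (F (\<xi> + s \<xi> *\<^sub>R \<zeta>)))\<^sup>2 *
          (cmod (hat ((1 / s \<xi>) *\<^sub>R (\<xi> + s \<xi> *\<^sub>R \<zeta> - \<xi>))))\<^sup>2) \<partial>lborel) = (\<integral>\<^sup>+\<zeta>. ennreal ((cmod (g \<zeta>))\<^sup>2) \<partial>lborel)"
      using s by (intro nn_integral_cong) (simp add: g_def norm_mult power_mult_distrib)
    finally show ?thesis using s by (simp add: L2_norm_nn_integral[OF g])
  qed
  have "(\<integral>\<^sup>+j. ennreal ((cmod (L2_inner lborel F (packet_hat ((\<beta> / s \<xi>) *\<^sub>R int_vec j, \<xi>))))\<^sup>2) \<partial>count_space UNIV)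
      = (\<integral>\<^sup>+j. ennreal (s \<xi> ^ CARD('n)) * ennreal ((cmod (?J j))\<^sup>2) \<partial>count_space UNIV)"
    using s by (intro nn_integral_cong) (simp add: inner ennreal_mult)
  also have "\<dots> = ennreal (s \<xi> ^ CARD('n)) * ennreal ((2 * pi / \<beta>) ^ CARD('n) * (L2_norm lborel g)\<^sup>2)"
  proof -
    have "(\<integral>\<^sup>+j. ennreal ((cmod (?J j))\<^sup>2) \<partial>count_space UNIV) = ennreal ((2 * pi / \<beta>) ^ CARD('n) * (L2_norm lborel g)\<^sup>2)"
      by (rule cube_Parseval_scaled[OF g beta_pos]) (rule g0)
    then show ?thesis by (simp only: nn_integral_cmult[OF borel_measurable_count_space])
  qed
  also have "\<dots> = ennreal ((2 * pi / \<beta>) ^ CARD('n)) * (ennreal (s \<xi> ^ CARD('n)) * ennreal ((L2_norm lborel g)\<^sup>2))"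
    using beta_pos s by (simp add: ennreal_mult mult_ac)
  finally show ?thesis by (simp only: norm_g)
qed

end

lemma infsum_eq_nn_integral:
  fixes g :: "'i \<Rightarrow> real"
  assumes pos: "\<And>i. 0 \<le> g i" and V: "(\<integral>\<^sup>+i. ennreal (g i) \<partial>count_space I) = ennreal V" "0 \<le> V"
  shows "g summable_on I" and "infsum g I = V"
proof -
  have int: "integrable (count_space I) g"
    by (rule integrableI_nn_integral_finite[OF _ _ V(1)]) (use pos in auto)
  then have "Infinite_Set_Sum.abs_summable_on g I" by (simp add: abs_summable_on_def)
  then have "Infinite_Sum.abs_summable_on g I" by (simp only: abs_summable_equivalent)
  then show "g summable_on I" using pos by simp
  have "infsum g I = infsetsum g I"
    by (rule infsetsum_infsum[symmetric]) (use int in \<open>simp add: abs_summable_on_def\<close>)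
  also have "\<dots> = (LINT i|count_space I. g i)" by (simp add: infsetsum_def)
  also have "\<dots> = V"
    by (rule integral_eq_nn_integral[THEN trans]) (use pos V in auto)
  finally show "infsum g I = V" .
qed

context subdyadic_packets
begin

lemma nn_integral_lattice:
  "(\<integral>\<^sup>+z. f z \<partial>count_space lattice)
    = (\<integral>\<^sup>+\<xi>. \<integral>\<^sup>+j. f ((\<beta> / s \<xi>) *\<^sub>R int_vec j, \<xi>) \<partial>count_space UNIV \<partial>count_space \<Xi>)"
proof -
  let ?h = "\<lambda>(\<xi>, j). ((\<beta> / s \<xi>) *\<^sub>R int_vec (j :: int^'n), \<xi>)"
  have co: "b * \<rho> * norm \<xi> powr (\<alpha> - 1) = \<beta> / s \<xi>" for \<xi> :: "real^'n"
    using powr_minus_divide[of "norm \<xi>" "1 - \<alpha>"] by (simp add: local_scale_def)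
  have lat: "lattice = ?h ` (\<Xi> \<times> (UNIV :: (int^'n) set))"
    unfolding lattice_def co int_vec_def by auto
  have inj: "inj_on ?h (\<Xi> \<times> UNIV)"
  proof (rule inj_onI)
    fix p q assume p: "p \<in> \<Xi> \<times> (UNIV :: (int^'n) set)" and q: "q \<in> \<Xi> \<times> (UNIV :: (int^'n) set)" and e: "?h p = ?h q"
    obtain \<xi> j \<eta> k where pq: "p = (\<xi>, j)" "q = (\<eta>, k)" by (cases p, cases q) auto
    have "\<xi> = \<eta>" using e pq by simp
    moreover have "\<beta> / s \<xi> \<noteq> 0" using b \<rho> scale_pos[of \<xi>] p pq by auto
    ultimately have "int_vec j = int_vec k" using e pq by simp
    then have "j = k" by (simp add: int_vec_def vec_eq_iff)
    then show "p = q" using pq \<open>\<xi> = \<eta>\<close> by simp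
  qed
  have "(\<integral>\<^sup>+z. f z \<partial>count_space lattice) = (\<integral>\<^sup>+p. f (?h p) \<partial>count_space (\<Xi> \<times> UNIV))"
    by (rule nn_integral_bij_count_space[symmetric]) (use inj lat in \<open>simp add: bij_betw_def\<close>)
  also have "\<dots> = (\<integral>\<^sup>+\<xi>. \<integral>\<^sup>+j. f (?h (\<xi>, j)) \<partial>count_space UNIV \<partial>count_space \<Xi>)"
    by (subst sigma_finite_measure.nn_integral_fst)
      (simp_all add: sigma_finite_measure_count_space_countable pair_measure_countable centers_countable)
  finally show ?thesis by simp
qed

definition overlap :: "real^'n \<Rightarrow> (real^'n) set" where
  "overlap u = {\<xi>\<in>\<Xi>. norm (u - \<xi>) < R\<^sub>1 * s \<xi>}"

text \<open>
  The symbol of the frame operator. Centers outside \<open>overlap u\<close> contribute nothing, and the restriction makes the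
  sum finite.
\<close>

definition multiplier :: "real^'n \<Rightarrow> real" where
  "multiplier u = 1 / \<beta> ^ CARD('n) * (\<Sum>\<xi>\<in>overlap u. (cmod (hat ((1 / s \<xi>) *\<^sub>R (u - \<xi>))))\<^sup>2)"

lemma R1_pos: "0 < R\<^sub>1" using R by simp

lemma overlap_finite: "finite (overlap u)"
  and overlap_card: "\<exists>m::nat. \<forall>u. card (overlap u) \<le> m"
proof -
  obtain m :: nat where m: "\<forall>\<xi>\<in>\<Xi>. finite {\<eta>\<in>\<Xi>. neighbours \<alpha> R\<^sub>1 \<xi> \<eta>} \<and> card {\<eta>\<in>\<Xi>. neighbours \<alpha> R\<^sub>1 \<xi> \<eta>} \<le> m"
    using neighbours_card[OF R1_pos] by blast
  have fc: "finite (overlap u) \<and> card (overlap u) \<le> m" for u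
  proof (cases "overlap u = {}")
    case False
    then obtain \<xi> where \<xi>: "\<xi> \<in> overlap u" by blast
    then have x: "\<xi> \<in> \<Xi>" by (simp add: overlap_def)
    have "overlap u \<subseteq> {\<eta>\<in>\<Xi>. neighbours \<alpha> R\<^sub>1 \<xi> \<eta>}"
      using \<xi> by (auto simp: overlap_def neighbours_def)
    then show ?thesis using bspec[OF m x] by (meson card_mono finite_subset order_trans)
  qed simp
  then show "finite (overlap u)" "\<exists>m::nat. \<forall>u. card (overlap u) \<le> m" by blast+
qed

lemma hat_zero_outside: "\<xi> \<in> \<Xi> \<Longrightarrow> R\<^sub>1 * s \<xi> \<le> norm (u - \<xi>) \<Longrightarrow> hat ((1 / s \<xi>) *\<^sub>R (u - \<xi>)) = 0"
  using scale_pos[of \<xi>] by (intro hat_zero) (simp add: pos_le_divide_eq)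

lemma multiplier_nn_integral:
  "(\<integral>\<^sup>+\<xi>. ennreal ((cmod (hat ((1 / s \<xi>) *\<^sub>R (u - \<xi>))))\<^sup>2) \<partial>count_space \<Xi>) = ennreal (\<beta> ^ CARD('n) * multiplier u)"
proof -
  have "(\<integral>\<^sup>+\<xi>. ennreal ((cmod (hat ((1 / s \<xi>) *\<^sub>R (u - \<xi>))))\<^sup>2) \<partial>count_space \<Xi>)
      = (\<Sum>\<xi>\<in>overlap u. ennreal ((cmod (hat ((1 / s \<xi>) *\<^sub>R (u - \<xi>))))\<^sup>2))"
  proof (rule nn_integral_count_space'[OF overlap_finite])
    show "overlap u \<subseteq> \<Xi>" by (auto simp: overlap_def)
    show "ennreal ((cmod (hat ((1 / s \<xi>) *\<^sub>R (u - \<xi>))))\<^sup>2) = 0" if "\<xi> \<in> \<Xi>" "\<xi> \<notin> overlap u" for \<xi>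
      using hat_zero_outside[OF that(1), of u] that by (auto simp: overlap_def not_less)
  qed
  also have "\<dots> = ennreal (\<beta> ^ CARD('n) * multiplier u)"
    using b \<rho> by (simp add: sum_ennreal multiplier_def)
  finally show ?thesis .
qed

lemma multiplier_nonneg: "0 \<le> multiplier u"
  using beta_pos by (simp add: multiplier_def sum_nonneg)

lemma multiplier_measurable [measurable]: "multiplier \<in> borel_measurable borel"
proof -
  have "(\<lambda>u. \<integral>\<^sup>+\<xi>. ennreal ((cmod (hat ((1 / s \<xi>) *\<^sub>R (u - \<xi>))))\<^sup>2) \<partial>count_space \<Xi>) \<in> borel_measurable borel"
    by (rule borel_measurable_nn_integral_count_space[OF centers_countable]) measurable
  then have [measurable]: "(\<lambda>u. ennreal (\<beta> ^ CARD('n) * multiplier u)) \<in> borel_measurable borel"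
    by (simp only: multiplier_nn_integral)
  have "(\<lambda>u. 1 / \<beta> ^ CARD('n) * enn2real (ennreal (\<beta> ^ CARD('n) * multiplier u))) \<in> borel_measurable borel"
    by measurable
  moreover have e: "1 / \<beta> ^ CARD('n) * enn2real (ennreal (\<beta> ^ CARD('n) * multiplier u)) = multiplier u" for u
  proof -
    have "0 \<le> \<beta> ^ CARD('n) * multiplier u" using beta_pos multiplier_nonneg[of u] by simp
    then show ?thesis using b \<rho> by simp
  qed
  ultimately show ?thesis by (simp only: e)
qed

lemma multiplier_lower: "\<exists>A>0. \<forall>u. A \<le> multiplier u"
proof (intro exI conjI allI)
  show "0 < 1 / \<beta> ^ CARD('n) * m\<^sub>0\<^sup>2" using beta_pos m0 by simp
  fix u
  obtain \<xi> where \<xi>: "\<xi> \<in> \<Xi>" "norm (u - \<xi>) \<le> R\<^sub>0 * s \<xi>" using cover by blast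
  have sp: "0 < s \<xi>" by (rule scale_pos[OF \<xi>(1)])
  have "R\<^sub>0 * s \<xi> < R\<^sub>1 * s \<xi>" using R sp by simp
  then have mem: "\<xi> \<in> overlap u" using \<xi> by (simp add: overlap_def)
  have "norm ((1 / s \<xi>) *\<^sub>R (u - \<xi>)) \<le> R\<^sub>0" using \<xi>(2) sp by (simp add: pos_divide_le_eq)
  then have "m\<^sub>0 \<le> cmod (hat ((1 / s \<xi>) *\<^sub>R (u - \<xi>)))" unfolding hat_def by (rule hat_lower)
  then have "m\<^sub>0\<^sup>2 \<le> (cmod (hat ((1 / s \<xi>) *\<^sub>R (u - \<xi>))))\<^sup>2" using m0 by (intro power_mono) auto
  also have "\<dots> \<le> (\<Sum>\<xi>\<in>overlap u. (cmod (hat ((1 / s \<xi>) *\<^sub>R (u - \<xi>))))\<^sup>2)"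
    by (rule member_le_sum[OF mem _ overlap_finite]) simp
  finally show "1 / \<beta> ^ CARD('n) * m\<^sub>0\<^sup>2 \<le> multiplier u"
    unfolding multiplier_def using beta_pos by (intro mult_left_mono) auto
qed

lemma multiplier_upper: "\<exists>B\<ge>0. \<forall>u. multiplier u \<le> B"
proof -
  obtain K where K: "0 \<le> K" "\<And>\<zeta>. cmod (hat \<zeta>) \<le> K" by (rule hat_bounded) blast
  obtain m :: nat where m: "\<forall>u. card (overlap u) \<le> m" using overlap_card by blast
  have "multiplier u \<le> 1 / \<beta> ^ CARD('n) * (real m * K\<^sup>2)" for u
  proof -
    have "(\<Sum>\<xi>\<in>overlap u. (cmod (hat ((1 / s \<xi>) *\<^sub>R (u - \<xi>))))\<^sup>2) \<le> of_nat (card (overlap u)) * K\<^sup>2"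
      using K by (intro sum_bounded_above power_mono) auto
    also have "\<dots> \<le> real m * K\<^sup>2" using m by (intro mult_right_mono) auto
    finally show ?thesis unfolding multiplier_def using beta_pos by (intro mult_left_mono) auto
  qed
  moreover have "0 \<le> 1 / \<beta> ^ CARD('n) * (real m * K\<^sup>2)" using beta_pos by simp
  ultimately show ?thesis by blast
qed

lemma lattice_center: "z \<in> lattice \<Longrightarrow> snd z \<in> \<Xi>"
  by (auto simp: lattice_def)

lemma lattice_packet_pair: "z \<in> lattice \<Longrightarrow> fourier_pair (packet \<alpha> \<phi> z) (packet_hat z)"
  using packet_pair[of "snd z" "fst z"] lattice_center by simp

text \<open>
  On the Fourier side the frame operator is multiplication by \<open>multiplier\<close>: for each center, Parseval on
  the cube sums the coefficients over the spatial lattice, and then the centers are summed.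
\<close>

lemma frame_identity:
  assumes fF: "fourier_pair f F"
  shows "(\<integral>\<^sup>+z. ennreal ((cmod (L2_inner lborel f (packet \<alpha> \<phi> z)))\<^sup>2) \<partial>count_space lattice)
    = ennreal (1 / (2 * pi) ^ CARD('n)) * (\<integral>\<^sup>+u. ennreal ((cmod (F u))\<^sup>2 * multiplier u) \<partial>lborel)"
proof -
  let ?\<pi> = "(2 * pi) ^ CARD('n) :: real"
  have F: "F \<in> L2_space lborel" by (rule fourier_pair_L2(2)[OF fF])
  have Fm [measurable]: "F \<in> borel_measurable borel" using L2_measurable[OF F] by simp
  have assoc: "ennreal x * (ennreal y * (ennreal v * X)) = ennreal (x * (y * v)) * X"
    if "0 \<le> x" "0 \<le> y" "0 \<le> v" for x y v X
    using that by (simp add: ennreal_mult mult.assoc)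
  have c1: "ennreal ((cmod (L2_inner lborel f (packet \<alpha> \<phi> z)))\<^sup>2)
      = ennreal (1 / ?\<pi>\<^sup>2) * ennreal ((cmod (L2_inner lborel F (packet_hat z)))\<^sup>2)" if "z \<in> lattice" for z
  proof -
    have "L2_inner lborel F (packet_hat z) = of_real ?\<pi> * L2_inner lborel f (packet \<alpha> \<phi> z)"
      by (rule fourier_pair_inner[OF fF lattice_packet_pair[OF that]])
    then have "cmod (L2_inner lborel F (packet_hat z)) = ?\<pi> * cmod (L2_inner lborel f (packet \<alpha> \<phi> z))"
      by (simp add: norm_mult norm_power)
    then have "(cmod (L2_inner lborel f (packet \<alpha> \<phi> z)))\<^sup>2 = 1 / ?\<pi>\<^sup>2 * (cmod (L2_inner lborel F (packet_hat z)))\<^sup>2"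
      by (simp add: power_mult_distrib)
    then show ?thesis by (simp only: ennreal_mult''[OF zero_le_power2])
  qed
  have "(\<integral>\<^sup>+z. ennreal ((cmod (L2_inner lborel f (packet \<alpha> \<phi> z)))\<^sup>2) \<partial>count_space lattice)
      = ennreal (1 / ?\<pi>\<^sup>2) * (\<integral>\<^sup>+z. ennreal ((cmod (L2_inner lborel F (packet_hat z)))\<^sup>2) \<partial>count_space lattice)"
    by (subst nn_integral_cmult[symmetric]) (auto intro!: nn_integral_cong simp: c1)
  also have "(\<integral>\<^sup>+z. ennreal ((cmod (L2_inner lborel F (packet_hat z)))\<^sup>2) \<partial>count_space lattice)
      = (\<integral>\<^sup>+\<xi>. ennreal ((2 * pi / \<beta>) ^ CARD('n)) *
          (\<integral>\<^sup>+u. ennreal ((cmod (F u))\<^sup>2 * (cmod (hat ((1 / s \<xi>) *\<^sub>R (u - \<xi>))))\<^sup>2) \<partial>lborel) \<partial>count_space \<Xi>)"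
    unfolding nn_integral_lattice by (intro nn_integral_cong center_coefficients F) simp
  also have "\<dots> = ennreal ((2 * pi / \<beta>) ^ CARD('n)) *
      (\<integral>\<^sup>+\<xi>. \<integral>\<^sup>+u. ennreal ((cmod (F u))\<^sup>2 * (cmod (hat ((1 / s \<xi>) *\<^sub>R (u - \<xi>))))\<^sup>2) \<partial>lborel \<partial>count_space \<Xi>)"
    by (rule nn_integral_cmult) simp
  also have "(\<integral>\<^sup>+\<xi>. \<integral>\<^sup>+u. ennreal ((cmod (F u))\<^sup>2 * (cmod (hat ((1 / s \<xi>) *\<^sub>R (u - \<xi>))))\<^sup>2) \<partial>lborel \<partial>count_space \<Xi>)
      = (\<integral>\<^sup>+u. \<integral>\<^sup>+\<xi>. ennreal ((cmod (F u))\<^sup>2 * (cmod (hat ((1 / s \<xi>) *\<^sub>R (u - \<xi>))))\<^sup>2) \<partial>count_space \<Xi> \<partial>lborel)"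
    by (rule nn_integral_count_space_nn_integral[OF centers_countable, symmetric]) measurable
  also have "\<dots> = (\<integral>\<^sup>+u. ennreal (\<beta> ^ CARD('n)) * ennreal ((cmod (F u))\<^sup>2 * multiplier u) \<partial>lborel)"
  proof (rule nn_integral_cong)
    fix u
    have "(\<integral>\<^sup>+\<xi>. ennreal ((cmod (F u))\<^sup>2 * (cmod (hat ((1 / s \<xi>) *\<^sub>R (u - \<xi>))))\<^sup>2) \<partial>count_space \<Xi>)
        = ennreal ((cmod (F u))\<^sup>2) * ennreal (\<beta> ^ CARD('n) * multiplier u)"
      by (simp only: ennreal_mult''[OF zero_le_power2] nn_integral_cmult[OF borel_measurable_count_space] multiplier_nn_integral)
    also have "\<dots> = ennreal (\<beta> ^ CARD('n)) * ennreal ((cmod (F u))\<^sup>2 * multiplier u)"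
      using multiplier_nonneg[of u] beta_pos by (simp add: ennreal_mult mult_ac)
    finally show "(\<integral>\<^sup>+\<xi>. ennreal ((cmod (F u))\<^sup>2 * (cmod (hat ((1 / s \<xi>) *\<^sub>R (u - \<xi>))))\<^sup>2) \<partial>count_space \<Xi>)
        = ennreal (\<beta> ^ CARD('n)) * ennreal ((cmod (F u))\<^sup>2 * multiplier u)" .
  qed
  also have "\<dots> = ennreal (\<beta> ^ CARD('n)) * (\<integral>\<^sup>+u. ennreal ((cmod (F u))\<^sup>2 * multiplier u) \<partial>lborel)"
    by (rule nn_integral_cmult) measurable
  also have "ennreal (1 / ?\<pi>\<^sup>2) * (ennreal ((2 * pi / \<beta>) ^ CARD('n)) * (ennreal (\<beta> ^ CARD('n)) *
      (\<integral>\<^sup>+u. ennreal ((cmod (F u))\<^sup>2 * multiplier u) \<partial>lborel)))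
      = ennreal (1 / ?\<pi>\<^sup>2 * ((2 * pi / \<beta>) ^ CARD('n) * \<beta> ^ CARD('n))) * (\<integral>\<^sup>+u. ennreal ((cmod (F u))\<^sup>2 * multiplier u) \<partial>lborel)"
    by (rule assoc) (use b \<rho> in auto)
  also have "1 / ?\<pi>\<^sup>2 * ((2 * pi / \<beta>) ^ CARD('n) * \<beta> ^ CARD('n)) = 1 / ?\<pi>"
    using b \<rho> by (simp add: power_divide power2_eq_square)
  finally show ?thesis .
qed

text \<open>
  Up to a constant, the analysis operator has the norm of this weighted transform, and an identity of norms
  can be polarized.
\<close>

definition weighted :: "(real^'n \<Rightarrow> complex) \<Rightarrow> real^'n \<Rightarrow> complex" where
  "weighted F u = of_real (sqrt (multiplier u)) * F u"

lemma weighted_L2: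
  assumes F: "F \<in> L2_space lborel" shows "weighted F \<in> L2_space lborel"
proof -
  obtain B where B: "0 \<le> B" "\<forall>u. multiplier u \<le> B" using multiplier_upper by blast
  have [measurable]: "F \<in> borel_measurable borel" using L2_measurable[OF F] by simp
  show ?thesis
  proof (rule L2_space_bound[OF F, of _ "sqrt B"])
    show "weighted F \<in> borel_measurable lborel" unfolding weighted_def[abs_def] by measurable
    show "cmod (weighted F u) \<le> sqrt B * cmod (F u)" for u
      using B multiplier_nonneg[of u] by (simp add: weighted_def norm_mult mult_right_mono)
  qed
qed

lemma weighted_norm:
  "F \<in> L2_space lborel \<Longrightarrow> (\<integral>\<^sup>+u. ennreal ((cmod (F u))\<^sup>2 * multiplier u) \<partial>lborel) = ennreal ((L2_norm lborel (weighted F))\<^sup>2)"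
  by (subst L2_norm_nn_integral[OF weighted_L2, symmetric])
    (auto intro!: nn_integral_cong simp: weighted_def norm_mult power_mult_distrib multiplier_nonneg mult.commute)

lemma is_frame_packets: "is_frame lborel lattice (packet \<alpha> \<phi>)"
proof -
  let ?\<pi> = "(2 * pi) ^ CARD('n) :: real"
  obtain A where A: "0 < A" "\<forall>u. A \<le> multiplier u" using multiplier_lower by blast
  obtain B where B: "0 \<le> B" "\<forall>u. multiplier u \<le> B" using multiplier_upper by blast
  have main: "(\<lambda>z. (cmod (L2_inner lborel f (packet \<alpha> \<phi> z)))\<^sup>2) summable_on lattice \<and>
        A * (L2_norm lborel f)\<^sup>2 \<le> (\<Sum>\<^sub>\<infinity>z\<in>lattice. (cmod (L2_inner lborel f (packet \<alpha> \<phi> z)))\<^sup>2) \<and>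
        (\<Sum>\<^sub>\<infinity>z\<in>lattice. (cmod (L2_inner lborel f (packet \<alpha> \<phi> z)))\<^sup>2) \<le> B * (L2_norm lborel f)\<^sup>2"
    if f: "f \<in> L2_space lborel" for f
  proof -
    obtain F where F: "fourier_pair f F" using fourier_pair_ex[OF f] by blast
    have FL: "F \<in> L2_space lborel" by (rule fourier_pair_L2(2)[OF F])
    let ?V = "1 / ?\<pi> * (L2_norm lborel (weighted F))\<^sup>2"
    have "(\<integral>\<^sup>+z. ennreal ((cmod (L2_inner lborel f (packet \<alpha> \<phi> z)))\<^sup>2) \<partial>count_space lattice) = ennreal ?V"
      unfolding frame_identity[OF F] weighted_norm[OF FL] by (simp only: ennreal_mult''[OF zero_le_power2])
    note V = infsum_eq_nn_integral[OF zero_le_power2 this]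
    have V0: "0 \<le> ?V" by simp
    have nF: "(L2_norm lborel F)\<^sup>2 = ?\<pi> * (L2_norm lborel f)\<^sup>2" by (rule fourier_pair_norm[OF F])
    have "A * (L2_norm lborel F)\<^sup>2 \<le> (L2_norm lborel (weighted F))\<^sup>2"
    proof -
      have "sqrt A * L2_norm lborel F = L2_norm lborel (\<lambda>u. of_real (sqrt A) * F u)"
        using A by (simp add: L2_norm_scale)
      also have "\<dots> \<le> L2_norm lborel (weighted F)"
        by (rule L2_norm_mono) (use A FL weighted_L2[OF FL] multiplier_nonneg in \<open>auto simp: weighted_def norm_mult intro!: mult_right_mono\<close>)
      finally have "(sqrt A * L2_norm lborel F)\<^sup>2 \<le> (L2_norm lborel (weighted F))\<^sup>2"
        using A by (intro power_mono) auto
      then show ?thesis using A by (simp add: power_mult_distrib)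
    qed
    then have low: "A * (L2_norm lborel f)\<^sup>2 \<le> ?V" unfolding nF by (simp add: pos_le_divide_eq mult_ac)
    have "(L2_norm lborel (weighted F))\<^sup>2 \<le> B * (L2_norm lborel F)\<^sup>2"
    proof -
      have "L2_norm lborel (weighted F) \<le> L2_norm lborel (\<lambda>u. of_real (sqrt B) * F u)"
        by (rule L2_norm_mono) (use B FL weighted_L2[OF FL] multiplier_nonneg in \<open>auto simp: weighted_def norm_mult intro!: mult_right_mono\<close>)
      also have "\<dots> = sqrt B * L2_norm lborel F" using B by (simp add: L2_norm_scale)
      finally have "(L2_norm lborel (weighted F))\<^sup>2 \<le> (sqrt B * L2_norm lborel F)\<^sup>2"
        by (intro power_mono) auto
      then show ?thesis using B by (simp add: power_mult_distrib)
    qed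
    then have up: "?V \<le> B * (L2_norm lborel f)\<^sup>2" unfolding nF by (simp add: pos_divide_le_eq mult_ac)
    show ?thesis using V[OF V0] low up by simp
  qed
  have mem: "\<forall>z\<in>lattice. packet \<alpha> \<phi> z \<in> L2_space lborel"
    using fourier_pair_L2(1)[OF lattice_packet_pair] by simp
  show ?thesis
    unfolding is_frame_def
    by (rule conjI[OF mem], rule exI[of _ A], rule exI[of _ B], rule conjI[OF A(1)], rule ballI, rule main)
qed

sublocale packets: L2_frame lborel lattice "packet \<alpha> \<phi>"
  by unfold_locales (rule is_frame_packets)

lemma analysis_norm:
  assumes F: "fourier_pair f F"
  shows "(L2_norm (count_space lattice) (packets.C f))\<^sup>2 = 1 / (2 * pi) ^ CARD('n) * (L2_norm lborel (weighted F))\<^sup>2"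
proof -
  have "ennreal ((L2_norm (count_space lattice) (packets.C f))\<^sup>2)
      = ennreal (1 / (2 * pi) ^ CARD('n) * (L2_norm lborel (weighted F))\<^sup>2)"
  proof (rule trans[OF L2_norm_nn_integral[symmetric]])
    show "packets.C f \<in> packets.l2" by (rule packets.analysis_L2[OF fourier_pair_L2(1)[OF F]])
    show "(\<integral>\<^sup>+z. ennreal ((cmod (packets.C f z))\<^sup>2) \<partial>count_space lattice)
        = ennreal (1 / (2 * pi) ^ CARD('n) * (L2_norm lborel (weighted F))\<^sup>2)"
      unfolding analysis_op_def frame_identity[OF F] weighted_norm[OF fourier_pair_L2(2)[OF F]]
      by (simp only: ennreal_mult''[OF zero_le_power2])
  qed
  then show ?thesis by (subst (asm) ennreal_inj) auto
qed

lemma analysis_inner: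
  assumes F: "fourier_pair f F" and G: "fourier_pair g G"
  shows "L2_inner (count_space lattice) (packets.C f) (packets.C g)
    = of_real (1 / (2 * pi) ^ CARD('n)) * L2_inner lborel (weighted F) (weighted G)"
proof (rule L2_polarize)
  have lin: "(L2_norm (count_space lattice) (\<lambda>x. packets.C f x + packets.C h x))\<^sup>2
      = 1 / (2 * pi) ^ CARD('n) * (L2_norm lborel (\<lambda>x. weighted F x + weighted H x))\<^sup>2"
    if H: "fourier_pair h H" for h H
  proof -
    note fL = fourier_pair_L2(1)[OF F] and hL = fourier_pair_L2(1)[OF H]
    have "L2_norm (count_space lattice) (\<lambda>x. packets.C f x + packets.C h x)
        = L2_norm (count_space lattice) (packets.C (\<lambda>x. f x + h x))"
      by (rule L2_norm_cong[OF L2_eq_sym[OF packets.analysis_add[OF fL hL]]])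
        (use packets.analysis_L2 fL hL in auto)
    moreover have "weighted (\<lambda>x. F x + H x) = (\<lambda>x. weighted F x + weighted H x)"
      by (rule ext) (simp add: weighted_def distrib_left)
    ultimately show ?thesis using analysis_norm[OF fourier_pair_add[OF F H]] by simp
  qed
  show "(L2_norm (count_space lattice) (\<lambda>x. packets.C f x + packets.C g x))\<^sup>2
      = 1 / (2 * pi) ^ CARD('n) * (L2_norm lborel (\<lambda>x. weighted F x + weighted G x))\<^sup>2"
    by (rule lin[OF G])
  have "weighted (\<lambda>x. \<i> * G x) = (\<lambda>x. \<i> * weighted G x)"
    by (rule ext) (simp add: weighted_def)
  then show "(L2_norm (count_space lattice) (\<lambda>x. packets.C f x + \<i> * packets.C g x))\<^sup>2
      = 1 / (2 * pi) ^ CARD('n) * (L2_norm lborel (\<lambda>x. weighted F x + \<i> * weighted G x))\<^sup>2"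
    using lin[OF fourier_pair_scale[OF G, of \<i>]] by (simp add: packets.analysis_scale)
qed (use packets.analysis_L2 fourier_pair_L2[OF F] fourier_pair_L2[OF G] weighted_L2 analysis_norm[OF F] analysis_norm[OF G] in auto)

definition dual_hat :: "(real^'n) \<times> (real^'n) \<Rightarrow> real^'n \<Rightarrow> complex" where
  "dual_hat z u = packet_hat z u * of_real (inverse (multiplier u))"

definition dual_packet :: "(real^'n) \<times> (real^'n) \<Rightarrow> real^'n \<Rightarrow> complex" where
  "dual_packet z t = of_real (1 / (2 * pi) ^ CARD('n)) * fourier (dual_hat z) (- t)"

lemma dual_pair:
  assumes z: "z \<in> lattice" shows "fourier_pair (dual_packet z) (dual_hat z)"
proof -
  obtain A where A: "0 < A" "\<forall>u. A \<le> multiplier u" using multiplier_lower by blast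
  have pc: "L2_compact (packet_hat z)"
    using packet_hat_compact[OF lattice_center[OF z], of "fst z"] by simp
  have "dual_hat z \<in> L2_space lborel"
  proof (rule L2_space_bound[OF L2_compact_L2[OF pc], of _ "inverse A"])
    show "dual_hat z \<in> borel_measurable lborel" unfolding dual_hat_def[abs_def] by measurable
    show "cmod (dual_hat z u) \<le> inverse A * cmod (packet_hat z u)" for u
    proof -
      have "inverse (multiplier u) \<le> inverse A" using A by (intro le_imp_inverse_le) auto
      from mult_right_mono[OF this norm_ge_zero[of "packet_hat z u"]]
      show ?thesis using multiplier_nonneg[of u] by (simp add: dual_hat_def norm_mult norm_inverse mult.commute)
    qed
  qed
  moreover obtain r where "\<forall>t. r < norm t \<longrightarrow> packet_hat z t = 0" using pc by (auto simp: L2_compact_def)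
  ultimately have "L2_compact (dual_hat z)" unfolding L2_compact_def by (auto simp: dual_hat_def)
  from fourier_pair_inverse[OF this] show ?thesis by (simp only: dual_packet_def[abs_def])
qed

text \<open>The canonical dual packet is obtained by dividing by the multiplier on the Fourier side.\<close>

lemma dual_eq_dual_packet:
  assumes z: "z \<in> lattice" shows "L2_eq lborel (packets.dual z) (dual_packet z)"
  unfolding packets.dual_eq
proof (rule packets.inverse_unique)
  show \<theta>: "dual_packet z \<in> L2_space lborel" by (rule fourier_pair_L2(1)[OF dual_pair[OF z]])
  show \<psi>: "packet \<alpha> \<phi> z \<in> L2_space lborel" by (rule packets.frame_L2[OF z])
  show "L2_eq lborel (packets.S (dual_packet z)) (packet \<alpha> \<phi> z)"
    unfolding packets.frame_op_eq_iff[OF \<theta> \<psi>]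
  proof
    fix h :: "real^'n \<Rightarrow> complex" assume h: "h \<in> L2_space lborel"
    obtain H where H: "fourier_pair h H" using fourier_pair_ex[OF h] by blast
    obtain A where A: "0 < A" "\<forall>u. A \<le> multiplier u" using multiplier_lower by blast
    have "L2_inner lborel (weighted H) (weighted (dual_hat z)) = L2_inner lborel H (packet_hat z)"
      unfolding L2_inner_def
    proof (rule Bochner_Integration.integral_cong[OF refl])
      fix u
      have m: "0 < multiplier u" using A less_le_trans by blast
      have "complex_of_real (sqrt (multiplier u)) * complex_of_real (sqrt (multiplier u)) = complex_of_real (multiplier u)"
        using m by (simp flip: of_real_mult)
      then have "weighted H u * cnj (weighted (dual_hat z) u)
          = (complex_of_real (multiplier u) * complex_of_real (inverse (multiplier u))) * (H u * cnj (packet_hat z u))"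
        by (simp add: weighted_def dual_hat_def mult_ac)
      also have "complex_of_real (multiplier u) * complex_of_real (inverse (multiplier u)) = 1"
        using m by (simp flip: of_real_mult)
      finally show "weighted H u * cnj (weighted (dual_hat z) u) = H u * cnj (packet_hat z u)" by simp
    qed
    also have "\<dots> = of_real ((2 * pi) ^ CARD('n)) * L2_inner lborel h (packet \<alpha> \<phi> z)"
      by (rule fourier_pair_inner[OF H lattice_packet_pair[OF z]])
    finally show "L2_inner (count_space lattice) (packets.C h) (packets.C (dual_packet z)) = L2_inner lborel h (packet \<alpha> \<phi> z)"
      unfolding analysis_inner[OF H dual_pair[OF z]] by simp
  qed
qed

definition multiplier_integral :: "nat \<Rightarrow> (real^'n) \<times> (real^'n) \<Rightarrow> (real^'n) \<times> (real^'n) \<Rightarrow> complex" where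
  "multiplier_integral p z w = (LINT u|lborel. packet_hat z u * cnj (packet_hat w u) * of_real (inverse (multiplier u) ^ p))"

text \<open>
  Plancherel, where the constant \<open>(2 pi)\<^sup>d\<close> is at least 1 and is dropped.
\<close>

lemma dual_inner_dual:
  assumes z: "z \<in> lattice" and w: "w \<in> lattice"
  shows "cmod (L2_inner lborel (packets.dual z) (packets.dual w)) \<le> cmod (multiplier_integral 2 z w)"
    and "cmod (L2_inner lborel (packets.dual z) (packet \<alpha> \<phi> w)) \<le> cmod (multiplier_integral 1 z w)"
proof -
  let ?\<pi> = "(2 * pi) ^ CARD('n) :: real"
  have \<pi>: "1 \<le> ?\<pi>" using pi_ge_two by (intro one_le_power) linarith
  have le: "cmod v \<le> cmod (of_real ?\<pi> * v)" for v
    using mult_right_mono[OF \<pi> norm_ge_zero[of v]] by (simp add: norm_mult norm_power)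
  note dz = packets.inverse_L2[OF packets.frame_L2[OF z], folded packets.dual_eq]
    and dw = packets.inverse_L2[OF packets.frame_L2[OF w], folded packets.dual_eq]
    and tz = fourier_pair_L2(1)[OF dual_pair[OF z]] and tw = fourier_pair_L2(1)[OF dual_pair[OF w]]
  have "L2_inner lborel (packets.dual z) (packets.dual w) = L2_inner lborel (dual_packet z) (dual_packet w)"
    by (intro L2_inner_cong dual_eq_dual_packet z w dz dw tz tw)
  moreover have "of_real ?\<pi> * L2_inner lborel (dual_packet z) (dual_packet w) = multiplier_integral 2 z w"
    unfolding fourier_pair_inner[OF dual_pair[OF z] dual_pair[OF w], symmetric] unfolding L2_inner_def multiplier_integral_def
    by (intro Bochner_Integration.integral_cong refl) (simp add: dual_hat_def power2_eq_square mult_ac)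
  ultimately show "cmod (L2_inner lborel (packets.dual z) (packets.dual w)) \<le> cmod (multiplier_integral 2 z w)"
    using le by metis
  have "L2_inner lborel (packets.dual z) (packet \<alpha> \<phi> w) = L2_inner lborel (dual_packet z) (packet \<alpha> \<phi> w)"
    by (intro L2_inner_cong dual_eq_dual_packet L2_eq_refl z dz tz packets.frame_L2 w)
  moreover have "of_real ?\<pi> * L2_inner lborel (dual_packet z) (packet \<alpha> \<phi> w) = multiplier_integral 1 z w"
    unfolding fourier_pair_inner[OF dual_pair[OF z] lattice_packet_pair[OF w], symmetric] unfolding L2_inner_def multiplier_integral_def
    by (intro Bochner_Integration.integral_cong refl) (simp add: dual_hat_def mult_ac)
  ultimately show "cmod (L2_inner lborel (packets.dual z) (packet \<alpha> \<phi> w)) \<le> cmod (multiplier_integral 1 z w)"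
    using le by metis
qed

end


section \<open>Decay of the dual Gram matrices\<close>

context subdyadic_packets
begin

lemma hat_affine_bounded:
  assumes \<sigma>: "\<And>j. j \<in> J \<Longrightarrow> \<bar>\<sigma> j\<bar> \<le> S"
  shows "deriv_bounded n J V (\<lambda>j \<tau>. hat (pt j + (\<sigma> j * \<tau>) *\<^sub>R axis (dir j) 1))"
proof -
  have base: "deriv_bounded n UNIV (\<lambda>_. UNIV) (\<lambda>(\<zeta>, i) \<tau>. hat (\<zeta> + \<tau> *\<^sub>R axis i 1))"
    using hat_line_bounded[of n 0] by simp
  have "deriv_bounded n J (\<lambda>_. UNIV) (\<lambda>j. (\<lambda>(\<zeta>, i) \<tau>. hat (\<zeta> + \<tau> *\<^sub>R axis i 1)) (pt j, dir j))"
    by (rule deriv_bounded_reindex[OF base, where h="\<lambda>j. (pt j, dir j)"]) auto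
  then have "deriv_bounded n J (\<lambda>_. UNIV) (\<lambda>j \<tau>. hat (pt j + \<tau> *\<^sub>R axis (dir j) 1))" by simp
  from deriv_bounded_affine[OF \<sigma> _ this, where V=V and c="\<lambda>_. 0"] show ?thesis by simp
qed

text \<open>
  Near \<open>\<xi>\<close> the sum runs over an index set independent of the point, so that it can be differentiated termwise.
\<close>

lemma multiplier_local:
  assumes \<xi>: "\<xi> \<in> \<Xi>" and u: "norm (u - \<xi>) < R\<^sub>1 * s \<xi>" and fin: "finite {k\<in>\<Xi>. neighbours \<alpha> R\<^sub>1 \<xi> k}"
  shows "complex_of_real (multiplier u) = of_real (1 / \<beta> ^ CARD('n)) *
    (\<Sum>k\<in>{k\<in>\<Xi>. neighbours \<alpha> R\<^sub>1 \<xi> k}. hat ((1 / s k) *\<^sub>R (u - k)) * cnj (hat ((1 / s k) *\<^sub>R (u - k))))"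
proof -
  let ?N = "{k\<in>\<Xi>. neighbours \<alpha> R\<^sub>1 \<xi> k}"
  have "(\<Sum>k\<in>overlap u. (cmod (hat ((1 / s k) *\<^sub>R (u - k))))\<^sup>2) = (\<Sum>k\<in>?N. (cmod (hat ((1 / s k) *\<^sub>R (u - k))))\<^sup>2)"
  proof (rule sum.mono_neutral_left[OF fin])
    show "overlap u \<subseteq> ?N" using u by (auto simp: overlap_def neighbours_def)
    show "\<forall>k\<in>?N - overlap u. (cmod (hat ((1 / s k) *\<^sub>R (u - k))))\<^sup>2 = 0"
      using hat_zero_outside[of _ u] by (auto simp: overlap_def not_less)
  qed
  then show ?thesis by (simp add: multiplier_def mult_cnj_cmod)
qed

definition symbol :: "nat \<Rightarrow> (real^'n) \<times> (real^'n) \<Rightarrow> real^'n \<Rightarrow> complex" where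
  "symbol p = (\<lambda>(\<xi>, \<eta>) \<zeta>. hat \<zeta> * (cnj (hat ((1 / s \<eta>) *\<^sub>R (\<xi> + s \<xi> *\<^sub>R \<zeta> - \<eta>))) *
     of_real (inverse (multiplier (\<xi> + s \<xi> *\<^sub>R \<zeta>)) ^ p)))"

definition center_pairs :: "((real^'n) \<times> (real^'n)) set" where
  "center_pairs = {(\<xi>, \<eta>). \<xi> \<in> \<Xi> \<and> \<eta> \<in> \<Xi> \<and> neighbours \<alpha> R\<^sub>1 \<xi> \<eta>}"

text \<open>
  In the coordinate \<open>\<zeta> = (u - \<xi>) / s \<xi>\<close> all ingredients of the integrand vary on unit scale, since
  the scales of neighbouring centers are comparable and only boundedly many of them contribute to
  the multiplier on the support of \<open>hat\<close>.
\<close>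

lemma symbol_bounded:
  "deriv_bounded n (center_pairs \<times> UNIV) (\<lambda>_. UNIV) (\<lambda>(q, \<zeta>, i) \<tau>. symbol p q (\<zeta> + \<tau> *\<^sub>R axis i 1))"
proof -
  obtain \<Lambda> where \<Lambda>: "\<Lambda> \<ge> 1" and cmp: "\<forall>\<xi> \<eta> :: real^'n. 1 \<le> norm \<xi> \<longrightarrow> 1 \<le> norm \<eta> \<longrightarrow> neighbours \<alpha> R\<^sub>1 \<xi> \<eta> \<longrightarrow>
    norm \<xi> \<le> \<Lambda> * norm \<eta> \<and> norm \<eta> \<le> \<Lambda> * norm \<xi> \<and> s \<xi> \<le> \<Lambda> * s \<eta> \<and> s \<eta> \<le> \<Lambda> * s \<xi>"
    using neighbours_comparable[OF \<alpha> R1_pos] by blast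
  obtain m :: nat where m: "\<forall>\<xi>\<in>\<Xi>. finite {\<eta>\<in>\<Xi>. neighbours \<alpha> R\<^sub>1 \<xi> \<eta>} \<and> card {\<eta>\<in>\<Xi>. neighbours \<alpha> R\<^sub>1 \<xi> \<eta>} \<le> m"
    using neighbours_card[OF R1_pos] by blast
  obtain A where A: "0 < A" "\<forall>u. A \<le> multiplier u" using multiplier_lower by blast
  have ratio: "\<bar>s \<xi> / s k\<bar> \<le> \<Lambda>" if "\<xi> \<in> \<Xi>" "k \<in> \<Xi>" "neighbours \<alpha> R\<^sub>1 \<xi> k" for \<xi> k
    using cmp norm_center[OF that(1)] norm_center[OF that(2)] that(3) scale_pos[OF that(1)] scale_pos[OF that(2)]
    by (simp add: pos_divide_le_eq)
  let ?J = "center_pairs \<times> (UNIV :: ((real^'n) \<times> 'n) set)"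
  let ?c = "\<lambda>j :: ((real^'n) \<times> (real^'n)) \<times> (real^'n) \<times> 'n. fst (fst j)"
  let ?e = "\<lambda>j :: ((real^'n) \<times> (real^'n)) \<times> (real^'n) \<times> 'n. snd (fst j)"
  let ?z = "\<lambda>j :: ((real^'n) \<times> (real^'n)) \<times> (real^'n) \<times> 'n. fst (snd j)"
  let ?i = "\<lambda>j :: ((real^'n) \<times> (real^'n)) \<times> (real^'n) \<times> 'n. snd (snd j)"
  let ?x = "\<lambda>j \<tau>. ?z j + \<tau> *\<^sub>R axis (?i j) 1"
  let ?U = "\<lambda>j. {\<tau>. norm (?x j \<tau>) < R\<^sub>1}"
  let ?K = "\<lambda>j. {\<tau>. ?x j \<tau> \<in> support hat}"
  have J: "?c j \<in> \<Xi>" "?e j \<in> \<Xi>" "neighbours \<alpha> R\<^sub>1 (?c j) (?e j)" if "j \<in> ?J" for j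
    using that by (auto simp: center_pairs_def)
  have xc: "continuous_on UNIV (?x j)" for j by (intro continuous_intros)
  have U: "open (?U j)" for j
    by (intro open_Collect_less continuous_intros)
  have K: "closed (?K j)" for j
  proof -
    have "closed (?x j -` support hat)" by (rule closed_vimage[OF _ xc]) (simp add: support_def)
    then show ?thesis by (simp add: vimage_def)
  qed
  have KU: "?K j \<subseteq> ?U j" for j using support_hat unfolding hat_def[symmetric] by auto
  have move: "(1 / s k) *\<^sub>R (?c j + s (?c j) *\<^sub>R ?x j \<tau> - k)
      = (1 / s k) *\<^sub>R (?c j + s (?c j) *\<^sub>R ?z j - k) + (s (?c j) / s k * \<tau>) *\<^sub>R axis (?i j) 1" for j k \<tau>
    by (simp add: algebra_simps)
  have f1: "deriv_bounded n ?J (\<lambda>_. UNIV) (\<lambda>j \<tau>. hat (?x j \<tau>))"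
    using hat_affine_bounded[of ?J "\<lambda>_. 1" 1 n "\<lambda>_. UNIV" ?z ?i] by simp
  have f2: "deriv_bounded n ?J ?U (\<lambda>j \<tau>. cnj (hat ((1 / s (?e j)) *\<^sub>R (?c j + s (?c j) *\<^sub>R ?x j \<tau> - ?e j))))"
    unfolding move using ratio J by (intro deriv_bounded_cnj hat_affine_bounded[where S=\<Lambda>]) blast
  let ?N = "\<lambda>j. {k\<in>\<Xi>. neighbours \<alpha> R\<^sub>1 (?c j) k}"
  let ?h = "\<lambda>p \<tau>. hat ((1 / s (snd p)) *\<^sub>R (?c (fst p) + s (?c (fst p)) *\<^sub>R ?x (fst p) \<tau> - snd p))"
  have h: "deriv_bounded n (Sigma ?J ?N) (\<lambda>(j, k). ?U j) ?h"
    unfolding move using ratio J by (intro hat_affine_bounded[where S=\<Lambda>]) auto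
  have "deriv_bounded n ?J ?U (\<lambda>j \<tau>. \<Sum>k\<in>?N j. ?h (j, k) \<tau> * cnj (?h (j, k) \<tau>))"
    by (rule deriv_bounded_sum[where m=m and f="\<lambda>p \<tau>. ?h p \<tau> * cnj (?h p \<tau>)"])
      (use m J in \<open>auto intro!: deriv_bounded_mult deriv_bounded_cnj h\<close>)
  then have "deriv_bounded n ?J ?U (\<lambda>j \<tau>. of_real (1 / \<beta> ^ CARD('n)) * (\<Sum>k\<in>?N j. ?h (j, k) \<tau> * cnj (?h (j, k) \<tau>)))"
    by (intro deriv_bounded_mult deriv_bounded_const[where K="cmod (of_real (1 / \<beta> ^ CARD('n)))"]) auto
  then have mult: "deriv_bounded n ?J ?U (\<lambda>j \<tau>. complex_of_real (multiplier (?c j + s (?c j) *\<^sub>R ?x j \<tau>)))"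
  proof (rule deriv_bounded_cong[rotated 2])
    fix j \<tau> assume j: "j \<in> ?J" and \<tau>: "\<tau> \<in> ?U j"
    have sp: "0 < s (?c j)" by (rule scale_pos[OF J(1)[OF j]])
    have "norm (?c j + s (?c j) *\<^sub>R ?x j \<tau> - ?c j) < R\<^sub>1 * s (?c j)"
      using \<tau> sp by (simp add: mult.commute)
    from multiplier_local[OF J(1)[OF j] this] bspec[OF m J(1)[OF j]]
    show "of_real (1 / \<beta> ^ CARD('n)) * (\<Sum>k\<in>?N j. ?h (j, k) \<tau> * cnj (?h (j, k) \<tau>))
        = complex_of_real (multiplier (?c j + s (?c j) *\<^sub>R ?x j \<tau>))" by (simp only: fst_conv snd_conv)
  qed (rule U)
  have inv: "deriv_bounded n ?J ?U (\<lambda>j \<tau>. inverse (complex_of_real (multiplier (?c j + s (?c j) *\<^sub>R ?x j \<tau>))))"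
    by (rule deriv_bounded_inverse[OF A(1) _ mult]) (use A(2) multiplier_nonneg in simp)
  have g: "deriv_bounded n ?J ?U (\<lambda>j \<tau>. cnj (hat ((1 / s (?e j)) *\<^sub>R (?c j + s (?c j) *\<^sub>R ?x j \<tau> - ?e j))) *
      inverse (complex_of_real (multiplier (?c j + s (?c j) *\<^sub>R ?x j \<tau>))) ^ p)"
    by (rule deriv_bounded_mult[OF f2 deriv_bounded_power[OF inv]])
  have f10: "hat (?x j \<tau>) = 0" if "\<tau> \<notin> ?K j" for j \<tau>
    using hat_partial_zero[of "?x j \<tau>" "[]"] that by simp
  have "deriv_bounded n ?J (\<lambda>_. UNIV) (\<lambda>j \<tau>. if \<tau> \<in> ?U j then hat (?x j \<tau>) *
      (cnj (hat ((1 / s (?e j)) *\<^sub>R (?c j + s (?c j) *\<^sub>R ?x j \<tau> - ?e j))) *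
      inverse (complex_of_real (multiplier (?c j + s (?c j) *\<^sub>R ?x j \<tau>))) ^ p) else 0)"
    by (rule deriv_bounded_extend[where K="?K", OF U K KU f1 f10 g])
  then show ?thesis
  proof (rule deriv_bounded_cong[rotated 2])
    fix j \<tau> assume "j \<in> ?J" "\<tau> \<in> (UNIV :: real set)"
    show "(if \<tau> \<in> ?U j then hat (?x j \<tau>) *
      (cnj (hat ((1 / s (?e j)) *\<^sub>R (?c j + s (?c j) *\<^sub>R ?x j \<tau> - ?e j))) *
      inverse (complex_of_real (multiplier (?c j + s (?c j) *\<^sub>R ?x j \<tau>))) ^ p) else 0)
      = (case j of (q, \<zeta>, i) \<Rightarrow> \<lambda>\<tau>. symbol p q (\<zeta> + \<tau> *\<^sub>R axis i 1)) \<tau>"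
    proof (cases "\<tau> \<in> ?U j")
      case True
      then show ?thesis by (simp add: symbol_def case_prod_unfold)
    next
      case False
      then have "hat (?x j \<tau>) = 0" by (intro hat_zero) simp
      then show ?thesis using False by (simp add: symbol_def case_prod_unfold)
    qed
  qed simp
qed

text \<open>
  The substitution \<open>u = \<xi> + s \<xi> * \<zeta>\<close>; what remains of the modulations is a Fourier exponential at frequency
  \<open>s \<xi> * (x - y)\<close> and a factor of modulus 1.
\<close>

lemma multiplier_integral_eq:
  assumes \<xi>: "\<xi> \<in> \<Xi>" and \<eta>: "\<eta> \<in> \<Xi>"
  shows "cmod (multiplier_integral p (x, \<xi>) (y, \<eta>)) = (s \<xi> / s \<eta>) powr (real CARD('n) / 2) *
    cmod (LINT \<zeta>|lborel. symbol p (\<xi>, \<eta>) \<zeta> * exp (- \<i> * complex_of_real ((s \<xi> *\<^sub>R (x - y)) \<bullet> \<zeta>)))"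
proof -
  let ?d = "real CARD('n)"
  let ?c = "\<lambda>\<xi>. s \<xi> powr (- (?d / 2))"
  have sx: "0 < s \<xi>" and se: "0 < s \<eta>" using scale_pos \<xi> \<eta> by auto
  let ?f = "\<lambda>u. packet_hat (x, \<xi>) u * cnj (packet_hat (y, \<eta>) u) * of_real (inverse (multiplier u) ^ p)"
  have "multiplier_integral p (x, \<xi>) (y, \<eta>) = \<bar>s \<xi>\<bar> ^ DIM(real^'n) *\<^sub>R (LINT \<zeta>|lborel. ?f (\<xi> + s \<xi> *\<^sub>R \<zeta>))"
    unfolding multiplier_integral_def by (rule lborel_integral_affine) (use sx in auto)
  also have "(LINT \<zeta>|lborel. ?f (\<xi> + s \<xi> *\<^sub>R \<zeta>)) = (LINT \<zeta>|lborel. (of_real (?c \<xi> * ?c \<eta>) * exp (\<i> * complex_of_real (y \<bullet> (\<xi> - \<eta>)))) *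
      (symbol p (\<xi>, \<eta>) \<zeta> * exp (- \<i> * complex_of_real ((s \<xi> *\<^sub>R (x - y)) \<bullet> \<zeta>))))"
  proof (rule Bochner_Integration.integral_cong[OF refl])
    fix \<zeta>
    have e: "exp (- \<i> * complex_of_real (x \<bullet> (s \<xi> *\<^sub>R \<zeta>))) * exp (\<i> * complex_of_real (y \<bullet> (\<xi> + s \<xi> *\<^sub>R \<zeta> - \<eta>)))
        = exp (\<i> * complex_of_real (y \<bullet> (\<xi> - \<eta>))) * exp (- \<i> * complex_of_real ((s \<xi> *\<^sub>R (x - y)) \<bullet> \<zeta>))"
      unfolding mult_exp_exp
      by (rule arg_cong[of _ _ exp]) (simp add: inner_add_right inner_diff_right inner_diff_left algebra_simps)
    have p1: "packet_hat (x, \<xi>) (\<xi> + s \<xi> *\<^sub>R \<zeta>) = of_real (?c \<xi>) * hat \<zeta> * exp (- \<i> * complex_of_real (x \<bullet> (s \<xi> *\<^sub>R \<zeta>)))"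
      using sx by (simp add: packet_hat_def)
    have p2: "cnj (packet_hat (y, \<eta>) (\<xi> + s \<xi> *\<^sub>R \<zeta>)) = of_real (?c \<eta>) * cnj (hat ((1 / s \<eta>) *\<^sub>R (\<xi> + s \<xi> *\<^sub>R \<zeta> - \<eta>))) *
        exp (\<i> * complex_of_real (y \<bullet> (\<xi> + s \<xi> *\<^sub>R \<zeta> - \<eta>)))"
      by (simp add: packet_hat_def exp_cnj)
    have "?f (\<xi> + s \<xi> *\<^sub>R \<zeta>) = of_real (?c \<xi> * ?c \<eta>) * symbol p (\<xi>, \<eta>) \<zeta> *
        (exp (- \<i> * complex_of_real (x \<bullet> (s \<xi> *\<^sub>R \<zeta>))) * exp (\<i> * complex_of_real (y \<bullet> (\<xi> + s \<xi> *\<^sub>R \<zeta> - \<eta>))))"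
      unfolding p1 p2 symbol_def case_prod_conv of_real_mult by (simp only: mult_ac)
    then show "?f (\<xi> + s \<xi> *\<^sub>R \<zeta>) = (of_real (?c \<xi> * ?c \<eta>) * exp (\<i> * complex_of_real (y \<bullet> (\<xi> - \<eta>)))) *
      (symbol p (\<xi>, \<eta>) \<zeta> * exp (- \<i> * complex_of_real ((s \<xi> *\<^sub>R (x - y)) \<bullet> \<zeta>)))"
      unfolding e by (simp only: mult_ac)
  qed
  also have "\<dots> = (of_real (?c \<xi> * ?c \<eta>) * exp (\<i> * complex_of_real (y \<bullet> (\<xi> - \<eta>)))) *
      (LINT \<zeta>|lborel. symbol p (\<xi>, \<eta>) \<zeta> * exp (- \<i> * complex_of_real ((s \<xi> *\<^sub>R (x - y)) \<bullet> \<zeta>)))"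
    by (rule integral_mult_right_zero)
  finally have "cmod (multiplier_integral p (x, \<xi>) (y, \<eta>)) = (s \<xi> ^ CARD('n) * (?c \<xi> * ?c \<eta>)) *
      cmod (LINT \<zeta>|lborel. symbol p (\<xi>, \<eta>) \<zeta> * exp (- \<i> * complex_of_real ((s \<xi> *\<^sub>R (x - y)) \<bullet> \<zeta>)))"
    using sx by (simp add: norm_mult)
  also have "s \<xi> ^ CARD('n) * (?c \<xi> * ?c \<eta>) = (s \<xi> / s \<eta>) powr (?d / 2)"
  proof -
    have "s \<xi> ^ CARD('n) * ?c \<xi> = s \<xi> powr (?d / 2)"
      using sx by (simp add: powr_realpow[symmetric] powr_add[symmetric])
    moreover have "s \<xi> powr (?d / 2) * ?c \<eta> = (s \<xi> / s \<eta>) powr (?d / 2)"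
      using sx se by (simp add: powr_divide powr_minus_divide)
    ultimately show ?thesis by (simp add: mult.assoc[symmetric])
  qed
  finally show ?thesis .
qed

lemma multiplier_integral_zero:
  assumes "\<xi> \<in> \<Xi>" "\<eta> \<in> \<Xi>" "\<not> neighbours \<alpha> R\<^sub>1 \<xi> \<eta>"
  shows "multiplier_integral p (x, \<xi>) (y, \<eta>) = 0"
proof -
  have "packet_hat (x, \<xi>) u * cnj (packet_hat (y, \<eta>) u) = 0" for u
  proof (cases "norm (u - \<xi>) < R\<^sub>1 * s \<xi>")
    case True
    then have "R\<^sub>1 * s \<eta> \<le> norm (u - \<eta>)" using assms(3) unfolding neighbours_def by (metis not_less)
    then show ?thesis using hat_zero_outside[OF assms(2)] by (simp add: packet_hat_def)
  next
    case False
    then show ?thesis using hat_zero_outside[OF assms(1), of u] by (simp add: packet_hat_def)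
  qed
  then show ?thesis by (simp only: multiplier_integral_def mult_zero_left Bochner_Integration.integral_zero)
qed

text \<open>
  For neighbours all scales and moduli in the definition of the separation are comparable, and its frequency
  part is bounded.
\<close>

lemma separation_bound:
  "\<exists>C\<ge>1. \<forall>x y \<xi> \<eta>. \<xi> \<in> \<Xi> \<longrightarrow> \<eta> \<in> \<Xi> \<longrightarrow> neighbours \<alpha> R\<^sub>1 \<xi> \<eta> \<longrightarrow>
    1 + separation \<alpha> (y, \<eta>) (x, \<xi>) \<le> C * (1 + norm (s \<xi> *\<^sub>R (x - y)))"
proof -
  obtain \<Lambda> where \<Lambda>: "\<Lambda> \<ge> 1" and cmp: "\<forall>\<xi> \<eta> :: real^'n. 1 \<le> norm \<xi> \<longrightarrow> 1 \<le> norm \<eta> \<longrightarrow> neighbours \<alpha> R\<^sub>1 \<xi> \<eta> \<longrightarrow>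
    norm \<xi> \<le> \<Lambda> * norm \<eta> \<and> norm \<eta> \<le> \<Lambda> * norm \<xi> \<and> s \<xi> \<le> \<Lambda> * s \<eta> \<and> s \<eta> \<le> \<Lambda> * s \<xi>"
    using neighbours_comparable[OF \<alpha> R1_pos] by blast
  define k where "k = max 2 \<Lambda>"
  define k' where "k' = k powr \<bar>1 - \<alpha>\<bar>"
  define C where "C = 1 + k' + k' * (R\<^sub>1 + R\<^sub>1 * \<Lambda>)"
  have k: "k \<ge> 2" "k \<ge> \<Lambda>" by (auto simp: k_def)
  have k': "0 < k'" using k by (simp add: k'_def)
  have RL: "0 \<le> R\<^sub>1 + R\<^sub>1 * \<Lambda>" using R1_pos \<Lambda> by simp
  have C: "C \<ge> 1" using k' RL by (simp add: C_def)
  have "1 + separation \<alpha> (y, \<eta>) (x, \<xi>) \<le> C * (1 + norm (s \<xi> *\<^sub>R (x - y)))"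
    if h: "\<xi> \<in> \<Xi>" "\<eta> \<in> \<Xi>" "neighbours \<alpha> R\<^sub>1 \<xi> \<eta>" for x y \<xi> \<eta>
  proof -
    have n: "1 \<le> norm \<xi>" "1 \<le> norm \<eta>" using norm_center h by auto
    have sx: "0 < s \<xi>" by (rule scale_pos[OF h(1)])
    have c: "norm \<xi> \<le> \<Lambda> * norm \<eta>" "s \<eta> \<le> \<Lambda> * s \<xi>" using cmp n h(3) by blast+
    define r where "r = 1 + min (norm \<eta>) (norm \<xi>)"
    have r0: "0 < r" using n by (simp add: r_def)
    have r1: "r \<le> k * norm \<xi>"
    proof -
      have "r \<le> 2 * norm \<xi>" using n by (simp add: r_def)
      also have "\<dots> \<le> k * norm \<xi>" using k by (intro mult_right_mono) auto
      finally show ?thesis .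
    qed
    have r2: "norm \<xi> \<le> k * r"
    proof (cases "norm \<xi> \<le> norm \<eta>")
      case True
      have "norm \<xi> \<le> 1 * r" using True by (simp add: r_def)
      also have "\<dots> \<le> k * r" using k r0 by (intro mult_right_mono) auto
      finally show ?thesis .
    next
      case False
      have "norm \<xi> \<le> \<Lambda> * r" using c(1) False \<Lambda> by (simp add: r_def min_def distrib_left)
      also have "\<dots> \<le> k * r" using k r0 by (intro mult_right_mono) auto
      finally show ?thesis .
    qed
    have n0: "0 < norm \<xi>" using n by linarith
    have e1: "r powr (1 - \<alpha>) \<le> k' * s \<xi>"
      unfolding k'_def local_scale_def by (rule powr_comparable[OF r0 n0 _ r1 r2]) (use k in simp)
    have e2: "r powr (\<alpha> - 1) \<le> k' * (1 / s \<xi>)"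
    proof -
      have "r powr (\<alpha> - 1) \<le> k powr \<bar>\<alpha> - 1\<bar> * norm \<xi> powr (\<alpha> - 1)"
        by (rule powr_comparable[OF r0 n0 _ r1 r2]) (use k in simp)
      also have "norm \<xi> powr (\<alpha> - 1) = 1 / s \<xi>"
        using powr_minus_divide[of "norm \<xi>" "1 - \<alpha>"] by (simp add: local_scale_def)
      finally show ?thesis by (simp add: k'_def abs_minus_commute)
    qed
    obtain u where u: "norm (u - \<xi>) < R\<^sub>1 * s \<xi>" "norm (u - \<eta>) < R\<^sub>1 * s \<eta>"
      using h(3) by (auto simp: neighbours_def)
    have "norm (\<eta> - \<xi>) \<le> norm (u - \<xi>) + norm (u - \<eta>)"
      using norm_triangle_ineq4[of "u - \<xi>" "u - \<eta>"] by simp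
    also have "\<dots> \<le> R\<^sub>1 * s \<xi> + R\<^sub>1 * (\<Lambda> * s \<xi>)"
      using u c(2) R1_pos order_trans[OF less_imp_le[OF u(2)] mult_left_mono[OF c(2), of R\<^sub>1]] by simp
    finally have d: "norm (\<eta> - \<xi>) \<le> (R\<^sub>1 + R\<^sub>1 * \<Lambda>) * s \<xi>" by (simp add: algebra_simps)
    have "separation \<alpha> (y, \<eta>) (x, \<xi>) = r powr (1 - \<alpha>) * norm (y - x) + r powr (\<alpha> - 1) * norm (\<eta> - \<xi>)"
      by (simp add: separation_def r_def)
    also have "\<dots> \<le> k' * s \<xi> * norm (y - x) + k' * (1 / s \<xi>) * ((R\<^sub>1 + R\<^sub>1 * \<Lambda>) * s \<xi>)"
      using k' sx by (intro add_mono mult_mono e1 e2 d) auto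
    also have "\<dots> = k' * norm (s \<xi> *\<^sub>R (x - y)) + k' * (R\<^sub>1 + R\<^sub>1 * \<Lambda>)"
      using sx by (simp add: norm_minus_commute)
    finally have "1 + separation \<alpha> (y, \<eta>) (x, \<xi>) \<le> 1 * 1 + k' * norm (s \<xi> *\<^sub>R (x - y)) + k' * (R\<^sub>1 + R\<^sub>1 * \<Lambda>) * 1" by simp
    also have "\<dots> \<le> 1 * (1 + norm (s \<xi> *\<^sub>R (x - y))) + k' * (1 + norm (s \<xi> *\<^sub>R (x - y)))
        + k' * (R\<^sub>1 + R\<^sub>1 * \<Lambda>) * (1 + norm (s \<xi> *\<^sub>R (x - y)))"
      using k' RL by (intro add_mono mult_left_mono) (auto simp del: norm_scaleR)
    also have "\<dots> = C * (1 + norm (s \<xi> *\<^sub>R (x - y)))" by (simp only: C_def distrib_right)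
    finally show ?thesis .
  qed
  then show ?thesis using C by blast
qed

lemma multiplier_integral_decay:
  assumes N: "0 < (N::real)"
  shows "\<exists>K\<ge>0. \<forall>z\<in>lattice. \<forall>w\<in>lattice. cmod (multiplier_integral p z w) \<le> K * (1 + separation \<alpha> w z) powr (- N)"
proof -
  obtain n :: nat where n: "N \<le> real n" using real_arch_simple by blast
  obtain \<Lambda> where \<Lambda>: "\<Lambda> \<ge> 1" and cmp: "\<forall>\<xi> \<eta> :: real^'n. 1 \<le> norm \<xi> \<longrightarrow> 1 \<le> norm \<eta> \<longrightarrow> neighbours \<alpha> R\<^sub>1 \<xi> \<eta> \<longrightarrow>
    norm \<xi> \<le> \<Lambda> * norm \<eta> \<and> norm \<eta> \<le> \<Lambda> * norm \<xi> \<and> s \<xi> \<le> \<Lambda> * s \<eta> \<and> s \<eta> \<le> \<Lambda> * s \<xi>"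
    using neighbours_comparable[OF \<alpha> R1_pos] by blast
  obtain C where C: "C \<ge> 1" and sep: "\<forall>x y \<xi> \<eta>. \<xi> \<in> \<Xi> \<longrightarrow> \<eta> \<in> \<Xi> \<longrightarrow> neighbours \<alpha> R\<^sub>1 \<xi> \<eta> \<longrightarrow>
    1 + separation \<alpha> (y, \<eta>) (x, \<xi>) \<le> C * (1 + norm (s \<xi> *\<^sub>R (x - y)))"
    using separation_bound by blast
  have "\<exists>K\<ge>0. \<forall>q\<in>center_pairs. \<forall>v. cmod (LINT \<zeta>|lborel. symbol p q \<zeta> * exp (- \<i> * complex_of_real (v \<bullet> \<zeta>)))
    * (1 + norm v) ^ n \<le> K"
  proof (rule Fourier_integral_decay[OF _ _ symbol_bounded, where R=R\<^sub>1])
    show "symbol p q \<in> borel_measurable borel" for q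
      unfolding symbol_def case_prod_unfold by measurable
    show "symbol p q x = 0" if "R\<^sub>1 < norm x" for q x
      using hat_zero[of x] that by (simp add: symbol_def case_prod_unfold)
  qed
  then obtain K where K: "K \<ge> 0" "\<forall>q\<in>center_pairs. \<forall>v.
      cmod (LINT \<zeta>|lborel. symbol p q \<zeta> * exp (- \<i> * complex_of_real (v \<bullet> \<zeta>))) * (1 + norm v) ^ n \<le> K"
    by blast
  define L where "L = \<Lambda> powr (real CARD('n) / 2)"
  have L: "0 \<le> L" by (simp add: L_def)
  have main: "cmod (multiplier_integral p (x, \<xi>) (y, \<eta>)) \<le> (L * K * C powr N) * (1 + separation \<alpha> (y, \<eta>) (x, \<xi>)) powr (- N)"
    if h: "\<xi> \<in> \<Xi>" "\<eta> \<in> \<Xi>" for x y \<xi> \<eta>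
  proof (cases "neighbours \<alpha> R\<^sub>1 \<xi> \<eta>")
    case False
    then show ?thesis using multiplier_integral_zero[OF h False] L K by simp
  next
    case True
    have sx: "0 < s \<xi>" and se: "0 < s \<eta>" using scale_pos h by auto
    define v where "v = 1 + norm (s \<xi> *\<^sub>R (x - y))"
    have v: "1 \<le> v" by (simp add: v_def)
    let ?I = "cmod (LINT \<zeta>|lborel. symbol p (\<xi>, \<eta>) \<zeta> * exp (- \<i> * complex_of_real ((s \<xi> *\<^sub>R (x - y)) \<bullet> \<zeta>)))"
    have "(\<xi>, \<eta>) \<in> center_pairs" using h True by (simp add: center_pairs_def)
    then have "?I * v ^ n \<le> K" using K(2) unfolding v_def by blast
    then have I: "?I \<le> K * v powr (- real n)" using v by (simp add: powr_minus powr_realpow pos_le_divide_eq divide_inverse[symmetric])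
    have "s \<xi> / s \<eta> \<le> \<Lambda>" using cmp norm_center[OF h(1)] norm_center[OF h(2)] True se by (simp add: pos_divide_le_eq)
    then have "(s \<xi> / s \<eta>) powr (real CARD('n) / 2) \<le> L" unfolding L_def using sx se by (intro powr_mono2) auto
    then have "cmod (multiplier_integral p (x, \<xi>) (y, \<eta>)) \<le> L * (K * v powr (- real n))"
      unfolding multiplier_integral_eq[OF h] using I L by (intro mult_mono) auto
    also have "\<dots> \<le> L * (K * v powr (- N))"
      using L K(1) v n by (intro mult_left_mono powr_mono) auto
    also have "v powr (- N) \<le> C powr N * (1 + separation \<alpha> (y, \<eta>) (x, \<xi>)) powr (- N)"
    proof -
      have s0: "0 < 1 + separation \<alpha> (y, \<eta>) (x, \<xi>)"
        by (simp add: separation_def add_pos_nonneg)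
      have "1 + separation \<alpha> (y, \<eta>) (x, \<xi>) \<le> C * v" using sep h True unfolding v_def by blast
      then have "(C * v) powr (- N) \<le> (1 + separation \<alpha> (y, \<eta>) (x, \<xi>)) powr (- N)"
        using s0 N by (intro powr_mono2') auto
      then have "C powr N * (C * v) powr (- N) \<le> C powr N * (1 + separation \<alpha> (y, \<eta>) (x, \<xi>)) powr (- N)"
        by (rule mult_left_mono) simp
      moreover have "C powr N * (C * v) powr (- N) = v powr (- N)"
        using C v by (simp add: powr_mult powr_minus)
      ultimately show ?thesis by simp
    qed
    then have "L * (K * v powr (- N)) \<le> L * (K * (C powr N * (1 + separation \<alpha> (y, \<eta>) (x, \<xi>)) powr (- N)))"
      using L K(1) by (intro mult_left_mono) auto
    finally show ?thesis by (simp add: mult_ac)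
  qed
  show ?thesis
  proof (intro exI[of _ "L * K * C powr N"] conjI ballI)
    show "0 \<le> L * K * C powr N" using L K by simp
    fix z w assume "z \<in> lattice" "w \<in> lattice"
    then show "cmod (multiplier_integral p z w) \<le> (L * K * C powr N) * (1 + separation \<alpha> w z) powr (- N)"
      using main[of "snd z" "snd w" "fst z" "fst w"] lattice_center by simp
  qed
qed

lemma dual_decay:
  assumes N: "0 < (N::real)"
  shows "\<exists>K. \<forall>w\<in>lattice. \<forall>z\<in>lattice. cmod (L2_inner lborel (packets.dual z) (packets.dual w)) +
    cmod (L2_inner lborel (packets.dual z) (packet \<alpha> \<phi> w)) \<le> K * (1 + separation \<alpha> w z) powr (- N)"
proof -
  obtain K1 where K1: "\<forall>z\<in>lattice. \<forall>w\<in>lattice. cmod (multiplier_integral 2 z w) \<le> K1 * (1 + separation \<alpha> w z) powr (- N)"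
    using multiplier_integral_decay[OF N] by blast
  obtain K2 where K2: "\<forall>z\<in>lattice. \<forall>w\<in>lattice. cmod (multiplier_integral 1 z w) \<le> K2 * (1 + separation \<alpha> w z) powr (- N)"
    using multiplier_integral_decay[OF N] by blast
  show ?thesis
  proof (intro exI[of _ "K1 + K2"] ballI)
    fix w z assume w: "w \<in> lattice" and z: "z \<in> lattice"
    show "cmod (L2_inner lborel (packets.dual z) (packets.dual w)) +
      cmod (L2_inner lborel (packets.dual z) (packet \<alpha> \<phi> w)) \<le> (K1 + K2) * (1 + separation \<alpha> w z) powr (- N)"
      unfolding distrib_right
      by (rule add_mono[OF order_trans[OF dual_inner_dual(1)[OF z w] bspec[OF bspec[OF K1 z] w]]
            order_trans[OF dual_inner_dual(2)[OF z w] bspec[OF bspec[OF K2 z] w]]])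
  qed
qed

end


section \<open>Dual frames of subdyadic packets\<close>

theorem lemma5p2:
  fixes \<alpha> a b \<rho>\<^sub>0 A :: real
    and \<phi> :: "real^'n::finite \<Rightarrow> real"
    and \<Omega> :: "((real^'n) \<times> (real^'n)) set"
    and \<psi> \<psi>' :: "(real^'n) \<times> (real^'n) \<Rightarrow> real^'n \<Rightarrow> complex"
    and C :: "(real^'n \<Rightarrow> complex) \<Rightarrow> ((real^'n) \<times> (real^'n) \<Rightarrow> complex)"
    and Cadj :: "((real^'n) \<times> (real^'n) \<Rightarrow> complex) \<Rightarrow> (real^'n \<Rightarrow> complex)"
    and S Sinv :: "(real^'n \<Rightarrow> complex) \<Rightarrow> (real^'n \<Rightarrow> complex)"
    and G Gpinv :: "((real^'n) \<times> (real^'n) \<Rightarrow> complex) \<Rightarrow> ((real^'n) \<times> (real^'n) \<Rightarrow> complex)"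
  assumes "0 < \<alpha>" and "0 < a" and "0 < b" and "0 < \<rho>\<^sub>0"
    and "covering_constant TYPE('n) \<alpha> a \<rho>\<^sub>0 A"
    and "subdyadic_frame_pair \<alpha> a b \<rho>\<^sub>0 A \<phi> \<Omega>"
    and "\<psi> = packet \<alpha> \<phi>"
    and "\<psi>' = canonical_dual lborel \<Omega> \<psi>"
    and "C = analysis_op lborel \<psi>"
    and "Cadj = adjoint_op lborel (count_space \<Omega>) C"
    and "S = Cadj \<circ> C"
    and "Sinv = inverse_op lborel lborel S"
    and "G = C \<circ> Cadj"
    and "Gpinv = moore_penrose (count_space \<Omega>) (count_space \<Omega>) G"
  shows "(is_frame lborel \<Omega> \<psi>) \<and>
    (\<forall>N>0. \<exists>K. \<forall>w\<in>\<Omega>. \<forall>z\<in>\<Omega>.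
           cmod (L2_inner lborel (\<psi>' z) (\<psi>' w)) + cmod (L2_inner lborel (\<psi>' z) (\<psi> w))
             \<le> K * (1 + separation \<alpha> w z) powr (- N)) \<and>
    (is_moore_penrose (count_space \<Omega>) (count_space \<Omega>) G Gpinv) \<and>
    (\<forall>w\<in>\<Omega>. \<forall>z\<in>\<Omega>. matrix_entry \<Omega> Gpinv w z = L2_inner lborel (\<psi>' z) (\<psi>' w)) \<and>
    (\<forall>w\<in>\<Omega>. \<forall>z\<in>\<Omega>. matrix_entry \<Omega> (G \<circ> Gpinv) w z = L2_inner lborel (\<psi>' z) (\<psi> w)) \<and>
    (\<forall>c\<in>L2_space (count_space \<Omega>).
           L2_eq (count_space \<Omega>) ((G \<circ> Gpinv) c) ((C \<circ> Sinv \<circ> Cadj) c)) \<and>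
    (is_orthogonal_projection (count_space \<Omega>) (range_op lborel (count_space \<Omega>) C) (G \<circ> Gpinv))"
proof -
  obtain R\<^sub>0 R\<^sub>1 m\<^sub>0 \<rho> where sw: "schwartz \<phi>"
    and normalized: "(LINT t|lborel. (\<phi> t)\<^sup>2) = 1"
    and hat: "smooth (fourier (\<lambda>t. complex_of_real (\<phi> t)))"
      "compact (support (fourier (\<lambda>t. complex_of_real (\<phi> t))))"
      "support (fourier (\<lambda>t. complex_of_real (\<phi> t))) \<subseteq> ball 0 R\<^sub>1"
    and m0: "0 < m\<^sub>0"
    and lower: "\<forall>\<zeta>. norm \<zeta> \<le> R\<^sub>0 \<longrightarrow> m\<^sub>0 \<le> cmod (fourier (\<lambda>t. complex_of_real (\<phi> t)) \<zeta>)"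
    and R: "3 * 2 powr max (\<alpha> - 1) 0 < R\<^sub>0" "R\<^sub>0 < R\<^sub>1"
    and \<rho>: "0 < \<rho>" "\<rho> \<le> \<rho>\<^sub>0" and lat: "subdyadic_lattice \<alpha> a b \<rho> \<Omega>"
    and AR: "A * \<rho> < R\<^sub>0" and band: "b * \<rho> * R\<^sub>1 < pi"
    using assms(6) unfolding subdyadic_frame_pair_def by blast
  obtain \<Xi> where \<Xi>: "subdyadic_centers \<alpha> a \<rho> \<Xi>"
    and \<Omega>: "\<Omega> = {((b * \<rho> * norm \<xi> powr (\<alpha> - 1)) *\<^sub>R (\<chi> i. real_of_int (j $ i)), \<xi>) |
              \<xi> (j :: int^'n). \<xi> \<in> \<Xi>}"
    using lat unfolding subdyadic_lattice_def by blast
  have R0: "0 < R\<^sub>0" by (rule less_trans[OF _ R(1)]) simp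
  \<comment> \<open>The covering of all frequencies is needed before the packets can be introduced.\<close>
  interpret centers: subdyadic_center_set \<alpha> a \<rho> \<Xi>
    by unfold_locales (fact assms \<rho> \<Xi>)+
  interpret subdyadic_packets \<alpha> a \<rho> \<Xi> b R\<^sub>0 R\<^sub>1 m\<^sub>0 \<phi>
  proof unfold_locales
    show "\<exists>\<xi>\<in>\<Xi>. norm (u - \<xi>) \<le> R\<^sub>0 * local_scale \<alpha> \<xi>" for u
      by (rule centers.covering[OF assms(5) \<rho>(2) AR R(1)])
    show "m\<^sub>0 \<le> cmod (fourier (\<lambda>t. complex_of_real (\<phi> t)) \<zeta>)" if "norm \<zeta> \<le> R\<^sub>0" for \<zeta>
      using lower that by blast
  qed (fact assms sw normalized hat m0 R0 R band)+
  have \<Omega>_lattice: "\<Omega> = lattice" unfolding lattice_def by (rule \<Omega>)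
  have dual: "\<psi>' = packets.dual" by (simp only: assms(7,8) \<Omega>_lattice)
  have ops: "C = packets.C" "Cadj = packets.Cadj" "S = packets.S" "Sinv = packets.Sinv" "G = packets.G"
      "Gpinv = packets.Gpinv"
    by (simp_all only: assms(7-14) \<Omega>_lattice)
  show ?thesis
    unfolding dual ops assms(7) \<Omega>_lattice
  proof (intro conjI ballI allI impI)
    fix u assume "u \<in> packets.l2"
    then show "L2_eq (count_space lattice) ((packets.G \<circ> packets.Gpinv) u) ((packets.C \<circ> packets.Sinv \<circ> packets.Cadj) u)"
      using packets.Gram_Gpinv_eq[of u] by (simp only: comp_apply)
  next
    show "is_moore_penrose (count_space lattice) (count_space lattice) packets.G packets.Gpinv"
      by (rule packets.moore_penrose_Gram)
  next
    show "is_orthogonal_projection (count_space lattice) (range_op lborel (count_space lattice) packets.C)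
        (packets.G \<circ> packets.Gpinv)"
      by (rule packets.orthogonal_projection_Gram_Gpinv)
  qed (fact is_frame_packets | erule dual_decay | erule (1) packets.matrix_entry_Gpinv
      | erule (1) packets.matrix_entry_Gram_Gpinv)+
qed

end
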